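(* For any given $a\in\mathbb{R}^d$ and $T\ge 0$, let $\bar S_T$ be the estimator $$\bar S_T=a^\top\Big(\Phi^\top(0;T)m_0+\Psi^\top(0;T)(\bar X_0-m_0)+\int_0^T\Phi^\top(t;T)\mathsf{K}_t\,dZ_t\Big),\quad \bar X_0\sim\mathcal{N}(m_0,\Sigma_0).$$ Then $\bar S_T=a^\top\bar X_T$, where $\bar X_T$ is the strong solution (at time $T$) of the following mean-field stochastic differential equation: $$d\bar X_t=A_t\bar X_t\,dt+\mathsf{K}_t\Big(dZ_t-\frac{C_t\bar X_t+C_t\bar m_t}{2}\,dt\Big)+\frac12Q_t\Sigma_t^{-1}(\bar X_t-\bar m_t)\,dt,$$ where $\bar m_t=\mathsf{E}[\bar X_t|\mathcal{Z}_t]$ and the initial condition $\bar X_0\sim\mathcal{N}(m_0,\Sigma_0)$.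
   Context: Model: the hidden state $X_t\in\mathbb{R}^d$ and the observation $Z_t\in\mathbb{R}^m$ satisfy $dX_t=A_tX_t\,dt+dB_t$, $X_0\sim\mathcal{N}(m_0,\Sigma_0)$, and $dZ_t=C_tX_t\,dt+dW_t$. $A_t$ and $C_t$ are matrices of appropriate dimension ($d\times d$ and $m\times d$) whose elements are continuous in $t$. $\{B_t\}$ and $\{W_t\}$ are Wiener processes taking values in $\mathbb{R}^d$ and $\mathbb{R}^m$, with associated covariances $Q_t$ and $R_t$ respectively. The covariance matrices $Q_t$, $R_t$ and $\Sigma_0$ are strictly positive definite for all $t$; $m_0\in\mathbb{R}^d$. The noise processes $\{B_t\}$, $\{W_t\}$ and the initial conditions $X_0$, $\bar X_0$ are all mutually independent. $\mathcal{Z}_t:=\sigma(Z_s;s\in[0,t])$ is the filtration generated by the observations. Notation: $\Sigma_t$ is the solution of the dynamic Riccati equation $$\frac{d\Sigma_t}{dt}=A_t\Sigma_t+\Sigma_tA_t^\top+Q_t-\Sigma_tC_t^\top R_t^{-1}C_t\Sigma_t$$ with initial condition $\Sigma_0$, and $\mathsf{K}_t:=\Sigma_tC_t^\top R_t^{-1}$ is the Kalman gain. The state transition matrices $\Phi(t;\tau)$ and $\Psi(t;\tau)$ are defined by $$\frac{d\Phi}{dt}(t;\tau)=\big(-A_t^\top+C_t^\top\mathsf{K}_t^\top\big)\Phi(t;\tau),\qquad \frac{d\Psi}{dt}(t;\tau)=\big(-A_t^\top+\tfrac12C_t^\top\mathsf{K}_t^\top-\tfrac12\Sigma_t^{-1}Q_t\big)\Psi(t;\tau),$$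 with $\Phi(\tau;\tau)=\Psi(\tau;\tau)=I$, the identity matrix. $\Phi^\top(t;\tau)$ and $\Psi^\top(t;\tau)$ denote the transposes of $\Phi(t;\tau)$ and $\Psi(t;\tau)$. *)

theory Defs
  imports "HOL-Probability.Probability"
begin

definition pos_def :: "real^'n^'n \<Rightarrow> bool" where
  "pos_def S \<longleftrightarrow> transpose S = S \<and> (\<forall>v. v \<noteq> 0 \<longrightarrow> 0 < v \<bullet> (S *v v))"

(* X ~ N(mu, S) for a positive definite S: every nontrivial linear functional of X is
   univariate normal with the matching mean and variance. (For singular S the predicate is
   false, since normal_density with standard deviation 0 is not a density.) *)
definition gaussian_vector :: "'a measure \<Rightarrow> ('a \<Rightarrow> real^'n) \<Rightarrow> real^'n \<Rightarrow> real^'n^'n \<Rightarrow> bool" where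
  "gaussian_vector M X \<mu> S \<longleftrightarrow>
     X \<in> borel_measurable M \<and>
     (\<forall>v. v \<noteq> 0 \<longrightarrow>
        distributed M lborel (\<lambda>\<omega>. v \<bullet> X \<omega>) (normal_density (v \<bullet> \<mu>) (sqrt (v \<bullet> (S *v v)))))"

(* Wiener process with time-dependent (infinitesimal) covariance Q: the increment over
   (s, t] is N(0, integral of Q over [s, t]). Local integrability of Q is exactly what this
   requires; no continuity of Q is imposed. *)
definition wiener_process ::
    "'a measure \<Rightarrow> (real \<Rightarrow> real^'n^'n) \<Rightarrow> (real \<Rightarrow> 'a \<Rightarrow> real^'n) \<Rightarrow> bool" where
  "wiener_process M Q B \<longleftrightarrow>
     (\<forall>T\<ge>0. set_integrable lborel {0..T} Q) \<and>
     (\<forall>t\<ge>0. B t \<in> borel_measurable M) \<and>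
     (AE \<omega> in M. B 0 \<omega> = 0) \<and>
     (AE \<omega> in M. continuous_on {0..} (\<lambda>t. B t \<omega>)) \<and>
     (\<forall>s t. 0 \<le> s \<and> s < t \<longrightarrow>
        gaussian_vector M (\<lambda>\<omega>. B t \<omega> - B s \<omega>) 0 (LINT r:{s..t}|lborel. Q r)) \<and>
     (\<forall>(n::nat) \<tau>. 0 \<le> \<tau> 0 \<and> mono \<tau> \<longrightarrow>
        prob_space.indep_vars M (\<lambda>_. borel) (\<lambda>i \<omega>. B (\<tau> (Suc i)) \<omega> - B (\<tau> i) \<omega>) {..<n})"

definition gen_sigma ::
    "'a measure \<Rightarrow> 't set \<Rightarrow> ('t \<Rightarrow> 'a \<Rightarrow> 'b::topological_space) \<Rightarrow> 'a measure" where
  "gen_sigma M J Y =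
     sigma (space M) {Y t -` S \<inter> space M |t S. t \<in> J \<and> S \<in> sets borel}"

(* The filtration generated by an initial condition x0 and an observation process Z,
   augmented by the null sets of M. *)
definition augmented_filtration ::
    "'a measure \<Rightarrow> ('a \<Rightarrow> real^'n) \<Rightarrow> (real \<Rightarrow> 'a \<Rightarrow> real^'m) \<Rightarrow> real \<Rightarrow> 'a measure" where
  "augmented_filtration M x0 Z t =
     sigma (space M) (sets (gen_sigma M {()} (\<lambda>_. x0)) \<union> sets (gen_sigma M {0..t} Z) \<union> null_sets M)"

definition vec_cond_exp :: "'a measure \<Rightarrow> 'a measure \<Rightarrow> ('a \<Rightarrow> real^'n) \<Rightarrow> 'a \<Rightarrow> real^'n" where
  "vec_cond_exp M F Y \<omega> = (\<chi> i. real_cond_exp M F (\<lambda>\<omega>'. Y \<omega>' $ i) \<omega>)"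

(* Stochastic integrals of deterministic matrix-valued integrands. A step integrand is given by
   a number n of steps, nodes tau 0 <= ... <= tau n and coefficients c i on (tau i, tau (i+1)]. *)

definition step_integrand ::
    "nat \<Rightarrow> (nat \<Rightarrow> real) \<Rightarrow> (nat \<Rightarrow> real^'m^'n) \<Rightarrow> real \<Rightarrow> real^'m^'n" where
  "step_integrand n \<tau> c t = (\<Sum>i<n. indicat_real {\<tau> i<..\<tau> (Suc i)} t *\<^sub>R c i)"

definition step_integral ::
    "nat \<Rightarrow> (nat \<Rightarrow> real) \<Rightarrow> (nat \<Rightarrow> real^'m^'n) \<Rightarrow> (real \<Rightarrow> 'a \<Rightarrow> real^'m) \<Rightarrow> 'a \<Rightarrow> real^'n" where
  "step_integral n \<tau> c W \<omega> = (\<Sum>i<n. c i *v (W (\<tau> (Suc i)) \<omega> - W (\<tau> i) \<omega>))"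

(* J is the integral of f against W over [0, T]: the mean-square limit of integrals of step
   integrands that converge to f in the seminorm given by the Ito isometry,
   E |int f dW|^2 = int trace (f R f^T) dt. *)
definition is_wiener_integral ::
    "'a measure \<Rightarrow> (real \<Rightarrow> real^'m^'m) \<Rightarrow> (real \<Rightarrow> 'a \<Rightarrow> real^'m) \<Rightarrow> real \<Rightarrow>
     (real \<Rightarrow> real^'m^'n) \<Rightarrow> ('a \<Rightarrow> real^'n) \<Rightarrow> bool" where
  "is_wiener_integral M R W T f J \<longleftrightarrow>
     set_borel_measurable lborel {0..T} f \<and>
     J \<in> borel_measurable M \<and>
     (\<exists>(n :: nat \<Rightarrow> nat) (\<tau> :: nat \<Rightarrow> nat \<Rightarrow> real) c.
        (\<forall>k. 0 \<le> \<tau> k 0 \<and> mono_on {..n k} (\<tau> k) \<and> \<tau> k (n k) \<le> T) \<and>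
        (\<lambda>k. \<integral>\<^sup>+t\<in>{0..T}. ennreal (trace
            ((f t - step_integrand (n k) (\<tau> k) (c k) t) ** R t **
             transpose (f t - step_integrand (n k) (\<tau> k) (c k) t))) \<partial>lborel) \<longlonglongrightarrow> 0 \<and>
        (\<lambda>k. \<integral>\<^sup>+\<omega>. ennreal ((norm (step_integral (n k) (\<tau> k) (c k) W \<omega> - J \<omega>))\<^sup>2) \<partial>M) \<longlonglongrightarrow> 0)"

(* Such a J is unique up to almost sure equality; fix a version. *)
definition wiener_integral ::
    "'a measure \<Rightarrow> (real \<Rightarrow> real^'m^'m) \<Rightarrow> (real \<Rightarrow> 'a \<Rightarrow> real^'m) \<Rightarrow> real \<Rightarrow>
     (real \<Rightarrow> real^'m^'n) \<Rightarrow> 'a \<Rightarrow> real^'n" where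
  "wiener_integral M R W T f = (SOME J. is_wiener_integral M R W T f J)"

(* The integral of f over [0, T] against the observation process dZ = C X dt + dW. *)
definition obs_integral ::
    "'a measure \<Rightarrow> (real \<Rightarrow> real^'m^'m) \<Rightarrow> (real \<Rightarrow> real^'d^'m) \<Rightarrow> (real \<Rightarrow> 'a \<Rightarrow> real^'d) \<Rightarrow>
     (real \<Rightarrow> 'a \<Rightarrow> real^'m) \<Rightarrow> real \<Rightarrow> (real \<Rightarrow> real^'m^'n) \<Rightarrow> 'a \<Rightarrow> real^'n" where
  "obs_integral M R C X W T f \<omega> =
     (LINT t:{0..T}|lborel. f t *v (C t *v X t \<omega>)) + wiener_integral M R W T f \<omega>"

definition linear_gaussian_model ::
    "'a measure \<Rightarrow> (real \<Rightarrow> real^'d^'d) \<Rightarrow> (real \<Rightarrow> real^'d^'m) \<Rightarrow> (real \<Rightarrow> real^'d^'d) \<Rightarrow>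
     (real \<Rightarrow> real^'m^'m) \<Rightarrow> real^'d \<Rightarrow> real^'d^'d \<Rightarrow> (real \<Rightarrow> 'a \<Rightarrow> real^'d) \<Rightarrow>
     (real \<Rightarrow> 'a \<Rightarrow> real^'m) \<Rightarrow> (real \<Rightarrow> 'a \<Rightarrow> real^'d) \<Rightarrow> (real \<Rightarrow> 'a \<Rightarrow> real^'m) \<Rightarrow> bool" where
  "linear_gaussian_model M A C Q R m0 \<Sigma>0 X Z B W \<longleftrightarrow>
     continuous_on {0..} A \<and> continuous_on {0..} C \<and>
     (\<forall>t\<ge>0. pos_def (Q t)) \<and> (\<forall>t\<ge>0. pos_def (R t)) \<and> pos_def \<Sigma>0 \<and>
     wiener_process M Q B \<and> wiener_process M R W \<and>
     (\<forall>t\<ge>0. X t \<in> borel_measurable M) \<and> (\<forall>t\<ge>0. Z t \<in> borel_measurable M) \<and>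
     gaussian_vector M (X 0) m0 \<Sigma>0 \<and>
     (AE \<omega> in M. continuous_on {0..} (\<lambda>t. X t \<omega>)) \<and>
     (AE \<omega> in M. \<forall>t\<ge>0. X t \<omega> = X 0 \<omega> + (LINT s:{0..t}|lborel. A s *v X s \<omega>) + B t \<omega>) \<and>
     (AE \<omega> in M. \<forall>t\<ge>0. Z t \<omega> = (LINT s:{0..t}|lborel. C s *v X s \<omega>) + W t \<omega>)"

(* Strong solution Y on [0, oo) of the mean-field SDE
     dY = b(t, Y, m) dt + K dZ,  m_t = E[Y_t | sigma(Z_s; s <= t)],  Y_0 = x0,
   where dZ = C X dt + dW. As the conditional expectation is determined only up to a null
   set for each single t, m is required to be a jointly measurable version. *)
definition mean_field_strong_solution ::
    "'a measure \<Rightarrow> (real \<Rightarrow> real^'m^'m) \<Rightarrow> (real \<Rightarrow> real^'d^'m) \<Rightarrow> (real \<Rightarrow> 'a \<Rightarrow> real^'d) \<Rightarrow>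
     (real \<Rightarrow> 'a \<Rightarrow> real^'m) \<Rightarrow> (real \<Rightarrow> 'a \<Rightarrow> real^'m) \<Rightarrow>
     (real \<Rightarrow> real^'d \<Rightarrow> real^'d \<Rightarrow> real^'d) \<Rightarrow> (real \<Rightarrow> real^'m^'d) \<Rightarrow> ('a \<Rightarrow> real^'d) \<Rightarrow>
     (real \<Rightarrow> 'a \<Rightarrow> real^'d) \<Rightarrow> bool" where
  "mean_field_strong_solution M R C X W Z b K x0 Y \<longleftrightarrow>
     (\<forall>t\<ge>0. Y t \<in> borel_measurable (augmented_filtration M x0 Z t)) \<and>
     (\<forall>t\<ge>0. integrable M (Y t)) \<and>
     (AE \<omega> in M. continuous_on {0..} (\<lambda>t. Y t \<omega>)) \<and>
     (\<exists>m :: real \<Rightarrow> 'a \<Rightarrow> real^'d.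
        (\<lambda>(t, \<omega>). m t \<omega>) \<in> borel_measurable (restrict_space borel {0..} \<Otimes>\<^sub>M M) \<and>
        (\<forall>t\<ge>0. AE \<omega> in M. m t \<omega> = vec_cond_exp M (gen_sigma M {0..t} Z) (Y t) \<omega>) \<and>
        (\<forall>t\<ge>0. AE \<omega> in M. set_integrable lborel {0..t} (\<lambda>s. b s (Y s \<omega>) (m s \<omega>))) \<and>
        (\<forall>t\<ge>0. AE \<omega> in M. Y t \<omega> = x0 \<omega> + (LINT s:{0..t}|lborel. b s (Y s \<omega>) (m s \<omega>))
                               + obs_integral M R C X W t K \<omega>))"

end

theory Submission
  imports Defs
begin

text \<open>
Write \<open>F = A - K C\<close> and \<open>\<Gamma> = A - K C / 2 + Q \<Sigma>\<^sup>-\<^sup>1 / 2\<close>. The drift of the mean-field equation is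
\<open>F m + \<Gamma> (x - m)\<close>, and \<open>-F\<^sup>T\<close>, \<open>-\<Gamma>\<^sup>T\<close> generate \<open>\<Phi>\<close> and \<open>\<Psi>\<close>. Hence \<open>V t = \<Phi>(0;t)\<^sup>T\<close> solves
\<open>V' = F V\<close> and \<open>\<Psi>(0;t)\<^sup>T\<close> solves the same equation with \<open>\<Gamma>\<close> (locale \<open>adjoint_flow\<close>). So
\<open>m t = V t (m0 + \<integral>\<^sub>0\<^sup>t V\<^sup>-\<^sup>1 K dZ)\<close> and \<open>Xbar t = m t + \<Psi>(0;t)\<^sup>T (Xbar0 - m0)\<close>
solve the equation, by variation of constants, if \<open>m\<close> is the conditional mean of \<open>Xbar\<close>. It is: the first
summand is a function of the observations up to time \<open>t\<close>, and the second is centred and independent of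
them. At time \<open>T\<close> this formula is the estimator, since \<open>\<Phi>(t;T)\<^sup>T = V T V(t)\<^sup>-\<^sup>1\<close>.

For uniqueness let \<open>e\<close> be the difference of two solutions and \<open>\<mu>\<close> the difference of their conditional
means, so \<open>e' = \<Gamma> e + (F - \<Gamma>) \<mu>\<close> with \<open>e 0 = 0\<close>. Solving for \<open>e\<close> writes \<open>e t\<close> as an integral of \<open>\<mu>\<close> over
\<open>[0, t]\<close>, so \<open>e t\<close> is a function of the observations and equals its own conditional mean \<open>\<mu> t\<close>.
Therefore \<open>e' = F e\<close>, and Gronwall's inequality gives \<open>e = 0\<close> (\<open>solution_unique\<close>).

Three points need real work.

\<^item> Nothing is assumed about \<open>Q\<close> and \<open>R\<close> beyond positivity and local integrability, so neither the integrability
  of \<open>G = C\<^sup>T R\<^sup>-\<^sup>1 C\<close> nor the positivity of \<open>\<Sigma>\<close> is given. Both come from the Riccati equation itself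
  (\<open>\<Sigma>_pos_def\<close>, \<open>G_integrable\<close>): it makes \<open>\<Sigma> G \<Sigma>\<close> integrable, and where \<open>\<Sigma>\<close> is invertible this
  controls \<open>G\<close>.

\<^item> The stochastic integral is a mean-square limit for each fixed end point, whereas the paths of the
  solution must be continuous. Step functions that approximate the integrand at a geometric rate give
  almost surely locally uniform convergence, by a maximal inequality and the Borel-Cantelli lemma
  (\<open>version_paths\<close>). The variation-of-constants formula then rests on an integration by parts for such
  integrals (\<open>wi_integration_by_parts\<close>).

\<^item> The integral against \<open>Z\<close> is defined as a sum of a drift integral and an integral against \<open>W\<close>, neither
  of which is a function of the observations. The same step functions, integrated against \<open>Z\<close>, converge
  to the sum (\<open>drift_tendsto\<close>, \<open>Zint_eq\<close>). This shows that the sum is measurable for the observations.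
\<close>

section \<open>Matrix products as bounded bilinear maps\<close>

lemma matrix_vector_norm_le: "norm ((A::real^'n^'m) *v x) \<le> norm A * norm x"
proof -
  have "(norm (A *v x))\<^sup>2 = (\<Sum>i\<in>UNIV. ((A *v x) $ i)\<^sup>2)"
    by (simp add: norm_vec_def L2_set_def sum_nonneg)
  also have "\<dots> = (\<Sum>i\<in>UNIV. (A $ i \<bullet> x)\<^sup>2)"
    by (simp only: matrix_vector_mul_component)
  also have "\<dots> \<le> (\<Sum>i\<in>UNIV. (norm (A $ i))\<^sup>2 * (norm x)\<^sup>2)"
    by (intro sum_mono) (metis Cauchy_Schwarz_ineq power2_norm_eq_inner)
  also have "\<dots> = (norm A * norm x)\<^sup>2"
    by (simp add: norm_vec_def[of A] L2_set_def sum_nonneg power_mult_distrib sum_distrib_right)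
  finally show ?thesis by (rule power2_le_imp_le) simp
qed

lemma norm_transpose: "norm (transpose (A::real^'n^'m)) = norm A"
proof -
  have "(norm (transpose A))\<^sup>2 = (norm A)\<^sup>2"
    unfolding power2_norm_eq_inner inner_vec_def transpose_def
    by (simp, subst sum.swap, rule refl)
  then show ?thesis by (simp add: power2_eq_iff_nonneg)
qed

lemma matrix_matrix_norm_le: "norm ((A::real^'n^'m) ** (B::real^'p^'n)) \<le> norm A * norm B"
proof -
  have row: "(A ** B) $ i = transpose B *v (A $ i)" for i
    by (simp add: vec_eq_iff matrix_matrix_mult_def vector_matrix_mult_def mult.commute)
  have "(norm (A ** B))\<^sup>2 = (\<Sum>i\<in>UNIV. (norm ((A ** B) $ i))\<^sup>2)"
    by (simp add: norm_vec_def[of "A ** B"] L2_set_def sum_nonneg)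
  also have "\<dots> \<le> (\<Sum>i\<in>UNIV. (norm B)\<^sup>2 * (norm (A $ i))\<^sup>2)"
    unfolding row by (intro sum_mono)
      (metis matrix_vector_norm_le norm_transpose norm_ge_zero power_mono power_mult_distrib)
  also have "\<dots> = (norm A * norm B)\<^sup>2"
    by (simp add: norm_vec_def[of A] L2_set_def sum_nonneg power_mult_distrib sum_distrib_left mult.commute)
  finally show ?thesis by (rule power2_le_imp_le) simp
qed

lemma bounded_bilinear_matrix_vector: "bounded_bilinear ((*v) :: real^'n^'m \<Rightarrow> real^'n \<Rightarrow> real^'m)"
proof (rule bounded_bilinear.intro)
  fix a :: real and A :: "real^'n^'m" and x :: "real^'n"
  show "(a *\<^sub>R A) *v x = a *\<^sub>R (A *v x)" by (rule scaleR_matrix_vector_assoc[symmetric])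
  show "A *v (a *\<^sub>R x) = a *\<^sub>R (A *v x)" by (rule matrix_vector_mult_scaleR)
  show "\<exists>K. \<forall>(A::real^'n^'m) x. norm (A *v x) \<le> norm A * norm x * K"
    by (intro exI[of _ 1]) (simp add: matrix_vector_norm_le)
qed (simp_all add: matrix_vector_right_distrib matrix_vector_mult_add_rdistrib)

lemma bounded_bilinear_matrix_matrix:
  "bounded_bilinear ((**) :: real^'n^'m \<Rightarrow> real^'p^'n \<Rightarrow> real^'p^'m)"
proof (rule bounded_bilinear.intro)
  fix a :: real and A A' :: "real^'n^'m" and B :: "real^'p^'n"
  show "(A + A') ** B = A ** B + A' ** B"
    by (simp add: vec_eq_iff matrix_matrix_mult_def sum.distrib algebra_simps)
  show "(a *\<^sub>R A) ** B = a *\<^sub>R (A ** B)"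
    by (simp add: vec_eq_iff matrix_matrix_mult_def sum_distrib_left algebra_simps)
  show "A ** (a *\<^sub>R B) = a *\<^sub>R (A ** B)"
    by (simp add: vec_eq_iff matrix_matrix_mult_def sum_distrib_left algebra_simps)
  show "\<exists>K. \<forall>(A::real^'n^'m) (B::real^'p^'n). norm (A ** B) \<le> norm A * norm B * K"
    by (intro exI[of _ 1]) (simp add: matrix_matrix_norm_le)
qed (simp add: matrix_add_ldistrib)

interpretation mv: bounded_bilinear "(*v) :: real^'n^'m \<Rightarrow> real^'n \<Rightarrow> real^'m"
  by (rule bounded_bilinear_matrix_vector)

interpretation mm: bounded_bilinear "(**) :: real^'n^'m \<Rightarrow> real^'p^'n \<Rightarrow> real^'p^'m"
  by (rule bounded_bilinear_matrix_matrix)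

lemma bounded_linear_transpose: "bounded_linear (transpose :: real^'n^'m \<Rightarrow> real^'m^'n)"
  by (rule bounded_linear_intro[where K=1])
    (auto simp: norm_transpose, auto simp: transpose_def vec_eq_iff)

lemmas transpose_add = linear_add[OF bounded_linear.linear[OF bounded_linear_transpose]]
lemmas transpose_diff = linear_diff[OF bounded_linear.linear[OF bounded_linear_transpose]]
lemmas transpose_minus = linear_neg[OF bounded_linear.linear[OF bounded_linear_transpose]]

lemma inner_transpose_matrix: "x \<bullet> ((A::real^'n^'m) *v y) = (transpose A *v x) \<bullet> y"
  by (metis dot_lmul_matrix transpose_matrix_vector)

text \<open>The resolvent identity. Everything about derivatives and limits of inverses follows from it.\<close>

lemma matrix_inverse_path_diff:
  fixes P V :: "'a \<Rightarrow> real^'n^'n"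
  assumes "V s ** P s = mat 1" "P t ** V t = mat 1"
  shows "V s - V t = - (V s ** (P s - P t) ** V t)"
proof -
  have "V s ** (P s - P t) ** V t = (V s ** P s) ** V t - V s ** (P t ** V t)"
    by (simp add: mm.diff_left mm.diff_right matrix_mul_assoc)
  then show ?thesis using assms by simp
qed

text \<open>The resolvent identity bounds \<open>V s - V t\<close> by \<open>norm (V s)\<close> times a small quantity. Hence \<open>V\<close> stays
bounded near \<open>t\<close>, and the same identity then gives convergence.\<close>

lemma tendsto_matrix_inverse_path:
  fixes P V :: "'a::topological_space \<Rightarrow> real^'n^'n"
  assumes left: "\<And>s. s \<in> S \<Longrightarrow> V s ** P s = mat 1" and right: "P t ** V t = mat 1"
    and lim: "(P \<longlongrightarrow> P t) (at t within S)"
  shows "(V \<longlongrightarrow> V t) (at t within S)"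
proof -
  let ?F = "at t within S"
  have d0: "((\<lambda>s. norm (P s - P t)) \<longlongrightarrow> 0) ?F"
    using lim by (simp add: LIM_zero_iff tendsto_norm_zero)
  have ev1: "\<forall>\<^sub>F s in ?F. s \<in> S" by (simp add: eventually_at_filter)
  have "\<forall>\<^sub>F s in ?F. norm (P s - P t) * norm (V t) < 1/2"
    using tendsto_mult_left_zero[OF d0, of "norm (V t)"] by (rule order_tendstoD) simp
  then have "\<forall>\<^sub>F s in ?F. norm (V s - V t) \<le> 2 * norm (V t) * norm (V t) * norm (P s - P t)"
    using ev1
  proof eventually_elim
    case (elim s)
    have "V s - V t = - (V s ** (P s - P t) ** V t)"
      by (rule matrix_inverse_path_diff[where P=P]) (use left right elim in auto)
    then have 1: "norm (V s - V t) \<le> norm (V s) * (norm (P s - P t) * norm (V t))"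
      using matrix_matrix_norm_le[of "V s ** (P s - P t)" "V t"] matrix_matrix_norm_le[of "V s" "P s - P t"]
      by (metis (no_types, opaque_lifting) mult.assoc mult_right_mono norm_ge_zero norm_minus_cancel order_trans)
    also have "\<dots> \<le> norm (V s) * (1/2)" using elim by (intro mult_left_mono) auto
    finally have "norm (V s) \<le> 2 * norm (V t)"
      using norm_triangle_ineq2[of "V s" "V t"] by simp
    then have "norm (V s) * (norm (P s - P t) * norm (V t)) \<le> (2 * norm (V t)) * (norm (P s - P t) * norm (V t))"
      by (rule mult_right_mono) simp
    with 1 show ?case by (simp add: mult_ac)
  qed
  then have "((\<lambda>s. V s - V t) \<longlongrightarrow> 0) ?F"
    by (rule Lim_null_comparison) (use tendsto_mult_right_zero[OF d0] in simp)
  then show ?thesis by (simp add: LIM_zero_iff)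
qed

lemma matrix_inverse_path_has_vector_derivative:
  fixes P V :: "real \<Rightarrow> real^'n^'n"
  assumes left: "\<And>s. s \<in> S \<Longrightarrow> V s ** P s = mat 1" and right: "\<And>s. s \<in> S \<Longrightarrow> P s ** V s = mat 1"
    and t: "t \<in> S" and der: "(P has_vector_derivative P') (at t within S)"
  shows "(V has_vector_derivative - (V t ** P' ** V t)) (at t within S)"
proof -
  let ?F = "at t within S"
  have limP: "(P \<longlongrightarrow> P t) ?F"
    using has_vector_derivative_continuous[OF der] by (simp add: continuous_within)
  have limV: "(V \<longlongrightarrow> V t) ?F"
    by (rule tendsto_matrix_inverse_path[OF left right[OF t] limP])
  let ?d = "\<lambda>s. (1 / norm (s - t)) *\<^sub>R (P s - (P t + (s - t) *\<^sub>R P'))"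
  have d: "(?d \<longlongrightarrow> 0) ?F"
    using der unfolding has_vector_derivative_def has_derivative_within by blast
  have "\<forall>\<^sub>F s in ?F. s \<in> S" by (simp add: eventually_at_filter)
  moreover have "\<forall>\<^sub>F s in ?F. s \<noteq> t" by (simp add: eventually_at_filter)
  ultimately have bd: "\<forall>\<^sub>F s in ?F. norm ((1 / norm (s - t)) *\<^sub>R (V s - (V t + (s - t) *\<^sub>R - (V t ** P' ** V t))))
     \<le> norm (V s) * norm (?d s) * norm (V t) + norm (V s - V t) * norm P' * norm (V t)"
  proof eventually_elim
    case (elim s)
    have ne: "norm (s - t) \<noteq> 0" using elim by simp
    have "V s - V t = - (V s ** (P s - P t) ** V t)"
      by (rule matrix_inverse_path_diff[where P=P]) (use left right t elim in auto)
    then have "V s - (V t + (s - t) *\<^sub>R - (V t ** P' ** V t)) =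
       - (V s ** (P s - (P t + (s - t) *\<^sub>R P')) ** V t) - (s - t) *\<^sub>R ((V s - V t) ** P' ** V t)"
      by (simp add: mm.diff_left mm.diff_right mm.add_right mm.add_left mm.scaleR_left mm.scaleR_right algebra_simps)
    moreover have "(1/n) *\<^sub>R (- (a ** q ** b) - c *\<^sub>R w) = - (a ** ((1/n) *\<^sub>R q) ** b) - (c/n) *\<^sub>R w"
      for a b q w :: "real^'n^'n" and n c :: real
      by (simp add: mm.scaleR_left mm.scaleR_right real_vector.scale_right_diff_distrib)
    ultimately have eq: "(1 / norm (s - t)) *\<^sub>R (V s - (V t + (s - t) *\<^sub>R - (V t ** P' ** V t))) =
       - (V s ** ?d s ** V t) - ((s - t) / norm (s - t)) *\<^sub>R ((V s - V t) ** P' ** V t)"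
      by simp
    have n3: "norm (a ** b ** c) \<le> norm a * norm b * norm c" for a b c :: "real^'n^'n"
      by (meson matrix_matrix_norm_le mult_right_mono norm_ge_zero order_trans)
    have "norm (((s - t) / norm (s - t)) *\<^sub>R ((V s - V t) ** P' ** V t)) = norm ((V s - V t) ** P' ** V t)"
      using ne by (simp add: abs_mult)
    with n3[of "V s" "?d s" "V t"] n3[of "V s - V t" P' "V t"] show ?case
      unfolding eq
      by (smt (verit) norm_minus_cancel norm_triangle_ineq4)
  qed
  have "((\<lambda>s. norm (V s) * norm (?d s) * norm (V t) + norm (V s - V t) * norm P' * norm (V t))
     \<longlongrightarrow> norm (V t) * norm (0::real^'n^'n) * norm (V t) + norm (V t - V t) * norm P' * norm (V t)) ?F"
    by (intro tendsto_intros limV d)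
  then have "((\<lambda>s. (1 / norm (s - t)) *\<^sub>R (V s - (V t + (s - t) *\<^sub>R - (V t ** P' ** V t)))) \<longlongrightarrow> 0) ?F"
    by (intro Lim_null_comparison[OF bd]) simp
  then show ?thesis
    unfolding has_vector_derivative_def has_derivative_within
    by (intro conjI bounded_linear_scaleR_left)
qed

section \<open>Integrals over intervals, product rule and Gronwall inequalities\<close>

lemma LINT_eq_HK:
  fixes f :: "real \<Rightarrow> 'b::euclidean_space"
  shows "set_integrable lborel S f \<Longrightarrow> (LINT x:S|lborel. f x) = integral S f"
  by (rule set_borel_integral_eq_integral)

lemma set_integrable_sub_interval:
  fixes f :: "real \<Rightarrow> 'b::euclidean_space"
  shows "set_integrable lborel {a..b} f \<Longrightarrow> a \<le> c \<Longrightarrow> d \<le> b \<Longrightarrow> set_integrable lborel {c..d} f"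
  by (erule set_integrable_subset) auto

lemma LINT_split:
  fixes f :: "real \<Rightarrow> 'b::euclidean_space"
  assumes "set_integrable lborel {a..b} f" "a \<le> c" "c \<le> b"
  shows "(LINT s:{a..b}|lborel. f s) = (LINT s:{a..c}|lborel. f s) + (LINT s:{c..b}|lborel. f s)"
  using assms Henstock_Kurzweil_Integration.integral_combine[of a c b f]
  by (simp add: LINT_eq_HK set_integrable_sub_interval set_borel_integral_eq_integral(1))

lemma LINT_singleton [simp]: "(LINT s:{a::real}|lborel. f s) = (0::'b::euclidean_space)"
proof -
  have "AE s in lborel. indicator {a} s *\<^sub>R f s = 0"
    using AE_lborel_singleton[of a] by eventually_elim simp
  then show ?thesis unfolding set_lebesgue_integral_def
    by (simp add: integral_eq_zero_AE)
qed

lemma continuous_on_LINT: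
  fixes f :: "real \<Rightarrow> 'b::euclidean_space"
  assumes "set_integrable lborel {a..b} f"
  shows "continuous_on {a..b} (\<lambda>t. LINT s:{a..t}|lborel. f s)"
proof -
  have "continuous_on {a..b} (\<lambda>t. integral {a..t} f)"
    by (rule indefinite_integral_continuous_1[OF set_borel_integral_eq_integral(1)[OF assms]])
  then show ?thesis
    by (rule continuous_on_eq) (simp add: LINT_eq_HK set_integrable_sub_interval[OF assms])
qed

lemma continuous_on_LINT_halfline:
  fixes f :: "real \<Rightarrow> 'b::euclidean_space"
  assumes "\<And>T. T \<ge> 0 \<Longrightarrow> set_integrable lborel {0..T} f"
  shows "continuous_on {0..} (\<lambda>t. LINT s:{0..t}|lborel. f s)"
  unfolding continuous_on_eq_continuous_within
proof
  fix t :: real assume t: "t \<in> {0..}"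
  have "continuous_on {0..t+1} (\<lambda>t. LINT s:{0..t}|lborel. f s)"
    using t assms by (intro continuous_on_LINT) auto
  then have "continuous (at t within {0..t+1}) (\<lambda>t. LINT s:{0..t}|lborel. f s)"
    using t by (simp add: continuous_on_eq_continuous_within)
  moreover have "at t within {0..t+1} = at t within {0..}"
    by (rule at_within_nhd[where S="{..<t+1}"]) auto
  ultimately show "continuous (at t within {0..}) (\<lambda>t. LINT s:{0..t}|lborel. f s)" by simp
qed

text \<open>This is how an integrable coefficient and a continuous path are combined throughout. For a continuous
coefficient and an integrable path, use it with the bilinear map flipped.\<close>

lemma set_integrable_bilinear:
  fixes H :: "real \<Rightarrow> 'a::euclidean_space" and y :: "real \<Rightarrow> 'b::euclidean_space"
    and prod :: "'a \<Rightarrow> 'b \<Rightarrow> 'c::euclidean_space"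
  assumes bil: "bounded_bilinear prod" and H: "set_integrable lborel {a..b} H"
    and y: "continuous_on {a..b} y"
  shows "set_integrable lborel {a..b} (\<lambda>s. prod (H s) (y s))"
proof -
  interpret bounded_bilinear prod by (rule bil)
  obtain K where K: "\<And>u v. norm (prod u v) \<le> norm u * norm v * K" "0 < K" using pos_bounded by blast
  obtain B where B: "\<And>s. s \<in> {a..b} \<Longrightarrow> norm (y s) \<le> B"
    using compact_imp_bounded[OF compact_continuous_image[OF y compact_Icc]]
    by (force simp: bounded_iff)
  have cont: "continuous_on UNIV (\<lambda>z::'a\<times>'b. prod (fst z) (snd z))"
    by (intro continuous_on continuous_intros)
  have m: "(\<lambda>s. (indicator {a..b} s *\<^sub>R H s, indicator {a..b} s *\<^sub>R y s)) \<in> borel_measurable borel"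
  proof (rule borel_measurable_Pair)
    show "(\<lambda>s. indicator {a..b} s *\<^sub>R H s) \<in> borel_measurable borel"
      using H by (auto simp: set_integrable_def dest: borel_measurable_integrable)
    show "(\<lambda>s. indicator {a..b} s *\<^sub>R y s) \<in> borel_measurable borel"
      by (rule borel_measurable_continuous_on_indicator[OF _ y]) simp
  qed
  have eq: "(\<lambda>s. indicator {a..b} s *\<^sub>R prod (H s) (y s)) =
      (\<lambda>s. prod (indicator {a..b} s *\<^sub>R H s) (indicator {a..b} s *\<^sub>R y s))"
    by (auto simp: fun_eq_iff scaleR_left scaleR_right indicator_def)
  show ?thesis
  proof (rule set_integrable_bound[of _ _ "\<lambda>s. (K * B) *\<^sub>R H s"])
    show "set_integrable lborel {a..b} (\<lambda>s. (K * B) *\<^sub>R H s)"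
      using H unfolding set_integrable_def
      by (subst scaleR_left_commute) (rule integrable_scaleR_right)
    show "set_borel_measurable lborel {a..b} (\<lambda>s. prod (H s) (y s))"
      unfolding set_borel_measurable_def eq
      using borel_measurable_continuous_on[OF cont m] by simp
    show "AE s in lborel. s \<in> {a..b} \<longrightarrow> norm (prod (H s) (y s)) \<le> norm ((K * B) *\<^sub>R H s)"
    proof (intro AE_I2 impI)
      fix s assume s: "s \<in> {a..b}"
      have "norm (prod (H s) (y s)) \<le> norm (H s) * norm (y s) * K" by (rule K)
      also have "\<dots> \<le> norm (H s) * B * K" using B[OF s] K by (intro mult_right_mono mult_left_mono) auto
      also have "\<dots> \<le> norm ((K * B) *\<^sub>R H s)"
        using K by (simp add: mult_ac abs_mult mult_left_mono mult_right_mono)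
      finally show "norm (prod (H s) (y s)) \<le> norm ((K * B) *\<^sub>R H s)" .
    qed
  qed
qed

lemma LINT_bounded_linear:
  fixes f :: "real \<Rightarrow> 'a::euclidean_space" and h :: "'a \<Rightarrow> 'b::euclidean_space"
  assumes "bounded_linear h" "set_integrable lborel S f"
  shows "(LINT s:S|lborel. h (f s)) = h (LINT s:S|lborel. f s)"
    "set_integrable lborel S (\<lambda>s. h (f s))"
proof -
  interpret bounded_linear h by fact
  have eq: "(\<lambda>s. indicator S s *\<^sub>R h (f s)) = (\<lambda>s. h (indicator S s *\<^sub>R f s))" by (simp add: scaleR)
  show "(LINT s:S|lborel. h (f s)) = h (LINT s:S|lborel. f s)"
    using assms(2) integral_bounded_linear[OF assms(1)] unfolding set_lebesgue_integral_def eq set_integrable_def by blast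
  show "set_integrable lborel S (\<lambda>s. h (f s))"
    using assms(2) integrable_bounded_linear[OF assms(1)] unfolding eq set_integrable_def by blast
qed

lemma LINT_grid:
  fixes f :: "real \<Rightarrow> 'b::euclidean_space"
  assumes "h \<ge> 0" "set_integrable lborel {0..real n * h} f"
  shows "(\<Sum>i<n. LINT s:{real i * h..real (Suc i) * h}|lborel. f s) = (LINT s:{0..real n * h}|lborel. f s)"
  using assms(2)
proof (induction n)
  case 0 then show ?case by simp
next
  case (Suc n)
  have le: "real n * h \<le> real (Suc n) * h" using assms by (intro mult_right_mono) auto
  have "set_integrable lborel {0..real n * h} f"
    using Suc.prems le by (auto intro: set_integrable_sub_interval)
  then show ?case using Suc.IH LINT_split[OF Suc.prems _ le] assms by simp
qed

text \<open>Only the second factor is sampled; the first is integrated exactly over each grid cell. Therefore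
integrability of \<open>H\<close> suffices, and the error is at most the oscillation of \<open>y\<close> times the integral of
\<open>norm H\<close>. The intermediate points \<open>p n i\<close> are free, so that both end points of a cell can be used.\<close>

lemma riemann_sum_bilinear:
  fixes H :: "real \<Rightarrow> 'a::euclidean_space" and y :: "real \<Rightarrow> 'b::euclidean_space"
    and prod :: "'a \<Rightarrow> 'b \<Rightarrow> 'c::euclidean_space" and p :: "nat \<Rightarrow> nat \<Rightarrow> real"
  assumes bil: "bounded_bilinear prod" and T: "0 \<le> T" and H: "set_integrable lborel {0..T} H"
    and y: "continuous_on {0..T} y"
    and p: "\<And>n i. i \<le> n \<Longrightarrow> p n i \<in> {real i * (T / real (Suc n))..real (Suc i) * (T / real (Suc n))}"
  shows "(\<lambda>n. \<Sum>i<Suc n. prod (LINT s:{real i * (T / real (Suc n))..real (Suc i) * (T / real (Suc n))}|lborel. H s) (y (p n i)))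
         \<longlonglongrightarrow> (LINT s:{0..T}|lborel. prod (H s) (y s))"
proof (rule metric_LIMSEQ_I)
  fix e :: real assume e: "0 < e"
  interpret bounded_bilinear prod by (rule bil)
  obtain K where K: "\<And>u v. norm (prod u v) \<le> norm u * norm v * K" "0 < K" using pos_bounded by blast
  define N where "N = (LINT s:{0..T}|lborel. norm (H s))"
  have N0: "0 \<le> N" unfolding N_def set_lebesgue_integral_def by (intro Bochner_Integration.integral_nonneg) simp
  define e' where "e' = e / (K * (N + 1))"
  have e': "0 < e'" using e K N0 by (simp add: e'_def)
  have "uniformly_continuous_on {0..T} y" using y by (simp add: compact_uniformly_continuous)
  then obtain d where d: "d > 0" "\<And>u v. u \<in> {0..T} \<Longrightarrow> v \<in> {0..T} \<Longrightarrow> dist v u < d \<Longrightarrow> dist (y v) (y u) < e'"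
    using e' unfolding uniformly_continuous_on_def by metis
  obtain n0 :: nat where n0: "T / d < real n0" using reals_Archimedean2 by blast
  have Hy: "set_integrable lborel {0..T} (\<lambda>s. prod (H s) (y s))" by (rule set_integrable_bilinear[OF bil H y])
  show "\<exists>n0. \<forall>n\<ge>n0. dist (\<Sum>i<Suc n. prod (LINT s:{real i * (T / real (Suc n))..real (Suc i) * (T / real (Suc n))}|lborel. H s) (y (p n i)))
       (LINT s:{0..T}|lborel. prod (H s) (y s)) < e"
  proof (intro exI[of _ n0] allI impI)
    fix n assume n: "n0 \<le> n"
    define h where "h = T / real (Suc n)"
    have h0: "0 \<le> h" and hT: "real (Suc n) * h = T" using T by (auto simp: h_def)
    have "T < d * real (Suc n)" using n0 n d by (simp add: field_simps)
      (smt (verit) mult_left_mono of_nat_le_iff mult.commute)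
    then have hd: "h < d" by (simp add: h_def field_simps)
    let ?I = "\<lambda>i. {real i * h..real (Suc i) * h}"
    have sub: "?I i \<subseteq> {0..T}" if "i < Suc n" for i
    proof -
      have "real (Suc i) * h \<le> real (Suc n) * h" using that h0 by (intro mult_right_mono) auto
      then show ?thesis using h0 hT by auto
    qed
    have HI: "set_integrable lborel (?I i) H" if "i < Suc n" for i
      by (rule set_integrable_subset[OF H _ sub[OF that]]) simp
    have HyI: "set_integrable lborel (?I i) (\<lambda>s. prod (H s) (y s))" if "i < Suc n" for i
      by (rule set_integrable_subset[OF Hy _ sub[OF that]]) simp
    have tm: "norm (prod (LINT s:?I i|lborel. H s) (y (p n i)) - (LINT s:?I i|lborel. prod (H s) (y s)))
        \<le> K * e' * (LINT s:?I i|lborel. norm (H s))" if i: "i < Suc n" for i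
    proof -
      have pi: "p n i \<in> ?I i" using p[of i n] i by (auto simp: h_def)
      have lin: "bounded_linear (\<lambda>u. prod u (y (p n i)))" by (rule bounded_linear_left)
      note L = LINT_bounded_linear[OF lin HI[OF i]]
      have "prod (LINT s:?I i|lborel. H s) (y (p n i)) - (LINT s:?I i|lborel. prod (H s) (y s))
          = (LINT s:?I i|lborel. prod (H s) (y (p n i)) - prod (H s) (y s))"
        using L HyI[OF i] by (simp add: set_integral_diff)
      also have "norm \<dots> \<le> (LINT s:?I i|lborel. norm (prod (H s) (y (p n i)) - prod (H s) (y s)))"
        by (intro set_integral_norm_bound set_integral_diff L HyI i)
      also have "\<dots> \<le> (LINT s:?I i|lborel. K * e' * norm (H s))"
      proof (rule set_integral_mono)
        show "set_integrable lborel (?I i) (\<lambda>s. norm (prod (H s) (y (p n i)) - prod (H s) (y s)))"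
          by (intro set_integrable_norm set_integral_diff L HyI i)
        show "set_integrable lborel (?I i) (\<lambda>s. K * e' * norm (H s))"
          by (intro set_integrable_mult_right set_integrable_norm HI i)
        fix s assume s: "s \<in> ?I i"
        have "\<bar>p n i - s\<bar> \<le> h" using s pi by (auto simp: algebra_simps abs_le_iff)
        then have "dist (y (p n i)) (y s) < e'"
          using hd subsetD[OF sub[OF i] s] subsetD[OF sub[OF i] pi] by (intro d) (auto simp: dist_real_def)
        then have "norm (y (p n i) - y s) \<le> e'" by (simp add: dist_norm)
        then show "norm (prod (H s) (y (p n i)) - prod (H s) (y s)) \<le> K * e' * norm (H s)"
          using K(1)[of "H s" "y (p n i) - y s"] K(2)
          by (simp add: diff_right[symmetric])
            (smt (verit, best) mult.commute mult.left_commute mult_left_mono norm_ge_zero mult_nonneg_nonneg)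
      qed
      finally show ?thesis by simp
    qed
    have E: "(\<Sum>i<Suc n. prod (LINT s:?I i|lborel. H s) (y (p n i))) - (LINT s:{0..T}|lborel. prod (H s) (y s))
        = (\<Sum>i<Suc n. prod (LINT s:?I i|lborel. H s) (y (p n i)) - (LINT s:?I i|lborel. prod (H s) (y s)))"
      using LINT_grid[OF h0, of "Suc n" "\<lambda>s. prod (H s) (y s)"] Hy hT
      by (simp only: sum_subtractf)
    have sN: "(\<Sum>i<Suc n. LINT s:?I i|lborel. norm (H s)) = N"
      unfolding N_def hT[symmetric]
      by (rule LINT_grid[OF h0]) (use set_integrable_norm[OF H] hT in simp)
    have "norm ((\<Sum>i<Suc n. prod (LINT s:?I i|lborel. H s) (y (p n i))) - (LINT s:{0..T}|lborel. prod (H s) (y s)))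
       \<le> (\<Sum>i<Suc n. K * e' * (LINT s:?I i|lborel. norm (H s)))"
      unfolding E by (intro sum_norm_le tm) simp
    moreover have "(\<Sum>i<Suc n. K * e' * (LINT s:?I i|lborel. norm (H s))) = K * e' * N"
      unfolding sum_distrib_left[symmetric] sN ..
    moreover have "K * e' * N < e"
    proof -
      have "K * e' * N = e * (N / (N + 1))" using K N0 by (simp add: e'_def)
      also have "\<dots> < e * 1" using e N0 by (intro mult_strict_left_mono) (auto simp: divide_less_eq)
      finally show ?thesis by simp
    qed
    ultimately show "dist (\<Sum>i<Suc n. prod (LINT s:{real i * (T / real (Suc n))..real (Suc i) * (T / real (Suc n))}|lborel. H s) (y (p n i)))
       (LINT s:{0..T}|lborel. prod (H s) (y s)) < e"
      unfolding dist_norm h_def by linarith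
  qed
qed

lemma LINT_increment:
  fixes f f' :: "real \<Rightarrow> 'a::euclidean_space"
  assumes f': "set_integrable lborel {0..T} f'"
    and f: "\<And>t. t \<in> {0..T} \<Longrightarrow> f t = f 0 + (LINT s:{0..t}|lborel. f' s)"
    and ab: "0 \<le> a" "a \<le> b" "b \<le> T"
  shows "f b - f a = (LINT s:{a..b}|lborel. f' s)"
proof -
  have "set_integrable lborel {0..b} f'" by (rule set_integrable_sub_interval[OF f']) (use ab in auto)
  from LINT_split[OF this ab(1,2)] have "(LINT s:{0..b}|lborel. f' s) = (LINT s:{0..a}|lborel. f' s) + (LINT s:{a..b}|lborel. f' s)" .
  moreover have "f a = f 0 + (LINT s:{0..a}|lborel. f' s)" by (rule f) (use ab in auto)
  moreover have "f b = f 0 + (LINT s:{0..b}|lborel. f' s)" by (rule f) (use ab in auto)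
  ultimately show ?thesis by (simp add: algebra_simps)
qed

text \<open>Coefficients are merely integrable, so the derivatives exist only almost everywhere and the product
rule is stated for primitives. Summation by parts on a grid turns it into two Riemann sums, one sampled
at left and one at right end points.\<close>

lemma LINT_product_rule:
  fixes P p :: "real \<Rightarrow> 'a::euclidean_space" and y h :: "real \<Rightarrow> 'b::euclidean_space"
    and prod :: "'a \<Rightarrow> 'b \<Rightarrow> 'c::euclidean_space"
  assumes bil: "bounded_bilinear prod" and T: "0 \<le> T"
    and p: "set_integrable lborel {0..T} p" and h: "set_integrable lborel {0..T} h"
    and P: "\<And>t. t \<in> {0..T} \<Longrightarrow> P t = P 0 + (LINT s:{0..t}|lborel. p s)"
    and y: "\<And>t. t \<in> {0..T} \<Longrightarrow> y t = y 0 + (LINT s:{0..t}|lborel. h s)"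
  shows "prod (P T) (y T) = prod (P 0) (y 0) + (LINT s:{0..T}|lborel. prod (p s) (y s))
      + (LINT s:{0..T}|lborel. prod (P s) (h s))"
proof -
  interpret bounded_bilinear prod by (rule bil)
  have cP: "continuous_on {0..T} P"
    by (rule continuous_on_eq[of _ "\<lambda>t. P 0 + (LINT s:{0..t}|lborel. p s)"])
      (auto intro!: continuous_intros continuous_on_LINT p simp: P[symmetric])
  have cy: "continuous_on {0..T} y"
    by (rule continuous_on_eq[of _ "\<lambda>t. y 0 + (LINT s:{0..t}|lborel. h s)"])
      (auto intro!: continuous_intros continuous_on_LINT h simp: y[symmetric])
  let ?g = "\<lambda>n i. real i * (T / real (Suc n))"
  have g: "?g n i \<in> {0..T}" if "i \<le> Suc n" for n i
  proof -
    have "real i * T \<le> real (Suc n) * T" using that T by (intro mult_right_mono) auto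
    then show ?thesis using T by (simp add: field_simps)
  qed
  have gle: "?g n i \<le> ?g n (Suc i)" for n i using T by (intro mult_right_mono) auto
  have bil': "bounded_bilinear (\<lambda>u v. prod v u)" by (rule flip)
  have 1: "(\<lambda>n. \<Sum>i<Suc n. prod (LINT s:{?g n i..?g n (Suc i)}|lborel. p s) (y (?g n i)))
         \<longlonglongrightarrow> (LINT s:{0..T}|lborel. prod (p s) (y s))"
    by (rule riemann_sum_bilinear[OF bil T p cy]) (use gle in simp)
  have 2: "(\<lambda>n. \<Sum>i<Suc n. prod (P (?g n (Suc i))) (LINT s:{?g n i..?g n (Suc i)}|lborel. h s))
         \<longlonglongrightarrow> (LINT s:{0..T}|lborel. prod (P s) (h s))"
    by (rule riemann_sum_bilinear[OF bil' T h cP]) (use gle in simp)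
  have "(\<Sum>i<Suc n. prod (LINT s:{?g n i..?g n (Suc i)}|lborel. p s) (y (?g n i))) +
      (\<Sum>i<Suc n. prod (P (?g n (Suc i))) (LINT s:{?g n i..?g n (Suc i)}|lborel. h s)) = prod (P T) (y T) - prod (P 0) (y 0)" for n
  proof -
    have "(\<Sum>i<Suc n. prod (LINT s:{?g n i..?g n (Suc i)}|lborel. p s) (y (?g n i))) +
      (\<Sum>i<Suc n. prod (P (?g n (Suc i))) (LINT s:{?g n i..?g n (Suc i)}|lborel. h s))
      = (\<Sum>i<Suc n. prod (P (?g n (Suc i)) - P (?g n i)) (y (?g n i)) + prod (P (?g n (Suc i))) (y (?g n (Suc i)) - y (?g n i)))"
      unfolding sum.distrib[symmetric]
    proof (rule sum.cong[OF refl])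
      fix i assume "i \<in> {..<Suc n}"
      then have i: "0 \<le> ?g n i" "?g n i \<le> ?g n (Suc i)" "?g n (Suc i) \<le> T"
        using g[of i n] g[of "Suc i" n] gle[of i n] by auto
      show "prod (LINT s:{?g n i..?g n (Suc i)}|lborel. p s) (y (?g n i)) + prod (P (?g n (Suc i))) (LINT s:{?g n i..?g n (Suc i)}|lborel. h s) =
         prod (P (?g n (Suc i)) - P (?g n i)) (y (?g n i)) + prod (P (?g n (Suc i))) (y (?g n (Suc i)) - y (?g n i))"
        by (simp only: LINT_increment[OF p P i] LINT_increment[OF h y i])
    qed
    also have "\<dots> = (\<Sum>i<Suc n. prod (P (?g n (Suc i))) (y (?g n (Suc i))) - prod (P (?g n i)) (y (?g n i)))"
      by (simp add: diff_left diff_right)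
    also have "\<dots> = prod (P T) (y T) - prod (P 0) (y 0)"
      by (simp only: sum_lessThan_telescope[where f="\<lambda>i. prod (P (?g n i)) (y (?g n i))"]) simp
    finally show ?thesis .
  qed
  then have "(\<lambda>n. prod (P T) (y T) - prod (P 0) (y 0)) \<longlonglongrightarrow> (LINT s:{0..T}|lborel. prod (p s) (y s)) + (LINT s:{0..T}|lborel. prod (P s) (h s))"
    using tendsto_add[OF 1 2] by (simp only:)
  from LIMSEQ_unique[OF this tendsto_const] show ?thesis by (simp add: algebra_simps)
qed

lemma LINT_FTC:
  fixes P p :: "real \<Rightarrow> 'a::euclidean_space"
  assumes "a \<le> b" "set_integrable lborel {a..b} p"
    and "\<And>t. t \<in> {a..b} \<Longrightarrow> (P has_vector_derivative p t) (at t within {a..b})"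
  shows "P b = P a + (LINT s:{a..b}|lborel. p s)"
proof -
  have "(p has_integral (P b - P a)) {a..b}" by (rule fundamental_theorem_of_calculus) (use assms in auto)
  then show ?thesis using assms(2) by (simp add: LINT_eq_HK integral_unique)
qed

text \<open>The kernel \<open>k\<close> is integrable but possibly unbounded. Suppose that \<open>x\<close> vanishes up to \<open>c\<close> and \<open>c\<close> is maximal.
On a short interval after \<open>c\<close> the integral of \<open>k\<close> is below one half, so the maximum of \<open>norm x\<close> there is at
most half of itself.\<close>

lemma gronwall_zero:
  fixes x :: "real \<Rightarrow> 'a::euclidean_space" and k :: "real \<Rightarrow> real"
  assumes x: "continuous_on {a..b} x" and k: "set_integrable lborel {a..b} k"
    and k0: "\<And>s. s \<in> {a..b} \<Longrightarrow> 0 \<le> k s"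
    and le: "\<And>t. t \<in> {a..b} \<Longrightarrow> norm (x t) \<le> (LINT s:{a..t}|lborel. k s * norm (x s))"
    and t: "t \<in> {a..b}"
  shows "x t = 0"
proof -
  have ab: "a \<le> b" using t by simp
  \<comment> \<open>\<open>c\<close> is the end of the longest initial interval on which \<open>x\<close> vanishes.\<close>
  define S where "S = {t \<in> {a..b}. \<forall>s\<in>{a..t}. x s = 0}"
  have "x a = 0" using le[of a] ab by simp
  then have aS: "a \<in> S" using ab by (auto simp: S_def)
  have bdd: "bdd_above S" by (auto simp: S_def intro: bdd_aboveI[of _ b])
  define c where "c = Sup S"
  have ac: "a \<le> c" unfolding c_def by (rule cSup_upper[OF aS bdd])
  have cb: "c \<le> b" unfolding c_def by (rule cSup_least) (use aS in \<open>auto simp: S_def\<close>)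
  have zlt: "x s = 0" if "a \<le> s" "s < c" for s
  proof -
    have "\<exists>u\<in>S. s < u"
    proof (rule ccontr)
      assume "\<not> (\<exists>u\<in>S. s < u)"
      then have "c \<le> s" unfolding c_def using aS by (intro cSup_least) (auto simp: not_less)
      with that show False by simp
    qed
    then obtain u where "u \<in> S" "s < u" by blast
    then show ?thesis using that by (auto simp: S_def)
  qed
  have zc: "x c = 0"
  proof (cases "a = c")
    case False
    have "continuous_on {a..c} x" by (rule continuous_on_subset[OF x]) (use cb in auto)
    then have "closed {s \<in> {a..c}. x s = 0}" by (intro continuous_closed_preimage_constant) auto
    then have "closure {a..<c} \<subseteq> {s \<in> {a..c}. x s = 0}" by (intro closure_minimal) (auto simp: zlt)
    moreover have "c \<in> closure {a..<c}" using False ac by simp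
    ultimately show ?thesis by blast
  qed (use \<open>x a = 0\<close> in simp)
  have zle: "x s = 0" if "s \<in> {a..c}" for s using that zlt zc by (cases "s = c") auto
  have "c = b"
  proof (rule ccontr)
    assume "c \<noteq> b"
    then have cb': "c < b" using cb by simp
    have kc: "set_integrable lborel {c..b} k" by (rule set_integrable_sub_interval[OF k ac]) simp
    have "continuous_on {c..b} (\<lambda>t. LINT s:{c..t}|lborel. k s)" by (rule continuous_on_LINT[OF kc])
    then have "\<exists>d>0. \<forall>u\<in>{c..b}. dist u c < d \<longrightarrow> dist (LINT s:{c..u}|lborel. k s) (LINT s:{c..c}|lborel. k s) < 1/2"
      using cb' unfolding continuous_on_iff by (metis atLeastAtMost_iff half_gt_zero_iff less_eq_real_def zero_less_one)
    then obtain d where d: "d > 0" "\<And>u. u\<in>{c..b} \<Longrightarrow> dist u c < d \<Longrightarrow> \<bar>LINT s:{c..u}|lborel. k s\<bar> < 1/2"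
      by (auto simp: dist_norm)
    define u where "u = min b (c + d/2)"
    have u: "c < u" "u \<le> b" "u < c + d" using d(1) cb' by (auto simp: u_def)
    have "continuous_on {c..u} (\<lambda>s. norm (x s))"
      by (intro continuous_intros continuous_on_subset[OF x]) (use ac u in auto)
    then obtain v where v: "v \<in> {c..u}" "\<And>s. s \<in> {c..u} \<Longrightarrow> norm (x s) \<le> norm (x v)"
      using continuous_attains_sup[of "{c..u}" "\<lambda>s. norm (x s)"] u by auto
    have vab: "v \<in> {a..b}" using v u ac by auto
    have kn: "set_integrable lborel {a..b} (\<lambda>s. k s * norm (x s))"
      by (rule set_integrable_bilinear[OF bounded_bilinear_mult k]) (intro continuous_intros x)
    have kv: "set_integrable lborel {c..v} k" by (rule set_integrable_sub_interval[OF k]) (use ac vab in auto)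
    have "norm (x v) \<le> (LINT s:{a..v}|lborel. k s * norm (x s))" by (rule le[OF vab])
    also have "\<dots> = (LINT s:{a..c}|lborel. k s * norm (x s)) + (LINT s:{c..v}|lborel. k s * norm (x s))"
      by (rule LINT_split) (use ac v vab in \<open>auto intro: set_integrable_sub_interval[OF kn]\<close>)
    also have "(LINT s:{a..c}|lborel. k s * norm (x s)) = (LINT s:{a..c}|lborel. 0)"
      by (intro set_lebesgue_integral_cong) (auto simp: zle)
    also have "(LINT s:{c..v}|lborel. k s * norm (x s)) \<le> (LINT s:{c..v}|lborel. k s * norm (x v))"
      by (rule set_integral_mono)
        (use ac v vab u in \<open>auto intro!: set_integrable_sub_interval[OF kn] set_integrable_mult_left kv mult_left_mono k0\<close>)
    also have "\<dots> = (LINT s:{c..v}|lborel. k s) * norm (x v)" by simp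
    also have "\<dots> \<le> 1/2 * norm (x v)"
      using d(2)[of v] v u by (intro mult_right_mono) (auto simp: dist_real_def)
    finally have "norm (x v) \<le> 0" by (simp add: set_lebesgue_integral_def)
    then have "x s = 0" if "s \<in> {c..u}" for s using v(2)[OF that] by auto
    then have "u \<in> S" using zle u ac by (auto simp: S_def) (metis atLeastAtMost_iff linear)
    then have "u \<le> c" unfolding c_def by (rule cSup_upper[OF _ bdd])
    with u show False by simp
  qed
  then show ?thesis using zle t by auto
qed

text \<open>The classical form with a constant rate. The running integral \<open>y\<close> of \<open>norm x\<close> satisfies
\<open>y' \<le> norm g + L y\<close>, and \<open>exp (- L u) y u\<close> is integrated.\<close>

lemma gronwall_linear:
  fixes x g :: "real \<Rightarrow> 'a::euclidean_space"
  assumes x: "continuous_on {0..T} x" and g: "continuous_on {0..T} g" and L: "0 \<le> L"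
    and le: "\<And>t. t \<in> {0..T} \<Longrightarrow> norm (x t) \<le> norm (g t) + L * (LINT s:{0..t}|lborel. norm (x s))"
    and t: "t \<in> {0..T}"
  shows "norm (x t) \<le> norm (g t) + L * exp (L * T) * (LINT s:{0..T}|lborel. norm (g s))"
proof -
  define y where "y u = integral {0..u} (\<lambda>s. norm (x s))" for u
  have yL: "(LINT s:{0..u}|lborel. norm (x s)) = y u" if "u \<in> {0..T}" for u
    unfolding y_def using that
    by (intro LINT_eq_HK borel_integrable_atLeastAtMost' continuous_intros continuous_on_subset[OF x]) auto
  have yd: "(y has_vector_derivative norm (x u)) (at u within {0..t})" if "u \<in> {0..t}" for u
    unfolding y_def using that t
    by (intro integral_has_vector_derivative continuous_intros continuous_on_subset[OF x]) auto
  have "((\<lambda>u. exp (-L*u) * y u) has_vector_derivative exp (-L*u) * norm (x u) - L * exp (-L*u) * y u) (at u within {0..t})"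
    if "u \<in> {0..t}" for u
    using yd[OF that] unfolding has_real_derivative_iff_has_vector_derivative[symmetric]
    by (auto intro!: derivative_eq_intros simp: algebra_simps)
  then have I: "((\<lambda>u. exp (-L*u) * norm (x u) - L * exp (-L*u) * y u) has_integral exp (-L*t) * y t - exp (-L*0) * y 0) {0..t}"
    using t by (intro fundamental_theorem_of_calculus) auto
  have gi: "(\<lambda>s. norm (g s)) integrable_on {0..t}"
    using t by (intro integrable_continuous_real continuous_intros continuous_on_subset[OF g]) auto
  have "exp (-L*t) * y t - exp (-L*0) * y 0 \<le> integral {0..t} (\<lambda>s. norm (g s))"
  proof (rule has_integral_le[OF I integrable_integral[OF gi]])
    fix u assume u: "u \<in> {0..t}"
    then have "norm (x u) - L * y u \<le> norm (g u)" using le[of u] yL[of u] t by auto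
    then have "exp (-L*u) * (norm (x u) - L * y u) \<le> exp (-L*u) * norm (g u)" by (intro mult_left_mono) auto
    also have "\<dots> \<le> 1 * norm (g u)" using L u by (intro mult_right_mono) auto
    finally show "exp (-L*u) * norm (x u) - L * exp (-L*u) * y u \<le> norm (g u)" by (simp add: algebra_simps)
  qed
  then have "exp (-L*t) * y t \<le> integral {0..t} (\<lambda>s. norm (g s))" by (simp add: y_def)
  then have "exp (L*t) * (exp (-L*t) * y t) \<le> exp (L*t) * integral {0..t} (\<lambda>s. norm (g s))" by (intro mult_left_mono) auto
  then have "y t \<le> exp (L*t) * integral {0..t} (\<lambda>s. norm (g s))"
    by (simp add: mult.assoc[symmetric] exp_add[symmetric])
  also have "\<dots> \<le> exp (L*T) * integral {0..T} (\<lambda>s. norm (g s))"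
    using t L gi by (intro mult_mono integral_nonneg integral_subset_le integrable_continuous_real continuous_intros g continuous_on_subset[OF g])
       (auto intro: mult_left_mono)
  also have "integral {0..T} (\<lambda>s. norm (g s)) = (LINT s:{0..T}|lborel. norm (g s))"
    by (intro LINT_eq_HK[symmetric] borel_integrable_atLeastAtMost' continuous_intros g)
  finally have "L * y t \<le> L * (exp (L * T) * (LINT s:{0..T}|lborel. norm (g s)))"
    using L by (rule mult_left_mono)
  then show ?thesis using le[OF t] yL[OF t] by simp
qed

section \<open>Picard iteration for linear integral equations\<close>

text \<open>The iterates serve measurability: each one is an explicit functional of the path \<open>g\<close>, so its limit, the
solution of the linear equation, depends on nothing but \<open>g\<close>.\<close>

primrec picard :: "(real \<Rightarrow> real^'d^'d) \<Rightarrow> (real \<Rightarrow> real^'d) \<Rightarrow> nat \<Rightarrow> real \<Rightarrow> real^'d" where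
  "picard A g 0 t = g t"
| "picard A g (Suc n) t = g t + (LINT s:{0..t}|lborel. A s *v picard A g n s)"

lemma continuous_on_mv: "continuous_on S A \<Longrightarrow> continuous_on S x \<Longrightarrow> continuous_on S (\<lambda>s. (A s :: real^'n^'m) *v x s)"
  by (rule mv.continuous_on)

lemma continuous_on_picard:
  assumes "continuous_on {0..T} A" "continuous_on {0..T} g"
  shows "continuous_on {0..T} (picard A g n)"
  by (induction n)
    (auto intro!: assms continuous_on_add continuous_on_LINT borel_integrable_atLeastAtMost' mv.continuous_on simp: picard.simps[abs_def] continuous_on_cong[OF refl picard.simps(1)] continuous_on_cong[OF refl picard.simps(2)])

lemma picard_tendsto:
  assumes A: "continuous_on {0..T} A" and g: "continuous_on {0..T} g" and x: "continuous_on {0..T} x"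
    and eq: "\<And>t. t \<in> {0..T} \<Longrightarrow> x t = g t + (LINT s:{0..t}|lborel. A s *v x s)"
    and t: "t \<in> {0..T}"
  shows "(\<lambda>n. picard A g n t) \<longlonglongrightarrow> x t"
proof -
  have "bounded (A ` {0..T})" by (rule compact_imp_bounded[OF compact_continuous_image[OF A compact_Icc]])
  then obtain L0 where L0: "\<And>s. s \<in> {0..T} \<Longrightarrow> norm (A s) \<le> L0"
    unfolding bounded_iff by blast
  define L where "L = \<bar>L0\<bar>"
  have L: "0 \<le> L" "\<And>s. s \<in> {0..T} \<Longrightarrow> norm (A s) \<le> L" using L0 by (force simp: L_def)+
  have "continuous_on {0..T} (\<lambda>s. x s - g s)" by (intro continuous_intros x g)
  then obtain D where D: "\<And>s. s \<in> {0..T} \<Longrightarrow> norm (x s - g s) \<le> D"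
    using compact_imp_bounded[OF compact_continuous_image[OF _ compact_Icc]] by (force simp: bounded_iff)
  have bd: "norm (x s - picard A g n s) \<le> D * (L * s) ^ n / fact n" if "s \<in> {0..T}" for n s
    using that
  proof (induction n arbitrary: s)
    case 0 then show ?case using D by simp
  next
    case (Suc n)
    let ?f = "\<lambda>r. A r *v (x r - picard A g n r)"
    let ?b = "\<lambda>r. L * (D * (L * r) ^ n / fact n)"
    have sub: "{0..s} \<subseteq> {0..T}" using Suc.prems by auto
    have i1: "set_integrable lborel {0..s} (\<lambda>r. A r *v x r)"
      and i2: "set_integrable lborel {0..s} (\<lambda>r. A r *v picard A g n r)"
      by (intro borel_integrable_atLeastAtMost' mv.continuous_on continuous_on_subset[OF A sub]
          continuous_on_subset[OF x sub] continuous_on_subset[OF continuous_on_picard[OF A g] sub])+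
    have if': "set_integrable lborel {0..s} ?f" unfolding mv.diff_right by (rule set_integral_diff[OF i1 i2])
    have ib: "set_integrable lborel {0..s} ?b" by (intro borel_integrable_atLeastAtMost' continuous_intros) auto
    have "x s - picard A g (Suc n) s = (LINT r:{0..s}|lborel. ?f r)"
      using eq[OF Suc.prems] by (simp add: mv.diff_right set_integral_diff(2)[OF i1 i2])
    also have "norm \<dots> \<le> (LINT r:{0..s}|lborel. norm (?f r))" by (rule set_integral_norm_bound[OF if'])
    also have "\<dots> \<le> (LINT r:{0..s}|lborel. ?b r)"
    proof (rule set_integral_mono[OF set_integrable_norm[OF if'] ib])
      fix r assume r: "r \<in> {0..s}"
      have "norm (?f r) \<le> norm (A r) * norm (x r - picard A g n r)" by (rule matrix_vector_norm_le)
      also have "\<dots> \<le> ?b r" using L Suc.IH[of r] r sub by (intro mult_mono) auto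
      finally show "norm (?f r) \<le> ?b r" .
    qed
    also have "\<dots> = integral {0..s} ?b" by (rule LINT_eq_HK[OF ib])
    also have "\<dots> = D * (L * s) ^ Suc n / fact (Suc n)"
    proof (rule integral_unique)
      have "(?b has_integral (D * (L * s) ^ Suc n / fact (Suc n) - D * (L * 0) ^ Suc n / fact (Suc n))) {0..s}"
      proof (rule fundamental_theorem_of_calculus)
        show "0 \<le> s" using Suc.prems by simp
        fix r assume "r \<in> {0..s}"
        have "((\<lambda>r. (L * r) ^ Suc n) has_real_derivative (real (Suc n) * (L * r) ^ n * L)) (at r within {0..s})"
          by (rule derivative_eq_intros refl | simp)+
        then have "((\<lambda>r. D * (L * r) ^ Suc n / fact (Suc n)) has_real_derivative (D * (real (Suc n) * (L * r) ^ n * L) / fact (Suc n))) (at r within {0..s})"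
          by (intro DERIV_cdivide DERIV_cmult)
        also have "D * (real (Suc n) * q * L) / fact (Suc n) = L * (D * q / fact n)" for q
          unfolding fact_Suc by (simp add: divide_simps del: of_nat_Suc)
        finally show "((\<lambda>r. D * (L * r) ^ Suc n / fact (Suc n)) has_vector_derivative ?b r) (at r within {0..s})"
          by (simp only: has_real_derivative_iff_has_vector_derivative)
      qed
      then show "(?b has_integral (D * (L * s) ^ Suc n / fact (Suc n))) {0..s}" by simp
    qed
    finally show ?case .
  qed
  have "(\<lambda>n. D * (inverse (fact n) * (L * t) ^ n)) \<longlonglongrightarrow> D * 0"
    by (intro tendsto_mult tendsto_const summable_LIMSEQ_zero summable_exp)
  then have "(\<lambda>n. x t - picard A g n t) \<longlonglongrightarrow> 0"
    by (intro Lim_null_comparison[OF always_eventually[OF allI[OF bd[OF t]]]]) (simp add: field_simps)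
  then show ?thesis using tendsto_diff[OF tendsto_const[of "x t"]] by fastforce
qed

section \<open>Positive definite matrices\<close>

lemma bounded_linear_trace: "bounded_linear (trace :: real^'n^'n \<Rightarrow> real)"
  unfolding trace_def
  by (intro bounded_linear_sum bounded_linear_compose[OF bounded_linear_vec_nth] bounded_linear_vec_nth)

lemma abs_trace_le: "\<bar>trace (A::real^'n^'n)\<bar> \<le> real CARD('n) * norm A"
proof -
  have "\<bar>trace A\<bar> \<le> (\<Sum>i\<in>UNIV. \<bar>A $ i $ i\<bar>)" unfolding trace_def by (rule sum_abs)
  also have "\<dots> \<le> (\<Sum>i\<in>(UNIV::'n set). norm A)"
    by (intro sum_mono order_trans[OF component_le_norm_cart Finite_Cartesian_Product.norm_nth_le])
  finally show ?thesis by simp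
qed

lemma inner_axis_matrix_axis: "axis i (1::real) \<bullet> (A *v axis j 1) = A $ i $ j"
  by (simp add: matrix_vector_mult_basis column_def inner_axis' )

text \<open>Test the form on \<open>e\<^sub>i + e\<^sub>j\<close> and on \<open>e\<^sub>i - e\<^sub>j\<close>. It lets traces, which are linear, replace norms in integrability
arguments.\<close>

lemma psd_entry_le_trace:
  fixes G :: "real^'n^'n"
  assumes sym: "transpose G = G" and psd: "\<And>v. 0 \<le> v \<bullet> (G *v v)"
  shows "\<bar>G $ i $ j\<bar> \<le> trace G"
proof -
  have Gji: "G $ j $ i = G $ i $ j"
    using arg_cong[OF sym, of "\<lambda>M. M $ i $ j"] by (simp add: transpose_def)
  have d: "0 \<le> G $ k $ k" for k using psd[of "axis k 1"] by (simp add: inner_axis_matrix_axis)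
  have dt: "G $ k $ k \<le> trace G" for k
    unfolding trace_def by (rule member_le_sum) (auto simp: d)
  have "0 \<le> G $ i $ i + G $ j $ j + 2 * G $ i $ j"
    using psd[of "axis i 1 + axis j 1"]
    by (simp add: mv.add_right inner_add_left inner_add_right inner_axis_matrix_axis Gji)
  moreover have "0 \<le> G $ i $ i + G $ j $ j - 2 * G $ i $ j"
    using psd[of "axis i 1 - axis j 1"]
    by (simp add: mv.diff_right inner_diff_left inner_diff_right inner_axis_matrix_axis Gji)
  ultimately show ?thesis using dt[of i] dt[of j] by linarith
qed

lemma psd_norm_le_trace:
  fixes G :: "real^'n^'n"
  assumes sym: "transpose G = G" and psd: "\<And>v. 0 \<le> v \<bullet> (G *v v)"
  shows "norm G \<le> real CARD('n) * real CARD('n) * trace G"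
proof -
  have "norm G \<le> (\<Sum>i\<in>UNIV. norm (G $ i))" unfolding norm_vec_def by (rule L2_set_le_sum) simp
  also have "\<dots> \<le> (\<Sum>i\<in>UNIV. \<Sum>j\<in>UNIV. \<bar>G $ i $ j\<bar>)" by (intro sum_mono norm_le_l1_cart)
  also have "\<dots> \<le> (\<Sum>i\<in>(UNIV::'n set). \<Sum>j\<in>(UNIV::'n set). trace G)"
    by (intro sum_mono psd_entry_le_trace sym psd)
  finally show ?thesis by simp
qed

lemma psd_trace_nonneg:
  fixes G :: "real^'n^'n"
  assumes psd: "\<And>v. 0 \<le> v \<bullet> (G *v v)"
  shows "0 \<le> trace G"
  unfolding trace_def
proof (rule sum_nonneg)
  show "0 \<le> G $ k $ k" for k using psd[of "axis k 1"] by (simp add: inner_axis_matrix_axis)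
qed

lemma matrix_inv_works:
  assumes "invertible (A::real^'n^'n)"
  shows "A ** matrix_inv A = mat 1" "matrix_inv A ** A = mat 1"
proof -
  have "A ** matrix_inv A = mat 1 \<and> matrix_inv A ** A = mat 1"
    using assms unfolding invertible_def matrix_inv_def by (rule someI_ex)
  then show "A ** matrix_inv A = mat 1" "matrix_inv A ** A = mat 1" by auto
qed

lemma pos_def_invertible: "pos_def S \<Longrightarrow> invertible S"
proof -
  assume S: "pos_def S"
  have "\<forall>x. S *v x = 0 \<longrightarrow> x = 0" using S unfolding pos_def_def by (metis inner_zero_right less_irrefl)
  then obtain B where "B ** S = mat 1" using matrix_left_invertible_ker by blast
  then show ?thesis unfolding invertible_def using matrix_left_right_inverse by blast
qed

lemmas pos_def_inv_right = matrix_inv_works(1)[OF pos_def_invertible]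
lemmas pos_def_inv_left = matrix_inv_works(2)[OF pos_def_invertible]

lemma pos_def_matrix_inv: "pos_def S \<Longrightarrow> pos_def (matrix_inv S)"
proof -
  assume S: "pos_def S"
  let ?J = "matrix_inv S"
  have J: "S ** ?J = mat 1" "?J ** S = mat 1" using S by (auto intro: pos_def_inv_left pos_def_inv_right)
  have tS: "transpose S = S" using S by (simp add: pos_def_def)
  have "transpose ?J ** S = mat 1"
    using arg_cong[OF J(1), of transpose] by (simp add: matrix_transpose_mul tS)
  then have tJ: "transpose ?J = ?J"
    using J by (metis matrix_mul_assoc matrix_mul_lid matrix_mul_rid)
  have "0 < v \<bullet> (?J *v v)" if "v \<noteq> 0" for v
  proof -
    have Sv: "S *v (?J *v v) = v" by (simp add: matrix_vector_mul_assoc J)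
    then have "?J *v v \<noteq> 0" using that by force
    then have "0 < (?J *v v) \<bullet> (S *v (?J *v v))" using S by (simp add: pos_def_def)
    then show ?thesis by (simp add: Sv inner_commute)
  qed
  with tJ show ?thesis by (simp add: pos_def_def)
qed

lemma pos_def_nonneg: "pos_def S \<Longrightarrow> 0 \<le> v \<bullet> (S *v v)"
  by (cases "v = 0") (auto simp: pos_def_def less_imp_le)

text \<open>The margin is the minimum of the form on the unit sphere. The symmetry of \<open>S'\<close> must be required
separately because \<open>pos_def\<close> includes it.\<close>

lemma pos_def_near:
  assumes S: "pos_def (S::real^'n^'n)"
  shows "\<exists>e>0. \<forall>S'. transpose S' = S' \<and> norm (S' - S) < e \<longrightarrow> pos_def S'"
proof -
  let ?f = "\<lambda>v::real^'n. v \<bullet> (S *v v)"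
  have "continuous_on (sphere 0 1) ?f" by (intro continuous_intros mv.continuous_on)
  moreover have "axis undefined 1 \<in> sphere (0::real^'n) 1" by (simp add: norm_eq_sqrt_inner inner_axis_axis)
  ultimately obtain u where u: "norm u = 1" "\<And>v. norm v = 1 \<Longrightarrow> ?f u \<le> ?f v"
    using continuous_attains_inf[of "sphere (0::real^'n) 1" ?f] by auto
  have pos: "0 < ?f u" using S u(1) unfolding pos_def_def by (metis norm_zero zero_neq_one)
  have "pos_def S'" if S': "transpose S' = S'" "norm (S' - S) < ?f u" for S'
    unfolding pos_def_def
  proof (intro conjI allI impI S'(1))
    fix v :: "real^'n" assume v: "v \<noteq> 0"
    have "?f u \<le> ?f (v /\<^sub>R norm v)" using v by (intro u(2)) simp
    then have 1: "?f u * (norm v)\<^sup>2 \<le> ?f v"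
      using v by (simp add: mv.scaleR_right field_simps power2_eq_square)
    have "\<bar>v \<bullet> ((S' - S) *v v)\<bar> \<le> norm v * norm ((S' - S) *v v)" by (rule Cauchy_Schwarz_ineq2)
    also have "\<dots> \<le> norm v * (norm (S' - S) * norm v)" by (intro mult_left_mono matrix_vector_norm_le) simp
    also have "\<dots> < norm v * (?f u * norm v)" using v S'(2) by simp
    finally show "0 < v \<bullet> (S' *v v)"
      using 1 by (simp add: mv.diff_left inner_diff_right power2_eq_square mult_ac)
  qed
  with pos show ?thesis by blast
qed

lemma measurable_matrix_inv_indicator:
  "(\<lambda>A. indicator {A::real^'n^'n. invertible A} A *\<^sub>R matrix_inv A) \<in> borel_measurable borel"
proof (rule borel_measurable_continuous_on_indicator)
  have "continuous_on UNIV (det :: real^'n^'n \<Rightarrow> real)"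
    unfolding det_def by (intro continuous_intros)
  then have "open {A::real^'n^'n. det A \<noteq> 0}"
    by (intro open_Collect_neq continuous_intros)
  then show "{A::real^'n^'n. invertible A} \<in> sets borel" by (simp add: invertible_det_nz)
  show "continuous_on {A::real^'n^'n. invertible A} matrix_inv"
    unfolding continuous_on_def
  proof
    fix A :: "real^'n^'n" assume A: "A \<in> {A. invertible A}"
    show "(matrix_inv \<longlongrightarrow> matrix_inv A) (at A within {A. invertible A})"
      by (rule tendsto_matrix_inverse_path[where P="\<lambda>x. x"]) (use A in \<open>auto simp: matrix_inv_works\<close>)
  qed
qed

lemma set_borel_measurable_matrix_inv:
  fixes R :: "real \<Rightarrow> real^'n^'n"
  assumes "set_borel_measurable lborel S R" "\<And>t. t \<in> S \<Longrightarrow> invertible (R t)" and S: "S \<in> sets borel"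
  shows "set_borel_measurable lborel S (\<lambda>t. matrix_inv (R t))"
proof -
  have "(\<lambda>t. indicator S t *\<^sub>R (\<lambda>A. indicator {A::real^'n^'n. invertible A} A *\<^sub>R matrix_inv A) (indicator S t *\<^sub>R R t)) \<in> borel_measurable lborel"
    using S measurable_compose[OF assms(1)[unfolded set_borel_measurable_def] measurable_matrix_inv_indicator]
    by (intro borel_measurable_scaleR[OF borel_measurable_indicator]) auto
  moreover have "(\<lambda>t. indicator S t *\<^sub>R (\<lambda>A. indicator {A::real^'n^'n. invertible A} A *\<^sub>R matrix_inv A) (indicator S t *\<^sub>R R t)) = (\<lambda>t. indicator S t *\<^sub>R matrix_inv (R t))"
    using assms(2) by (auto simp: fun_eq_iff indicator_def)
  ultimately show ?thesis by (simp add: set_borel_measurable_def)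
qed

lemma set_borel_measurable_bilinear:
  fixes f :: "real \<Rightarrow> 'a::euclidean_space" and g :: "real \<Rightarrow> 'b::euclidean_space" and prod :: "'a \<Rightarrow> 'b \<Rightarrow> 'c::euclidean_space"
  assumes bil: "bounded_bilinear prod" and f: "set_borel_measurable lborel S f" and g: "set_borel_measurable lborel S g"
  shows "set_borel_measurable lborel S (\<lambda>s. prod (f s) (g s))"
proof -
  interpret bounded_bilinear prod by (rule bil)
  have cont: "continuous_on UNIV (\<lambda>z::'a\<times>'b. prod (fst z) (snd z))"
    by (intro continuous_on continuous_intros)
  have eq: "(\<lambda>s. indicator S s *\<^sub>R prod (f s) (g s)) =
      (\<lambda>s. prod (indicator S s *\<^sub>R f s) (indicator S s *\<^sub>R g s))"
    by (auto simp: fun_eq_iff scaleR_left scaleR_right indicator_def)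
  show ?thesis unfolding set_borel_measurable_def eq
    using borel_measurable_continuous_on[OF cont borel_measurable_Pair[OF f[unfolded set_borel_measurable_def] g[unfolded set_borel_measurable_def]]] by simp
qed

lemma set_borel_measurable_continuous_Icc:
  fixes f :: "real \<Rightarrow> 'a::euclidean_space"
  shows "continuous_on {a..b} f \<Longrightarrow> set_borel_measurable lborel {a..b} f"
  unfolding set_borel_measurable_def using borel_measurable_continuous_on_indicator[of "{a..b}" f] by simp

text \<open>The fundamental theorem of calculus delivers integrals in the Henstock-Kurzweil sense. A nonnegative
function integrable in that sense is Lebesgue integrable, and so is everything that it dominates.\<close>

lemma set_integrable_dominated_HK:
  fixes y :: "real \<Rightarrow> real" and g :: "real \<Rightarrow> 'a::euclidean_space"
  assumes y: "y integrable_on S" and y0: "\<And>t. t \<in> S \<Longrightarrow> norm (g t) \<le> y t"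
    and g: "set_borel_measurable lborel S g"
  shows "set_integrable lborel S g"
proof -
  have "set_integrable lebesgue S y"
    using y y0 by (intro nonnegative_absolutely_integrable_1) (auto intro: order_trans[OF norm_ge_zero])
  then have "set_integrable lebesgue S g"
  proof (rule set_integrable_bound)
    show "set_borel_measurable lebesgue S g"
      using g unfolding set_borel_measurable_def by (rule measurable_completion)
    show "AE t in lebesgue. t \<in> S \<longrightarrow> norm (g t) \<le> norm (y t)" using y0 by (force intro!: AE_I2)
  qed
  then show ?thesis
    using g unfolding set_borel_measurable_def set_integrable_def by (simp add: integrable_completion)
qed

lemma set_integrable_linear_add:
  fixes f g :: "real \<Rightarrow> 'a::euclidean_space"
  shows "set_integrable lborel S f \<Longrightarrow> set_integrable lborel S g \<Longrightarrow> set_integrable lborel S (\<lambda>t. f t + g t)"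
  by simp

section \<open>Positivity and integrability along the Riccati equation\<close>

locale riccati_flow =
  fixes A Q \<Sigma> :: "real \<Rightarrow> real^'d^'d" and C :: "real \<Rightarrow> real^'d^'m" and R :: "real \<Rightarrow> real^'m^'m"
  assumes contA: "continuous_on {0..} A" and contC: "continuous_on {0..} C"
    and Qpos: "\<And>t. t \<ge> 0 \<Longrightarrow> pos_def (Q t)" and Rpos: "\<And>t. t \<ge> 0 \<Longrightarrow> pos_def (R t)"
    and Qint: "\<And>T. T \<ge> 0 \<Longrightarrow> set_integrable lborel {0..T} Q"
    and Rint: "\<And>T. T \<ge> 0 \<Longrightarrow> set_integrable lborel {0..T} R"
    and \<Sigma>0: "pos_def (\<Sigma> 0)"
    and riccati: "\<And>t. t \<ge> 0 \<Longrightarrow>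
          (\<Sigma> has_vector_derivative
             (A t ** \<Sigma> t + \<Sigma> t ** transpose (A t) + Q t
              - \<Sigma> t ** transpose (C t) ** matrix_inv (R t) ** C t ** \<Sigma> t)) (at t within {0..})"
begin

definition "G t = transpose (C t) ** matrix_inv (R t) ** C t"

lemma riccati': "t \<ge> 0 \<Longrightarrow> (\<Sigma> has_vector_derivative
             (A t ** \<Sigma> t + \<Sigma> t ** transpose (A t) + Q t - \<Sigma> t ** G t ** \<Sigma> t)) (at t within {0..})"
  using riccati[of t] by (simp add: G_def matrix_mul_assoc)

lemma cont\<Sigma>: "continuous_on {0..} \<Sigma>"
  unfolding continuous_on_eq_continuous_within
  using riccati has_vector_derivative_continuous by (metis atLeast_iff)

lemma G_sym: "t \<ge> 0 \<Longrightarrow> transpose (G t) = G t"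
  using pos_def_matrix_inv[OF Rpos, of t] by (simp add: G_def matrix_transpose_mul matrix_mul_assoc pos_def_def)

lemma G_psd: assumes "t \<ge> 0" shows "0 \<le> v \<bullet> (G t *v v)"
proof -
  have "v \<bullet> (G t *v v) = (C t *v v) \<bullet> (matrix_inv (R t) *v (C t *v v))"
    unfolding G_def by (simp add: matrix_vector_mul_assoc[symmetric] inner_transpose_matrix del: transpose_matrix_vector)
  then show ?thesis using pos_def_nonneg[OF pos_def_matrix_inv[OF Rpos[OF assms]]] by simp
qed

lemma sub_halfline: "0 \<le> a \<Longrightarrow> {a..b} \<subseteq> {0::real..}" by auto

lemma invR_measurable: "0 \<le> a \<Longrightarrow> set_borel_measurable lborel {a..b} (\<lambda>t. matrix_inv (R t))"
proof (rule set_borel_measurable_matrix_inv)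
  assume a: "0 \<le> a"
  show "set_borel_measurable lborel {a..b} R"
  proof (cases "a \<le> b")
    case True
    have "set_integrable lborel {a..b} R" by (rule set_integrable_sub_interval[OF Rint[of b]]) (use a True in auto)
    then show ?thesis unfolding set_integrable_def set_borel_measurable_def by (rule borel_measurable_integrable)
  qed (simp add: set_borel_measurable_def)
  show "invertible (R t)" if "t \<in> {a..b}" for t using that a by (intro pos_def_invertible Rpos) auto
qed simp

lemma G_measurable: assumes "0 \<le> a" shows "set_borel_measurable lborel {a..b} G"
proof -
  have C: "continuous_on {a..b} C" using contC sub_halfline[OF assms] by (rule continuous_on_subset)
  show ?thesis unfolding G_def[abs_def]
    by (intro set_borel_measurable_bilinear[OF bounded_bilinear_matrix_matrix] invR_measurable assms
       set_borel_measurable_continuous_Icc C bounded_linear.continuous_on[OF bounded_linear_transpose])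
qed

text \<open>The derivative of \<open>\<Sigma>\<close> is integrable in the Henstock-Kurzweil sense, and the other terms of the Riccati
equation are integrable. So the quadratic term is, too, without any a priori bound on \<open>R\<^sup>-\<^sup>1\<close>.\<close>

lemma SGS_integrable_on:
  assumes a: "0 \<le> a" "a \<le> b"
  shows "(\<lambda>t. \<Sigma> t ** G t ** \<Sigma> t) integrable_on {a..b}"
proof -
  let ?S = "\<lambda>t. \<Sigma> t ** G t ** \<Sigma> t"
  let ?L = "\<lambda>t. A t ** \<Sigma> t + \<Sigma> t ** transpose (A t) + Q t"
  have c: "continuous_on {a..b} A" "continuous_on {a..b} \<Sigma>"
    using contA cont\<Sigma> by (auto intro: continuous_on_subset[OF _ sub_halfline[OF a(1)]])
  have "set_integrable lborel {a..b} Q" by (rule set_integrable_sub_interval[OF Qint[of b]]) (use a in auto)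
  then have Q: "Q integrable_on {a..b}" by (rule set_borel_integral_eq_integral)
  have L: "?L integrable_on {a..b}"
    by (intro integrable_add[OF _ Q] integrable_continuous_real continuous_on_add mm.continuous_on c
        bounded_linear.continuous_on[OF bounded_linear_transpose])
  have "((\<lambda>t. ?L t - ?S t) has_integral (\<Sigma> b - \<Sigma> a)) {a..b}"
    by (rule fundamental_theorem_of_calculus[OF a(2)])
      (use a in \<open>auto intro: has_vector_derivative_within_subset[OF riccati']\<close>)
  then have "(\<lambda>t. ?L t - (?L t - ?S t)) integrable_on {a..b}" by (rule integrable_diff[OF L has_integral_integrable])
  then show ?thesis by simp
qed

lemma trace_sandwich:
  fixes J X Y :: "real^'d^'d"
  shows "trace (J ** (X ** Y ** X) ** J) = trace ((X ** J ** J ** X) ** Y)"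
proof -
  have "trace (J ** (X ** Y ** X) ** J) = trace ((J ** X) ** (Y ** X ** J))" by (simp add: matrix_mul_assoc)
  also have "\<dots> = trace ((Y ** X ** J) ** (J ** X))" by (rule trace_mul_sym)
  also have "\<dots> = trace (Y ** (X ** J ** J ** X))" by (simp add: matrix_mul_assoc)
  also have "\<dots> = trace ((X ** J ** J ** X) ** Y)" by (rule trace_mul_sym)
  finally show ?thesis .
qed

text \<open>Symmetry is the issue here. A solution of the Riccati equation is symmetric because
\<open>\<Sigma> - \<Sigma>\<^sup>T\<close> solves a homogeneous linear equation, but Gronwall's inequality needs its coefficient, which contains \<open>G\<close>,
to be integrable. With \<open>J = (\<Sigma> t0)\<^sup>-\<^sup>1\<close> the trace of \<open>J (\<Sigma> G \<Sigma>) J\<close> is the trace of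
\<open>(\<Sigma> J J \<Sigma>) G\<close>, and \<open>\<Sigma> J J \<Sigma>\<close> is close to the identity near \<open>t0\<close>. So the trace of \<open>G\<close> is at most twice an
integrable function.\<close>

lemma pos_def_locally:
  assumes t0: "0 \<le> t0" and S0: "pos_def (\<Sigma> t0)"
  shows "\<exists>d>0. \<forall>t\<in>{t0..t0+d}. pos_def (\<Sigma> t)"
proof -
  let ?J = "matrix_inv (\<Sigma> t0)"
  let ?E = "\<lambda>t. \<Sigma> t ** ?J ** ?J ** \<Sigma> t - mat 1"
  let ?y = "\<lambda>t. trace (?J ** (\<Sigma> t ** G t ** \<Sigma> t) ** ?J)"
  define N where "N = real CARD('d)"
  have N: "N > 0" by (simp add: N_def)
  have E0: "?E t0 = 0" by (simp add: pos_def_inv_right[OF S0] pos_def_inv_left[OF S0] matrix_mul_assoc[symmetric])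
  obtain e where e: "e > 0" "\<And>S'. transpose S' = S' \<Longrightarrow> norm (S' - \<Sigma> t0) < e \<Longrightarrow> pos_def S'"
    using pos_def_near[OF S0] by blast
  have cE: "continuous_on {0..} (\<lambda>t. norm (?E t))"
    by (intro continuous_intros mm.continuous_on cont\<Sigma>)
  \<comment> \<open>This bound on \<open>?E\<close> makes \<open>trace (?E t ** G t)\<close> at most half of \<open>trace (G t)\<close>.\<close>
  obtain d1 where d1: "d1 > 0" "\<And>t. t \<ge> 0 \<Longrightarrow> dist t t0 < d1 \<Longrightarrow> norm (?E t) < 1 / (2 * N * (N * N))"
  proof -
    define r where "r = 1 / (2 * N * (N * N))"
    have "r > 0" using N by (simp add: r_def)
    then obtain d where d: "d > 0" "\<And>t. t \<in> {0..} \<Longrightarrow> dist t t0 < d \<Longrightarrow> dist (norm (?E t)) (norm (?E t0)) < r"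
      using cE[unfolded continuous_on_iff, rule_format, of t0 r] t0 by auto
    have "norm (?E t) < r" if "t \<ge> 0" "dist t t0 < d" for t
      using d(2)[of t] that unfolding E0 by simp
    then show ?thesis using that[OF d(1)] by (simp add: r_def)
  qed
  obtain d2 where d2: "d2 > 0" "\<And>t. t \<ge> 0 \<Longrightarrow> dist t t0 < d2 \<Longrightarrow> norm (\<Sigma> t - \<Sigma> t0) < e"
    using cont\<Sigma> t0 e(1) unfolding continuous_on_iff dist_norm by (metis atLeast_iff)
  define d where "d = min d1 d2 / 2"
  have d: "d > 0" "d < d1" "d < d2" using d1(1) d2(1) by (auto simp: d_def)
  let ?I = "{t0..t0+d}"
  have nn: "t \<ge> 0" if "t \<in> ?I" for t using that t0 by simp
  have yG: "trace (G t) \<le> 2 * ?y t" if t: "t \<in> ?I" for t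
  proof -
    have tr0: "0 \<le> trace (G t)" by (rule psd_trace_nonneg[OF G_psd[OF nn[OF t]]])
    have "?y t = trace (?E t ** G t) + trace (G t)"
      unfolding trace_sandwich by (simp add: mm.diff_left trace_sub)
    moreover have "\<bar>trace (?E t ** G t)\<bar> \<le> 1/2 * trace (G t)"
    proof -
      have "\<bar>trace (?E t ** G t)\<bar> \<le> N * (norm (?E t) * norm (G t))"
        using abs_trace_le[of "?E t ** G t"] matrix_matrix_norm_le[of "?E t" "G t"] N
        unfolding N_def by (meson mult_left_mono of_nat_0_le_iff order_trans)
      also have "\<dots> \<le> N * ((1 / (2 * N * (N * N))) * (N * N * trace (G t)))"
        using d1(2)[of t] t nn[OF t] d N psd_norm_le_trace[OF G_sym G_psd, OF nn[OF t] nn[OF t]] tr0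
        unfolding N_def by (intro mult_left_mono mult_mono less_imp_le[OF d1(2)]) (auto simp: dist_real_def)
      also have "\<dots> = 1/2 * trace (G t)" using N by (simp add: field_simps)
      finally show ?thesis .
    qed
    ultimately show ?thesis by linarith
  qed
  have G: "set_integrable lborel ?I G"
  proof (rule set_integrable_dominated_HK)
    have "(\<lambda>S. (N * N * 2) * trace (?J ** S ** ?J)) \<circ> (\<lambda>t. \<Sigma> t ** G t ** \<Sigma> t) integrable_on ?I"
      by (intro integrable_linear SGS_integrable_on bounded_linear_compose[OF bounded_linear_mult_right] bounded_linear_compose[OF bounded_linear_trace]
        bounded_linear_compose[OF mm.bounded_linear_left] mm.bounded_linear_right) (use t0 d in auto)
    then show "(\<lambda>t. (N * N * 2) * ?y t) integrable_on ?I" by (simp add: o_def)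
    fix t assume t: "t \<in> ?I"
    have "norm (G t) \<le> N * N * trace (G t)"
      using psd_norm_le_trace[OF G_sym G_psd, OF nn[OF t] nn[OF t]] by (simp add: N_def)
    also have "\<dots> \<le> N * N * (2 * ?y t)" using yG[OF t] N by (intro mult_left_mono) auto
    finally show "norm (G t) \<le> (N * N * 2) * ?y t" by (simp add: mult_ac)
  qed (rule G_measurable[OF t0])
  \<comment> \<open>The skew part \<open>?U\<close> of \<open>\<Sigma>\<close> and its linear equation \<open>?U' = ?p\<close>.\<close>
  let ?U = "\<lambda>t. \<Sigma> t - transpose (\<Sigma> t)"
  let ?p = "\<lambda>t. A t ** ?U t + ?U t ** transpose (A t) - ?U t ** G t ** \<Sigma> t - transpose (\<Sigma> t) ** G t ** ?U t"
  let ?k = "\<lambda>t. 2 * norm (A t) + 2 * (norm (G t) * norm (\<Sigma> t))"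
  have cA: "continuous_on ?I A" and cS: "continuous_on ?I \<Sigma>"
    using contA cont\<Sigma> by (auto intro: continuous_on_subset[OF _ sub_halfline[OF t0]])
  have cT: "continuous_on ?I (\<lambda>t. transpose (\<Sigma> t))" "continuous_on ?I (\<lambda>t. transpose (A t))"
    by (intro bounded_linear.continuous_on[OF bounded_linear_transpose] cS cA)+
  have cU: "continuous_on ?I ?U" by (intro continuous_intros cS cT)
  note mi = set_integrable_bilinear[OF bounded_bilinear_matrix_matrix]
    set_integrable_bilinear[OF bounded_bilinear.flip[OF bounded_bilinear_matrix_matrix]]
  have ip: "set_integrable lborel ?I ?p"
    by (intro set_integral_diff set_integrable_linear_add mi G cU cS cT
        borel_integrable_atLeastAtMost' mm.continuous_on cA)
  have ik: "set_integrable lborel ?I ?k"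
    by (intro set_integrable_linear_add borel_integrable_atLeastAtMost' continuous_intros cA
      set_integrable_mult_right set_integrable_bilinear[OF bounded_bilinear_mult] set_integrable_norm G cS)
  have der: "(?U has_vector_derivative ?p t) (at t within {0..})" if t: "t \<ge> 0" for t
  proof -
    have "(?U has_vector_derivative (A t ** \<Sigma> t + \<Sigma> t ** transpose (A t) + Q t - \<Sigma> t ** G t ** \<Sigma> t)
        - transpose (A t ** \<Sigma> t + \<Sigma> t ** transpose (A t) + Q t - \<Sigma> t ** G t ** \<Sigma> t)) (at t within {0..})"
      by (intro has_vector_derivative_diff bounded_linear.has_vector_derivative[OF bounded_linear_transpose] riccati'[OF t])
    moreover have "transpose (Q t) = Q t" using Qpos[OF t] by (simp add: pos_def_def)
    ultimately show ?thesis
      by (elim has_vector_derivative_eq_rhs)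
        (simp add: transpose_add transpose_diff matrix_transpose_mul G_sym[OF t] mm.diff_left mm.diff_right matrix_mul_assoc)
  qed
  have n3: "norm (a ** b ** c) \<le> norm a * norm b * norm c" for a b c :: "real^'d^'d"
    by (meson matrix_matrix_norm_le mult_right_mono norm_ge_zero order_trans)
  have "?U t = 0" if t: "t \<in> ?I" for t
  proof (rule gronwall_zero[OF cU ik _ _ t])
    fix s assume s: "s \<in> ?I"
    show "0 \<le> ?k s" by simp
    have ints: "set_integrable lborel {t0..s} ?p" "set_integrable lborel {t0..s} ?k" "continuous_on {t0..s} ?U"
      using s by (auto intro: set_integrable_sub_interval[OF ip] set_integrable_sub_interval[OF ik] continuous_on_subset[OF cU])
    have "?U s = ?U t0 + (LINT r:{t0..s}|lborel. ?p r)"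
      by (rule LINT_FTC) (use s t0 ints in \<open>auto intro!: has_vector_derivative_within_subset[OF der]\<close>)
    also have "?U t0 = 0" using S0 by (simp add: pos_def_def)
    finally have "norm (?U s) = norm (LINT r:{t0..s}|lborel. ?p r)" by simp
    also have "\<dots> \<le> (LINT r:{t0..s}|lborel. norm (?p r))" by (rule set_integral_norm_bound[OF ints(1)])
    also have "\<dots> \<le> (LINT r:{t0..s}|lborel. ?k r * norm (?U r))"
    proof (rule set_integral_mono)
      show "set_integrable lborel {t0..s} (\<lambda>r. norm (?p r))" by (rule set_integrable_norm[OF ints(1)])
      show "set_integrable lborel {t0..s} (\<lambda>r. ?k r * norm (?U r))"
        by (intro set_integrable_bilinear[OF bounded_bilinear_mult ints(2)] continuous_on_norm ints(3))
      fix r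
      have "norm (?p r) \<le> norm (A r ** ?U r) + norm (?U r ** transpose (A r)) + norm (?U r ** G r ** \<Sigma> r)
          + norm (transpose (\<Sigma> r) ** G r ** ?U r)"
        using norm_triangle_ineq4 norm_triangle_ineq by (smt (verit))
      also have "\<dots> \<le> norm (A r) * norm (?U r) + norm (?U r) * norm (A r) + norm (?U r) * norm (G r) * norm (\<Sigma> r)
          + norm (\<Sigma> r) * norm (G r) * norm (?U r)"
        using matrix_matrix_norm_le[of "A r" "?U r"] matrix_matrix_norm_le[of "?U r" "transpose (A r)"]
          n3[of "?U r" "G r" "\<Sigma> r"] n3[of "transpose (\<Sigma> r)" "G r" "?U r"] by (simp only: norm_transpose)
      also have "\<dots> = ?k r * norm (?U r)" by (simp add: algebra_simps)
      finally show "norm (?p r) \<le> ?k r * norm (?U r)" .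
    qed
    finally show "norm (?U s) \<le> (LINT r:{t0..s}|lborel. ?k r * norm (?U r))" .
  qed
  then have "pos_def (\<Sigma> t)" if "t \<in> ?I" for t
    using that d d2(2)[of t] t0 by (intro e(2)) (auto simp: dist_real_def)
  then show ?thesis using d by blast
qed

text \<open>The limit is positive semidefinite. If it annihilated some \<open>v \<noteq> 0\<close>, the derivative of \<open>v \<bullet> \<Sigma> v\<close>
at \<open>t0\<close> would be \<open>v \<bullet> Q v > 0\<close>, so that the form would be negative just before \<open>t0\<close>.\<close>

lemma pos_def_left_limit:
  assumes t0: "0 < t0" and S: "\<And>t. 0 \<le> t \<Longrightarrow> t < t0 \<Longrightarrow> pos_def (\<Sigma> t)"
  shows "pos_def (\<Sigma> t0)"
proof -
  have cl: "t0 \<in> closure {0..<t0}" using t0 by simp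
  have c: "continuous_on {0..t0} \<Sigma>" using cont\<Sigma> by (rule continuous_on_subset) auto
  have sym: "transpose (\<Sigma> t0) = \<Sigma> t0"
  proof -
    have "closed {t \<in> {0..t0}. transpose (\<Sigma> t) - \<Sigma> t = 0}"
      by (intro continuous_closed_preimage_constant continuous_intros c bounded_linear.continuous_on[OF bounded_linear_transpose])
    then have "closure {0..<t0} \<subseteq> {t \<in> {0..t0}. transpose (\<Sigma> t) - \<Sigma> t = 0}"
      using S by (intro closure_minimal) (auto simp: pos_def_def)
    from subsetD[OF this cl] show ?thesis by simp
  qed
  have psd: "0 \<le> v \<bullet> (\<Sigma> t0 *v v)" for v
  proof -
    have "continuous_on {0..t0} (\<lambda>t. v \<bullet> (\<Sigma> t *v v))" by (intro continuous_intros mv.continuous_on c)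
    then have "closed {t \<in> {0..t0}. 0 \<le> v \<bullet> (\<Sigma> t *v v)}"
      by (intro continuous_on_closed_Collect_le continuous_on_const closed_atLeastAtMost)
    moreover have "{0..<t0} \<subseteq> {t \<in> {0..t0}. 0 \<le> v \<bullet> (\<Sigma> t *v v)}"
    proof
      fix t assume "t \<in> {0..<t0}"
      then show "t \<in> {t \<in> {0..t0}. 0 \<le> v \<bullet> (\<Sigma> t *v v)}" using pos_def_nonneg[OF S[of t], of v] by simp
    qed
    ultimately have "closure {0..<t0} \<subseteq> {t \<in> {0..t0}. 0 \<le> v \<bullet> (\<Sigma> t *v v)}" by (intro closure_minimal)
    then show ?thesis using cl by blast
  qed
  have "0 < v \<bullet> (\<Sigma> t0 *v v)" if v: "v \<noteq> 0" for v
  proof (rule ccontr)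
    assume "\<not> 0 < v \<bullet> (\<Sigma> t0 *v v)"
    then have z: "v \<bullet> (\<Sigma> t0 *v v) = 0" using psd[of v] by simp
    define w where "w = \<Sigma> t0 *v v"
    have wv: "w \<bullet> (\<Sigma> t0 *v v) = (norm w)\<^sup>2" "v \<bullet> (\<Sigma> t0 *v w) = (norm w)\<^sup>2"
      using sym by (simp_all add: w_def power2_norm_eq_inner inner_transpose_matrix del: transpose_matrix_vector)
    define c where "c = w \<bullet> (\<Sigma> t0 *v w)"
    define n where "n = (norm w)\<^sup>2"
    have c0: "0 \<le> c" unfolding c_def by (rule psd)
    \<comment> \<open>A vector on which a semidefinite form vanishes lies in the kernel: perturb \<open>v\<close> in the direction of \<open>w\<close>.\<close>
    have "w = 0"
    proof (rule ccontr)
      assume "w \<noteq> 0"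
      then have n0: "0 < n" by (simp add: n_def)
      define r where "r = n / (c + 1)"
      have r: "r > 0" "r * (c + 1) = n" using n0 c0 by (auto simp: r_def)
      have "0 \<le> (v - r *\<^sub>R w) \<bullet> (\<Sigma> t0 *v (v - r *\<^sub>R w))" by (rule psd)
      also have "\<dots> = r * (r * c - 2 * n)"
        using z wv by (simp add: mv.diff_right mv.scaleR_right inner_diff_left inner_diff_right c_def n_def algebra_simps)
      finally have "0 \<le> r * c - 2 * n" using r(1) by (simp add: zero_le_mult_iff)
      then show False using r n0 c0 by (simp add: algebra_simps)
    qed
    then have Sv: "\<Sigma> t0 *v v = 0" by (simp add: w_def)
    let ?D = "A t0 ** \<Sigma> t0 + \<Sigma> t0 ** transpose (A t0) + Q t0 - \<Sigma> t0 ** G t0 ** \<Sigma> t0"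
    have "((\<lambda>t. v \<bullet> (\<Sigma> t *v v)) has_vector_derivative v \<bullet> (?D *v v)) (at t0 within {0..})"
      by (intro bounded_linear.has_vector_derivative[OF bounded_linear_compose[OF bounded_linear_inner_right mv.bounded_linear_left]]
         riccati') (use t0 in simp)
    moreover have "v \<bullet> (?D *v v) = v \<bullet> (Q t0 *v v)"
    proof -
      have "v \<bullet> (\<Sigma> t0 *v u) = 0" for u
        using sym Sv by (simp add: inner_transpose_matrix del: transpose_matrix_vector)
      then show ?thesis
        by (simp add: mv.add_left mv.diff_left matrix_vector_mul_assoc[symmetric] Sv inner_add_right inner_diff_right)
    qed
    ultimately have d: "((\<lambda>t. v \<bullet> (\<Sigma> t *v v)) has_real_derivative v \<bullet> (Q t0 *v v)) (at t0 within {0..})"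
      by (simp add: has_real_derivative_iff_has_vector_derivative)
    have "0 < v \<bullet> (Q t0 *v v)" using Qpos[of t0] t0 v by (simp add: pos_def_def)
    from has_real_derivative_pos_inc_left[OF d this] obtain e where e: "e > 0"
      "\<And>h. h > 0 \<Longrightarrow> t0 - h \<in> {0..} \<Longrightarrow> h < e \<Longrightarrow> v \<bullet> (\<Sigma> (t0 - h) *v v) < v \<bullet> (\<Sigma> t0 *v v)" by blast
    define h where "h = min t0 (e/2)"
    have "v \<bullet> (\<Sigma> (t0 - h) *v v) < 0" using e(2)[of h] e(1) t0 z by (auto simp: h_def)
    moreover have "0 < v \<bullet> (\<Sigma> (t0 - h) *v v)" using S[of "t0 - h"] v e(1) t0 by (auto simp: h_def pos_def_def)
    ultimately show False by simp
  qed
  with sym show ?thesis by (simp add: pos_def_def)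
qed

text \<open>Positivity cannot fail at a first time, nor after a last good time.\<close>

theorem \<Sigma>_pos_def: assumes "t \<ge> 0" shows "pos_def (\<Sigma> t)"
proof (rule ccontr)
  assume "\<not> pos_def (\<Sigma> t)"
  define N where "N = {t. t \<ge> 0 \<and> \<not> pos_def (\<Sigma> t)}"
  have N: "N \<noteq> {}" using assms \<open>\<not> pos_def (\<Sigma> t)\<close> by (auto simp: N_def)
  have bdd: "bdd_below N" by (auto simp: N_def intro: bdd_belowI[of _ 0])
  define t0 where "t0 = Inf N"
  have t0: "0 \<le> t0" unfolding t0_def by (rule cInf_greatest[OF N]) (simp add: N_def)
  have below: "pos_def (\<Sigma> s)" if "0 \<le> s" "s < t0" for s
  proof (rule ccontr)
    assume "\<not> pos_def (\<Sigma> s)"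
    then have "t0 \<le> s" unfolding t0_def using that by (intro cInf_lower bdd) (simp add: N_def)
    with that show False by simp
  qed
  have "pos_def (\<Sigma> t0)"
  proof (cases "t0 = 0")
    case False
    with t0 have "0 < t0" by simp
    from pos_def_left_limit[OF this below] show ?thesis by simp
  next
    case True
    then show ?thesis using \<Sigma>0 by simp
  qed
  from pos_def_locally[OF t0 this] obtain d where d: "d > 0" "\<And>s. s \<in> {t0..t0+d} \<Longrightarrow> pos_def (\<Sigma> s)" by blast
  have "t0 + d \<le> Inf N"
  proof (rule cInf_greatest[OF N])
    fix s assume "s \<in> N"
    then have s: "s \<ge> 0" "\<not> pos_def (\<Sigma> s)" by (auto simp: N_def)
    have "\<not> s < t0" using below[of s] s by blast
    moreover have "s \<notin> {t0..t0+d}" using d(2)[of s] s by blast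
    ultimately show "t0 + d \<le> s" by simp
  qed
  with d show False by (simp add: t0_def)
qed

lemma cont_inv\<Sigma>: "continuous_on {0..} (\<lambda>t. matrix_inv (\<Sigma> t))"
  unfolding continuous_on_def
proof
  fix t :: real assume t: "t \<in> {0..}"
  show "((\<lambda>t. matrix_inv (\<Sigma> t)) \<longlongrightarrow> matrix_inv (\<Sigma> t)) (at t within {0..})"
    by (rule tendsto_matrix_inverse_path[where P=\<Sigma>])
      (use t cont\<Sigma> in \<open>auto simp: \<Sigma>_pos_def pos_def_inv_left pos_def_inv_right continuous_on_def\<close>)
qed

text \<open>Now \<open>\<Sigma>\<close> has a continuous inverse on \<open>[0, T]\<close>, and \<open>G = \<Sigma>\<^sup>-\<^sup>1 (\<Sigma> G \<Sigma>) \<Sigma>\<^sup>-\<^sup>1\<close>.\<close>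

theorem G_integrable: assumes T: "0 \<le> T" shows "set_integrable lborel {0..T} G"
proof -
  let ?S = "\<lambda>t. \<Sigma> t ** G t ** \<Sigma> t"
  have sym: "transpose (\<Sigma> t) = \<Sigma> t" if "t \<ge> 0" for t using \<Sigma>_pos_def[OF that] by (simp add: pos_def_def)
  have psd: "0 \<le> v \<bullet> (?S t *v v)" if t: "t \<ge> 0" for t v
  proof -
    have "v \<bullet> (?S t *v v) = (\<Sigma> t *v v) \<bullet> (G t *v (\<Sigma> t *v v))"
      using sym[OF t] by (simp add: matrix_vector_mul_assoc[symmetric] inner_transpose_matrix del: transpose_matrix_vector)
    then show ?thesis using G_psd[OF t] by simp
  qed
  have cS: "continuous_on {0..T} \<Sigma>" and ci: "continuous_on {0..T} (\<lambda>t. matrix_inv (\<Sigma> t))"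
    using cont\<Sigma> cont_inv\<Sigma> by (auto intro: continuous_on_subset)
  have "set_integrable lborel {0..T} ?S"
  proof (rule set_integrable_dominated_HK)
    have "(\<lambda>x. (real CARD('d) * real CARD('d)) * trace x) \<circ> ?S integrable_on {0..T}"
      by (intro integrable_linear SGS_integrable_on bounded_linear_compose[OF bounded_linear_mult_right bounded_linear_trace] T) simp
    then show "(\<lambda>t. (real CARD('d) * real CARD('d)) * trace (?S t)) integrable_on {0..T}" by (simp add: o_def)
    show "norm (?S t) \<le> (real CARD('d) * real CARD('d)) * trace (?S t)" if "t \<in> {0..T}" for t
    proof (rule psd_norm_le_trace[OF _ psd])
      show "0 \<le> t" using that by simp
      then show "transpose (?S t) = ?S t" by (simp add: matrix_transpose_mul matrix_mul_assoc sym G_sym)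
    qed
    show "set_borel_measurable lborel {0..T} ?S"
      by (intro set_borel_measurable_bilinear[OF bounded_bilinear_matrix_matrix] set_borel_measurable_continuous_Icc cS G_measurable) simp
  qed
  then have "set_integrable lborel {0..T} (\<lambda>t. matrix_inv (\<Sigma> t) ** (?S t ** matrix_inv (\<Sigma> t)))"
    using set_integrable_bilinear[OF bounded_bilinear.flip[OF bounded_bilinear_matrix_matrix]
        set_integrable_bilinear[OF bounded_bilinear_matrix_matrix _ ci] ci] by blast
  moreover have eq: "matrix_inv (\<Sigma> t) ** (?S t ** matrix_inv (\<Sigma> t)) = G t" if t: "t \<in> {0..T}" for t
  proof -
    have "matrix_inv (\<Sigma> t) ** (?S t ** matrix_inv (\<Sigma> t)) = (matrix_inv (\<Sigma> t) ** \<Sigma> t) ** G t ** (\<Sigma> t ** matrix_inv (\<Sigma> t))"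
      by (simp add: matrix_mul_assoc)
    then show ?thesis using t by (simp add: pos_def_inv_left pos_def_inv_right \<Sigma>_pos_def)
  qed
  ultimately show ?thesis
    by (subst set_integrable_cong[OF refl refl eq[symmetric]])
qed

end

section \<open>The Ito isometry for step functions\<close>

lemma trace_quad_rows:
  "trace ((G::real^'m^'n) ** S ** transpose G) = (\<Sum>k\<in>UNIV. G $ k \<bullet> (S *v (G $ k)))"
proof -
  have "(G ** S ** transpose G) $ k $ k = G $ k \<bullet> (S *v (G $ k))" for k
  proof -
    have "(G ** S ** transpose G) $ k $ k = (\<Sum>j\<in>UNIV. (\<Sum>i\<in>UNIV. G $ k $ i * S $ i $ j) * G $ k $ j)"
      by (simp add: matrix_matrix_mult_def transpose_def)
    also have "\<dots> = (\<Sum>j\<in>UNIV. \<Sum>i\<in>UNIV. G $ k $ i * (S $ i $ j * G $ k $ j))"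
      by (simp add: sum_distrib_right mult.assoc)
    also have "\<dots> = G $ k \<bullet> (S *v (G $ k))"
      by (subst sum.swap) (simp add: inner_vec_def matrix_vector_mult_def sum_distrib_left)
    finally show ?thesis .
  qed
  then show ?thesis by (simp add: trace_def)
qed

text \<open>With \<open>S = R t\<close> this is the integrand of the Ito isometry: the trace of the covariance rate of
\<open>G dW\<close>.\<close>

definition quad :: "real^'m^'m \<Rightarrow> real^'m^'n \<Rightarrow> real" where
  "quad S G = trace (G ** S ** transpose G)"

lemma quad_nonneg: "pos_def S \<Longrightarrow> 0 \<le> quad S G"
  unfolding quad_def trace_quad_rows by (intro sum_nonneg pos_def_nonneg)

lemma quad_0 [simp]: "quad S 0 = 0" by (simp add: quad_def mm.zero_left trace_def)

lemma quad_scaleR: "quad S (a *\<^sub>R G) = a\<^sup>2 * quad S G"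
  unfolding quad_def trace_quad_rows
  by (simp add: mv.scaleR_right sum_distrib_left power2_eq_square mult_ac)

lemma quad_minus [simp]: "quad S (- G) = quad S G"
  using quad_scaleR[of S "-1" G] by simp

lemma quad_add_le: "pos_def S \<Longrightarrow> quad S (G + H) \<le> 2 * quad S G + 2 * quad S H"
proof -
  assume S: "pos_def S"
  have "quad S (G + H) + quad S (G - H) = 2 * quad S G + 2 * quad S H"
    unfolding quad_def by (simp add: transpose_add transpose_diff mm.add_left mm.add_right mm.diff_left mm.diff_right trace_add trace_sub)
  then show ?thesis using quad_nonneg[OF S, of "G - H"] by simp
qed

lemma quad_le_norm: "\<bar>quad S (G::real^'m^'n)\<bar> \<le> real CARD('n) * (norm G)\<^sup>2 * norm S"
proof -
  have "\<bar>quad S G\<bar> \<le> real CARD('n) * norm (G ** S ** transpose G)" unfolding quad_def by (rule abs_trace_le)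
  also have "\<dots> \<le> real CARD('n) * (norm G * norm S * norm G)"
    using matrix_matrix_norm_le[of "G ** S" "transpose G"] matrix_matrix_norm_le[of G S]
    by (intro mult_left_mono) (simp_all add: norm_transpose, meson mult_right_mono norm_ge_zero order_trans)
  finally show ?thesis by (simp add: power2_eq_square mult_ac)
qed

text \<open>Regard \<open>quad S (V ** G)\<close> as a quadratic function of \<open>V\<close> with the semidefinite matrix \<open>G S G\<^sup>T\<close>.\<close>

lemma quad_mult_le:
  fixes V :: "real^'n^'p" and G :: "real^'m^'n"
  assumes S: "pos_def S"
  shows "quad S (V ** G) \<le> real CARD('p) * (real CARD('n) * real CARD('n)) * (norm V)\<^sup>2 * quad S G"
proof -
  let ?P = "G ** S ** transpose G"
  have psd: "0 \<le> v \<bullet> (?P *v v)" for v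
  proof -
    have "v \<bullet> (?P *v v) = (transpose G *v v) \<bullet> (S *v (transpose G *v v))"
      by (simp add: matrix_vector_mul_assoc[symmetric] inner_transpose_matrix del: transpose_matrix_vector)
    then show ?thesis using pos_def_nonneg[OF S] by simp
  qed
  have sym: "transpose ?P = ?P" using S by (simp add: pos_def_def matrix_transpose_mul matrix_mul_assoc)
  have "quad S (V ** G) = quad ?P V" by (simp add: quad_def matrix_transpose_mul matrix_mul_assoc)
  also have "\<dots> \<le> real CARD('p) * (norm V)\<^sup>2 * norm ?P" using quad_le_norm[of ?P V] by simp
  also have "\<dots> \<le> real CARD('p) * (norm V)\<^sup>2 * (real CARD('n) * real CARD('n) * trace ?P)"
    by (intro mult_left_mono psd_norm_le_trace sym psd) simp
  finally show ?thesis by (simp add: quad_def mult_ac)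
qed

text \<open>A list of pairs \<open>(s, c)\<close> stands for the step function \<open>\<Sum> c 1\<^bsub>(0, s]\<^esub>\<close>, with repetitions and any order
of the nodes allowed. This makes sums, cutting at a time and multiplication by a matrix list operations,
and proofs inductions over lists. The function is \<open>el xs\<close> and its integral is \<open>eI Y xs\<close>.\<close>

definition el :: "(real \<times> (real^'m^'n)) list \<Rightarrow> real \<Rightarrow> real^'m^'n" where
  "el xs t = (\<Sum>(s, c)\<leftarrow>xs. indicat_real {0<..s} t *\<^sub>R c)"

definition eI :: "(real \<Rightarrow> 'a \<Rightarrow> real^'m) \<Rightarrow> (real \<times> (real^'m^'n)) list \<Rightarrow> 'a \<Rightarrow> real^'n" where
  "eI Y xs \<omega> = (\<Sum>(s, c)\<leftarrow>xs. c *v (Y s \<omega> - Y 0 \<omega>))"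

definition cut :: "real \<Rightarrow> (real \<times> (real^'m^'n)) list \<Rightarrow> (real \<times> (real^'m^'n)) list" where
  "cut u xs = map (\<lambda>(s, c). (min s u, c)) xs"

definition lmult :: "real^'n^'p \<Rightarrow> (real \<times> (real^'m^'n)) list \<Rightarrow> (real \<times> (real^'m^'p)) list" where
  "lmult V xs = map (\<lambda>(s, c). (s, V ** c)) xs"

definition tpos :: "(real \<times> 'c) list \<Rightarrow> bool" where "tpos xs \<longleftrightarrow> (\<forall>x\<in>set xs. 0 \<le> fst x)"

lemma el_append [simp]: "el (xs @ ys) t = el xs t + el ys t" by (simp add: el_def)
lemma eI_append [simp]: "eI Y (xs @ ys) \<omega> = eI Y xs \<omega> + eI Y ys \<omega>" by (simp add: eI_def)
lemma el_Nil [simp]: "el [] t = 0" by (simp add: el_def)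
lemma eI_Nil [simp]: "eI Y [] \<omega> = 0" by (simp add: eI_def)
lemma el_Cons [simp]: "el ((s, c) # xs) t = indicat_real {0<..s} t *\<^sub>R c + el xs t" by (simp add: el_def)
lemma eI_Cons [simp]: "eI Y ((s, c) # xs) \<omega> = c *v (Y s \<omega> - Y 0 \<omega>) + eI Y xs \<omega>" by (simp add: eI_def)
lemma cut_Nil [simp]: "cut u [] = []" by (simp add: cut_def)
lemma cut_Cons [simp]: "cut u ((s, c) # xs) = (min s u, c) # cut u xs" by (simp add: cut_def)
lemma cut_append [simp]: "cut u (xs @ ys) = cut u xs @ cut u ys" by (simp add: cut_def)
lemma lmult_Nil [simp]: "lmult V [] = []" by (simp add: lmult_def)
lemma lmult_Cons [simp]: "lmult V ((s, c) # xs) = (s, V ** c) # lmult V xs" by (simp add: lmult_def)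
lemma tpos_Nil [simp]: "tpos []" by (simp add: tpos_def)
lemma tpos_Cons [simp]: "tpos (x # xs) \<longleftrightarrow> 0 \<le> fst x \<and> tpos xs" by (simp add: tpos_def)
lemma tpos_append [simp]: "tpos (xs @ ys) \<longleftrightarrow> tpos xs \<and> tpos ys" by (auto simp: tpos_def)
lemma tpos_cut [simp]: "tpos xs \<Longrightarrow> 0 \<le> u \<Longrightarrow> tpos (cut u xs)" by (auto simp: tpos_def cut_def)
lemma tpos_lmult [simp]: "tpos (lmult V xs) = tpos xs" by (auto simp: tpos_def lmult_def)

lemma el_lmult: "el (lmult V xs) t = V ** el xs t"
  by (induction xs) (auto simp: mm.add_right mm.scaleR_right mm.zero_right)

lemma eI_lmult: "eI Y (lmult V xs) \<omega> = V *v eI Y xs \<omega>"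
  by (induction xs) (auto simp: mv.add_right mv.zero_right matrix_vector_mul_assoc)

lemma el_cut: "el (cut u xs) t = indicat_real {0<..u} t *\<^sub>R el xs t"
  by (induction xs) (auto simp: indicator_def scaleR_add_right)

lemma el_measurable: "el xs \<in> borel_measurable borel"
proof (induction xs)
  case Nil then show ?case by (simp add: el_def[abs_def])
next
  case (Cons x xs)
  obtain s c where x: "x = (s, c)" by force
  have "el (x # xs) = (\<lambda>t. indicat_real {0<..s} t *\<^sub>R c + el xs t)" by (simp add: x fun_eq_iff)
  then show ?case using Cons by simp
qed

locale wiener_integration = prob_space M for M :: "'a measure" +
  fixes R :: "real \<Rightarrow> real^'m^'m" and W :: "real \<Rightarrow> 'a \<Rightarrow> real^'m"
  assumes wp: "wiener_process M R W" and Rpos: "\<And>t. t \<ge> 0 \<Longrightarrow> pos_def (R t)"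
begin

lemma Rint: "T \<ge> 0 \<Longrightarrow> set_integrable lborel {0..T} R"
  and W_meas: "t \<ge> 0 \<Longrightarrow> W t \<in> borel_measurable M"
  and W_0: "AE \<omega> in M. W 0 \<omega> = 0"
  and W_cont: "AE \<omega> in M. continuous_on {0..} (\<lambda>t. W t \<omega>)"
  and W_gauss: "0 \<le> s \<Longrightarrow> s < t \<Longrightarrow> gaussian_vector M (\<lambda>\<omega>. W t \<omega> - W s \<omega>) 0 (LINT r:{s..t}|lborel. R r)"
  and W_indep: "0 \<le> \<tau> 0 \<Longrightarrow> mono \<tau> \<Longrightarrow> indep_vars (\<lambda>_. borel) (\<lambda>i \<omega>. W (\<tau> (Suc i)) \<omega> - W (\<tau> i) \<omega>) {..<n::nat}"
  using wp unfolding wiener_process_def by blast+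

definition "cov s t = (LINT r:{s..t}|lborel. R r)"

lemma Rint': "0 \<le> s \<Longrightarrow> set_integrable lborel {s..t} R"
proof (cases "s \<le> t")
  assume "0 \<le> s" "s \<le> t"
  then show ?thesis by (intro set_integrable_sub_interval[OF Rint[of t]]) auto
qed (simp add: set_integrable_def)

lemma cov_pos:
  assumes st: "0 \<le> s" "s < t" and v: "v \<noteq> 0"
  shows "0 < v \<bullet> (cov s t *v v)"
proof -
  have lin: "bounded_linear (\<lambda>S::real^'m^'m. v \<bullet> (S *v v))"
    by (intro bounded_linear_compose[OF bounded_linear_inner_right mv.bounded_linear_left])
  note L = LINT_bounded_linear[OF lin Rint'[OF st(1)]]
  have eq: "v \<bullet> (cov s t *v v) = (LINT r:{s..t}|lborel. v \<bullet> (R r *v v))" by (simp add: cov_def L)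
  have nn: "0 \<le> indicat_real {s..t} r *\<^sub>R (v \<bullet> (R r *v v))" for r
    using Rpos[of r] st pos_def_nonneg by (auto simp: indicator_def)
  have "(LINT r:{s..t}|lborel. v \<bullet> (R r *v v)) \<noteq> 0"
  proof
    assume "(LINT r:{s..t}|lborel. v \<bullet> (R r *v v)) = 0"
    then have "AE r in lborel. indicat_real {s..t} r *\<^sub>R (v \<bullet> (R r *v v)) = 0"
      using integral_nonneg_eq_0_iff_AE[OF L(2)[of t, unfolded set_integrable_def]] nn
      unfolding set_lebesgue_integral_def by auto
    then have "AE r in lborel. r \<notin> {s..t}"
    proof eventually_elim
      case (elim r)
      then show ?case using Rpos[of r] st v by (auto simp: indicator_def pos_def_def dest!: spec[of _ v])
    qed
    then have "emeasure lborel {s..t} = 0" by (subst (asm) AE_iff_measurable[of "{s..t}"]) auto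
    with st show False by simp
  qed
  moreover have "0 \<le> (LINT r:{s..t}|lborel. v \<bullet> (R r *v v))"
    unfolding set_lebesgue_integral_def by (rule Bochner_Integration.integral_nonneg) (use nn in auto)
  ultimately show ?thesis by (simp add: eq)
qed

lemma increment_moments:
  assumes st: "0 \<le> s" "s < t"
  shows "has_bochner_integral M (\<lambda>\<omega>. v \<bullet> (W t \<omega> - W s \<omega>)) 0"
    "has_bochner_integral M (\<lambda>\<omega>. (v \<bullet> (W t \<omega> - W s \<omega>))\<^sup>2) (v \<bullet> (cov s t *v v))"
proof -
  let ?X = "\<lambda>\<omega>. v \<bullet> (W t \<omega> - W s \<omega>)"
  have "has_bochner_integral M ?X 0 \<and> has_bochner_integral M (\<lambda>\<omega>. (?X \<omega>)\<^sup>2) (v \<bullet> (cov s t *v v))"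
  proof (cases "v = 0")
    case True then show ?thesis by (simp add: has_bochner_integral_zero)
  next
    case False
    let ?\<sigma> = "sqrt (v \<bullet> (cov s t *v v))"
    have \<sigma>: "0 < ?\<sigma>" using cov_pos[OF st False] by simp
    have d: "distributed M lborel ?X (normal_density 0 ?\<sigma>)"
      using W_gauss[OF st] False unfolding gaussian_vector_def cov_def by auto
    have i1: "integrable M ?X"
      using integrable_normal_moment[OF \<sigma>, of 0 1]
      by (subst distributed_integrable[OF d, of "\<lambda>x. x", symmetric]) auto
    have i2: "integrable M (\<lambda>\<omega>. (?X \<omega>)\<^sup>2)"
      using integrable_normal_moment[OF \<sigma>, of 0 2]
      by (subst distributed_integrable[OF d, of "\<lambda>x. x\<^sup>2", symmetric]) auto
    have e1: "expectation ?X = 0" by (rule normal_distributed_expectation[OF \<sigma> d])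
    have "variance ?X = ?\<sigma>\<^sup>2" by (rule normal_distributed_variance[OF \<sigma> d])
    then have "expectation (\<lambda>\<omega>. (?X \<omega>)\<^sup>2) = ?\<sigma>\<^sup>2" by (simp add: e1)
    then show ?thesis using i1 i2 e1 \<sigma> by (simp add: has_bochner_integral_iff)
  qed
  then show "has_bochner_integral M ?X 0" "has_bochner_integral M (\<lambda>\<omega>. (?X \<omega>)\<^sup>2) (v \<bullet> (cov s t *v v))" by auto
qed

lemma cov_sym: assumes "0 \<le> s" shows "transpose (cov s t) = cov s t"
proof -
  have "transpose (cov s t) = (LINT r:{s..t}|lborel. transpose (R r))"
    unfolding cov_def by (rule LINT_bounded_linear(1)[OF bounded_linear_transpose Rint'[OF assms], symmetric])
  also have "\<dots> = cov s t" unfolding cov_def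
    by (rule set_lebesgue_integral_cong) (use Rpos assms in \<open>auto simp: pos_def_def\<close>)
  finally show ?thesis .
qed

text \<open>Polarization of the variances.\<close>

lemma increment_covariance:
  assumes st: "0 \<le> s" "s \<le> t"
  shows "has_bochner_integral M (\<lambda>\<omega>. (W t \<omega> - W s \<omega>) $ i * (W t \<omega> - W s \<omega>) $ j) (cov s t $ i $ j)"
proof (cases "s = t")
  case True then show ?thesis by (simp add: cov_def has_bochner_integral_zero)
next
  case False
  then have st': "s < t" using st by simp
  let ?X = "\<lambda>v \<omega>. v \<bullet> (W t \<omega> - W s \<omega>)"
  let ?a = "axis i (1::real)" and ?b = "axis j (1::real)"
  note m2 = increment_moments(2)[OF st(1) st']
  have "has_bochner_integral M (\<lambda>\<omega>. ((?X (?a + ?b) \<omega>)\<^sup>2 - (?X ?a \<omega>)\<^sup>2 - (?X ?b \<omega>)\<^sup>2) / 2)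
     (((?a + ?b) \<bullet> (cov s t *v (?a + ?b)) - ?a \<bullet> (cov s t *v ?a) - ?b \<bullet> (cov s t *v ?b)) / 2)"
    by (intro has_bochner_integral_divide_zero has_bochner_integral_diff m2)
  moreover have "(\<lambda>\<omega>. ((?X (?a + ?b) \<omega>)\<^sup>2 - (?X ?a \<omega>)\<^sup>2 - (?X ?b \<omega>)\<^sup>2) / 2) = (\<lambda>\<omega>. (W t \<omega> - W s \<omega>) $ i * (W t \<omega> - W s \<omega>) $ j)"
    by (auto simp: fun_eq_iff inner_add_left inner_axis' power2_eq_square field_simps)
  moreover have "cov s t $ j $ i = cov s t $ i $ j"
    using arg_cong[OF cov_sym[OF st(1), of t], of "\<lambda>M. M $ i $ j"] by (simp add: transpose_def)
  ultimately show ?thesis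
    by (simp add: mv.add_right inner_add_left inner_add_right inner_axis_matrix_axis)
qed

text \<open>Independence of the increments is used on a mesh of three nodes, which must be distinct. If
\<open>s = 0\<close> or \<open>s = t\<close>, one increment is zero.\<close>

lemma disjoint_increments_covariance:
  assumes st: "0 \<le> s" "s \<le> t"
  shows "has_bochner_integral M (\<lambda>\<omega>. (W s \<omega> - W 0 \<omega>) $ i * (W t \<omega> - W s \<omega>) $ j) 0"
proof (cases "0 < s \<and> s < t")
  case False
  then have "s = 0 \<or> s = t" using st by auto
  then show ?thesis by (auto simp: has_bochner_integral_zero)
next
  case True
  define \<tau> where "\<tau> k = (if k = (0::nat) then 0 else if k = 1 then s else t)" for k
  have "mono \<tau>" using True by (auto simp: mono_def \<tau>_def)
  then have iv: "indep_vars (\<lambda>_. borel) (\<lambda>i \<omega>. W (\<tau> (Suc i)) \<omega> - W (\<tau> i) \<omega>) {..<2::nat}"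
    by (intro W_indep) (simp_all add: \<tau>_def[of 0])
  have "indep_var borel ((\<lambda>f. f (0::nat) $ i) \<circ> (\<lambda>\<omega>. restrict (\<lambda>i. W (\<tau> (Suc i)) \<omega> - W (\<tau> i) \<omega>) {0}))
      borel ((\<lambda>f. f (1::nat) $ j) \<circ> (\<lambda>\<omega>. restrict (\<lambda>i. W (\<tau> (Suc i)) \<omega> - W (\<tau> i) \<omega>) {1}))"
  proof (rule indep_var_compose[OF indep_var_restrict[OF iv, of "{0}" "{1}"]])
    show "(\<lambda>f. f (0::nat) $ i) \<in> borel_measurable (Pi\<^sub>M {0} (\<lambda>_. borel::(real^'m) measure))"
      by (rule measurable_compose[OF _ borel_measurable_nth], rule measurable_component_singleton) simp
    show "(\<lambda>f. f (1::nat) $ j) \<in> borel_measurable (Pi\<^sub>M {1} (\<lambda>_. borel::(real^'m) measure))"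
      by (rule measurable_compose[OF _ borel_measurable_nth], rule measurable_component_singleton) simp
  qed auto
  then have ind: "indep_var borel (\<lambda>\<omega>. (W s \<omega> - W 0 \<omega>) $ i) borel (\<lambda>\<omega>. (W t \<omega> - W s \<omega>) $ j)"
    by (simp add: o_def \<tau>_def)
  have i: "has_bochner_integral M (\<lambda>\<omega>. (W s \<omega> - W 0 \<omega>) $ i) 0" "has_bochner_integral M (\<lambda>\<omega>. (W t \<omega> - W s \<omega>) $ j) 0"
    using increment_moments(1)[of 0 s "axis i 1"] increment_moments(1)[of s t "axis j 1"] True by (simp_all add: inner_axis')
  show ?thesis
    using indep_var_integrable[OF ind] indep_var_lebesgue_integral[OF ind] i
    by (simp add: has_bochner_integral_iff)
qed

lemma cov_increment: "0 \<le> s \<Longrightarrow> 0 \<le> t \<Longrightarrow>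
  has_bochner_integral M (\<lambda>\<omega>. (W s \<omega> - W 0 \<omega>) $ i * (W t \<omega> - W 0 \<omega>) $ j) (cov 0 (min s t) $ i $ j)"
proof (induction s t arbitrary: i j rule: linorder_wlog)
  case (le s t)
  have "has_bochner_integral M (\<lambda>\<omega>. (W s \<omega> - W 0 \<omega>) $ i * (W s \<omega> - W 0 \<omega>) $ j + (W s \<omega> - W 0 \<omega>) $ i * (W t \<omega> - W s \<omega>) $ j)
     (cov 0 s $ i $ j + 0)"
    using le by (intro has_bochner_integral_add increment_covariance disjoint_increments_covariance) auto
  then show ?case using le by (simp add: algebra_simps min_def)
next
  case (sym s t)
  have "cov 0 (min t s) $ j $ i = cov 0 (min t s) $ i $ j"
    using arg_cong[OF cov_sym[of 0 "min t s"], of "\<lambda>M. M $ i $ j"] by (simp add: transpose_def)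
  then show ?case using sym(1)[of j i] sym(2,3) by (simp add: mult.commute min.commute)
qed

lemma inner_matrix_expand:
  "((c::real^'m^'n) *v u) \<bullet> ((d::real^'m^'n) *v v) = (\<Sum>k\<in>UNIV. \<Sum>i\<in>UNIV. \<Sum>j\<in>UNIV. (c $ k $ i * d $ k $ j) * (u $ i * v $ j))"
  by (simp add: inner_vec_def matrix_vector_mult_def sum_product mult_ac)

lemma trace_matrix_expand:
  "trace ((c::real^'m^'n) ** S ** transpose (d::real^'m^'n)) = (\<Sum>k\<in>UNIV. \<Sum>i\<in>UNIV. \<Sum>j\<in>UNIV. (c $ k $ i * d $ k $ j) * S $ i $ j)"
  unfolding trace_def
proof (rule sum.cong[OF refl])
  fix k
  have "(c ** S ** transpose d) $ k $ k = (\<Sum>j\<in>UNIV. \<Sum>i\<in>UNIV. c $ k $ i * S $ i $ j * d $ k $ j)"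
    by (simp add: matrix_matrix_mult_def transpose_def sum_distrib_right)
  also have "\<dots> = (\<Sum>i\<in>UNIV. \<Sum>j\<in>UNIV. (c $ k $ i * d $ k $ j) * S $ i $ j)"
    by (subst sum.swap) (simp add: mult_ac)
  finally show "(c ** S ** transpose d) $ k $ k = (\<Sum>i\<in>UNIV. \<Sum>j\<in>UNIV. (c $ k $ i * d $ k $ j) * S $ i $ j)" .
qed

text \<open>Both sides of the isometry for a pair of elementary integrands, with a common value. The intervals
\<open>(0, s]\<close> and \<open>[0, s]\<close> differ by a null set.\<close>

lemma pair_isometry:
  fixes c d :: "real^'m^'n"
  assumes st: "0 \<le> s" "0 \<le> t"
  shows "has_bochner_integral M (\<lambda>\<omega>. (c *v (W s \<omega> - W 0 \<omega>)) \<bullet> (d *v (W t \<omega> - W 0 \<omega>))) (trace (c ** cov 0 (min s t) ** transpose d))"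
    "has_bochner_integral lborel (\<lambda>r. indicat_real {0..} r *\<^sub>R trace ((indicat_real {0<..s} r *\<^sub>R c) ** R r ** transpose (indicat_real {0<..t} r *\<^sub>R d)))
       (trace (c ** cov 0 (min s t) ** transpose d))"
proof -
  show "has_bochner_integral M (\<lambda>\<omega>. (c *v (W s \<omega> - W 0 \<omega>)) \<bullet> (d *v (W t \<omega> - W 0 \<omega>))) (trace (c ** cov 0 (min s t) ** transpose d))"
    unfolding inner_matrix_expand trace_matrix_expand
    by (intro has_bochner_integral_sum has_bochner_integral_mult_right cov_increment st)
  have lin: "bounded_linear (\<lambda>S. trace (c ** S ** transpose d))"
    by (intro bounded_linear_compose[OF bounded_linear_trace] bounded_linear_compose[OF mm.bounded_linear_left] mm.bounded_linear_right)
  have "0 \<le> min s t" using st by simp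
  note L = LINT_bounded_linear[OF lin Rint[OF this]]
  have A: "has_bochner_integral lborel (\<lambda>r. indicat_real {0..min s t} r *\<^sub>R trace (c ** R r ** transpose d)) (trace (c ** cov 0 (min s t) ** transpose d))"
    using L unfolding set_integrable_def set_lebesgue_integral_def cov_def by (simp add: has_bochner_integral_iff)
  have B: "AE r in lborel. indicat_real {0..min s t} r *\<^sub>R trace (c ** R r ** transpose d)
      = indicat_real {0..} r *\<^sub>R trace ((indicat_real {0<..s} r *\<^sub>R c) ** R r ** transpose (indicat_real {0<..t} r *\<^sub>R d))"
    using AE_lborel_singleton[of 0]
    by eventually_elim (auto simp: indicator_def mm.zero_left mm.zero_right trace_def transpose_def zero_vec_def[symmetric])
  have C: "(\<lambda>r. indicat_real {0..} r *\<^sub>R trace ((indicat_real {0<..s} r *\<^sub>R c) ** R r ** transpose (indicat_real {0<..t} r *\<^sub>R d))) =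
     (\<lambda>r. indicat_real ({0<..s} \<inter> {0<..t}) r *\<^sub>R (indicat_real {0..min s t} r *\<^sub>R trace (c ** R r ** transpose d)))"
    by (auto simp: fun_eq_iff indicator_def mm.zero_left mm.zero_right trace_def transpose_def zero_vec_def[symmetric])
  have D: "(\<lambda>r. indicat_real ({0<..s} \<inter> {0<..t}) r *\<^sub>R (indicat_real {0..min s t} r *\<^sub>R trace (c ** R r ** transpose d))) \<in> borel_measurable lborel"
    by (intro borel_measurable_scaleR[OF borel_measurable_indicator borel_measurable_integrable[OF L(2)[unfolded set_integrable_def]]]) simp
  show "has_bochner_integral lborel (\<lambda>r. indicat_real {0..} r *\<^sub>R trace ((indicat_real {0<..s} r *\<^sub>R c) ** R r ** transpose (indicat_real {0<..t} r *\<^sub>R d)))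
       (trace (c ** cov 0 (min s t) ** transpose d))"
    by (rule iffD1[OF has_bochner_integral_cong_AE[OF borel_measurable_has_bochner_integral[OF A] D[folded C] B] A])
qed

lemma el_pairing:
  fixes xs ys :: "(real \<times> (real^'m^'n)) list"
  assumes "tpos xs" "tpos ys"
  shows "\<exists>v. has_bochner_integral M (\<lambda>\<omega>. eI W xs \<omega> \<bullet> eI W ys \<omega>) v \<and>
    has_bochner_integral lborel (\<lambda>r. indicat_real {0..} r *\<^sub>R trace (el xs r ** R r ** transpose (el ys r))) v"
  using assms(1)
proof (induction xs)
  case Nil
  then show ?case by (auto simp: mm.zero_left trace_def has_bochner_integral_zero intro!: exI[of _ 0])
next
  case (Cons x xs)
  obtain s c where x: "x = (s, c)" by force
  have s: "0 \<le> s" using Cons x by simp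
  have "\<exists>v. has_bochner_integral M (\<lambda>\<omega>. (c *v (W s \<omega> - W 0 \<omega>)) \<bullet> eI W ys \<omega>) v \<and>
    has_bochner_integral lborel (\<lambda>r. indicat_real {0..} r *\<^sub>R trace ((indicat_real {0<..s} r *\<^sub>R c) ** R r ** transpose (el ys r))) v"
    using assms(2)
  proof (induction ys)
    case Nil
    then show ?case by (auto simp: mm.zero_right trace_def transpose_def zero_vec_def[symmetric] has_bochner_integral_zero intro!: exI[of _ 0])
  next
    case (Cons y ys)
    obtain t d where y: "y = (t, d)" by force
    have t: "0 \<le> t" using Cons y by simp
    from Cons obtain v where v: "has_bochner_integral M (\<lambda>\<omega>. (c *v (W s \<omega> - W 0 \<omega>)) \<bullet> eI W ys \<omega>) v"
      "has_bochner_integral lborel (\<lambda>r. indicat_real {0..} r *\<^sub>R trace ((indicat_real {0<..s} r *\<^sub>R c) ** R r ** transpose (el ys r))) v"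
      by auto
    show ?case
      using has_bochner_integral_add[OF pair_isometry(1)[OF s t, of c d] v(1)]
        has_bochner_integral_add[OF pair_isometry(2)[OF s t, of c d] v(2)]
      unfolding y eI_Cons el_Cons inner_add_right transpose_add mm.add_right trace_add scaleR_add_right by blast
  qed
  then obtain v where v: "has_bochner_integral M (\<lambda>\<omega>. (c *v (W s \<omega> - W 0 \<omega>)) \<bullet> eI W ys \<omega>) v"
    "has_bochner_integral lborel (\<lambda>r. indicat_real {0..} r *\<^sub>R trace ((indicat_real {0<..s} r *\<^sub>R c) ** R r ** transpose (el ys r))) v" by auto
  from Cons obtain v' where v': "has_bochner_integral M (\<lambda>\<omega>. eI W xs \<omega> \<bullet> eI W ys \<omega>) v'"
    "has_bochner_integral lborel (\<lambda>r. indicat_real {0..} r *\<^sub>R trace (el xs r ** R r ** transpose (el ys r))) v'" by auto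
  show ?case
    using has_bochner_integral_add[OF v(1) v'(1)] has_bochner_integral_add[OF v(2) v'(2)]
    unfolding x eI_Cons el_Cons inner_add_left mm.add_left trace_add scaleR_add_right by blast
qed

text \<open>The two squared seminorms of the Ito isometry, on integrands (\<open>q\<close>) and on random vectors (\<open>d2\<close>).\<close>

definition q :: "(real \<Rightarrow> real^'m^'n) \<Rightarrow> ennreal" where
  "q g = (\<integral>\<^sup>+t\<in>{0..}. ennreal (quad (R t) (g t)) \<partial>lborel)"

definition d2 :: "('a \<Rightarrow> real^'n) \<Rightarrow> ennreal" where
  "d2 Y = (\<integral>\<^sup>+\<omega>. ennreal ((norm (Y \<omega>))\<^sup>2) \<partial>M)"

lemma isometry: "tpos xs \<Longrightarrow> d2 (eI W xs) = q (el xs)"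
proof -
  assume "tpos xs"
  from el_pairing[OF this this] obtain v where
    v: "has_bochner_integral M (\<lambda>\<omega>. (norm (eI W xs \<omega>))\<^sup>2) v"
    "has_bochner_integral lborel (\<lambda>r. indicat_real {0..} r *\<^sub>R quad (R r) (el xs r)) v"
    unfolding power2_norm_eq_inner quad_def by auto
  have "d2 (eI W xs) = ennreal v" unfolding d2_def
    using v(1) by (subst nn_integral_eq_integral) (auto simp: has_bochner_integral_iff)
  moreover have "q (el xs) = (\<integral>\<^sup>+r. ennreal (indicat_real {0..} r *\<^sub>R quad (R r) (el xs r)) \<partial>lborel)"
    unfolding q_def by (intro nn_integral_cong) (auto simp: indicator_def)
  moreover have "\<dots> = ennreal v"
    using v(2) quad_nonneg[OF Rpos] by (subst nn_integral_eq_integral) (auto simp: has_bochner_integral_iff indicator_def)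
  ultimately show ?thesis by simp
qed

end

section \<open>Wiener integrals as mean-square limits\<close>

lemma ennreal_two_sum_less:
  assumes "a < ennreal (e/4)" "b < ennreal (e/4)"
  shows "2 * a + 2 * b < ennreal e"
proof -
  have ab: "a < top" "b < top" using assms by (auto intro: less_trans ennreal_less_top)
  then obtain x y where x: "a = ennreal x" "0 \<le> x" and y: "b = ennreal y" "0 \<le> y"
    by (metis ennreal_cases less_irrefl)
  have xy: "x < e/4" "y < e/4" using assms x y by (auto simp: ennreal_less_iff)
  have "2 * a + 2 * b = ennreal (2 * x + 2 * y)"
    using x y by (simp add: ennreal_plus ennreal_mult)
  also have "\<dots> < ennreal e" using x y xy by (intro ennreal_lessI) auto
  finally show ?thesis .
qed

lemma borel_measurable_bilinear:
  fixes f :: "'c \<Rightarrow> 'a::euclidean_space" and g :: "'c \<Rightarrow> 'b::euclidean_space" and prod :: "'a \<Rightarrow> 'b \<Rightarrow> 'd::euclidean_space"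
  assumes bil: "bounded_bilinear prod" and f: "f \<in> borel_measurable N" and g: "g \<in> borel_measurable N"
  shows "(\<lambda>s. prod (f s) (g s)) \<in> borel_measurable N"
proof -
  interpret bounded_bilinear prod by (rule bil)
  have cont: "continuous_on UNIV (\<lambda>z::'a\<times>'b. prod (fst z) (snd z))"
    by (intro continuous_on continuous_intros)
  show ?thesis using borel_measurable_continuous_on[OF cont borel_measurable_Pair[OF f g]] by simp
qed

lemma borel_measurable_linear:
  fixes h :: "'a::euclidean_space \<Rightarrow> 'b::euclidean_space"
  assumes "bounded_linear h" "f \<in> borel_measurable N"
  shows "(\<lambda>s. h (f s)) \<in> borel_measurable N"
  by (rule borel_measurable_continuous_on[OF _ assms(2)]) (rule linear_continuous_on[OF assms(1)])

lemmas measurable_mv = borel_measurable_bilinear[OF bounded_bilinear_matrix_vector]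
lemmas measurable_mm = borel_measurable_bilinear[OF bounded_bilinear_matrix_matrix]

lemma lmult_uminus_el: "el (lmult (- mat 1) xs) t = - el xs t"
  by (simp add: el_lmult mm.minus_left)
lemma lmult_uminus_eI: "eI Y (lmult (- mat 1) xs) \<omega> = - eI Y xs \<omega>"
  by (simp add: eI_lmult mv.minus_left)

text \<open>A step on \<open>(\<tau> i, \<tau> (i+1)]\<close> is a difference of two indicators of intervals that start at 0.\<close>

definition steps :: "nat \<Rightarrow> (nat \<Rightarrow> real) \<Rightarrow> (nat \<Rightarrow> real^'m^'n) \<Rightarrow> (real \<times> (real^'m^'n)) list" where
  "steps n \<tau> c = concat (map (\<lambda>i. [(\<tau> (Suc i), c i), (\<tau> i, - c i)]) [0..<n])"

lemma steps_Suc: "steps (Suc n) \<tau> c = steps n \<tau> c @ [(\<tau> (Suc n), c n), (\<tau> n, - c n)]" by (simp add: steps_def)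
lemma steps_0: "steps 0 \<tau> c = []" by (simp add: steps_def)

lemma mono_on_nodes_nonneg: "0 \<le> \<tau> 0 \<Longrightarrow> mono_on {..n} \<tau> \<Longrightarrow> i \<le> n \<Longrightarrow> 0 \<le> (\<tau> i :: real)" for n :: nat
  by (metis atMost_iff le0 mono_onD order_trans)

lemma el_steps: "0 \<le> \<tau> 0 \<Longrightarrow> mono_on {..n} \<tau> \<Longrightarrow> el (steps n \<tau> c) t = step_integrand n \<tau> c t"
proof (induction n)
  case 0 then show ?case by (simp add: steps_0 step_integrand_def)
next
  case (Suc n)
  have m: "mono_on {..n} \<tau>" using Suc.prems(2) by (rule mono_on_subset) auto
  have "\<tau> n \<le> \<tau> (Suc n)" using Suc.prems(2) by (intro mono_onD[of "{..Suc n}" \<tau>]) auto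
  moreover have "0 \<le> \<tau> n" by (rule mono_on_nodes_nonneg[OF Suc.prems]) simp
  ultimately have "indicat_real {0<..\<tau> (Suc n)} t *\<^sub>R c n + indicat_real {0<..\<tau> n} t *\<^sub>R - c n = indicat_real {\<tau> n<..\<tau> (Suc n)} t *\<^sub>R c n"
    by (auto simp: indicator_def)
  then show ?case using Suc.IH[OF Suc.prems(1) m] by (simp add: steps_Suc step_integrand_def)
qed

lemma eI_steps: "eI Y (steps n \<tau> c) \<omega> = step_integral n \<tau> c Y \<omega>"
proof (induction n)
  case 0 then show ?case by (simp add: steps_0 step_integral_def)
next
  case (Suc n)
  then show ?case by (simp add: steps_Suc step_integral_def mv.minus_left mv.diff_right)
qed

lemma tpos_steps: "0 \<le> \<tau> 0 \<Longrightarrow> mono_on {..n} \<tau> \<Longrightarrow> tpos (steps n \<tau> c)"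
  unfolding tpos_def steps_def
  by (auto intro: mono_on_nodes_nonneg)

lemma step_integrand_value:
  assumes "mono_on {..n} \<tau>" "\<tau> 0 < t" "t \<le> \<tau> n"
  shows "\<exists>i<n. \<tau> i < t \<and> t \<le> \<tau> (Suc i) \<and> step_integrand n \<tau> c t = c i"
  using assms
proof (induction n)
  case 0 then show ?case by simp
next
  case (Suc n)
  have m: "mono_on {..n} \<tau>" using Suc.prems(1) by (rule mono_on_subset) auto
  show ?case
  proof (cases "t \<le> \<tau> n")
    case True
    from Suc.IH[OF m Suc.prems(2) True] obtain i where "i < n" "\<tau> i < t" "t \<le> \<tau> (Suc i)" "step_integrand n \<tau> c t = c i" by blast
    then show ?thesis using True by (intro exI[of _ i]) (auto simp: step_integrand_def)
  next
    case False
    have "indicat_real {\<tau> i<..\<tau> (Suc i)} t = 0" if "i < n" for i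
      using mono_onD[OF m, of "Suc i" n] that False by (auto simp: indicator_def)
    then have "step_integrand (Suc n) \<tau> c t = c n"
      using False Suc.prems by (simp add: step_integrand_def)
    then show ?thesis using False Suc.prems by (intro exI[of _ n]) auto
  qed
qed

context wiener_integration begin

lemma R_meas: "(\<lambda>t. indicat_real {0..} t *\<^sub>R R t) \<in> borel_measurable borel"
proof (rule borel_measurable_LIMSEQ_metric)
  show "(\<lambda>t. indicat_real {0..real n} t *\<^sub>R R t) \<in> borel_measurable borel" for n
    using borel_measurable_integrable[OF Rint[of "real n", unfolded set_integrable_def]] by simp
  fix t :: real
  obtain N :: nat where "t \<le> real N" using real_arch_simple by blast
  then have "\<forall>\<^sub>F n in sequentially. indicat_real {0..real n} t *\<^sub>R R t = indicat_real {0..} t *\<^sub>R R t"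
    by (intro eventually_sequentiallyI[of N]) (auto simp: indicator_def)
  then show "(\<lambda>n. indicat_real {0..real n} t *\<^sub>R R t) \<longlonglongrightarrow> indicat_real {0..} t *\<^sub>R R t"
    by (rule tendsto_eventually)
qed

lemma quad_meas:
  assumes f: "f \<in> borel_measurable borel"
  shows "(\<lambda>t. ennreal (quad (R t) (f t)) * indicator {0..} t) \<in> borel_measurable lborel"
proof -
  have "(\<lambda>t. trace (f t ** (indicat_real {0..} t *\<^sub>R R t) ** transpose (f t))) \<in> borel_measurable borel"
    by (intro borel_measurable_linear[OF bounded_linear_trace] measurable_mm f R_meas borel_measurable_linear[OF bounded_linear_transpose])
  then have "(\<lambda>t. ennreal (trace (f t ** (indicat_real {0..} t *\<^sub>R R t) ** transpose (f t))) * indicator {0..} t) \<in> borel_measurable lborel"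
    by simp
  moreover have "(\<lambda>t. ennreal (trace (f t ** (indicat_real {0..} t *\<^sub>R R t) ** transpose (f t))) * indicator {0..} t)
      = (\<lambda>t. ennreal (quad (R t) (f t)) * indicator {0..} t)"
    by (auto simp: fun_eq_iff indicator_def quad_def)
  ultimately show ?thesis by simp
qed

lemma q_mono:
  assumes "\<And>t. t \<ge> 0 \<Longrightarrow> quad (R t) (f t) \<le> quad (R t) (g t)"
  shows "q f \<le> q g"
  unfolding q_def by (intro nn_integral_mono) (auto simp: indicator_def intro!: ennreal_leI assms)

lemma q_cong_AE:
  assumes "AE t in lborel. t \<ge> 0 \<longrightarrow> f t = g t" shows "q f = q g"
  unfolding q_def by (intro nn_integral_cong_AE) (use assms in eventually_elim, auto simp: indicator_def)

lemma q_uminus: "q (\<lambda>t. - f t) = q f" unfolding q_def by simp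

lemma q_add_le:
  assumes f: "f \<in> borel_measurable borel" and g: "g \<in> borel_measurable borel"
  shows "q (\<lambda>t. f t + g t) \<le> 2 * q f + 2 * q g"
proof -
  have "q (\<lambda>t. f t + g t) \<le> (\<integral>\<^sup>+t. 2 * (ennreal (quad (R t) (f t)) * indicator {0..} t) + 2 * (ennreal (quad (R t) (g t)) * indicator {0..} t) \<partial>lborel)"
    unfolding q_def
  proof (rule nn_integral_mono)
    fix t :: real
    show "ennreal (quad (R t) (f t + g t)) * indicator {0..} t \<le> 2 * (ennreal (quad (R t) (f t)) * indicator {0..} t) + 2 * (ennreal (quad (R t) (g t)) * indicator {0..} t)"
    proof (cases "t \<ge> 0")
      case True
      have "ennreal (quad (R t) (f t + g t)) \<le> ennreal (2 * quad (R t) (f t) + 2 * quad (R t) (g t))"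
        by (rule ennreal_leI[OF quad_add_le[OF Rpos[OF True]]])
      also have "\<dots> = 2 * ennreal (quad (R t) (f t)) + 2 * ennreal (quad (R t) (g t))"
        using quad_nonneg[OF Rpos[OF True], of "f t"] quad_nonneg[OF Rpos[OF True], of "g t"]
        by (simp add: ennreal_plus ennreal_mult)
      finally show ?thesis using True by simp
    qed simp
  qed
  also have "\<dots> = 2 * q f + 2 * q g"
    unfolding q_def using quad_meas[OF f] quad_meas[OF g] by (simp add: nn_integral_add nn_integral_cmult)
  finally show ?thesis .
qed

lemma q_diff_le:
  assumes f: "f \<in> borel_measurable borel" and g: "g \<in> borel_measurable borel"
  shows "q (\<lambda>t. f t - g t) \<le> 2 * q f + 2 * q g"
  using q_add_le[OF f borel_measurable_uminus[OF g]] by (simp add: q_uminus)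

lemma q_mult_le:
  fixes V :: "real^'n^'p"
  assumes f: "f \<in> borel_measurable borel"
  shows "q (\<lambda>t. V ** f t) \<le> ennreal (real CARD('p) * (real CARD('n) * real CARD('n)) * (norm V)\<^sup>2) * q f"
proof -
  let ?k = "real CARD('p) * (real CARD('n) * real CARD('n)) * (norm V)\<^sup>2"
  have "q (\<lambda>t. V ** f t) \<le> (\<integral>\<^sup>+t. ennreal ?k * (ennreal (quad (R t) (f t)) * indicator {0..} t) \<partial>lborel)"
    unfolding q_def
  proof (rule nn_integral_mono)
    fix t :: real
    show "ennreal (quad (R t) (V ** f t)) * indicator {0..} t \<le> ennreal ?k * (ennreal (quad (R t) (f t)) * indicator {0..} t)"
      using ennreal_leI[OF quad_mult_le[OF Rpos[of t], of V "f t"]] quad_nonneg[OF Rpos[of t], of "f t"]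
      by (auto simp: indicator_def ennreal_mult)
  qed
  also have "\<dots> = ennreal ?k * q f" unfolding q_def using quad_meas[OF f] by (rule nn_integral_cmult)
  finally show ?thesis .
qed

lemma q_indicator_le: "q (\<lambda>t. indicat_real S t *\<^sub>R f t) \<le> q f"
  by (rule q_mono) (use quad_nonneg[OF Rpos] in \<open>auto simp: indicator_def\<close>)

lemma d2_uminus: "d2 (\<lambda>\<omega>. - Y \<omega>) = d2 Y" unfolding d2_def by simp

lemma d2_minus_commute: "d2 (\<lambda>\<omega>. Y \<omega> - X \<omega>) = d2 (\<lambda>\<omega>. X \<omega> - Y \<omega>)"
  using d2_uminus[of "\<lambda>\<omega>. Y \<omega> - X \<omega>"] by simp

lemma d2_cong_AE: "AE \<omega> in M. X \<omega> = Y \<omega> \<Longrightarrow> d2 X = d2 Y"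
  unfolding d2_def by (rule nn_integral_cong_AE) auto

lemma norm_sum_sq: "(norm (x + y))\<^sup>2 \<le> 2 * (norm x)\<^sup>2 + 2 * (norm y)\<^sup>2" for x y :: "'b::real_normed_vector"
proof -
  have "(norm (x + y))\<^sup>2 \<le> (norm x + norm y)\<^sup>2" by (intro power_mono norm_triangle_ineq) simp
  also have "\<dots> \<le> 2 * (norm x)\<^sup>2 + 2 * (norm y)\<^sup>2"
    using zero_le_power2[of "norm x - norm y"] unfolding power2_sum power2_diff by linarith
  finally show ?thesis .
qed

lemma d2_add_le:
  assumes f: "f \<in> borel_measurable M" and g: "g \<in> borel_measurable M"
  shows "d2 (\<lambda>t. f t + g t) \<le> 2 * d2 f + 2 * d2 g"
proof -
  have "d2 (\<lambda>t. f t + g t) \<le> (\<integral>\<^sup>+\<omega>. 2 * ennreal ((norm (f \<omega>))\<^sup>2) + 2 * ennreal ((norm (g \<omega>))\<^sup>2) \<partial>M)"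
    unfolding d2_def
  proof (rule nn_integral_mono)
    fix t
    have "ennreal ((norm (f t + g t))\<^sup>2) \<le> ennreal (2 * (norm (f t))\<^sup>2 + 2 * (norm (g t))\<^sup>2)"
      by (rule ennreal_leI[OF norm_sum_sq])
    then show "ennreal ((norm (f t + g t))\<^sup>2) \<le> 2 * ennreal ((norm (f t))\<^sup>2) + 2 * ennreal ((norm (g t))\<^sup>2)"
      by (simp add: ennreal_plus ennreal_mult)
  qed
  also have "\<dots> = 2 * d2 f + 2 * d2 g"
    unfolding d2_def using f g by (simp add: nn_integral_add nn_integral_cmult)
  finally show ?thesis .
qed

lemma d2_mult_le:
  assumes f: "f \<in> borel_measurable M"
  shows "d2 (\<lambda>t. V *v f t) \<le> ennreal ((norm V)\<^sup>2) * d2 f"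
proof -
  have "d2 (\<lambda>t. V *v f t) \<le> (\<integral>\<^sup>+\<omega>. ennreal ((norm V)\<^sup>2) * ennreal ((norm (f \<omega>))\<^sup>2) \<partial>M)"
    unfolding d2_def
  proof (rule nn_integral_mono)
    fix t
    have "(norm (V *v f t))\<^sup>2 \<le> (norm V * norm (f t))\<^sup>2" by (intro power_mono matrix_vector_norm_le) simp
    then show "ennreal ((norm (V *v f t))\<^sup>2) \<le> ennreal ((norm V)\<^sup>2) * ennreal ((norm (f t))\<^sup>2)"
      by (simp add: ennreal_mult[symmetric] power_mult_distrib ennreal_leI)
  qed
  also have "\<dots> = ennreal ((norm V)\<^sup>2) * d2 f" unfolding d2_def using f by (intro nn_integral_cmult) simp
  finally show ?thesis .
qed

lemma d2_0_imp_AE: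
  assumes "f \<in> borel_measurable M" "d2 f = 0" shows "AE \<omega> in M. f \<omega> = 0"
proof -
  have "AE \<omega> in M. ennreal ((norm (f \<omega>))\<^sup>2) = 0"
    using assms unfolding d2_def by (subst (asm) nn_integral_0_iff_AE) auto
  then show ?thesis by eventually_elim simp
qed

lemma eI_meas: "tpos xs \<Longrightarrow> eI W xs \<in> borel_measurable M"
proof (induction xs)
  case Nil then show ?case by (simp add: eI_def[abs_def])
next
  case (Cons x xs)
  obtain s c where x: "x = (s, c)" by force
  have "eI W (x # xs) = (\<lambda>\<omega>. c *v (W s \<omega> - W 0 \<omega>) + eI W xs \<omega>)" by (simp add: x fun_eq_iff)
  then show ?case using Cons x by (auto intro!: borel_measurable_add measurable_mv borel_measurable_diff W_meas)
qed

text \<open>One simultaneous approximation in both seminorms, with no time horizon and no prescribed shape of the step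
functions. For integrands of finite seminorm, cut off at \<open>T\<close>, it is equivalent to \<open>is_wiener_integral\<close>, and
much easier to add, multiply and pass to the limit.\<close>

definition has_wiener_integral :: "(real \<Rightarrow> real^'m^'n) \<Rightarrow> ('a \<Rightarrow> real^'n) \<Rightarrow> bool" where
  "has_wiener_integral f J \<longleftrightarrow> f \<in> borel_measurable borel \<and> J \<in> borel_measurable M \<and>
    (\<forall>e>0::real. \<exists>xs. tpos xs \<and> q (\<lambda>t. f t - el xs t) < ennreal e \<and> d2 (\<lambda>\<omega>. J \<omega> - eI W xs \<omega>) < ennreal e)"

lemma wiD: assumes "has_wiener_integral f J" shows "f \<in> borel_measurable borel" "J \<in> borel_measurable M"
  using assms by (auto simp: has_wiener_integral_def)

lemma wi_approx: assumes "has_wiener_integral f J" "0 < (e::real)"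
  obtains xs where "tpos xs" "q (\<lambda>t. f t - el xs t) < ennreal e" "d2 (\<lambda>\<omega>. J \<omega> - eI W xs \<omega>) < ennreal e"
  using assms unfolding has_wiener_integral_def by blast

lemma wi_eI: "tpos xs \<Longrightarrow> has_wiener_integral (el xs) (eI W xs)"
  unfolding has_wiener_integral_def
  by (auto simp: el_measurable eI_meas q_def d2_def intro!: exI[of _ xs])

text \<open>The isometry up to a constant: the inequality \<open>(norm (x + y))\<^sup>2 \<le> 2 (norm x)\<^sup>2 + 2 (norm y)\<^sup>2\<close> enters
once on each side.\<close>

lemma wi_bound: assumes w: "has_wiener_integral f J" shows "d2 J \<le> 4 * q f"
proof (rule ennreal_le_epsilon)
  fix e :: real assume "0 < e"
  then have "e / 6 > 0" by simp
  from wi_approx[OF w this] obtain xs where xs: "tpos xs" "q (\<lambda>t. f t - el xs t) < ennreal (e/6)" "d2 (\<lambda>\<omega>. J \<omega> - eI W xs \<omega>) < ennreal (e/6)" .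
  note m = wiD[OF w] el_measurable[of xs] eI_meas[OF xs(1)]
  have "d2 J \<le> 2 * d2 (\<lambda>\<omega>. J \<omega> - eI W xs \<omega>) + 2 * d2 (eI W xs)"
    using d2_add_le[of "\<lambda>\<omega>. J \<omega> - eI W xs \<omega>" "eI W xs"] m by simp
  also have "d2 (eI W xs) = q (el xs)" by (rule isometry[OF xs(1)])
  also have "q (el xs) \<le> 2 * q f + 2 * q (\<lambda>t. f t - el xs t)"
    using q_diff_le[of f "\<lambda>t. f t - el xs t"] m by simp
  finally have "d2 J \<le> 2 * d2 (\<lambda>\<omega>. J \<omega> - eI W xs \<omega>) + 2 * (2 * q f + 2 * q (\<lambda>t. f t - el xs t))"
    by (simp add: add_left_mono mult_left_mono)
  also have "\<dots> \<le> 2 * ennreal (e/6) + 2 * (2 * q f + 2 * ennreal (e/6))"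
    using xs by (intro add_mono mult_left_mono) (auto simp: less_imp_le)
  also have "\<dots> = 4 * q f + (2 * ennreal (e/6) + 4 * ennreal (e/6))"
    by (simp add: distrib_left mult.assoc[symmetric] add_ac)
  also have "2 * ennreal (e/6) + 4 * ennreal (e/6) = ennreal (2 * (e/6) + 4 * (e/6))"
    using \<open>0 < e\<close> by (simp only: ennreal_plus ennreal_mult ennreal_numeral)
  also have "2 * (e/6) + 4 * (e/6) = e" by simp
  finally show "d2 J \<le> 4 * q f + ennreal e" .
qed

lemma wi_limit:
  assumes f: "f \<in> borel_measurable borel" and J: "J \<in> borel_measurable M"
    and lim: "\<And>e::real. e > 0 \<Longrightarrow> \<exists>g H. has_wiener_integral g H \<and> q (\<lambda>t. f t - g t) < ennreal e \<and> d2 (\<lambda>\<omega>. J \<omega> - H \<omega>) < ennreal e"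
  shows "has_wiener_integral f J"
  unfolding has_wiener_integral_def
proof (intro conjI allI impI f J)
  fix e :: real assume "0 < e"
  then have e4: "e/4 > 0" by simp
  obtain g H where g: "has_wiener_integral g H" "q (\<lambda>t. f t - g t) < ennreal (e/4)" "d2 (\<lambda>\<omega>. J \<omega> - H \<omega>) < ennreal (e/4)"
    using lim[OF e4] by blast
  from wi_approx[OF g(1) e4] obtain xs where xs: "tpos xs" "q (\<lambda>t. g t - el xs t) < ennreal (e/4)" "d2 (\<lambda>\<omega>. H \<omega> - eI W xs \<omega>) < ennreal (e/4)" .
  note m = wiD[OF g(1)] el_measurable[of xs] eI_meas[OF xs(1)] f J
  have "q (\<lambda>t. f t - el xs t) \<le> 2 * q (\<lambda>t. f t - g t) + 2 * q (\<lambda>t. g t - el xs t)"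
    using q_add_le[of "\<lambda>t. f t - g t" "\<lambda>t. g t - el xs t"] m by simp
  also have "\<dots> < ennreal e" by (rule ennreal_two_sum_less[OF g(2) xs(2)])
  finally have 1: "q (\<lambda>t. f t - el xs t) < ennreal e" .
  have "d2 (\<lambda>\<omega>. J \<omega> - eI W xs \<omega>) \<le> 2 * d2 (\<lambda>\<omega>. J \<omega> - H \<omega>) + 2 * d2 (\<lambda>\<omega>. H \<omega> - eI W xs \<omega>)"
    using d2_add_le[of "\<lambda>\<omega>. J \<omega> - H \<omega>" "\<lambda>\<omega>. H \<omega> - eI W xs \<omega>"] m by simp
  also have "\<dots> < ennreal e" by (rule ennreal_two_sum_less[OF g(3) xs(3)])
  finally show "\<exists>xs. tpos xs \<and> q (\<lambda>t. f t - el xs t) < ennreal e \<and> d2 (\<lambda>\<omega>. J \<omega> - eI W xs \<omega>) < ennreal e"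
    using 1 xs(1) by blast
qed

lemma wi_add: assumes f: "has_wiener_integral f J" and g: "has_wiener_integral g H" shows "has_wiener_integral (\<lambda>t. f t + g t) (\<lambda>\<omega>. J \<omega> + H \<omega>)"
proof (rule wi_limit)
  note m0 = wiD[OF f] wiD[OF g]
  show "(\<lambda>t. f t + g t) \<in> borel_measurable borel" "(\<lambda>\<omega>. J \<omega> + H \<omega>) \<in> borel_measurable M" using m0 by simp_all
  fix e :: real assume "0 < e"
  then have e4: "e/4 > 0" by simp
  from wi_approx[OF f e4] obtain xs where xs: "tpos xs" "q (\<lambda>t. f t - el xs t) < ennreal (e/4)" "d2 (\<lambda>\<omega>. J \<omega> - eI W xs \<omega>) < ennreal (e/4)" .
  from wi_approx[OF g e4] obtain ys where ys: "tpos ys" "q (\<lambda>t. g t - el ys t) < ennreal (e/4)" "d2 (\<lambda>\<omega>. H \<omega> - eI W ys \<omega>) < ennreal (e/4)" .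
  note m = m0 el_measurable[of xs] eI_meas[OF xs(1)] el_measurable[of ys] eI_meas[OF ys(1)]
  have "q (\<lambda>t. (f t + g t) - el (xs @ ys) t) \<le> 2 * q (\<lambda>t. f t - el xs t) + 2 * q (\<lambda>t. g t - el ys t)"
    using q_add_le[of "\<lambda>t. f t - el xs t" "\<lambda>t. g t - el ys t"] m by (simp add: algebra_simps)
  also have "\<dots> < ennreal e" by (rule ennreal_two_sum_less[OF xs(2) ys(2)])
  finally have 1: "q (\<lambda>t. (f t + g t) - el (xs @ ys) t) < ennreal e" .
  have "d2 (\<lambda>\<omega>. (J \<omega> + H \<omega>) - eI W (xs @ ys) \<omega>) \<le> 2 * d2 (\<lambda>\<omega>. J \<omega> - eI W xs \<omega>) + 2 * d2 (\<lambda>\<omega>. H \<omega> - eI W ys \<omega>)"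
    using d2_add_le[of "\<lambda>\<omega>. J \<omega> - eI W xs \<omega>" "\<lambda>\<omega>. H \<omega> - eI W ys \<omega>"] m by (simp add: algebra_simps)
  also have "\<dots> < ennreal e" by (rule ennreal_two_sum_less[OF xs(3) ys(3)])
  finally show "\<exists>g' H'. has_wiener_integral g' H' \<and> q (\<lambda>t. (f t + g t) - g' t) < ennreal e \<and> d2 (\<lambda>\<omega>. (J \<omega> + H \<omega>) - H' \<omega>) < ennreal e"
    by (intro exI[of _ "el (xs @ ys)"] exI[of _ "eI W (xs @ ys)"] conjI 1 wi_eI) (simp add: xs ys)
qed

lemma ennreal_mult_less_of_div:
  assumes "a < ennreal (e / (k + 1))" "0 \<le> k" "0 < e"
  shows "ennreal k * a < ennreal e"
proof -
  have "a < top" using assms(1) by (auto intro: less_trans ennreal_less_top)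
  then obtain x where x: "a = ennreal x" "0 \<le> x" by (metis ennreal_cases less_irrefl)
  have "x < e / (k + 1)" using assms x by (simp add: ennreal_less_iff)
  then have "x * (k + 1) < e" using assms by (simp add: pos_less_divide_eq)
  then have "k * x < e" using x by (simp add: algebra_simps)
  then show ?thesis using x assms by (simp add: ennreal_mult[symmetric] ennreal_less_iff)
qed

lemma wi_mult:
  fixes V :: "real^'n^'p"
  assumes f: "has_wiener_integral f J" shows "has_wiener_integral (\<lambda>t. V ** f t) (\<lambda>\<omega>. V *v J \<omega>)"
proof (rule wi_limit)
  note m0 = wiD[OF f]
  show "(\<lambda>t. V ** f t) \<in> borel_measurable borel" "(\<lambda>\<omega>. V *v J \<omega>) \<in> borel_measurable M"
    using m0 by (auto intro: measurable_mm measurable_mv)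
  fix e :: real assume e: "0 < e"
  let ?k = "real CARD('p) * (real CARD('n) * real CARD('n)) * (norm V)\<^sup>2"
  define k where "k = max ?k ((norm V)\<^sup>2)"
  have k: "0 \<le> k" "?k \<le> k" "(norm V)\<^sup>2 \<le> k" by (auto simp: k_def le_max_iff_disj)
  have "e / (k + 1) > 0" using e k by simp
  from wi_approx[OF f this] obtain xs where xs: "tpos xs" "q (\<lambda>t. f t - el xs t) < ennreal (e/(k+1))" "d2 (\<lambda>\<omega>. J \<omega> - eI W xs \<omega>) < ennreal (e/(k+1))" .
  note m = m0 el_measurable[of xs] eI_meas[OF xs(1)]
  have "q (\<lambda>t. V ** f t - el (lmult V xs) t) \<le> ennreal ?k * q (\<lambda>t. f t - el xs t)"
    using q_mult_le[of "\<lambda>t. f t - el xs t" V] m by (simp add: el_lmult mm.diff_right)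
  also have "\<dots> \<le> ennreal k * q (\<lambda>t. f t - el xs t)" by (intro mult_right_mono ennreal_leI k) simp
  also have "\<dots> < ennreal e" by (rule ennreal_mult_less_of_div[OF xs(2) k(1) e])
  finally have 1: "q (\<lambda>t. V ** f t - el (lmult V xs) t) < ennreal e" .
  have "d2 (\<lambda>\<omega>. V *v J \<omega> - eI W (lmult V xs) \<omega>) \<le> ennreal ((norm V)\<^sup>2) * d2 (\<lambda>\<omega>. J \<omega> - eI W xs \<omega>)"
    using d2_mult_le[of "\<lambda>\<omega>. J \<omega> - eI W xs \<omega>" V] m by (simp add: eI_lmult mv.diff_right)
  also have "\<dots> \<le> ennreal k * d2 (\<lambda>\<omega>. J \<omega> - eI W xs \<omega>)" by (intro mult_right_mono ennreal_leI k) simp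
  also have "\<dots> < ennreal e" by (rule ennreal_mult_less_of_div[OF xs(3) k(1) e])
  finally show "\<exists>g' H'. has_wiener_integral g' H' \<and> q (\<lambda>t. V ** f t - g' t) < ennreal e \<and> d2 (\<lambda>\<omega>. V *v J \<omega> - H' \<omega>) < ennreal e"
    by (intro exI[of _ "el (lmult V xs)"] exI[of _ "eI W (lmult V xs)"] conjI 1 wi_eI) (simp add: xs)
qed

lemma wi_diff: assumes f: "has_wiener_integral f J" and g: "has_wiener_integral g H" shows "has_wiener_integral (\<lambda>t. f t - g t) (\<lambda>\<omega>. J \<omega> - H \<omega>)"
  using wi_add[OF f wi_mult[OF g, of "- mat 1"]] by (simp add: mm.minus_left mv.minus_left)

lemma wi_0: "has_wiener_integral (\<lambda>t. 0 :: real^'m^'n) (\<lambda>\<omega>. 0)"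
  using wi_eI[of "[] :: (real \<times> (real^'m^'n)) list"] by (simp add: el_def[abs_def] eI_def[abs_def])

lemma wi_sum: "(\<And>i. i < n \<Longrightarrow> has_wiener_integral (f i) (J i)) \<Longrightarrow> has_wiener_integral (\<lambda>t. \<Sum>i<n. f i t) (\<lambda>\<omega>. \<Sum>i<(n::nat). J i \<omega>)"
  by (induction n) (auto intro: wi_0 wi_add)

text \<open>The integral of the zero function has second moment zero.\<close>

lemma wi_unique:
  fixes f g :: "real \<Rightarrow> real^'m^'n"
  assumes f: "has_wiener_integral f J" and g: "has_wiener_integral g H" and "AE t in lborel. t \<ge> 0 \<longrightarrow> f t = g t"
  shows "AE \<omega> in M. J \<omega> = H \<omega>"
proof -
  have "q (\<lambda>t. f t - g t) = q (\<lambda>t. 0 :: real^'m^'n)" by (rule q_cong_AE) (use assms(3) in eventually_elim, simp)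
  also have "\<dots> = 0" by (simp add: q_def)
  finally have "d2 (\<lambda>\<omega>. J \<omega> - H \<omega>) \<le> 4 * 0" using wi_bound[OF wi_diff[OF f g]] by simp
  then have "d2 (\<lambda>\<omega>. J \<omega> - H \<omega>) = 0" by simp
  then have "AE \<omega> in M. J \<omega> - H \<omega> = 0"
    using wiD[OF f] wiD[OF g] by (intro d2_0_imp_AE) auto
  then show ?thesis by eventually_elim simp
qed

lemma Rnorm_integral_finite: assumes "0 \<le> T" shows "(\<integral>\<^sup>+t. ennreal (c * norm (R t)) * indicator {0..T} t \<partial>lborel) < \<infinity>"
proof -
  have i: "integrable lborel (\<lambda>t. norm (indicat_real {0..T} t *\<^sub>R (\<bar>c\<bar> *\<^sub>R R t)))"
    using Rint[OF assms] unfolding set_integrable_def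
    by (intro integrable_norm) (subst scaleR_left_commute, rule integrable_scaleR_right)
  have "(\<integral>\<^sup>+t. ennreal (c * norm (R t)) * indicator {0..T} t \<partial>lborel) \<le> (\<integral>\<^sup>+t. ennreal (norm (indicat_real {0..T} t *\<^sub>R (\<bar>c\<bar> *\<^sub>R R t))) \<partial>lborel)"
    by (intro nn_integral_mono) (auto simp: indicator_def intro!: ennreal_leI mult_right_mono)
  also have "\<dots> < \<infinity>" using i by (subst nn_integral_eq_integral) auto
  finally show ?thesis .
qed

text \<open>Dominated convergence, with \<open>norm R\<close> as the integrable majorant.\<close>

lemma q_bounded_convergence:
  fixes u :: "nat \<Rightarrow> real \<Rightarrow> real^'m^'n"
  assumes u: "\<And>j. u j \<in> borel_measurable borel" and B: "\<And>j t. norm (u j t) \<le> B" and T: "0 \<le> T"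
    and supp: "\<And>j t. t \<notin> {0<..T} \<Longrightarrow> u j t = 0"
    and lim: "AE t in lborel. (\<lambda>j. u j t) \<longlonglongrightarrow> 0"
  shows "(\<lambda>j. q (u j)) \<longlonglongrightarrow> 0"
proof -
  let ?w = "\<lambda>t. ennreal ((real CARD('n) * B\<^sup>2) * norm (R t)) * indicator {0..T} t"
  have wm: "?w \<in> borel_measurable lborel"
  proof -
    define R' where "R' = (\<lambda>t. indicat_real {0..} t *\<^sub>R R t)"
    have [measurable]: "R' \<in> borel_measurable lborel" using R_meas by (simp add: R'_def)
    have "(\<lambda>t. ennreal ((real CARD('n) * B\<^sup>2) * norm (R' t)) * indicator {0..T} t) \<in> borel_measurable lborel"
      by measurable
    then have "(\<lambda>t. ennreal ((real CARD('n) * B\<^sup>2) * norm (indicat_real {0..} t *\<^sub>R R t)) * indicator {0..T} t) \<in> borel_measurable lborel"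
      by (simp add: R'_def)
    moreover have "(\<lambda>t. ennreal ((real CARD('n) * B\<^sup>2) * norm (indicat_real {0..} t *\<^sub>R R t)) * indicator {0..T} t) = ?w"
      by (auto simp: fun_eq_iff indicator_def)
    ultimately show ?thesis by simp
  qed
  have "(\<lambda>j. \<integral>\<^sup>+t. ennreal (quad (R t) (u j t)) * indicator {0..} t \<partial>lborel) \<longlonglongrightarrow> (\<integral>\<^sup>+(t::real). 0 \<partial>lborel)"
  proof (rule nn_integral_dominated_convergence[where w="?w" and u'="\<lambda>_. 0"])
    show "(\<lambda>t. ennreal (quad (R t) (u j t)) * indicator {0..} t) \<in> borel_measurable lborel" for j by (rule quad_meas[OF u])
    show "AE t in lborel. ennreal (quad (R t) (u j t)) * indicator {0..} t \<le> ?w t" for j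
    proof (rule AE_I2)
      fix t
      show "ennreal (quad (R t) (u j t)) * indicator {0..} t \<le> ?w t"
      proof (cases "t \<in> {0<..T}")
        case True
        have "quad (R t) (u j t) \<le> real CARD('n) * (norm (u j t))\<^sup>2 * norm (R t)" using quad_le_norm[of "R t" "u j t"] by simp
        also have "\<dots> \<le> real CARD('n) * B\<^sup>2 * norm (R t)" using B[of j t] by (intro mult_right_mono mult_left_mono power_mono) auto
        finally show ?thesis using True by (simp add: ennreal_leI)
      qed (simp add: supp)
    qed
    show "(\<integral>\<^sup>+t. ?w t \<partial>lborel) < \<infinity>" by (rule Rnorm_integral_finite[OF T])
    show "AE t in lborel. (\<lambda>j. ennreal (quad (R t) (u j t)) * indicator {0..} t) \<longlonglongrightarrow> 0"
      using lim
    proof eventually_elim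
      case (elim t)
      have "(\<lambda>j. trace (u j t ** R t ** transpose (u j t))) \<longlonglongrightarrow> trace (0 ** R t ** transpose (0::real^'m^'n))"
        by (intro bounded_linear.tendsto[OF bounded_linear_trace] mm.tendsto bounded_linear.tendsto[OF bounded_linear_transpose] elim tendsto_const)
      then have "(\<lambda>j. ennreal (quad (R t) (u j t))) \<longlonglongrightarrow> ennreal 0"
        unfolding quad_def by (intro tendsto_ennrealI) (simp add: mm.zero_left trace_def)
      then show ?case by (cases "t \<ge> 0") auto
    qed
  qed (use wm in auto)
  then show ?thesis by (simp add: q_def)
qed

end

section \<open>A maximal inequality\<close>

lemma continuous_le_on_rats:
  fixes \<phi> :: "real \<Rightarrow> real"
  assumes c: "continuous_on {0..T} \<phi>" and T: "0 < T"
    and le: "\<And>r. r \<in> \<rat> \<Longrightarrow> r \<in> {0..T} \<Longrightarrow> \<phi> r \<le> c" and t: "t \<in> {0..T}"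
  shows "\<phi> t \<le> c"
proof -
  have "closed {t \<in> {0..T}. \<phi> t \<le> c}"
    by (intro continuous_on_closed_Collect_le c continuous_on_const closed_atLeastAtMost)
  then have 1: "closure (\<rat> \<inter> {0<..<T}) \<subseteq> {t \<in> {0..T}. \<phi> t \<le> c}"
    using le by (intro closure_minimal) auto
  have "{0<..<T} \<subseteq> closure (\<rat> \<inter> {0<..<T})"
  proof
    fix x assume x: "x \<in> {0<..<T}"
    show "x \<in> closure (\<rat> \<inter> {0<..<T})" unfolding closure_approachable
    proof (intro allI impI)
      fix e :: real assume "0 < e"
      then have "x < min T (x + e)" using x by simp
      from Rats_dense_in_real[OF this] obtain r where "r \<in> \<rat>" "x < r" "r < min T (x + e)" by blast
      then show "\<exists>y\<in>\<rat> \<inter> {0<..<T}. dist y x < e" using x by (intro bexI[of _ r]) (auto simp: dist_real_def)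
    qed
  qed
  then have "closure {0<..<T} \<subseteq> closure (\<rat> \<inter> {0<..<T})" using closure_mono closure_closure by blast
  moreover have "t \<in> closure {0<..<T}" using t T by simp
  ultimately show ?thesis using 1 by blast
qed

text \<open>Let \<open>k\<close> be the first index at which the partial sum leaves the ball of radius \<open>2 \<alpha>\<close>. Then either the
total sum or the sum of the remaining terms has norm above \<open>\<alpha>\<close>, and the remaining terms are independent of the
event that \<open>k\<close> is the first index.\<close>

lemma (in prob_space) ottaviani:
  fixes X :: "nat \<Rightarrow> 'a \<Rightarrow> real^'n"
  assumes iv: "indep_vars (\<lambda>_. borel) X {..<n}"
    and p: "\<And>k. k \<le> n \<Longrightarrow> prob {\<omega>\<in>space M. \<alpha> < norm (\<Sum>i\<in>{k..<n}. X i \<omega>)} \<le> p"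
  shows "prob {\<omega>\<in>space M. \<exists>k\<le>n. 2 * \<alpha> < norm (\<Sum>i<k. X i \<omega>)} \<le> 2 * p"
proof -
  have X: "X i \<in> borel_measurable M" if "i < n" for i using iv that by (auto simp: indep_vars_def)
  define S where "S k \<omega> = (\<Sum>i<k. X i \<omega>)" for k \<omega>
  define U where "U k \<omega> = (\<Sum>i\<in>{k..<n}. X i \<omega>)" for k \<omega>
  have Sm: "S k \<in> borel_measurable M" if "k \<le> n" for k
    unfolding S_def[abs_def] using that by (intro borel_measurable_sum X) auto
  have Um: "U k \<in> borel_measurable M" for k
    unfolding U_def[abs_def] by (intro borel_measurable_sum X) auto
  have SU: "S n \<omega> = S k \<omega> + U k \<omega>" if "k \<le> n" for k \<omega>
    unfolding S_def U_def lessThan_atLeast0 using that by (simp add: sum.atLeastLessThan_concat)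
  \<comment> \<open>\<open>A k\<close>: the ball is left for the first time at \<open>k\<close>; \<open>B k\<close>: the remainder after \<open>k\<close> is large.\<close>
  define A where "A k = {\<omega>\<in>space M. 2 * \<alpha> < norm (S k \<omega>) \<and> (\<forall>j<k. \<not> 2 * \<alpha> < norm (S j \<omega>))}" for k
  define B where "B k = {\<omega>\<in>space M. \<alpha> < norm (U k \<omega>)}" for k
  have Bm: "B k \<in> events" for k unfolding B_def using Um[of k] by measurable
  have ind: "A k \<in> events \<and> prob (A k \<inter> B k) = prob (A k) * prob (B k)" if k: "k \<le> n" for k
  proof -
    let ?P = "\<lambda>I. Pi\<^sub>M I (\<lambda>_. borel :: (real^'n) measure)"
    have iv2: "indep_var (?P {..<k}) (\<lambda>\<omega>. restrict (\<lambda>i. X i \<omega>) {..<k}) (?P {k..<n}) (\<lambda>\<omega>. restrict (\<lambda>i. X i \<omega>) {k..<n})"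
      by (rule indep_var_restrict[OF iv]) (use k in auto)
    let ?Xa = "{f \<in> space (?P {..<k}). 2 * \<alpha> < norm (\<Sum>i<k. f i) \<and> (\<forall>j\<in>{..<k}. \<not> 2 * \<alpha> < norm (\<Sum>i<j. f i))}"
    let ?Xb = "{f \<in> space (?P {k..<n}). \<alpha> < norm (\<Sum>i\<in>{k..<n}. f i)}"
    have c: "(\<lambda>f. \<Sum>i\<in>J. f i) \<in> borel_measurable (?P I)" if "J \<subseteq> I" for J I :: "nat set"
      using that by (intro borel_measurable_sum measurable_component_singleton) auto
    have c1: "(\<lambda>f. \<Sum>i<j. f i) \<in> borel_measurable (?P {..<k})" if "j \<le> k" for j
      by (rule c) (use that in auto)
    have Xa: "?Xa \<in> sets (?P {..<k})"
    proof -
      have "?Xa = {f \<in> space (?P {..<k}). 2 * \<alpha> < norm (\<Sum>i<k. f i)} \<inter> (\<Inter>j\<in>{..k}. if j = k then space (?P {..<k}) else {f \<in> space (?P {..<k}). \<not> 2 * \<alpha> < norm (\<Sum>i<j. f i)})"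
        by (auto split: if_splits)
      also have "\<dots> \<in> sets (?P {..<k})"
      proof (intro sets.Int sets.finite_INT)
        show "{f \<in> space (?P {..<k}). 2 * \<alpha> < norm (\<Sum>i<k. f i)} \<in> sets (?P {..<k})"
          using c1[of k] by measurable
        fix j assume "j \<in> {..k}"
        then have [measurable]: "(\<lambda>f. \<Sum>i<j. f i) \<in> borel_measurable (?P {..<k})" by (intro c1) simp
        have "{f \<in> space (?P {..<k}). \<not> 2 * \<alpha> < norm (\<Sum>i<j. f i)} \<in> sets (?P {..<k})" by measurable
        then show "(if j = k then space (?P {..<k}) else {f \<in> space (?P {..<k}). \<not> 2 * \<alpha> < norm (\<Sum>i<j. f i)}) \<in> sets (?P {..<k})"
          by simp
      qed auto
      finally show ?thesis .
    qed
    have [measurable]: "(\<lambda>f. \<Sum>i\<in>{k..<n}. f i) \<in> borel_measurable (?P {k..<n})" by (rule c) simp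
    have Xb: "?Xb \<in> sets (?P {k..<n})" by measurable
    have a: "(\<lambda>\<omega>. restrict (\<lambda>i. X i \<omega>) {..<k}) -` ?Xa \<inter> space M = A k"
      by (auto simp: A_def space_PiM S_def)
    have b: "(\<lambda>\<omega>. restrict (\<lambda>i. X i \<omega>) {k..<n}) -` ?Xb \<inter> space M = B k"
      by (auto simp: B_def space_PiM U_def)
    have ab: "(\<lambda>\<omega>. (restrict (\<lambda>i. X i \<omega>) {..<k}, restrict (\<lambda>i. X i \<omega>) {k..<n})) -` (?Xa \<times> ?Xb) \<inter> space M = A k \<inter> B k"
      unfolding a[symmetric] b[symmetric] by blast
    have "A k \<in> events" unfolding a[symmetric] by (rule measurable_sets[OF indep_var_rv1[OF iv2] Xa])
    moreover have "prob (A k \<inter> B k) = prob (A k) * prob (B k)"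
      using indep_varD[OF iv2 Xa Xb] unfolding a b ab .
    ultimately show ?thesis by blast
  qed
  have Am: "A k \<in> events" if "k \<le> n" for k using ind[OF that] by blast
  have disj: "disjoint_family_on A {..n}"
    unfolding disjoint_family_on_def A_def by (auto, metis nat_neq_iff)
  have p0: "0 \<le> p" using p[of 0] measure_nonneg order_trans by blast
  have sub: "{\<omega>\<in>space M. \<exists>k\<le>n. 2 * \<alpha> < norm (\<Sum>i<k. X i \<omega>)} \<subseteq> B 0 \<union> (\<Union>k\<in>{..n}. A k \<inter> B k)"
  proof
    fix \<omega> assume "\<omega> \<in> {\<omega>\<in>space M. \<exists>k\<le>n. 2 * \<alpha> < norm (\<Sum>i<k. X i \<omega>)}"
    then have \<omega>: "\<omega> \<in> space M" and ex: "\<exists>k. k \<le> n \<and> 2 * \<alpha> < norm (S k \<omega>)" by (auto simp: S_def)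
    define k where "k = (LEAST k. k \<le> n \<and> 2 * \<alpha> < norm (S k \<omega>))"
    have k: "k \<le> n" "2 * \<alpha> < norm (S k \<omega>)" using LeastI_ex[OF ex] unfolding k_def by auto
    have "\<not> 2 * \<alpha> < norm (S j \<omega>)" if "j < k" for j
      using not_less_Least[of j "\<lambda>k. k \<le> n \<and> 2 * \<alpha> < norm (S k \<omega>)"] that k(1) unfolding k_def by auto
    then have Ak: "\<omega> \<in> A k" using \<omega> k by (simp add: A_def)
    show "\<omega> \<in> B 0 \<union> (\<Union>k\<in>{..n}. A k \<inter> B k)"
    proof (cases "\<alpha> < norm (U k \<omega>)")
      case True
      then show ?thesis using Ak \<omega> k by (auto simp: B_def)
    next
      case False
      have "norm (S k \<omega>) \<le> norm (S n \<omega>) + norm (U k \<omega>)" using SU[OF k(1), of \<omega>] norm_triangle_ineq4[of "S n \<omega>" "U k \<omega>"] by simp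
      then have "\<alpha> < norm (S n \<omega>)" using k False by linarith
      moreover have "U 0 \<omega> = S n \<omega>" by (simp add: U_def S_def lessThan_atLeast0)
      ultimately show ?thesis using \<omega> by (simp add: B_def)
    qed
  qed
  have "prob {\<omega>\<in>space M. \<exists>k\<le>n. 2 * \<alpha> < norm (\<Sum>i<k. X i \<omega>)} \<le> prob (B 0 \<union> (\<Union>k\<in>{..n}. A k \<inter> B k))"
    using Am Bm by (intro finite_measure_mono sub sets.Un sets.finite_UN sets.Int) auto
  also have "\<dots> \<le> prob (B 0) + prob (\<Union>k\<in>{..n}. A k \<inter> B k)"
    using Am Bm by (intro measure_Un_le sets.finite_UN sets.Int) auto
  also have "prob (\<Union>k\<in>{..n}. A k \<inter> B k) \<le> (\<Sum>k\<in>{..n}. prob (A k \<inter> B k))"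
    using Am Bm by (intro finite_measure_subadditive_finite) auto
  also have "(\<Sum>k\<in>{..n}. prob (A k \<inter> B k)) \<le> (\<Sum>k\<in>{..n}. prob (A k) * p)"
    using ind p by (intro sum_mono) (auto simp: B_def U_def intro!: mult_left_mono)
  also have "\<dots> = prob (\<Union>k\<in>{..n}. A k) * p"
    using Am disj by (subst finite_measure_finite_Union) (auto simp: sum_distrib_right)
  also have "\<dots> \<le> 1 * p" by (intro mult_right_mono p0 prob_le_1)
  also have "prob (B 0) \<le> p" using p[of 0] by (simp add: B_def U_def)
  finally show ?thesis by simp
qed

context wiener_integration begin

lemma d2_chebyshev:
  assumes Y: "Y \<in> borel_measurable M" and v: "d2 Y \<le> ennreal v" "0 \<le> v" and a: "0 < \<alpha>"
  shows "prob {\<omega>\<in>space M. \<alpha> < norm (Y \<omega>)} \<le> v / \<alpha>\<^sup>2"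
proof -
  have [measurable]: "Y \<in> borel_measurable M" by fact
  have "ennreal (\<alpha>\<^sup>2) * emeasure M {\<omega>\<in>space M. \<alpha> < norm (Y \<omega>)} = (\<integral>\<^sup>+\<omega>. ennreal (\<alpha>\<^sup>2) * indicator {\<omega>\<in>space M. \<alpha> < norm (Y \<omega>)} \<omega> \<partial>M)"
    by (rule nn_integral_cmult_indicator[symmetric]) measurable
  also have "\<dots> \<le> d2 Y" unfolding d2_def
    using a by (intro nn_integral_mono) (auto simp: indicator_def intro!: ennreal_leI power_mono)
  also have "\<dots> \<le> ennreal v" by (rule v)
  finally have "ennreal (\<alpha>\<^sup>2 * prob {\<omega>\<in>space M. \<alpha> < norm (Y \<omega>)}) \<le> ennreal v"
    by (simp add: emeasure_eq_measure ennreal_mult)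
  then have "\<alpha>\<^sup>2 * prob {\<omega>\<in>space M. \<alpha> < norm (Y \<omega>)} \<le> v" using v by simp
  then show ?thesis using a by (simp add: pos_le_divide_eq mult.commute)
qed

lemma eI_cut_0: "tpos xs \<Longrightarrow> eI W (cut 0 xs) \<omega> = 0"
  by (induction xs) (auto simp: min_def mv.zero_right split: prod.splits)

lemma eI_cut_increment:
  assumes "\<And>s c. (s, c) \<in> set xs \<Longrightarrow> s \<le> u \<or> v \<le> s" "u \<le> v"
  shows "eI W (cut v xs) \<omega> - eI W (cut u xs) \<omega> = (\<Sum>(s, c)\<leftarrow>xs. if v \<le> s then c else 0) *v (W v \<omega> - W u \<omega>)"
  using assms(1)
proof (induction xs)
  case Nil then show ?case by (simp add: mv.zero_left)
next
  case (Cons x xs)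
  obtain s c where x: "x = (s, c)" by force
  have s1: "c *v (W (min s v) \<omega> - W 0 \<omega>) - c *v (W (min s u) \<omega> - W 0 \<omega>) = (if v \<le> s then c else 0) *v (W v \<omega> - W u \<omega>)"
  proof (cases "v \<le> s")
    case True
    then show ?thesis using assms(2) by (simp add: min_def mv.diff_right)
  next
    case False
    then have "s \<le> u" using Cons.prems[of s c] x by auto
    then show ?thesis using False by (simp add: min_def mv.zero_left)
  qed
  have s2: "eI W (cut v xs) \<omega> - eI W (cut u xs) \<omega> = (\<Sum>(s, c)\<leftarrow>xs. if v \<le> s then c else 0) *v (W v \<omega> - W u \<omega>)"
    by (rule Cons.IH) (use Cons.prems in auto)
  have s3: "(\<Sum>(s, c)\<leftarrow>(s, c) # xs. if v \<le> s then c else 0) = (if v \<le> s then c else 0) + (\<Sum>(s, c)\<leftarrow>xs. if v \<le> s then c else 0)"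
    by (simp add: x)
  show ?case
    unfolding x cut_Cons eI_Cons add_diff_add s3 mv.add_left by (simp only: s1 s2)
qed

text \<open>Refine the finite set by the nodes of the step function. Then the integral process is constant matrix
times Wiener increment on each cell, so its increments are independent, and Chebyshev's inequality
with the isometry gives the hypothesis of \<open>ottaviani\<close>.\<close>

lemma maximal_finite:
  assumes xs: "tpos xs" and T: "0 \<le> T" and F: "finite F" "F \<subseteq> {0..T}" and a: "0 < \<alpha>"
    and v: "q (el (cut T xs)) \<le> ennreal v" "0 \<le> v"
  shows "prob {\<omega>\<in>space M. \<exists>t\<in>F. 2 * \<alpha> < norm (eI W (cut t xs) \<omega>)} \<le> 2 * (v / \<alpha>\<^sup>2)"
proof -
  define P where "P = F \<union> insert 0 (insert T ((\<lambda>x. min (fst x) T) ` set xs))"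
  have P: "finite P" "P \<subseteq> {0..T}" "0 \<in> P" "T \<in> P" "F \<subseteq> P"
    using F T xs by (auto simp: P_def tpos_def)
  define l where "l = sorted_list_of_set P"
  have l: "sorted l" "set l = P" "distinct l" using P(1) by (auto simp: l_def)
  have lne: "l \<noteq> []" using l(2) P(3) by auto
  define n where "n = length l - 1"
  have n: "length l = Suc n" using lne by (cases l) (auto simp: n_def)
  define \<tau> where "\<tau> i = l ! min i n" for i
  have mono: "mono \<tau>"
  proof (rule monoI)
    fix i j :: nat assume "i \<le> j"
    then show "\<tau> i \<le> \<tau> j" unfolding \<tau>_def by (intro sorted_nth_mono[OF l(1)]) (simp_all add: n)
  qed
  have inP: "\<tau> i \<in> P" for i
  proof -
    have "\<tau> i \<in> set l" unfolding \<tau>_def by (rule nth_mem) (simp add: n)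
    then show ?thesis by (simp add: l)
  qed
  have surj: "\<exists>k\<le>n. \<tau> k = t" if "t \<in> P" for t
  proof -
    have "t \<in> set l" using that l(2) by simp
    then obtain k where "k < length l" "l ! k = t" unfolding in_set_conv_nth by blast
    moreover have "k \<le> n" using \<open>k < length l\<close> n by simp
    ultimately show ?thesis by (intro exI[of _ k]) (simp add: \<tau>_def)
  qed
  have nn: "0 \<le> \<tau> i" for i using inP[of i] P(2) by auto
  have \<tau>0: "\<tau> 0 = 0"
  proof -
    obtain k where "\<tau> k = 0" using surj[OF P(3)] by blast
    then have "\<tau> 0 \<le> 0" using monoD[OF mono, of 0 k] by simp
    then show ?thesis using nn[of 0] by simp
  qed
  have \<tau>n: "\<tau> n = T"
  proof -
    obtain k where "k \<le> n" "\<tau> k = T" using surj[OF P(4)] by blast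
    then have "T \<le> \<tau> n" using monoD[OF mono, of k n] by simp
    then show ?thesis using inP[of n] P(2) by auto
  qed
  define X where "X i \<omega> = eI W (cut (\<tau> (Suc i)) xs) \<omega> - eI W (cut (\<tau> i) xs) \<omega>" for i \<omega>
  define c where "c i = (\<Sum>(s, c)\<leftarrow>xs. if \<tau> (Suc i) \<le> s then c else 0)" for i
  \<comment> \<open>No node of \<open>xs\<close> lies strictly inside a cell.\<close>
  have gap: "s \<le> \<tau> i \<or> \<tau> (Suc i) \<le> s" if sc: "(s, d) \<in> set xs" and i: "i < n" for s d i
  proof -
    have "min s T \<in> P" using sc by (force simp: P_def)
    then obtain k where k: "k \<le> n" "\<tau> k = min s T" using surj by blast
    show ?thesis
    proof (cases "k \<le> i")
      case True
      then have "min s T \<le> \<tau> i" using monoD[OF mono True] k by simp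
      moreover have "\<tau> i < T \<or> \<tau> i = T" using inP[of i] P(2) by auto
      moreover have "\<tau> (Suc i) \<le> T" using inP[of "Suc i"] P(2) by auto
      ultimately show ?thesis by (auto simp: min_def split: if_splits)
    next
      case False
      then have "\<tau> (Suc i) \<le> min s T" using monoD[OF mono, of "Suc i" k] k by simp
      then show ?thesis by simp
    qed
  qed
  have X_eq: "X i \<omega> = c i *v (W (\<tau> (Suc i)) \<omega> - W (\<tau> i) \<omega>)" if "i < n" for i \<omega>
    unfolding X_def c_def by (rule eI_cut_increment) (use gap that monoD[OF mono, of i "Suc i"] in auto)
  have "indep_vars (\<lambda>_. borel) (\<lambda>i \<omega>. c i *v (W (\<tau> (Suc i)) \<omega> - W (\<tau> i) \<omega>)) {..<n}"
    by (rule indep_vars_compose2[OF W_indep[OF nn mono]])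
      (auto intro!: borel_measurable_linear[OF mv.bounded_linear_right, of "\<lambda>x. x"])
  then have iv: "indep_vars (\<lambda>_. borel) X {..<n}"
    by (rule iffD1[OF indep_vars_cong, rotated -1]) (auto simp: X_eq fun_eq_iff)
  have tel: "(\<Sum>i\<in>{k..<m}. X i \<omega>) = eI W (cut (\<tau> m) xs) \<omega> - eI W (cut (\<tau> k) xs) \<omega>" if "k \<le> m" for k m \<omega>
    unfolding X_def using that by (rule sum_Suc_diff')
  have tel0: "(\<Sum>i<k. X i \<omega>) = eI W (cut (\<tau> k) xs) \<omega>" for k \<omega>
    using tel[of 0 k \<omega>] by (simp add: \<tau>0 eI_cut_0[OF xs] lessThan_atLeast0)
  have p: "prob {\<omega>\<in>space M. \<alpha> < norm (\<Sum>i\<in>{k..<n}. X i \<omega>)} \<le> v / \<alpha>\<^sup>2" if k: "k \<le> n" for k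
  proof -
    \<comment> \<open>The increment from \<open>\<tau> k\<close> to \<open>T\<close> is the integral of \<open>xs\<close> restricted to \<open>(\<tau> k, T]\<close>.\<close>
    let ?ys = "cut T xs @ lmult (- mat 1) (cut (\<tau> k) xs)"
    have ys: "tpos ?ys" using xs T nn[of k] by simp
    have e: "(\<Sum>i\<in>{k..<n}. X i \<omega>) = eI W ?ys \<omega>" for \<omega>
      using tel[OF k, of \<omega>] by (simp add: \<tau>n lmult_uminus_eI)
    have el: "el ?ys t = indicat_real {\<tau> k<..} t *\<^sub>R el (cut T xs) t" for t
      using nn[of k] inP[of k] P(2) by (auto simp: lmult_uminus_el el_cut indicator_def)
    have "d2 (eI W ?ys) = q (el ?ys)" by (rule isometry[OF ys])
    also have "\<dots> \<le> q (el (cut T xs))" unfolding el[abs_def] by (rule q_indicator_le)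
    finally have "d2 (eI W ?ys) \<le> ennreal v" using v(1) by (rule order_trans)
    from d2_chebyshev[OF eI_meas[OF ys] this v(2) a] show ?thesis by (simp only: e)
  qed
  have "prob {\<omega>\<in>space M. \<exists>t\<in>F. 2 * \<alpha> < norm (eI W (cut t xs) \<omega>)} \<le> prob {\<omega>\<in>space M. \<exists>k\<le>n. 2 * \<alpha> < norm (\<Sum>i<k. X i \<omega>)}"
  proof (rule finite_measure_mono)
    show "{\<omega>\<in>space M. \<exists>t\<in>F. 2 * \<alpha> < norm (eI W (cut t xs) \<omega>)} \<subseteq> {\<omega>\<in>space M. \<exists>k\<le>n. 2 * \<alpha> < norm (\<Sum>i<k. X i \<omega>)}"
      unfolding tel0 using surj P(5) by blast
    have [measurable]: "eI W (cut (\<tau> k) xs) \<in> borel_measurable M" for k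
      by (intro eI_meas tpos_cut xs nn)
    have "{\<omega>\<in>space M. \<exists>k\<le>n. 2 * \<alpha> < norm (\<Sum>i<k. X i \<omega>)} = (\<Union>k\<in>{..n}. {\<omega>\<in>space M. 2 * \<alpha> < norm (eI W (cut (\<tau> k) xs) \<omega>)})"
      unfolding tel0 by auto
    also have "\<dots> \<in> events" by (intro sets.finite_UN) auto
    finally show "{\<omega>\<in>space M. \<exists>k\<le>n. 2 * \<alpha> < norm (\<Sum>i<k. X i \<omega>)} \<in> events" .
  qed
  also have "\<dots> \<le> 2 * (v / \<alpha>\<^sup>2)" by (rule ottaviani[OF iv p])
  finally show ?thesis .
qed

lemma maximal_rats:
  assumes xs: "tpos xs" and T: "0 \<le> T" and a: "0 < \<alpha>"
    and v: "q (el (cut T xs)) \<le> ennreal v" "0 \<le> v"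
  shows "{\<omega>\<in>space M. \<exists>t\<in>\<rat> \<inter> {0..T}. 2 * \<alpha> < norm (eI W (cut t xs) \<omega>)} \<in> events"
    "prob {\<omega>\<in>space M. \<exists>t\<in>\<rat> \<inter> {0..T}. 2 * \<alpha> < norm (eI W (cut t xs) \<omega>)} \<le> 2 * (v / \<alpha>\<^sup>2)"
proof -
  have ne: "\<rat> \<inter> {0..T} \<noteq> {}" using T by (auto intro!: exI[of _ 0])
  have cnt: "countable (\<rat> \<inter> {0..T})" by (intro countable_Int1 countable_rat)
  define g where "g = from_nat_into (\<rat> \<inter> {0..T})"
  have g: "range g = \<rat> \<inter> {0..T}" unfolding g_def by (rule range_from_nat_into[OF ne cnt])
  define E where "E m = {\<omega>\<in>space M. \<exists>t\<in>g ` {..m}. 2 * \<alpha> < norm (eI W (cut t xs) \<omega>)}" for m :: nat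
  have gT: "g i \<in> {0..T}" for i using g by blast
  have [measurable]: "eI W (cut (g i) xs) \<in> borel_measurable M" for i
    using gT[of i] by (intro eI_meas tpos_cut xs) simp
  have Em: "E m \<in> events" for m
  proof -
    have "E m = (\<Union>i\<in>{..m}. {\<omega>\<in>space M. 2 * \<alpha> < norm (eI W (cut (g i) xs) \<omega>)})" by (auto simp: E_def)
    also have "\<dots> \<in> events" by (intro sets.finite_UN) auto
    finally show ?thesis .
  qed
  have U: "(\<Union>m. E m) = {\<omega>\<in>space M. \<exists>t\<in>\<rat> \<inter> {0..T}. 2 * \<alpha> < norm (eI W (cut t xs) \<omega>)}"
    unfolding E_def g[symmetric] by auto
  have inc: "incseq E" by (force simp: incseq_def E_def)
  show "{\<omega>\<in>space M. \<exists>t\<in>\<rat> \<inter> {0..T}. 2 * \<alpha> < norm (eI W (cut t xs) \<omega>)} \<in> events"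
    unfolding U[symmetric] using Em by auto
  have "(\<lambda>m. prob (E m)) \<longlonglongrightarrow> prob (\<Union>m. E m)"
    by (rule finite_Lim_measure_incseq) (use Em inc in auto)
  moreover have "prob (E m) \<le> 2 * (v / \<alpha>\<^sup>2)" for m
    unfolding E_def by (rule maximal_finite[OF xs T _ _ a v]) (use gT in auto)
  ultimately show "prob {\<omega>\<in>space M. \<exists>t\<in>\<rat> \<inter> {0..T}. 2 * \<alpha> < norm (eI W (cut t xs) \<omega>)} \<le> 2 * (v / \<alpha>\<^sup>2)"
    unfolding U[symmetric] by (intro LIMSEQ_le_const2) auto
qed

lemma eI_cut_continuous:
  assumes Y: "continuous_on {0..} (\<lambda>t. Y t \<omega>)" and xs: "tpos xs"
  shows "continuous_on {0..} (\<lambda>t. eI Y (cut t xs) \<omega>)"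
  using xs
proof (induction xs)
  case Nil then show ?case by simp
next
  case (Cons x xs)
  obtain s c where x: "x = (s, c)" by force
  have "continuous_on {0..} (\<lambda>t. Y (min s t) \<omega>)"
    by (rule continuous_on_compose2[OF Y]) (use Cons x in \<open>auto intro!: continuous_intros\<close>)
  then show ?case using Cons
    by (auto simp: x intro!: continuous_on_add mv.continuous_on continuous_intros)
qed

text \<open>The integrals \<open>H n\<close> are Cauchy in mean square, and Fatou's lemma identifies the mean-square limit with
the pointwise one.\<close>

lemma wi_pointwise_limit:
  fixes f :: "real \<Rightarrow> real^'m^'n"
  assumes w: "\<And>n. has_wiener_integral (g n) (H n)" and f: "f \<in> borel_measurable borel" and J: "J \<in> borel_measurable M"
    and lim: "(\<lambda>n. q (\<lambda>t. f t - g n t)) \<longlonglongrightarrow> 0"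
    and ae: "AE \<omega> in M. (\<lambda>n. H n \<omega>) \<longlonglongrightarrow> J \<omega>"
  shows "has_wiener_integral f J"
proof (rule wi_limit[OF f J])
  fix e :: real assume e: "0 < e"
  have "0 < ennreal (e/32)" using e by simp
  from order_tendstoD(2)[OF lim this] obtain N where N: "\<And>n. n \<ge> N \<Longrightarrow> q (\<lambda>t. f t - g n t) < ennreal (e/32)"
    unfolding eventually_sequentially by blast
  have b: "d2 (\<lambda>\<omega>. H m \<omega> - H N \<omega>) \<le> ennreal (e/2)" if m: "m \<ge> N" for m
  proof -
    have e8: "ennreal (e/8) = ennreal ((e/2)/4)" by simp
    have "d2 (\<lambda>\<omega>. H m \<omega> - H N \<omega>) \<le> 4 * q (\<lambda>t. g m t - g N t)" by (rule wi_bound[OF wi_diff[OF w w]])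
    also have "q (\<lambda>t. g m t - g N t) \<le> 2 * q (\<lambda>t. f t - g N t) + 2 * q (\<lambda>t. f t - g m t)"
      using q_diff_le[of "\<lambda>t. f t - g N t" "\<lambda>t. f t - g m t"] f wiD(1)[OF w[of N]] wiD(1)[OF w[of m]] by simp
    also have "\<dots> \<le> ennreal (e/8)"
      using ennreal_two_sum_less[of "q (\<lambda>t. f t - g N t)" "e/8" "q (\<lambda>t. f t - g m t)"] N[of N] N[OF m] by (simp add: less_imp_le)
    finally have "d2 (\<lambda>\<omega>. H m \<omega> - H N \<omega>) \<le> 4 * ennreal (e/8)" by (simp add: mult_left_mono)
    also have "\<dots> = ennreal (4 * (e/8))" using e by (simp only: ennreal_mult ennreal_numeral)
    finally show ?thesis by simp
  qed
  have "d2 (\<lambda>\<omega>. J \<omega> - H N \<omega>) = (\<integral>\<^sup>+\<omega>. liminf (\<lambda>m. ennreal ((norm (H m \<omega> - H N \<omega>))\<^sup>2)) \<partial>M)"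
    unfolding d2_def
  proof (rule nn_integral_cong_AE, use ae in eventually_elim)
    fix \<omega> assume "(\<lambda>n. H n \<omega>) \<longlonglongrightarrow> J \<omega>"
    then have "(\<lambda>m. ennreal ((norm (H m \<omega> - H N \<omega>))\<^sup>2)) \<longlonglongrightarrow> ennreal ((norm (J \<omega> - H N \<omega>))\<^sup>2)"
      by (intro tendsto_ennrealI tendsto_intros)
    then show "ennreal ((norm (J \<omega> - H N \<omega>))\<^sup>2) = liminf (\<lambda>m. ennreal ((norm (H m \<omega> - H N \<omega>))\<^sup>2))"
      by (intro lim_imp_Liminf[symmetric]) (rule trivial_limit_sequentially)
  qed
  also have "\<dots> \<le> liminf (\<lambda>m. d2 (\<lambda>\<omega>. H m \<omega> - H N \<omega>))"
    unfolding d2_def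
  proof (rule nn_integral_liminf)
    fix m
    have [measurable]: "H m \<in> borel_measurable M" "H N \<in> borel_measurable M" using w wiD by blast+
    show "(\<lambda>\<omega>. ennreal ((norm (H m \<omega> - H N \<omega>))\<^sup>2)) \<in> borel_measurable M" by measurable
  qed
  also have "\<dots> \<le> ennreal (e/2)"
  proof -
    have "\<forall>\<^sub>F m in sequentially. d2 (\<lambda>\<omega>. H m \<omega> - H N \<omega>) \<le> ennreal (e/2)"
      using b by (auto simp: eventually_sequentially)
    then show ?thesis by (intro Liminf_le) auto
  qed
  also have "\<dots> < ennreal e" using e by (simp add: ennreal_less_iff)
  finally have "d2 (\<lambda>\<omega>. J \<omega> - H N \<omega>) < ennreal e" .
  moreover have "q (\<lambda>t. f t - g N t) < ennreal e"
    using N[of N] e by (auto intro: less_le_trans ennreal_leI)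
  ultimately show "\<exists>g H. has_wiener_integral g H \<and> q (\<lambda>t. f t - g t) < ennreal e \<and> d2 (\<lambda>\<omega>. J \<omega> - H \<omega>) < ennreal e"
    using w by blast
qed

end

section \<open>Density of step functions and continuous versions\<close>

lemma step_integrand_outside:
  assumes "mono_on {..n} \<tau>" "t \<le> \<tau> 0 \<or> \<tau> n < t"
  shows "step_integrand n \<tau> c t = 0"
  unfolding step_integrand_def
proof (rule sum.neutral, rule ballI)
  fix i assume "i \<in> {..<n}"
  then have "\<tau> 0 \<le> \<tau> i" "\<tau> (Suc i) \<le> \<tau> n" by (auto intro!: mono_onD[OF assms(1)])
  then show "indicat_real {\<tau> i<..\<tau> (Suc i)} t *\<^sub>R c i = 0" using assms(2) by (auto simp: indicator_def)
qed

lemma step_integrand_measurable: "step_integrand n \<tau> c \<in> borel_measurable borel"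
  unfolding step_integrand_def[abs_def] by (intro borel_measurable_sum borel_measurable_scaleR) auto

lemma abs_diff_le_of_Ioc: "a < t \<Longrightarrow> t \<le> a + d \<Longrightarrow> \<bar>a - t\<bar> \<le> d" for a d t :: real
  by linarith

lemma indicator_Ioc_diff:
  fixes x :: "'b::real_vector" and a b t T :: real
  shows "0 \<le> a \<Longrightarrow> a \<le> b \<Longrightarrow> b \<le> T \<Longrightarrow>
    indicat_real {0<..b} t *\<^sub>R x - indicat_real {0<..a} t *\<^sub>R x = indicat_real {a<..b} t *\<^sub>R (indicat_real {0<..T} t *\<^sub>R x)"
  by (auto simp: indicator_def)

lemma continuous_on_halflineI:
  fixes f :: "real \<Rightarrow> 'b::topological_space"
  assumes "\<And>N::nat. continuous_on {0..real N} f"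
  shows "continuous_on {0..} f"
  unfolding continuous_on_eq_continuous_within
proof
  fix t :: real assume t: "t \<in> {0..}"
  obtain N :: nat where N: "t < real N" using reals_Archimedean2 by blast
  have "continuous (at t within {0..real N}) f"
    using assms[of N] t N by (simp add: continuous_on_eq_continuous_within)
  moreover have "at t within {0..real N} = at t within {0..}"
    by (rule at_within_nhd[where S="{..<real N}"]) (use N in auto)
  ultimately show "continuous (at t within {0..}) f" by simp
qed

context wiener_integration begin

text \<open>First of three steps towards the density of step functions: reduction to bounded integrands, then to
continuous ones, then sampling on a grid.\<close>

lemma truncation_approx:
  fixes f :: "real \<Rightarrow> real^'m^'n"
  assumes f: "f \<in> borel_measurable borel" and fin: "q f < \<infinity>"
  shows "(\<lambda>j. q (\<lambda>t. f t - indicat_real {t. norm (f t) \<le> real j} t *\<^sub>R f t)) \<longlonglongrightarrow> 0"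
proof -
  have [measurable]: "f \<in> borel_measurable borel" by fact
  have m: "(\<lambda>t. f t - indicat_real {t. norm (f t) \<le> real j} t *\<^sub>R f t) \<in> borel_measurable borel" for j
    by measurable
  have "(\<lambda>j. \<integral>\<^sup>+t. ennreal (quad (R t) (f t - indicat_real {t. norm (f t) \<le> real j} t *\<^sub>R f t)) * indicator {0..} t \<partial>lborel)
     \<longlonglongrightarrow> (\<integral>\<^sup>+(t::real). 0 \<partial>lborel)"
  proof (rule nn_integral_dominated_convergence[where w="\<lambda>t. ennreal (quad (R t) (f t)) * indicator {0..} t" and u'="\<lambda>_. 0"])
    show "(\<lambda>t. ennreal (quad (R t) (f t - indicat_real {t. norm (f t) \<le> real j} t *\<^sub>R f t)) * indicator {0..} t) \<in> borel_measurable lborel" for j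
      by (rule quad_meas[OF m])
    show "(\<lambda>t. ennreal (quad (R t) (f t)) * indicator {0..} t) \<in> borel_measurable lborel" by (rule quad_meas[OF f])
    show "(\<integral>\<^sup>+t. ennreal (quad (R t) (f t)) * indicator {0..} t \<partial>lborel) < \<infinity>" using fin by (simp add: q_def)
    show "AE t in lborel. ennreal (quad (R t) (f t - indicat_real {t. norm (f t) \<le> real j} t *\<^sub>R f t)) * indicator {0..} t
       \<le> ennreal (quad (R t) (f t)) * indicator {0..} t" for j
      by (rule AE_I2) (auto simp: indicator_def)
    show "AE t in lborel. (\<lambda>j. ennreal (quad (R t) (f t - indicat_real {t. norm (f t) \<le> real j} t *\<^sub>R f t)) * indicator {0..} t) \<longlonglongrightarrow> 0"
    proof (rule AE_I2)
      fix t :: real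
      obtain N :: nat where N: "norm (f t) \<le> real N" using real_arch_simple by blast
      show "(\<lambda>j. ennreal (quad (R t) (f t - indicat_real {t. norm (f t) \<le> real j} t *\<^sub>R f t)) * indicator {0..} t) \<longlonglongrightarrow> 0"
        by (rule tendsto_eventually, rule eventually_sequentiallyI[of N]) (use N in \<open>auto simp: indicator_def\<close>)
    qed
  qed simp
  then show ?thesis by (simp add: q_def)
qed

text \<open>A Lebesgue measurable function is almost everywhere a limit of continuous functions; projecting them to the ball
of radius \<open>B\<close> keeps a common bound.\<close>

lemma continuous_approx:
  fixes g :: "real \<Rightarrow> real^'m^'n"
  assumes g: "g \<in> borel_measurable borel" and B: "\<And>t. norm (g t) \<le> B" and T: "0 \<le> T"
  shows "\<exists>h. (\<forall>j. continuous_on UNIV (h j)) \<and> (\<forall>j t. norm (h j t) \<le> B) \<and>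
    (\<lambda>j. q (\<lambda>t. indicat_real {0<..T} t *\<^sub>R (g t - h j t))) \<longlonglongrightarrow> 0"
proof -
  have B0: "0 \<le> B" using B[of 0] norm_ge_zero order_trans by blast
  have "g \<in> borel_measurable lebesgue" using g by (intro measurable_completion) simp
  then have "g measurable_on UNIV" by (rule lebesgue_measurable_imp_measurable_on) simp
  then obtain N G where N: "negligible N" and G: "\<And>j. continuous_on UNIV (G j)"
    and lim: "\<And>t. t \<notin> N \<Longrightarrow> (\<lambda>j::nat. G j t) \<longlonglongrightarrow> g t"
    unfolding measurable_on_def by auto
  define cp where "cp = closest_point (cball (0::real^'m^'n) B)"
  have ne: "cball (0::real^'m^'n) B \<noteq> {}" using B0 by simp
  have ccp: "continuous_on UNIV cp" unfolding cp_def by (rule continuous_on_closest_point[OF convex_cball closed_cball ne])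
  have ncp: "norm (cp x) \<le> B" for x using closest_point_in_set[OF closed_cball ne, of x] by (simp add: cp_def)
  have icp: "cp x = x" if "norm x \<le> B" for x unfolding cp_def by (rule closest_point_self) (use that in simp)
  define h where "h j t = cp (G j t)" for j t
  have ch: "continuous_on UNIV (h j)" for j
    unfolding h_def by (rule continuous_on_compose2[OF ccp G]) simp
  have mh: "h j \<in> borel_measurable borel" for j by (rule borel_measurable_continuous_onI[OF ch])
  have "(\<lambda>j. q (\<lambda>t. indicat_real {0<..T} t *\<^sub>R (g t - h j t))) \<longlonglongrightarrow> 0"
  proof (rule q_bounded_convergence[where B="2 * B" and T=T])
    show "(\<lambda>t. indicat_real {0<..T} t *\<^sub>R (g t - h j t)) \<in> borel_measurable borel" for j using g mh[of j] by simp
    show "norm (indicat_real {0<..T} t *\<^sub>R (g t - h j t)) \<le> 2 * B" for j t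
      using norm_triangle_ineq4[of "g t" "h j t"] B[of t] ncp[of "G j t"] B0 by (auto simp: indicator_def h_def)
    have "N \<in> null_sets lebesgue" using N by (simp add: negligible_iff_null_sets)
    then have "AE t in lborel. t \<notin> N" using AE_not_in AE_completion_iff by blast
    then show "AE t in lborel. (\<lambda>j. indicat_real {0<..T} t *\<^sub>R (g t - h j t)) \<longlonglongrightarrow> 0"
    proof eventually_elim
      case (elim t)
      have "(\<lambda>j. cp (G j t)) \<longlonglongrightarrow> cp (g t)"
        using ccp lim[OF elim] by (intro continuous_on_tendsto_compose[OF ccp]) auto
      then have "(\<lambda>j. indicat_real {0<..T} t *\<^sub>R (g t - h j t)) \<longlonglongrightarrow> indicat_real {0<..T} t *\<^sub>R (g t - g t)"
        unfolding h_def icp[OF B] by (intro tendsto_intros)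
      then show ?case by simp
    qed
  qed (auto simp: T)
  then show ?thesis using ch ncp by (intro exI[of _ h]) (auto simp: h_def)
qed

lemma step_approx_continuous:
  fixes h :: "real \<Rightarrow> real^'m^'n"
  assumes h: "continuous_on UNIV h" and B: "\<And>t. norm (h t) \<le> B" and T: "0 \<le> T"
  shows "(\<lambda>n. q (\<lambda>t. indicat_real {0<..T} t *\<^sub>R (h t - step_integrand (Suc n) (\<lambda>i. real i * (T / real (Suc n))) (\<lambda>i. h (real i * (T / real (Suc n)))) t))) \<longlonglongrightarrow> 0"
proof -
  let ?\<tau> = "\<lambda>n i. real i * (T / real (Suc n))"
  let ?s = "\<lambda>n. step_integrand (Suc n) (?\<tau> n) (\<lambda>i. h (?\<tau> n i))"
  have mono: "mono_on A (?\<tau> n)" for n A using T by (intro mono_onI mult_right_mono) auto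
  have val: "\<exists>r. \<bar>r - t\<bar> \<le> T / real (Suc n) \<and> ?s n t = h r" if t: "t \<in> {0<..T}" for n t
  proof -
    have "?\<tau> n 0 < t" "t \<le> ?\<tau> n (Suc n)" using t by auto
    from step_integrand_value[OF mono this, of "\<lambda>i. h (?\<tau> n i)"]
    obtain i where i: "?\<tau> n i < t" "t \<le> ?\<tau> n (Suc i)" "?s n t = h (?\<tau> n i)" by blast
    have "?\<tau> n (Suc i) = ?\<tau> n i + T / real (Suc n)" by (simp only: of_nat_Suc distrib_right)
    then have i': "t \<le> ?\<tau> n i + T / real (Suc n)" using i(2) by (simp only:)
    have "\<bar>?\<tau> n i - t\<bar> \<le> T / real (Suc n)" using abs_diff_le_of_Ioc[OF i(1) i'] .
    then show ?thesis using i by blast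
  qed
  have B0: "0 \<le> B" using B[of 0] norm_ge_zero order_trans by blast
  show ?thesis
  proof (rule q_bounded_convergence[where B="2 * B" and T=T])
    have [measurable]: "h \<in> borel_measurable borel" by (rule borel_measurable_continuous_onI[OF h])
    show "(\<lambda>t. indicat_real {0<..T} t *\<^sub>R (h t - ?s n t)) \<in> borel_measurable borel" for n
      using step_integrand_measurable[of "Suc n" "?\<tau> n" "\<lambda>i. h (?\<tau> n i)"] by simp
    show "norm (indicat_real {0<..T} t *\<^sub>R (h t - ?s n t)) \<le> 2 * B" for n t
    proof (cases "t \<in> {0<..T}")
      case True
      obtain r where "?s n t = h r" using val[OF True] by blast
      then show ?thesis using True norm_triangle_ineq4[of "h t" "h r"] B[of t] B[of r] by simp
    qed (simp add: B0)
    show "AE t in lborel. (\<lambda>n. indicat_real {0<..T} t *\<^sub>R (h t - ?s n t)) \<longlonglongrightarrow> 0"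
    proof (rule AE_I2)
      fix t
      show "(\<lambda>n. indicat_real {0<..T} t *\<^sub>R (h t - ?s n t)) \<longlonglongrightarrow> 0"
      proof (cases "t \<in> {0<..T}")
        case True
        obtain r where r: "\<And>n. \<bar>r n - t\<bar> \<le> T / real (Suc n)" "\<And>n. ?s n t = h (r n)" using val[OF True] by metis
        have "(\<lambda>n. T / real (Suc n)) \<longlonglongrightarrow> 0"
          using tendsto_mult_right_zero[OF LIMSEQ_inverse_real_of_nat, of T] by (simp add: divide_inverse)
        then have "(\<lambda>n. r n - t) \<longlonglongrightarrow> 0"
        by (rule Lim_null_comparison[OF always_eventually[OF allI[OF r(1)[folded real_norm_def]]]])
        then have "r \<longlonglongrightarrow> t" by (simp add: LIM_zero_iff)
        then have "(\<lambda>n. h (r n)) \<longlonglongrightarrow> h t" by (intro continuous_on_tendsto_compose[OF h]) auto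
        then have "(\<lambda>n. h t - h (r n)) \<longlonglongrightarrow> h t - h t" by (intro tendsto_intros)
        then show ?thesis unfolding r(2) using True by simp
      qed simp
    qed
  qed (auto simp: T)
qed

lemma step_density:
  fixes f :: "real \<Rightarrow> real^'m^'n"
  assumes f: "f \<in> borel_measurable borel" and supp: "\<And>t. t \<notin> {0<..T} \<Longrightarrow> f t = 0" and T: "0 \<le> T"
    and fin: "q f < \<infinity>" and e: "0 < e"
  shows "\<exists>n \<tau> c. 0 \<le> \<tau> 0 \<and> mono_on {..n} \<tau> \<and> \<tau> n \<le> T \<and> q (\<lambda>t. f t - step_integrand n \<tau> c t) < ennreal e"
proof -
  have [measurable]: "f \<in> borel_measurable borel" by fact
  have ev: "\<exists>j::nat. a j < ennreal d" if "a \<longlonglongrightarrow> 0" "d > 0" for a :: "nat \<Rightarrow> ennreal" and d :: real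
  proof -
    have "0 < ennreal d" using that by simp
    from order_tendstoD(2)[OF that(1) this] show ?thesis by (auto simp: eventually_sequentially)
  qed
  obtain j where j: "q (\<lambda>t. f t - indicat_real {t. norm (f t) \<le> real j} t *\<^sub>R f t) < ennreal (e/4)"
    using ev[OF truncation_approx[OF f fin], of "e/4"] e by auto
  define g where "g t = indicat_real {t. norm (f t) \<le> real j} t *\<^sub>R f t" for t
  have g: "g \<in> borel_measurable borel" unfolding g_def[abs_def] by measurable
  have gB: "norm (g t) \<le> real j" for t by (auto simp: g_def indicator_def)
  have gsupp: "indicat_real {0<..T} t *\<^sub>R g t = g t" for t using supp[of t] by (auto simp: g_def indicator_def)
  from continuous_approx[OF g gB T] obtain hs where hs: "\<And>j. continuous_on UNIV (hs j)" "\<And>j' t. norm (hs j' t) \<le> real j"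
    "(\<lambda>j. q (\<lambda>t. indicat_real {0<..T} t *\<^sub>R (g t - hs j t))) \<longlonglongrightarrow> 0" by blast
  obtain i where i: "q (\<lambda>t. indicat_real {0<..T} t *\<^sub>R (g t - hs i t)) < ennreal (e/4/4)"
    using ev[OF hs(3), of "e/4/4"] e by auto
  let ?\<tau> = "\<lambda>n i. real i * (T / real (Suc n))"
  obtain n where n: "q (\<lambda>t. indicat_real {0<..T} t *\<^sub>R (hs i t - step_integrand (Suc n) (?\<tau> n) (\<lambda>k. hs i (?\<tau> n k)) t)) < ennreal (e/4/4)"
    using ev[OF step_approx_continuous[OF hs(1,2) T], of "e/4/4" i] e by auto
  let ?s = "step_integrand (Suc n) (?\<tau> n) (\<lambda>k. hs i (?\<tau> n k))"
  have mono: "mono_on {..Suc n} (?\<tau> n)" using T by (intro mono_onI mult_right_mono) auto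
  have ssupp: "indicat_real {0<..T} t *\<^sub>R ?s t = ?s t" for t
    using step_integrand_outside[OF mono, of t "\<lambda>k. hs i (?\<tau> n k)"] by (auto simp: indicator_def)
  have mh: "hs i \<in> borel_measurable borel" by (rule borel_measurable_continuous_onI[OF hs(1)])
  note ms = step_integrand_measurable[of "Suc n" "?\<tau> n" "\<lambda>k. hs i (?\<tau> n k)"]
  have "q (\<lambda>t. indicat_real {0<..T} t *\<^sub>R (g t - hs i t) + indicat_real {0<..T} t *\<^sub>R (hs i t - ?s t))
      \<le> 2 * q (\<lambda>t. indicat_real {0<..T} t *\<^sub>R (g t - hs i t)) + 2 * q (\<lambda>t. indicat_real {0<..T} t *\<^sub>R (hs i t - ?s t))"
    by (rule q_add_le) (use mh ms g in simp_all)
  also have "\<dots> < ennreal (e/4)" by (rule ennreal_two_sum_less[OF i n])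
  also have "(\<lambda>t. indicat_real {0<..T} t *\<^sub>R (g t - hs i t) + indicat_real {0<..T} t *\<^sub>R (hs i t - ?s t)) = (\<lambda>t. g t - ?s t)"
  proof
    fix t
    have "indicat_real {0<..T} t *\<^sub>R (g t - hs i t) + indicat_real {0<..T} t *\<^sub>R (hs i t - ?s t) = indicat_real {0<..T} t *\<^sub>R g t - indicat_real {0<..T} t *\<^sub>R ?s t"
      by (simp only: scaleR_diff_right) simp
    then show "indicat_real {0<..T} t *\<^sub>R (g t - hs i t) + indicat_real {0<..T} t *\<^sub>R (hs i t - ?s t) = g t - ?s t"
      by (simp only: gsupp ssupp)
  qed
  finally have gs: "q (\<lambda>t. g t - ?s t) < ennreal (e/4)" .
  have "q (\<lambda>t. f t - ?s t) \<le> 2 * q (\<lambda>t. f t - g t) + 2 * q (\<lambda>t. g t - ?s t)"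
    using q_add_le[OF borel_measurable_diff[OF f g] borel_measurable_diff[OF g ms]] by (simp only: diff_add_cancel add_diff_eq)
  also have "\<dots> < ennreal e" by (rule ennreal_two_sum_less[OF _ gs]) (use j in \<open>simp add: g_def\<close>)
  finally have fs: "q (\<lambda>t. f t - ?s t) < ennreal e" .
  have "0 \<le> ?\<tau> n 0" "?\<tau> n (Suc n) \<le> T" by simp_all
  then show ?thesis
    by (intro exI[of _ "Suc n"] exI[of _ "?\<tau> n"] exI[of _ "\<lambda>k. hs i (?\<tau> n k)"] conjI mono fs)
qed

text \<open>The step function vanishes outside \<open>(0, T]\<close>, so the half line may replace \<open>[0, T]\<close>.\<close>

lemma step_defect_eq_q:
  fixes f :: "real \<Rightarrow> real^'m^'n"
  assumes \<tau>: "0 \<le> \<tau> 0" "mono_on {..n} \<tau>" "\<tau> n \<le> T"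
  shows "(\<integral>\<^sup>+t\<in>{0..T}. ennreal (trace ((f t - step_integrand n \<tau> c t) ** R t ** transpose (f t - step_integrand n \<tau> c t))) \<partial>lborel)
    = q (\<lambda>t. indicat_real {0<..T} t *\<^sub>R f t - step_integrand n \<tau> c t)"
  unfolding q_def quad_def[symmetric]
proof (rule nn_integral_cong_AE, use AE_lborel_singleton[of "0::real"] in eventually_elim)
  fix t :: real assume t: "t \<noteq> 0"
  show "ennreal (quad (R t) (f t - step_integrand n \<tau> c t)) * indicator {0..T} t =
     ennreal (quad (R t) (indicat_real {0<..T} t *\<^sub>R f t - step_integrand n \<tau> c t)) * indicator {0..} t"
  proof (cases "t \<in> {0..T}")
    case True then show ?thesis using t by (simp add: indicator_def)
  next
    case False
    show ?thesis
    proof (cases "t < 0")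
      case True then show ?thesis using False by simp
    next
      case nn: False
      have "step_integrand n \<tau> c t = 0" by (rule step_integrand_outside) (use \<tau> False nn in auto)
      then show ?thesis using False by (simp add: indicator_def)
    qed
  qed
qed

lemma measurable_on_Ioc:
  fixes f :: "real \<Rightarrow> 'b::euclidean_space"
  assumes "set_borel_measurable lborel {0..T} f"
  shows "(\<lambda>t. indicat_real {0<..T} t *\<^sub>R f t) \<in> borel_measurable borel"
proof -
  have "(\<lambda>t. indicat_real {0<..T} t *\<^sub>R (indicat_real {0..T} t *\<^sub>R f t)) \<in> borel_measurable borel"
    using assms unfolding set_borel_measurable_def by (intro borel_measurable_scaleR[OF borel_measurable_indicator[of "{0<..T}"]]) auto
  moreover have "(\<lambda>t. indicat_real {0<..T} t *\<^sub>R (indicat_real {0..T} t *\<^sub>R f t)) = (\<lambda>t. indicat_real {0<..T} t *\<^sub>R f t)"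
    by (auto simp: fun_eq_iff indicator_def)
  ultimately show ?thesis by simp
qed

lemma is_wiener_integral_imp_wi:
  fixes f :: "real \<Rightarrow> real^'m^'n"
  assumes "is_wiener_integral M R W T f J"
  shows "has_wiener_integral (\<lambda>t. indicat_real {0<..T} t *\<^sub>R f t) J"
proof (rule wi_limit)
  from assms obtain n \<tau> c where
    fm: "set_borel_measurable lborel {0..T} f" and J: "J \<in> borel_measurable M"
    and \<tau>: "\<And>k. 0 \<le> \<tau> k 0" "\<And>k. mono_on {..n k} (\<tau> k)" "\<And>k. \<tau> k (n k) \<le> T"
    and l1: "(\<lambda>k. \<integral>\<^sup>+t\<in>{0..T}. ennreal (trace ((f t - step_integrand (n k) (\<tau> k) (c k) t) ** R t **
             transpose (f t - step_integrand (n k) (\<tau> k) (c k) t))) \<partial>lborel) \<longlonglongrightarrow> 0"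
    and l2: "(\<lambda>k. \<integral>\<^sup>+\<omega>. ennreal ((norm (step_integral (n k) (\<tau> k) (c k) W \<omega> - J \<omega>))\<^sup>2) \<partial>M) \<longlonglongrightarrow> 0"
    unfolding is_wiener_integral_def by blast
  show "(\<lambda>t. indicat_real {0<..T} t *\<^sub>R f t) \<in> borel_measurable borel" by (rule measurable_on_Ioc[OF fm])
  show "J \<in> borel_measurable M" by (rule J)
  fix e :: real assume "0 < e"
  then have "0 < ennreal e" by simp
  from order_tendstoD(2)[OF l1 this] order_tendstoD(2)[OF l2 this]
  have "\<forall>\<^sub>F k in sequentially. q (\<lambda>t. indicat_real {0<..T} t *\<^sub>R f t - step_integrand (n k) (\<tau> k) (c k) t) < ennreal e
     \<and> d2 (\<lambda>\<omega>. step_integral (n k) (\<tau> k) (c k) W \<omega> - J \<omega>) < ennreal e"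
    unfolding step_defect_eq_q[OF \<tau>] d2_def by eventually_elim blast
  then obtain k where k: "q (\<lambda>t. indicat_real {0<..T} t *\<^sub>R f t - step_integrand (n k) (\<tau> k) (c k) t) < ennreal e"
     "d2 (\<lambda>\<omega>. step_integral (n k) (\<tau> k) (c k) W \<omega> - J \<omega>) < ennreal e"
    unfolding eventually_sequentially by blast
  let ?xs = "steps (n k) (\<tau> k) (c k)"
  have "has_wiener_integral (el ?xs) (eI W ?xs)" by (rule wi_eI[OF tpos_steps[OF \<tau>(1,2)]])
  moreover have "q (\<lambda>t. indicat_real {0<..T} t *\<^sub>R f t - el ?xs t) < ennreal e"
    using k(1) by (simp only: el_steps[OF \<tau>(1,2)])
  moreover have "d2 (\<lambda>\<omega>. J \<omega> - eI W ?xs \<omega>) < ennreal e"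
    using k(2) by (simp only: eI_steps d2_minus_commute[of J])
  ultimately show "\<exists>g H. has_wiener_integral g H \<and> q (\<lambda>t. indicat_real {0<..T} t *\<^sub>R f t - g t) < ennreal e \<and> d2 (\<lambda>\<omega>. J \<omega> - H \<omega>) < ennreal e"
    by blast
qed

lemma wi_imp_is_wiener_integral:
  fixes f :: "real \<Rightarrow> real^'m^'n"
  assumes T: "0 \<le> T" and fm: "set_borel_measurable lborel {0..T} f"
    and w: "has_wiener_integral (\<lambda>t. indicat_real {0<..T} t *\<^sub>R f t) J" and fin: "q (\<lambda>t. indicat_real {0<..T} t *\<^sub>R f t) < \<infinity>"
  shows "is_wiener_integral M R W T f J"
proof -
  let ?f = "\<lambda>t. indicat_real {0<..T} t *\<^sub>R f t"
  have "\<exists>n \<tau> c. 0 \<le> \<tau> 0 \<and> mono_on {..n} \<tau> \<and> \<tau> n \<le> T \<and> q (\<lambda>t. ?f t - step_integrand n \<tau> c t) < ennreal (1 / real (Suc k))" for k :: nat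
    by (rule step_density[OF wiD(1)[OF w] _ T fin]) auto
  from choice[OF allI[OF this]] obtain n where
    "\<forall>k. \<exists>\<tau> c. 0 \<le> \<tau> 0 \<and> mono_on {..n k} \<tau> \<and> \<tau> (n k) \<le> T \<and> q (\<lambda>t. ?f t - step_integrand (n k) \<tau> c t) < ennreal (1 / real (Suc k))" ..
  from choice[OF this] obtain \<tau> where
    "\<forall>k. \<exists>c. 0 \<le> \<tau> k 0 \<and> mono_on {..n k} (\<tau> k) \<and> \<tau> k (n k) \<le> T \<and> q (\<lambda>t. ?f t - step_integrand (n k) (\<tau> k) c t) < ennreal (1 / real (Suc k))" ..
  from choice[OF this] obtain c where
    nodes: "\<forall>k. 0 \<le> \<tau> k 0 \<and> mono_on {..n k} (\<tau> k) \<and> \<tau> k (n k) \<le> T \<and> q (\<lambda>t. ?f t - step_integrand (n k) (\<tau> k) (c k) t) < ennreal (1 / real (Suc k))" ..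
  have \<tau>: "\<And>k. 0 \<le> \<tau> k 0" "\<And>k. mono_on {..n k} (\<tau> k)" "\<And>k. \<tau> k (n k) \<le> T"
    and lt: "\<And>k. q (\<lambda>t. ?f t - step_integrand (n k) (\<tau> k) (c k) t) < ennreal (1 / real (Suc k))"
    using nodes by blast+
  have z: "(\<lambda>k. ennreal (1 / real (Suc k))) \<longlonglongrightarrow> ennreal 0"
    using LIMSEQ_inverse_real_of_nat by (intro tendsto_ennrealI) (simp add: divide_inverse)
  have l1: "(\<lambda>k. q (\<lambda>t. ?f t - step_integrand (n k) (\<tau> k) (c k) t)) \<longlonglongrightarrow> 0"
    by (rule tendsto_sandwich[OF always_eventually[OF allI[OF zero_le]]
        always_eventually[OF allI[OF less_imp_le[OF lt]]] tendsto_const z[simplified ennreal_0]])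
  have l2: "(\<lambda>k. d2 (\<lambda>\<omega>. step_integral (n k) (\<tau> k) (c k) W \<omega> - J \<omega>)) \<longlonglongrightarrow> 0"
  proof (rule tendsto_sandwich[OF _ _ tendsto_const])
    have "d2 (\<lambda>\<omega>. step_integral (n k) (\<tau> k) (c k) W \<omega> - J \<omega>) \<le> 4 * q (\<lambda>t. ?f t - step_integrand (n k) (\<tau> k) (c k) t)" for k
      using wi_bound[OF wi_diff[OF w wi_eI[OF tpos_steps[OF \<tau>(1,2)], of k "c k"]]]
      by (simp only: el_steps[OF \<tau>(1,2)] eI_steps d2_minus_commute[of J])
    then show "\<forall>\<^sub>F k in sequentially. d2 (\<lambda>\<omega>. step_integral (n k) (\<tau> k) (c k) W \<omega> - J \<omega>) \<le> 4 * q (\<lambda>t. ?f t - step_integrand (n k) (\<tau> k) (c k) t)"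
      by simp
    show "(\<lambda>k. 4 * q (\<lambda>t. ?f t - step_integrand (n k) (\<tau> k) (c k) t)) \<longlonglongrightarrow> 0"
      using ennreal_tendsto_cmult[OF _ l1, of 4] by simp
  qed simp
  show ?thesis
    unfolding is_wiener_integral_def
    using fm wiD(2)[OF w] \<tau> l1 l2 unfolding step_defect_eq_q[OF \<tau>, symmetric] d2_def by blast
qed

text \<open>A single sequence for all time horizons: the \<open>k\<close>-th member is good on \<open>(0, k]\<close>. The rate \<open>8\<^sup>-\<^sup>k\<close> is chosen
for \<open>version_paths\<close> and \<open>drift_tendsto\<close>.\<close>

lemma approximating_sequence:
  fixes f :: "real \<Rightarrow> real^'m^'n"
  assumes f: "\<And>T. (\<lambda>t. indicat_real {0<..T} t *\<^sub>R f t) \<in> borel_measurable borel"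
    and fin: "\<And>T. 0 \<le> T \<Longrightarrow> q (\<lambda>t. indicat_real {0<..T} t *\<^sub>R f t) < \<infinity>"
  shows "\<exists>xs. (\<forall>k. tpos (xs k)) \<and> (\<forall>k::nat. q (\<lambda>t. indicat_real {0<..real k} t *\<^sub>R (f t - el (xs k) t)) \<le> ennreal ((1/8)^k))"
proof -
  have "\<exists>xs. tpos xs \<and> q (\<lambda>t. indicat_real {0<..real k} t *\<^sub>R (f t - el xs t)) \<le> ennreal ((1/8)^k)" for k :: nat
  proof -
    let ?f = "\<lambda>t. indicat_real {0<..real k} t *\<^sub>R f t"
    obtain n \<tau> c where \<tau>: "0 \<le> \<tau> 0" "mono_on {..n} \<tau>" and lt: "q (\<lambda>t. ?f t - step_integrand n \<tau> c t) < ennreal ((1/8)^k)"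
      using step_density[OF f[of "real k"] _ _ fin[of "real k"], of "real k" "(1/8)^k"] by auto
    have "(\<lambda>t. indicat_real {0<..real k} t *\<^sub>R (f t - el (steps n \<tau> c) t)) = (\<lambda>t. indicat_real {0<..real k} t *\<^sub>R (?f t - step_integrand n \<tau> c t))"
      by (auto simp: fun_eq_iff indicator_def el_steps[OF \<tau>])
    then have "q (\<lambda>t. indicat_real {0<..real k} t *\<^sub>R (f t - el (steps n \<tau> c) t)) \<le> q (\<lambda>t. ?f t - step_integrand n \<tau> c t)"
      using q_indicator_le[of "{0<..real k}"] by simp
    then show ?thesis using lt tpos_steps[OF \<tau>, of c] by (intro exI[of _ "steps n \<tau> c"]) auto
  qed
  then have "\<forall>k::nat. \<exists>xs. tpos xs \<and> q (\<lambda>t. indicat_real {0<..real k} t *\<^sub>R (f t - el xs t)) \<le> ennreal ((1/8)^k)"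
    by blast
  from choice[OF this] show ?thesis by blast
qed

text \<open>Where the limit does not exist, \<open>lim\<close> still denotes some value. For approximating sequences at a geometric rate this happens on a null set only.\<close>

definition version :: "(nat \<Rightarrow> (real \<times> (real^'m^'n)) list) \<Rightarrow> real \<Rightarrow> 'a \<Rightarrow> real^'n" where
  "version xs t \<omega> = lim (\<lambda>k. eI W (cut t (xs k)) \<omega>)"

text \<open>Consecutive approximants differ in squared seminorm by at most \<open>4 8\<^sup>-\<^sup>k\<close> on \<open>(0, k]\<close>. By the maximal
inequality at level \<open>2 2\<^sup>-\<^sup>k\<close>, they are uniformly close on \<open>[0, k]\<close> except with probability
\<open>8 2\<^sup>-\<^sup>k\<close>, which is summable. So almost surely the convergence is locally uniform and the limit
inherits continuity.\<close>

lemma version_paths: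
  fixes f :: "real \<Rightarrow> real^'m^'n"
  assumes f: "\<And>T. (\<lambda>t. indicat_real {0<..T} t *\<^sub>R f t) \<in> borel_measurable borel" and xs: "\<And>k. tpos (xs k)"
    and approx: "\<And>k. q (\<lambda>t. indicat_real {0<..real k} t *\<^sub>R (f t - el (xs k) t)) \<le> ennreal ((1/8)^k)"
  shows "AE \<omega> in M. continuous_on {0..} (\<lambda>t. version xs t \<omega>) \<and> (\<forall>t\<ge>0. (\<lambda>k. eI W (cut t (xs k)) \<omega>) \<longlonglongrightarrow> version xs t \<omega>)"
proof -
  define ys where "ys k = xs (Suc k) @ lmult (- mat 1) (xs k)" for k
  have ys: "tpos (ys k)" for k by (simp add: ys_def xs)
  have m: "(\<lambda>t. indicat_real {0<..real j} t *\<^sub>R (f t - el (xs k) t)) \<in> borel_measurable borel" for j k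
  proof -
    have "(\<lambda>t. indicat_real {0<..real j} t *\<^sub>R f t - indicat_real {0<..real j} t *\<^sub>R el (xs k) t) \<in> borel_measurable borel"
      by (intro borel_measurable_diff f borel_measurable_scaleR borel_measurable_indicator el_measurable) simp
    then show ?thesis by (simp only: scaleR_diff_right)
  qed
  have qk: "q (el (cut (real k) (ys k))) \<le> ennreal (4 * (1/8)^k)" for k
  proof -
    have "el (cut (real k) (ys k)) = (\<lambda>t. indicat_real {0<..real k} t *\<^sub>R (f t - el (xs k) t) - indicat_real {0<..real k} t *\<^sub>R (f t - el (xs (Suc k)) t))"
      by (auto simp: fun_eq_iff ys_def el_cut lmult_uminus_el indicator_def)
    then have "q (el (cut (real k) (ys k))) \<le> 2 * q (\<lambda>t. indicat_real {0<..real k} t *\<^sub>R (f t - el (xs k) t)) + 2 * q (\<lambda>t. indicat_real {0<..real k} t *\<^sub>R (f t - el (xs (Suc k)) t))"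
      using q_diff_le[OF m[of k k] m[of k "Suc k"]] by simp
    also have "\<dots> \<le> 2 * ennreal ((1/8)^k) + 2 * ennreal ((1/8)^k)"
    proof (intro add_mono mult_left_mono approx)
      have "q (\<lambda>t. indicat_real {0<..real k} t *\<^sub>R (f t - el (xs (Suc k)) t)) \<le> q (\<lambda>t. indicat_real {0<..real (Suc k)} t *\<^sub>R (f t - el (xs (Suc k)) t))"
        by (rule q_mono) (auto simp: indicator_def quad_nonneg Rpos)
      also have "\<dots> \<le> ennreal ((1/8)^Suc k)" by (rule approx)
      also have "\<dots> \<le> ennreal ((1/8)^k)" by (intro ennreal_leI power_decreasing) auto
      finally show "q (\<lambda>t. indicat_real {0<..real k} t *\<^sub>R (f t - el (xs (Suc k)) t)) \<le> ennreal ((1/8)^k)" .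
    qed auto
    also have "\<dots> = ennreal (2 * (1/8)^k + 2 * (1/8)^k)"
      by (simp only: ennreal_plus ennreal_mult ennreal_numeral zero_le_mult_iff zero_le_power zero_le_divide_1_iff zero_le_numeral simp_thms)
    finally show ?thesis by simp
  qed
  \<comment> \<open>The event that the paths of the \<open>k\<close>-th and the next approximant are not uniformly close on \<open>[0, k]\<close>.\<close>
  define E where "E k = {\<omega>\<in>space M. \<exists>t\<in>\<rat> \<inter> {0..real k}. 2 * (1/2)^k < norm (eI W (cut t (ys k)) \<omega>)}" for k
  have E: "E k \<in> events" "prob (E k) \<le> 8 * (1/2)^k" for k
  proof -
    have a: "0 < (1/2::real)^k" by simp
    note mr = maximal_rats[OF ys[of k] _ a qk[of k]]
    show "E k \<in> events" unfolding E_def by (rule mr(1)) auto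
    have "prob (E k) \<le> 2 * (4 * (1/8)^k / ((1/2)^k)\<^sup>2)" unfolding E_def by (rule mr(2)) auto
    also have "\<dots> = 8 * (1/2)^k"
    proof -
      have "(1/8::real)^k = ((1/2)^3)^k" by (simp add: power3_eq_cube)
      also have "\<dots> = ((1/2)^k)^3" by (simp only: power_mult[symmetric] mult.commute)
      finally have c: "(1/8::real)^k = ((1/2)^k)^3" .
      have "2 * (4 * x^3 / x\<^sup>2) = 8 * x" if "x > 0" for x :: real using that by (simp add: power3_eq_cube power2_eq_square)
      from this[OF a] show ?thesis unfolding c .
    qed
    finally show "prob (E k) \<le> 8 * (1/2)^k" .
  qed
  have "summable (\<lambda>k. prob (E k))"
    by (rule summable_comparison_test'[of "\<lambda>k. 8 * (1/2)^k" 0]) (use E in \<open>auto intro!: summable_mult\<close>)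
  then have "AE \<omega> in M. eventually (\<lambda>k. \<omega> \<in> space M - E k) sequentially"
    using E(1) by (intro borel_cantelli_AE1) (auto simp: emeasure_eq_measure)
  with W_cont show ?thesis
  proof eventually_elim
    case (elim \<omega>)
    define D where "D k t = eI W (cut t (xs k)) \<omega>" for k t
    have Dc: "continuous_on {0..} (D k)" for k unfolding D_def by (rule eI_cut_continuous[where Y=W, OF elim(1) xs])
    have diff: "eI W (cut t (ys k)) \<omega> = D (Suc k) t - D k t" for k t
    proof -
      have "cut t (ys k) = cut t (xs (Suc k)) @ lmult (- mat 1) (cut t (xs k))"
        by (auto simp: ys_def cut_def lmult_def)
      then show ?thesis by (simp add: lmult_uminus_eI D_def)
    qed
    have ev: "\<forall>\<^sub>F k in sequentially. \<forall>t\<in>{0..real N}. norm (D (Suc k) t - D k t) \<le> 2 * (1/2)^k" for N :: nat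
      using elim(2) eventually_ge_at_top[of "Suc N"]
    proof eventually_elim
      case (elim k)
      show ?case
      proof
        fix t assume t: "t \<in> {0..real N}"
        show "norm (D (Suc k) t - D k t) \<le> 2 * (1/2)^k"
        proof (rule continuous_le_on_rats[where T="real k" and \<phi>="\<lambda>t. norm (D (Suc k) t - D k t)"])
          show "continuous_on {0..real k} (\<lambda>t. norm (D (Suc k) t - D k t))"
            by (intro continuous_intros continuous_on_subset[OF Dc]) auto
          show "0 < real k" "t \<in> {0..real k}" using elim t by auto
          fix r assume "r \<in> \<rat>" "r \<in> {0..real k}"
          then show "norm (D (Suc k) r - D k r) \<le> 2 * (1/2)^k"
            using elim(1) unfolding E_def diff[symmetric] by (auto simp: not_less)
        qed
      qed
    qed
    define S where "S t = D 0 t + (\<Sum>i. D (Suc i) t - D i t)" for t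
    have sm: "summable (\<lambda>k. 2 * (1/2::real)^k)" by (intro summable_mult) simp
    have ul: "uniform_limit {0..real N} D S sequentially" for N
    proof -
      have "uniform_limit {0..real N} (\<lambda>n t. \<Sum>i<n. D (Suc i) t - D i t) (\<lambda>t. \<Sum>i. D (Suc i) t - D i t) sequentially"
        by (rule Weierstrass_m_test_ev[OF ev sm])
      then have "uniform_limit {0..real N} (\<lambda>n t. D 0 t + (\<Sum>i<n. D (Suc i) t - D i t)) S sequentially"
        unfolding S_def by (intro uniform_limit_intros)
      moreover have "D 0 t + (\<Sum>i<n. D (Suc i) t - D i t) = D n t" for n t
        using sum_lessThan_telescope[of "\<lambda>i. D i t" n] by simp
      ultimately show ?thesis by simp
    qed
    have lim: "(\<lambda>k. D k t) \<longlonglongrightarrow> S t" if t: "t \<ge> 0" for t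
    proof -
      obtain N :: nat where "t \<le> real N" using real_arch_simple by blast
      then show ?thesis using tendsto_uniform_limitI[OF ul[of N], of t] t by simp
    qed
    have vS: "version xs t \<omega> = S t" if t: "t \<ge> 0" for t
      using limI[OF lim[OF t]] by (simp add: version_def D_def)
    have "continuous_on {0..} S"
    proof (rule continuous_on_halflineI)
      fix N :: nat
      show "continuous_on {0..real N} S"
        by (rule uniform_limit_theorem[OF _ ul]) (auto intro!: always_eventually continuous_on_subset[OF Dc])
    qed
    then have "continuous_on {0..} (\<lambda>t. version xs t \<omega>)"
      by (rule continuous_on_eq) (simp add: vS)
    then show ?case using lim vS by (simp add: D_def)
  qed
qed

lemma version_measurable: "(\<And>k. tpos (xs k)) \<Longrightarrow> 0 \<le> t \<Longrightarrow> version xs t \<in> borel_measurable M"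
  unfolding version_def[abs_def] by (intro borel_measurable_lim_metric eI_meas tpos_cut)

lemma wi_version:
  fixes f :: "real \<Rightarrow> real^'m^'n"
  assumes f: "\<And>T. (\<lambda>t. indicat_real {0<..T} t *\<^sub>R f t) \<in> borel_measurable borel" and xs: "\<And>k. tpos (xs k)"
    and approx: "\<And>k. q (\<lambda>t. indicat_real {0<..real k} t *\<^sub>R (f t - el (xs k) t)) \<le> ennreal ((1/8)^k)"
    and t: "0 \<le> t"
  shows "has_wiener_integral (\<lambda>r. indicat_real {0<..t} r *\<^sub>R f r) (version xs t)"
proof (rule wi_pointwise_limit)
  show "has_wiener_integral (el (cut t (xs k))) (eI W (cut t (xs k)))" for k by (intro wi_eI tpos_cut xs t)
  show "(\<lambda>r. indicat_real {0<..t} r *\<^sub>R f r) \<in> borel_measurable borel" by (rule f)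
  show "version xs t \<in> borel_measurable M" by (rule version_measurable[OF xs t])
  show "AE \<omega> in M. (\<lambda>k. eI W (cut t (xs k)) \<omega>) \<longlonglongrightarrow> version xs t \<omega>"
    using version_paths[OF f xs approx] by eventually_elim (use t in blast)
  have z: "(\<lambda>k. ennreal ((1/8)^k)) \<longlonglongrightarrow> ennreal 0" by (intro tendsto_ennrealI LIMSEQ_power_zero) simp
  show "(\<lambda>k. q (\<lambda>r. indicat_real {0<..t} r *\<^sub>R f r - el (cut t (xs k)) r)) \<longlonglongrightarrow> 0"
  proof (rule tendsto_sandwich[OF _ _ tendsto_const z[simplified ennreal_0]])
    obtain N :: nat where N: "t \<le> real N" using real_arch_simple by blast
    show "\<forall>\<^sub>F k in sequentially. q (\<lambda>r. indicat_real {0<..t} r *\<^sub>R f r - el (cut t (xs k)) r) \<le> ennreal ((1/8)^k)"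
    proof (rule eventually_sequentiallyI[of N])
      fix k assume k: "N \<le> k"
      have "q (\<lambda>r. indicat_real {0<..t} r *\<^sub>R f r - el (cut t (xs k)) r) \<le> q (\<lambda>r. indicat_real {0<..real k} r *\<^sub>R (f r - el (xs k) r))"
        by (rule q_mono) (use N k in \<open>auto simp: el_cut indicator_def quad_nonneg Rpos\<close>)
      then show "q (\<lambda>r. indicat_real {0<..t} r *\<^sub>R f r - el (cut t (xs k)) r) \<le> ennreal ((1/8)^k)"
        using approx[of k] by (rule order_trans)
    qed
  qed simp
qed

text \<open>\<open>wiener_integral\<close> is a choice among all integrals of \<open>f\<close>. The version built above shows that the choice is not empty.\<close>

lemma wiener_integral_wi:
  fixes f :: "real \<Rightarrow> real^'m^'n"
  assumes T: "0 \<le> T" and fm: "set_borel_measurable lborel {0..T} f" and fin: "q (\<lambda>t. indicat_real {0<..T} t *\<^sub>R f t) < \<infinity>"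
  shows "has_wiener_integral (\<lambda>t. indicat_real {0<..T} t *\<^sub>R f t) (wiener_integral M R W T f)"
proof -
  let ?f = "\<lambda>t. indicat_real {0<..T} t *\<^sub>R f t"
  have m: "(\<lambda>t. indicat_real {0<..T'} t *\<^sub>R ?f t) \<in> borel_measurable borel" for T'
    using measurable_on_Ioc[OF fm] by (intro borel_measurable_scaleR[OF borel_measurable_indicator[of "{0<..T'}"]]) auto
  have "q (\<lambda>t. indicat_real {0<..T'} t *\<^sub>R ?f t) < \<infinity>" for T'
    using q_indicator_le[of "{0<..T'}" ?f] fin by (rule le_less_trans)
  from approximating_sequence[OF m this] obtain xs where xs: "\<And>k. tpos (xs k)"
    "\<And>k. q (\<lambda>t. indicat_real {0<..real k} t *\<^sub>R (?f t - el (xs k) t)) \<le> ennreal ((1/8)^k)" by blast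
  have "has_wiener_integral (\<lambda>t. indicat_real {0<..T} t *\<^sub>R ?f t) (version xs T)" by (rule wi_version[OF m xs T])
  moreover have "(\<lambda>t. indicat_real {0<..T} t *\<^sub>R ?f t) = ?f" by (auto simp: fun_eq_iff indicator_def)
  ultimately have "has_wiener_integral ?f (version xs T)" by simp
  from wi_imp_is_wiener_integral[OF T fm this fin] have "is_wiener_integral M R W T f (wiener_integral M R W T f)"
    unfolding wiener_integral_def by (rule someI[where P="is_wiener_integral M R W T f"])
  then show ?thesis by (rule is_wiener_integral_imp_wi)
qed

lemma q_dominated_convergence:
  fixes u :: "nat \<Rightarrow> real \<Rightarrow> real^'m^'n" and g :: "real \<Rightarrow> real^'m^'p"
  assumes u: "\<And>j. u j \<in> borel_measurable borel" and g: "g \<in> borel_measurable borel" and fin: "q g < \<infinity>" and c: "0 \<le> c"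
    and le: "\<And>j t. 0 \<le> t \<Longrightarrow> quad (R t) (u j t) \<le> c * quad (R t) (g t)"
    and lim: "\<And>t. (\<lambda>j. u j t) \<longlonglongrightarrow> 0"
  shows "(\<lambda>j. q (u j)) \<longlonglongrightarrow> 0"
proof -
  have "(\<lambda>j. \<integral>\<^sup>+t. ennreal (quad (R t) (u j t)) * indicator {0..} t \<partial>lborel) \<longlonglongrightarrow> (\<integral>\<^sup>+(t::real). 0 \<partial>lborel)"
  proof (rule nn_integral_dominated_convergence[where w="\<lambda>t. ennreal c * (ennreal (quad (R t) (g t)) * indicator {0..} t)" and u'="\<lambda>_. 0"])
    show "(\<lambda>t. ennreal (quad (R t) (u j t)) * indicator {0..} t) \<in> borel_measurable lborel" for j by (rule quad_meas[OF u])
    show "(\<lambda>t. ennreal c * (ennreal (quad (R t) (g t)) * indicator {0..} t)) \<in> borel_measurable lborel"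
      by (rule borel_measurable_times_ennreal[OF borel_measurable_const quad_meas[OF g]])
    show "AE t in lborel. ennreal (quad (R t) (u j t)) * indicator {0..} t \<le> ennreal c * (ennreal (quad (R t) (g t)) * indicator {0..} t)" for j
    proof (rule AE_I2)
      fix t :: real
      show "ennreal (quad (R t) (u j t)) * indicator {0..} t \<le> ennreal c * (ennreal (quad (R t) (g t)) * indicator {0..} t)"
        using ennreal_leI[OF le[of t j]] c by (auto simp: indicator_def ennreal_mult')
    qed
    have "(\<integral>\<^sup>+t. ennreal c * (ennreal (quad (R t) (g t)) * indicator {0..} t) \<partial>lborel) = ennreal c * q g"
      unfolding q_def by (rule nn_integral_cmult[OF quad_meas[OF g]])
    also have "\<dots> < \<infinity>" using fin by (simp add: ennreal_mult_less_top)
    finally show "(\<integral>\<^sup>+t. ennreal c * (ennreal (quad (R t) (g t)) * indicator {0..} t) \<partial>lborel) < \<infinity>" .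
    show "AE t in lborel. (\<lambda>j. ennreal (quad (R t) (u j t)) * indicator {0..} t) \<longlonglongrightarrow> 0"
    proof (rule AE_I2)
      fix t :: real
      have "(\<lambda>j. trace (u j t ** R t ** transpose (u j t))) \<longlonglongrightarrow> trace (0 ** R t ** transpose (0::real^'m^'n))"
        by (intro bounded_linear.tendsto[OF bounded_linear_trace] mm.tendsto bounded_linear.tendsto[OF bounded_linear_transpose] lim tendsto_const)
      then have "(\<lambda>j. ennreal (quad (R t) (u j t))) \<longlonglongrightarrow> ennreal 0"
        unfolding quad_def by (intro tendsto_ennrealI) (simp add: mm.zero_left trace_def)
      then show "(\<lambda>j. ennreal (quad (R t) (u j t)) * indicator {0..} t) \<longlonglongrightarrow> 0" by (cases "t \<ge> 0") auto
    qed
  qed simp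
  then show ?thesis by (simp add: q_def)
qed

text \<open>Sample \<open>V\<close> at the left end points of a grid. The integrals \<open>H n\<close> of the sampled integrands are
sums \<open>\<Sum> V(t\<^sub>i) (L(t\<^sub>i\<^sub>+\<^sub>1) - L(t\<^sub>i))\<close>. They converge in mean square because the integrands do, and path by path after
a summation by parts, which leaves Riemann sums of \<open>v L\<close>.\<close>

lemma wi_integration_by_parts:
  fixes f :: "real \<Rightarrow> real^'m^'n" and V v :: "real \<Rightarrow> real^'n^'n"
  assumes T: "0 \<le> T" and v: "set_integrable lborel {0..T} v"
    and V: "\<And>t. t \<in> {0..T} \<Longrightarrow> V t = V 0 + (LINT s:{0..t}|lborel. v s)"
    and fm: "(\<lambda>t. indicat_real {0<..T} t *\<^sub>R f t) \<in> borel_measurable borel"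
    and fin: "q (\<lambda>t. indicat_real {0<..T} t *\<^sub>R f t) < \<infinity>"
    and L: "\<And>t. t \<in> {0..T} \<Longrightarrow> has_wiener_integral (\<lambda>r. indicat_real {0<..t} r *\<^sub>R f r) (L t)"
    and cont: "AE \<omega> in M. continuous_on {0..T} (\<lambda>t. L t \<omega>)" and L0: "AE \<omega> in M. L 0 \<omega> = 0"
  shows "\<exists>H. has_wiener_integral (\<lambda>t. indicat_real {0<..T} t *\<^sub>R (V t ** f t)) H \<and>
    (AE \<omega> in M. H \<omega> = V T *v L T \<omega> - (LINT s:{0..T}|lborel. v s *v L s \<omega>))"
proof -
  define gd :: "nat \<Rightarrow> nat \<Rightarrow> real" where "gd = (\<lambda>n i. real i * (T / real (Suc n)))"
  let ?f = "\<lambda>t. indicat_real {0<..T} t *\<^sub>R f t"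
  have g: "gd n i \<in> {0..T}" if "i \<le> Suc n" for n i
  proof -
    have "real i * T \<le> real (Suc n) * T" using that T by (intro mult_right_mono) auto
    then show ?thesis using T by (simp add: gd_def field_simps)
  qed
  have gle: "gd n i \<le> gd n (Suc i)" for n i unfolding gd_def using T by (intro mult_right_mono) auto
  have mono: "mono_on A (gd n)" for n A unfolding gd_def using T by (intro mono_onI mult_right_mono) auto
  have gd0: "gd n 0 = 0" and gdT: "gd n (Suc n) = T" for n by (simp_all add: gd_def)
  have cV: "continuous_on {0..T} V"
    by (rule continuous_on_eq[of _ "\<lambda>t. V 0 + (LINT s:{0..t}|lborel. v s)"])
      (auto intro!: continuous_intros continuous_on_LINT v simp: V[symmetric])
  define F where "F n t = (\<Sum>i<Suc n. V (gd n i) ** (indicat_real {0<..gd n (Suc i)} t *\<^sub>R f t - indicat_real {0<..gd n i} t *\<^sub>R f t))" for n t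
  define H where "H n \<omega> = (\<Sum>i<Suc n. V (gd n i) *v (L (gd n (Suc i)) \<omega> - L (gd n i) \<omega>))" for n \<omega>
  have wFH: "has_wiener_integral (F n) (H n)" for n
    unfolding F_def[abs_def] H_def[abs_def] by (intro wi_sum wi_mult wi_diff L g) auto
  let ?s = "\<lambda>n. step_integrand (Suc n) (gd n) (\<lambda>i. V (gd n i))"
  have Fs: "F n t = ?s n t ** ?f t" for n t
  proof -
    have "V (gd n i) ** (indicat_real {0<..gd n (Suc i)} t *\<^sub>R f t - indicat_real {0<..gd n i} t *\<^sub>R f t)
        = (indicat_real {gd n i<..gd n (Suc i)} t *\<^sub>R V (gd n i)) ** ?f t" if i: "i < Suc n" for i
    proof -
      have "indicat_real {0<..gd n (Suc i)} t *\<^sub>R f t - indicat_real {0<..gd n i} t *\<^sub>R f t = indicat_real {gd n i<..gd n (Suc i)} t *\<^sub>R ?f t"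
        by (rule indicator_Ioc_diff) (use g[of i n] g[of "Suc i" n] gle[of n i] i in auto)
      then show ?thesis by (simp add: mm.scaleR_left mm.scaleR_right)
    qed
    then have "F n t = (\<Sum>i<Suc n. (indicat_real {gd n i<..gd n (Suc i)} t *\<^sub>R V (gd n i)) ** ?f t)"
      unfolding F_def by (intro sum.cong) auto
    then show ?thesis unfolding step_integrand_def by (simp only: mm.sum_left)
  qed
  have val: "\<exists>r\<in>{0..T}. \<bar>r - t\<bar> \<le> T / real (Suc n) \<and> ?s n t = V r" if t: "t \<in> {0<..T}" for n t
  proof -
    have "gd n 0 < t" "t \<le> gd n (Suc n)" using t by (auto simp: gd0 gdT)
    from step_integrand_value[OF mono this, of "\<lambda>i. V (gd n i)"]
    obtain i where i: "i < Suc n" "gd n i < t" "t \<le> gd n (Suc i)" "?s n t = V (gd n i)" by blast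
    have "gd n (Suc i) = gd n i + T / real (Suc n)" unfolding gd_def by (simp only: of_nat_Suc distrib_right)
    then have i': "t \<le> gd n i + T / real (Suc n)" using i(3) by (simp only:)
    have "\<bar>gd n i - t\<bar> \<le> T / real (Suc n)" using abs_diff_le_of_Ioc[OF i(2) i'] .
    then show ?thesis using i g[of i n] by (intro bexI[of _ "gd n i"]) auto
  qed
  obtain B where B: "\<And>t. t \<in> {0..T} \<Longrightarrow> norm (V t) \<le> B"
    using compact_imp_bounded[OF compact_continuous_image[OF cV compact_Icc]] unfolding bounded_iff by blast
  have B0: "0 \<le> B" using B[of 0] T norm_ge_zero order_trans by (metis atLeastAtMost_iff order_refl)
  define \<kappa> where "\<kappa> = real CARD('n) * (real CARD('n) * real CARD('n)) * (2 * B)\<^sup>2"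
  let ?Vt = "\<lambda>t. indicat_real {0..T} t *\<^sub>R V t"
  have Vm: "?Vt \<in> borel_measurable borel" by (rule borel_measurable_continuous_on_indicator[OF _ cV]) simp
  have Vf: "indicat_real {0<..T} t *\<^sub>R (V t ** f t) = ?Vt t ** ?f t" for t
    by (auto simp: indicator_def mm.zero_right)
  have "(\<lambda>t. ?Vt t ** ?f t) \<in> borel_measurable borel" by (intro measurable_mm Vm fm)
  then have Vfm: "(\<lambda>t. indicat_real {0<..T} t *\<^sub>R (V t ** f t)) \<in> borel_measurable borel" by (simp only: Vf)
  have qlim: "(\<lambda>n. q (\<lambda>t. indicat_real {0<..T} t *\<^sub>R (V t ** f t) - F n t)) \<longlonglongrightarrow> 0"
  proof (rule q_dominated_convergence[OF _ fm fin])
    show "(\<lambda>t. indicat_real {0<..T} t *\<^sub>R (V t ** f t) - F n t) \<in> borel_measurable borel" for n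
      by (intro borel_measurable_diff Vfm wiD(1)[OF wFH])
    show "0 \<le> \<kappa>" by (simp add: \<kappa>_def)
    fix t :: real
    have d: "indicat_real {0<..T} t *\<^sub>R (V t ** f t) - F n t = (?Vt t - ?s n t) ** ?f t" for n
      unfolding Vf Fs by (simp only: mm.diff_left)
    show "quad (R t) (indicat_real {0<..T} t *\<^sub>R (V t ** f t) - F n t) \<le> \<kappa> * quad (R t) (?f t)" if t: "0 \<le> t" for n
    proof (cases "t \<in> {0<..T}")
      case True
      obtain r where r: "r \<in> {0..T}" "?s n t = V r" using val[OF True] by blast
      have "norm (?Vt t - ?s n t) \<le> 2 * B"
        using True r norm_triangle_ineq4[of "V t" "V r"] B[of t] B[OF r(1)] by (simp add: indicator_def)
      then have "(norm (?Vt t - ?s n t))\<^sup>2 \<le> (2 * B)\<^sup>2" by (intro power_mono) auto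
      then have "real CARD('n) * (real CARD('n) * real CARD('n)) * (norm (?Vt t - ?s n t))\<^sup>2 * quad (R t) (?f t) \<le> \<kappa> * quad (R t) (?f t)"
        unfolding \<kappa>_def by (intro mult_right_mono mult_left_mono quad_nonneg Rpos t) auto
      then show ?thesis unfolding d using quad_mult_le[OF Rpos[OF t], of "?Vt t - ?s n t" "?f t"] by linarith
    next
      case False
      then show ?thesis unfolding d by (simp add: mm.zero_right)
    qed
    show "(\<lambda>n. indicat_real {0<..T} t *\<^sub>R (V t ** f t) - F n t) \<longlonglongrightarrow> 0"
    proof (cases "t \<in> {0<..T}")
      case True
      have "\<forall>n. \<exists>r. r \<in> {0..T} \<and> \<bar>r - t\<bar> \<le> T / real (Suc n) \<and> ?s n t = V r" using val[OF True] by blast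
      from choice[OF this] obtain r where r: "\<And>n. r n \<in> {0..T}" "\<And>n. \<bar>r n - t\<bar> \<le> T / real (Suc n)" "\<And>n. ?s n t = V (r n)" by blast
      have "(\<lambda>n. T / real (Suc n)) \<longlonglongrightarrow> 0"
        using tendsto_mult_right_zero[OF LIMSEQ_inverse_real_of_nat, of T] by (simp add: divide_inverse)
      then have "(\<lambda>n. r n - t) \<longlonglongrightarrow> 0"
        by (rule Lim_null_comparison[OF always_eventually[OF allI[OF r(2)[folded real_norm_def]]]])
      then have "r \<longlonglongrightarrow> t" by (simp add: LIM_zero_iff)
      then have "(\<lambda>n. V (r n)) \<longlonglongrightarrow> V t" using r(1) True by (intro continuous_on_tendsto_compose[OF cV]) auto
      then have "(\<lambda>n. (?Vt t - V (r n)) ** ?f t) \<longlonglongrightarrow> (?Vt t - V t) ** ?f t" by (intro mm.tendsto tendsto_intros)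
      then show ?thesis unfolding d r(3) using True by (simp add: mm.zero_left)
    next
      case False
      then show ?thesis unfolding d by (simp add: mm.zero_right)
    qed
  qed
  define J where "J \<omega> = lim (\<lambda>n. H n \<omega>)" for \<omega>
  have Jm: "J \<in> borel_measurable M" unfolding J_def[abs_def] by (intro borel_measurable_lim_metric wiD(2)[OF wFH])
  have path: "AE \<omega> in M. (\<lambda>n. H n \<omega>) \<longlonglongrightarrow> V T *v L T \<omega> - (LINT s:{0..T}|lborel. v s *v L s \<omega>)"
    using cont L0
  proof eventually_elim
    case (elim \<omega>)
    \<comment> \<open>Abel's summation by parts.\<close>
    have abel: "H n \<omega> = V T *v L T \<omega> - (\<Sum>i<Suc n. (LINT s:{gd n i..gd n (Suc i)}|lborel. v s) *v L (gd n (Suc i)) \<omega>)" for n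
    proof -
      have "H n \<omega> + (\<Sum>i<Suc n. (LINT s:{gd n i..gd n (Suc i)}|lborel. v s) *v L (gd n (Suc i)) \<omega>)
        = (\<Sum>i<Suc n. V (gd n (Suc i)) *v L (gd n (Suc i)) \<omega> - V (gd n i) *v L (gd n i) \<omega>)"
        unfolding H_def sum.distrib[symmetric]
      proof (rule sum.cong[OF refl])
        fix i assume "i \<in> {..<Suc n}"
        then have i: "0 \<le> gd n i" "gd n i \<le> gd n (Suc i)" "gd n (Suc i) \<le> T"
          using g[of i n] g[of "Suc i" n] gle[of n i] by auto
        show "V (gd n i) *v (L (gd n (Suc i)) \<omega> - L (gd n i) \<omega>) + (LINT s:{gd n i..gd n (Suc i)}|lborel. v s) *v L (gd n (Suc i)) \<omega>
          = V (gd n (Suc i)) *v L (gd n (Suc i)) \<omega> - V (gd n i) *v L (gd n i) \<omega>"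
          by (simp only: LINT_increment[OF v V i, symmetric] mv.diff_left mv.diff_right) simp
      qed
      also have "\<dots> = V T *v L T \<omega>"
        by (simp only: sum_lessThan_telescope[where f="\<lambda>i. V (gd n i) *v L (gd n i) \<omega>"]) (simp add: gd0 gdT elim(2) mv.zero_right)
      finally show ?thesis by (simp add: eq_diff_eq)
    qed
    have "(\<lambda>n. \<Sum>i<Suc n. (LINT s:{gd n i..gd n (Suc i)}|lborel. v s) *v L (gd n (Suc i)) \<omega>)
       \<longlonglongrightarrow> (LINT s:{0..T}|lborel. v s *v L s \<omega>)"
      unfolding gd_def
      by (rule riemann_sum_bilinear[OF bounded_bilinear_matrix_vector T v elim(1)]) (use gle in \<open>simp add: gd_def\<close>)
    then show ?case unfolding abel by (intro tendsto_intros)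
  qed
  have JA: "AE \<omega> in M. J \<omega> = V T *v L T \<omega> - (LINT s:{0..T}|lborel. v s *v L s \<omega>)"
    using path by eventually_elim (simp add: J_def limI)
  have "AE \<omega> in M. (\<lambda>n. H n \<omega>) \<longlonglongrightarrow> J \<omega>" using path JA by eventually_elim simp
  from wi_pointwise_limit[OF wFH Vfm Jm qlim this] JA show ?thesis by blast
qed

end

section \<open>Functions measurable up to null sets\<close>

text \<open>The integral equations for \<open>X\<close> and \<open>Z\<close> hold only almost surely, while the sigma algebras generated by \<open>B\<close>, \<open>W\<close>, \<open>Z\<close>
are not completed. Measurability is therefore tracked up to null sets.\<close>

definition ae_meas :: "'a measure \<Rightarrow> 'a measure \<Rightarrow> ('a \<Rightarrow> 'b::topological_space) \<Rightarrow> bool" where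
  "ae_meas M F f \<longleftrightarrow> (\<exists>g\<in>borel_measurable F. AE \<omega> in M. f \<omega> = g \<omega>)"

lemma ae_measI: "g \<in> borel_measurable F \<Longrightarrow> AE \<omega> in M. f \<omega> = g \<omega> \<Longrightarrow> ae_meas M F f"
  by (auto simp: ae_meas_def)

lemma ae_meas_meas: "f \<in> borel_measurable F \<Longrightarrow> ae_meas M F f"
  by (rule ae_measI[of f]) auto

lemma ae_meas_cong: assumes "ae_meas M F f" "AE \<omega> in M. f \<omega> = f' \<omega>" shows "ae_meas M F f'"
proof -
  from assms(1) obtain g where g: "g \<in> borel_measurable F" "AE \<omega> in M. f \<omega> = g \<omega>" by (auto simp: ae_meas_def)
  from g(2) assms(2) have "AE \<omega> in M. f' \<omega> = g \<omega>" by eventually_elim simp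
  with g(1) show ?thesis by (rule ae_measI)
qed

lemma ae_meas_add:
  fixes f g :: "'a \<Rightarrow> 'b::euclidean_space"
  assumes "ae_meas M F f" "ae_meas M F g" shows "ae_meas M F (\<lambda>\<omega>. f \<omega> + g \<omega>)"
proof -
  from assms obtain f' g' where *: "f' \<in> borel_measurable F" "AE \<omega> in M. f \<omega> = f' \<omega>"
     "g' \<in> borel_measurable F" "AE \<omega> in M. g \<omega> = g' \<omega>" by (auto simp: ae_meas_def)
  have "AE \<omega> in M. f \<omega> + g \<omega> = f' \<omega> + g' \<omega>" using *(2,4) by eventually_elim simp
  then show ?thesis by (rule ae_measI[OF borel_measurable_add[OF *(1,3)]])
qed

lemma ae_meas_linear:
  fixes f :: "'a \<Rightarrow> 'b::euclidean_space" and h :: "'b \<Rightarrow> 'c::euclidean_space"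
  assumes h: "bounded_linear h" and f: "ae_meas M F f" shows "ae_meas M F (\<lambda>\<omega>. h (f \<omega>))"
proof -
  from f obtain g where g: "g \<in> borel_measurable F" "AE \<omega> in M. f \<omega> = g \<omega>" by (auto simp: ae_meas_def)
  have "(\<lambda>\<omega>. h (g \<omega>)) \<in> borel_measurable F" by (rule borel_measurable_continuous_on[OF linear_continuous_on[OF h] g(1)])
  moreover have "AE \<omega> in M. h (f \<omega>) = h (g \<omega>)" using g(2) by eventually_elim simp
  ultimately show ?thesis by (rule ae_measI)
qed

lemma ae_meas_diff:
  fixes f g :: "'a \<Rightarrow> 'b::euclidean_space"
  assumes "ae_meas M F f" "ae_meas M F g" shows "ae_meas M F (\<lambda>\<omega>. f \<omega> - g \<omega>)"
  using ae_meas_add[OF assms(1) ae_meas_linear[OF bounded_linear_minus[OF bounded_linear_ident] assms(2)]] by simp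

lemma ae_meas_0: "ae_meas M F (\<lambda>\<omega>. 0 :: 'b::euclidean_space)" by (rule ae_meas_meas) simp

lemma ae_meas_sum:
  fixes f :: "nat \<Rightarrow> 'a \<Rightarrow> 'b::euclidean_space"
  shows "(\<And>i. i < n \<Longrightarrow> ae_meas M F (f i)) \<Longrightarrow> ae_meas M F (\<lambda>\<omega>. \<Sum>i<n. f i \<omega>)"
  by (induction n) (auto intro: ae_meas_0 ae_meas_add)

lemma ae_meas_lim:
  fixes f :: "nat \<Rightarrow> 'a \<Rightarrow> 'b::euclidean_space"
  assumes f: "\<And>n. ae_meas M F (f n)" and lim: "AE \<omega> in M. (\<lambda>n. f n \<omega>) \<longlonglongrightarrow> h \<omega>"
  shows "ae_meas M F h"
proof -
  have "\<forall>n. \<exists>g. g \<in> borel_measurable F \<and> (AE \<omega> in M. f n \<omega> = g \<omega>)" using f by (auto simp: ae_meas_def)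
  from choice[OF this] obtain g where g: "\<And>n. g n \<in> borel_measurable F" "\<And>n. AE \<omega> in M. f n \<omega> = g n \<omega>" by blast
  have "AE \<omega> in M. \<forall>n. f n \<omega> = g n \<omega>" using g(2) by (simp add: AE_all_countable)
  then have "AE \<omega> in M. h \<omega> = lim (\<lambda>n. g n \<omega>)" using lim
    by eventually_elim (simp add: limI)
  then show ?thesis by (rule ae_measI[OF borel_measurable_lim_metric[OF g(1)]])
qed

text \<open>Riemann sums at grid points converge along every continuous path.\<close>

lemma ae_meas_LINT:
  fixes H :: "real \<Rightarrow> 'c::euclidean_space" and y :: "real \<Rightarrow> 'a \<Rightarrow> 'd::euclidean_space"
    and prod :: "'c \<Rightarrow> 'd \<Rightarrow> 'e::euclidean_space"
  assumes bil: "bounded_bilinear prod" and T: "0 \<le> T" and H: "set_integrable lborel {0..T} H" and y: "\<And>s. s \<in> {0..T} \<Longrightarrow> ae_meas M F (y s)"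
    and c: "AE \<omega> in M. continuous_on {0..T} (\<lambda>s. y s \<omega>)"
  shows "ae_meas M F (\<lambda>\<omega>. LINT s:{0..T}|lborel. prod (H s) (y s \<omega>))"
proof -
  define g :: "nat \<Rightarrow> nat \<Rightarrow> real" where "g = (\<lambda>n i. real i * (T / real (Suc n)))"
  have g: "g n i \<in> {0..T}" if "i \<le> Suc n" for n i
  proof -
    have "real i * T \<le> real (Suc n) * T" using that T by (intro mult_right_mono) auto
    then show ?thesis using T by (simp add: g_def field_simps)
  qed
  have gle: "g n i \<le> g n (Suc i)" for n i unfolding g_def using T by (intro mult_right_mono) auto
  show ?thesis
  proof (rule ae_meas_lim)
    show "ae_meas M F (\<lambda>\<omega>. \<Sum>i<Suc n. prod (LINT s:{g n i..g n (Suc i)}|lborel. H s) (y (g n i) \<omega>))" for n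
      by (intro ae_meas_sum ae_meas_linear[OF bounded_bilinear.bounded_linear_right[OF bil]] y g) simp
    show "AE \<omega> in M. (\<lambda>n. \<Sum>i<Suc n. prod (LINT s:{g n i..g n (Suc i)}|lborel. H s) (y (g n i) \<omega>)) \<longlonglongrightarrow> (LINT s:{0..T}|lborel. prod (H s) (y s \<omega>))"
      using c
    proof eventually_elim
      case (elim \<omega>)
      show ?case unfolding g_def
        by (rule riemann_sum_bilinear[OF bil T H elim]) (use gle in \<open>simp add: g_def\<close>)
    qed
  qed
qed

lemma picard_ae_meas:
  fixes A :: "real \<Rightarrow> real^'d^'d" and g :: "real \<Rightarrow> 'a \<Rightarrow> real^'d"
  assumes T: "0 \<le> T" and A: "continuous_on {0..T} A" and g: "\<And>s. s \<in> {0..T} \<Longrightarrow> ae_meas M F (g s)"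
    and c: "AE \<omega> in M. continuous_on {0..T} (\<lambda>s. g s \<omega>)" and t: "t \<in> {0..T}"
  shows "ae_meas M F (\<lambda>\<omega>. picard A (\<lambda>s. g s \<omega>) n t)"
  using t
proof (induction n arbitrary: t)
  case 0 then show ?case using g by simp
next
  case (Suc n)
  have "ae_meas M F (\<lambda>\<omega>. LINT s:{0..t}|lborel. A s *v picard A (\<lambda>s. g s \<omega>) n s)"
  proof (rule ae_meas_LINT[OF bounded_bilinear_matrix_vector])
    show "0 \<le> t" using Suc.prems by simp
    show "set_integrable lborel {0..t} A"
      by (intro borel_integrable_atLeastAtMost' continuous_on_subset[OF A]) (use Suc.prems in auto)
    show "ae_meas M F (\<lambda>\<omega>. picard A (\<lambda>s. g s \<omega>) n s)" if "s \<in> {0..t}" for s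
      by (rule Suc.IH) (use that Suc.prems in auto)
    show "AE \<omega> in M. continuous_on {0..t} (picard A (\<lambda>s. g s \<omega>) n)"
      using c
    proof eventually_elim
      case (elim \<omega>)
      show ?case by (rule continuous_on_subset[OF continuous_on_picard[OF A elim]]) (use Suc.prems in auto)
    qed
  qed
  then show ?case using g[OF Suc.prems] by (simp add: ae_meas_add)
qed

text \<open>The solution is the almost sure limit of Picard iterates, each of which is built from \<open>g\<close> by integrals.\<close>

lemma linear_sde_ae_meas:
  fixes A :: "real \<Rightarrow> real^'d^'d" and g x :: "real \<Rightarrow> 'a \<Rightarrow> real^'d"
  assumes T: "0 \<le> T" and A: "continuous_on {0..T} A" and g: "\<And>s. s \<in> {0..T} \<Longrightarrow> ae_meas M F (g s)"
    and c: "AE \<omega> in M. continuous_on {0..T} (\<lambda>s. g s \<omega>)" and cx: "AE \<omega> in M. continuous_on {0..T} (\<lambda>s. x s \<omega>)"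
    and eq: "AE \<omega> in M. \<forall>t\<in>{0..T}. x t \<omega> = g t \<omega> + (LINT s:{0..t}|lborel. A s *v x s \<omega>)" and t: "t \<in> {0..T}"
  shows "ae_meas M F (x t)"
proof (rule ae_meas_lim)
  show "ae_meas M F (\<lambda>\<omega>. picard A (\<lambda>s. g s \<omega>) n t)" for n by (rule picard_ae_meas[OF T A g c t])
  show "AE \<omega> in M. (\<lambda>n. picard A (\<lambda>s. g s \<omega>) n t) \<longlonglongrightarrow> x t \<omega>"
    using c cx eq by eventually_elim (rule picard_tendsto[OF A _ _ _ t], auto)
qed

lemma borel_measurable_vecI:
  fixes f :: "'a \<Rightarrow> real^'n"
  assumes "\<And>i. (\<lambda>\<omega>. f \<omega> $ i) \<in> borel_measurable M" shows "f \<in> borel_measurable M"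
  by (subst borel_measurable_euclidean_space) (auto simp: Basis_vec_def inner_axis assms)

lemma ae_meas_vecI:
  fixes f :: "'a \<Rightarrow> real^'n"
  assumes "\<And>i. ae_meas M F (\<lambda>\<omega>. f \<omega> $ i)" shows "ae_meas M F f"
proof -
  have "\<forall>i. \<exists>g. g \<in> borel_measurable F \<and> (AE \<omega> in M. f \<omega> $ i = g \<omega>)" using assms by (auto simp: ae_meas_def)
  from choice[OF this] obtain g where g: "\<And>i. g i \<in> borel_measurable F" "\<And>i. AE \<omega> in M. f \<omega> $ i = g i \<omega>" by blast
  have "AE \<omega> in M. \<forall>i. f \<omega> $ i = g i \<omega>" using g(2) by (simp add: AE_all_countable)
  then have "AE \<omega> in M. f \<omega> = (\<chi> i. g i \<omega>)" by eventually_elim (simp add: vec_eq_iff)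
  then show ?thesis by (rule ae_measI[rotated]) (rule borel_measurable_vecI, simp add: g)
qed

section \<open>Generated sigma algebras, independence and conditional expectations\<close>

lemma space_gen_sigma [simp]: "space (gen_sigma M J Y) = space M"
  unfolding gen_sigma_def by (rule space_measure_of) auto

lemma sets_gen_sigma: "sets (gen_sigma M J Y) = sigma_sets (space M) {Y t -` S \<inter> space M |t S. t \<in> J \<and> S \<in> sets borel}"
  unfolding gen_sigma_def by (rule sets_measure_of) auto

lemma gen_sigma_measurable: "t \<in> J \<Longrightarrow> Y t \<in> borel_measurable (gen_sigma M J Y)"
  by (rule measurableI) (auto simp: sets_gen_sigma intro!: sigma_sets.Basic)

lemma gen_sigma_subalgebra:
  assumes "\<And>t. t \<in> J \<Longrightarrow> Y t \<in> borel_measurable M" shows "subalgebra M (gen_sigma M J Y)"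
  unfolding subalgebra_def
proof
  show "sets (gen_sigma M J Y) \<subseteq> sets M" unfolding sets_gen_sigma
    by (rule sets.sigma_sets_subset) (auto intro: measurable_sets[OF assms])
qed simp

text \<open>Passing from functions to the sigma algebra that they generate: events with an almost surely equal partner
in \<open>G\<close> form a sigma algebra.\<close>

lemma sets_ae_transfer:
  assumes Z: "\<And>t. t \<in> J \<Longrightarrow> ae_meas M G (Z t)" and G: "space G = space M" and E: "E \<in> sets (gen_sigma M J Z)"
  shows "\<exists>E'\<in>sets G. AE \<omega> in M. \<omega> \<in> E \<longleftrightarrow> \<omega> \<in> E'"
  using E unfolding sets_gen_sigma
proof (induction rule: sigma_sets.induct)
  case (Basic a)
  then obtain t S where a: "a = Z t -` S \<inter> space M" "t \<in> J" "S \<in> sets borel" by auto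
  from Z[OF a(2)] obtain g where g: "g \<in> borel_measurable G" "AE \<omega> in M. Z t \<omega> = g \<omega>" by (auto simp: ae_meas_def)
  have "g -` S \<inter> space M \<in> sets G" using measurable_sets[OF g(1) a(3)] G by simp
  moreover have "AE \<omega> in M. \<omega> \<in> a \<longleftrightarrow> \<omega> \<in> g -` S \<inter> space M" using g(2) by eventually_elim (simp add: a)
  ultimately show ?case by blast
next
  case Empty
  show ?case by (rule bexI[of _ "{}"]) auto
next
  case (Compl a)
  then obtain E' where E': "E' \<in> sets G" "AE \<omega> in M. \<omega> \<in> a \<longleftrightarrow> \<omega> \<in> E'" by blast
  have "space M - E' \<in> sets G" using sets.compl_sets[OF E'(1)] G by simp
  moreover have "AE \<omega> in M. \<omega> \<in> space M - a \<longleftrightarrow> \<omega> \<in> space M - E'" using E'(2) by eventually_elim simp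
  ultimately show ?case by blast
next
  case (Union a)
  have "\<forall>i. \<exists>E'. E' \<in> sets G \<and> (AE \<omega> in M. \<omega> \<in> a i \<longleftrightarrow> \<omega> \<in> E')" using Union by blast
  from choice[OF this] obtain E' where E': "\<And>i. E' i \<in> sets G" "\<And>i. AE \<omega> in M. \<omega> \<in> a i \<longleftrightarrow> \<omega> \<in> E' i" by blast
  have "AE \<omega> in M. \<forall>i. \<omega> \<in> a i \<longleftrightarrow> \<omega> \<in> E' i" using E'(2) by (simp add: AE_all_countable)
  then have "AE \<omega> in M. \<omega> \<in> (\<Union>i. a i) \<longleftrightarrow> \<omega> \<in> (\<Union>i. E' i)" by eventually_elim simp
  then show ?case using E'(1) by blast
qed

text \<open>Independence does not notice null sets, so it passes from \<open>G\<close> to processes that are only almost surely \<open>G\<close>-measurable.\<close>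

lemma (in prob_space) indep_set_ae_transfer:
  assumes Z: "\<And>t. t \<in> J \<Longrightarrow> ae_meas M G (Z t)" and Zm: "\<And>t. t \<in> J \<Longrightarrow> Z t \<in> borel_measurable M"
    and G: "subalgebra M G" and H: "subalgebra M H"
    and ind: "\<And>A B. A \<in> sets G \<Longrightarrow> B \<in> sets H \<Longrightarrow> prob (A \<inter> B) = prob A * prob B"
  shows "indep_set (sets (gen_sigma M J Z)) (sets H)"
proof (rule indep_setI)
  have sub: "subalgebra M (gen_sigma M J Z)" by (rule gen_sigma_subalgebra[OF Zm])
  show "sets (gen_sigma M J Z) \<subseteq> events" "sets H \<subseteq> events" using sub H by (auto simp: subalgebra_def)
  fix a b assume a: "a \<in> sets (gen_sigma M J Z)" and b: "b \<in> sets H"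
  have G': "space G = space M" using G by (simp add: subalgebra_def)
  from sets_ae_transfer[OF Z G' a] obtain a' where a': "a' \<in> sets G" "AE \<omega> in M. \<omega> \<in> a \<longleftrightarrow> \<omega> \<in> a'" by blast
  have ev: "a \<in> events" "b \<in> events" "a' \<in> events" using a b a' sub G H by (auto simp: subalgebra_def)
  have "prob (a \<inter> b) = prob (a' \<inter> b)"
    by (rule measure_eq_AE) (use a'(2) ev in \<open>auto\<close>)
  also have "\<dots> = prob a' * prob b" by (rule ind[OF a'(1) b])
  also have "prob a' = prob a" by (rule measure_eq_AE) (use a'(2) ev in \<open>auto\<close>)
  finally show "prob (a \<inter> b) = prob a * prob b" .
qed

lemma (in prob_space) real_cond_exp_indep:
  assumes F: "subalgebra M F" and H: "subalgebra M H" and ind: "indep_set (sets F) (sets H)"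
    and Y: "Y \<in> borel_measurable H" "integrable M Y"
  shows "AE \<omega> in M. real_cond_exp M F Y \<omega> = expectation Y"
proof -
  interpret F: finite_measure_subalgebra M F by standard (rule F)
  show ?thesis
  proof (rule F.real_cond_exp_charact)
    fix E assume E: "E \<in> sets F"
    have Em: "E \<in> events" using E F by (auto simp: subalgebra_def)
    have sF: "space F = space M" "space H = space M" using F H by (auto simp: subalgebra_def)
    have iv: "indep_var borel (indicat_real E) borel Y"
      unfolding indep_var_eq
    proof (intro conjI)
      show "random_variable borel (indicat_real E)" using Em by simp
      show "random_variable borel Y" using Y(2) by simp
      have i: "indicat_real E \<in> borel_measurable F" using E by simp
      have "sigma_sets (space M) {indicat_real E -` A \<inter> space M |A. A \<in> sets borel} \<subseteq> sets F"
        by (rule sets.sigma_sets_subset[of _ F, unfolded sF]) (use measurable_sets[OF i] sF in auto)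
      moreover have "sigma_sets (space M) {Y -` A \<inter> space M |A. A \<in> sets borel} \<subseteq> sets H"
        by (rule sets.sigma_sets_subset[of _ H, unfolded sF]) (use measurable_sets[OF Y(1)] sF in auto)
      ultimately show "indep_set (sigma_sets (space M) {indicat_real E -` A \<inter> space M |A. A \<in> sets borel})
          (sigma_sets (space M) {Y -` A \<inter> space M |A. A \<in> sets borel})"
        using ind unfolding indep_set_def
        by (elim indep_sets_mono_sets) (auto split: bool.split)
    qed
    have "(LINT \<omega>:E|M. Y \<omega>) = expectation (\<lambda>\<omega>. indicat_real E \<omega> * Y \<omega>)"
      by (simp add: set_lebesgue_integral_def)
    also have "\<dots> = expectation (indicat_real E) * expectation Y"
      by (rule indep_var_lebesgue_integral[OF iv _ Y(2)]) (use Em in \<open>simp add: integrable_indicator_iff emeasure_eq_measure\<close>)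
    also have "\<dots> = (LINT \<omega>:E|M. expectation Y)"
      using Em by (simp add: set_lebesgue_integral_def)
    finally show "(LINT \<omega>:E|M. Y \<omega>) = (LINT \<omega>:E|M. expectation Y)" .
  qed (use Y in auto)
qed

context finite_measure_subalgebra begin

lemma vec_cond_exp_measurable: "vec_cond_exp M F Y \<in> borel_measurable F"
  by (rule borel_measurable_vecI) (simp add: vec_cond_exp_def)

lemma integrable_component: "integrable M (Y :: 'a \<Rightarrow> real^'n) \<Longrightarrow> integrable M (\<lambda>\<omega>. Y \<omega> $ i)"
  using integrable_inner_left[of "axis i 1" M Y] by (simp add: inner_axis)

lemma vec_AE_iff: "(AE \<omega> in M. (X \<omega> :: real^'n) = Y \<omega>) \<longleftrightarrow> (\<forall>i. AE \<omega> in M. X \<omega> $ i = Y \<omega> $ i)"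
  unfolding vec_eq_iff by (simp add: AE_all_countable)

lemma vec_cond_exp_add:
  assumes "integrable M X" "integrable M Y"
  shows "AE \<omega> in M. vec_cond_exp M F (\<lambda>\<omega>. X \<omega> + Y \<omega>) \<omega> = vec_cond_exp M F X \<omega> + vec_cond_exp M F Y \<omega>"
  unfolding vec_AE_iff
  using real_cond_exp_add[OF integrable_component[OF assms(1)] integrable_component[OF assms(2)]]
  by (simp add: vec_cond_exp_def)

lemma vec_cond_exp_diff:
  assumes "integrable M X" "integrable M Y"
  shows "AE \<omega> in M. vec_cond_exp M F (\<lambda>\<omega>. X \<omega> - Y \<omega>) \<omega> = vec_cond_exp M F X \<omega> - vec_cond_exp M F Y \<omega>"
  unfolding vec_AE_iff
  using real_cond_exp_diff[OF integrable_component[OF assms(1)] integrable_component[OF assms(2)]]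
  by (simp add: vec_cond_exp_def)

lemma vec_cond_exp_ae_meas:
  assumes Y: "integrable M Y" "ae_meas M F Y"
  shows "AE \<omega> in M. vec_cond_exp M F Y \<omega> = Y \<omega>"
  unfolding vec_AE_iff
proof
  fix i
  from Y(2) obtain g where g: "g \<in> borel_measurable F" "AE \<omega> in M. Y \<omega> = g \<omega>" by (auto simp: ae_meas_def)
  have gM: "g \<in> borel_measurable M" by (rule measurable_from_subalg[OF subalg g(1)])
  have gi: "(\<lambda>\<omega>. g \<omega> $ i) \<in> borel_measurable F" "(\<lambda>\<omega>. g \<omega> $ i) \<in> borel_measurable M"     by (rule measurable_compose[OF g(1) borel_measurable_nth], rule measurable_compose[OF gM borel_measurable_nth])
  have ae: "AE \<omega> in M. Y \<omega> $ i = g \<omega> $ i" using g(2) by eventually_elim simp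
  have Yi: "integrable M (\<lambda>\<omega>. Y \<omega> $ i)" by (rule integrable_component[OF Y(1)])
  have int: "integrable M (\<lambda>\<omega>. g \<omega> $ i)" by (rule integrable_cong_AE_imp[OF Yi gi(2)]) (use ae in eventually_elim, simp)
  have "AE \<omega> in M. real_cond_exp M F (\<lambda>\<omega>. Y \<omega> $ i) \<omega> = real_cond_exp M F (\<lambda>\<omega>. g \<omega> $ i) \<omega>"
    by (rule real_cond_exp_cong[OF ae _ gi(2)]) (use Yi in simp)
  moreover have "AE \<omega> in M. real_cond_exp M F (\<lambda>\<omega>. g \<omega> $ i) \<omega> = g \<omega> $ i" by (rule real_cond_exp_F_meas[OF int gi(1)])
  ultimately show "AE \<omega> in M. vec_cond_exp M F Y \<omega> $ i = Y \<omega> $ i"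
    using ae by eventually_elim (simp add: vec_cond_exp_def)
qed

text \<open>Approximation by Riemann sums is not available: \<open>u\<close> is only jointly measurable, and each \<open>u s\<close> is only
almost surely \<open>F\<close>-measurable, with an exceptional set that depends on \<open>s\<close>. Instead let \<open>h\<close> be the difference between
the integral \<open>I\<close> and its conditional expectation. It is orthogonal to all bounded \<open>F\<close>-measurable
functions, hence to each \<open>u s\<close>, hence to \<open>I\<close> by Fubini's theorem. So \<open>h\<close> is orthogonal to itself.\<close>

lemma bounded_section_integral_ae_meas:
  fixes u :: "real \<Rightarrow> 'a \<Rightarrow> real"
  assumes m: "(\<lambda>(s, \<omega>). u s \<omega>) \<in> borel_measurable (lborel \<Otimes>\<^sub>M M)" and B: "\<And>s \<omega>. \<bar>u s \<omega>\<bar> \<le> B" and T: "0 \<le> T"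
    and supp: "\<And>s \<omega>. s \<notin> {0..T} \<Longrightarrow> u s \<omega> = 0" and am: "\<And>s. s \<in> {0..T} \<Longrightarrow> ae_meas M F (u s)"
  shows "ae_meas M F (\<lambda>\<omega>. \<integral>s. u s \<omega> \<partial>lborel)"
proof -
  interpret P: pair_sigma_finite lborel M by standard
  define I where "I \<omega> = (\<integral>s. u s \<omega> \<partial>lborel)" for \<omega>
  define E0 where "E0 = real_cond_exp M F I"
  \<comment> \<open>Clamping makes a version of the conditional expectation that is bounded everywhere.\<close>
  define E where "E \<omega> = max (- (B * T)) (min (B * T) (E0 \<omega>))" for \<omega>
  have m': "(\<lambda>(\<omega>, s). u s \<omega>) \<in> borel_measurable (M \<Otimes>\<^sub>M lborel)"
    using measurable_compose[OF measurable_pair_swap' m] by (simp add: split_beta')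
  have Im: "I \<in> borel_measurable M" unfolding I_def[abs_def]
    by (rule lborel.borel_measurable_lebesgue_integral[OF m'])
  have B0: "0 \<le> B" using B[of 0 undefined] by (meson abs_ge_zero order_trans)
  have IB: "\<bar>I \<omega>\<bar> \<le> B * T" for \<omega>
  proof -
    have "\<bar>I \<omega>\<bar> \<le> (\<integral>s. \<bar>u s \<omega>\<bar> \<partial>lborel)"
      unfolding I_def using integral_norm_bound[of lborel "\<lambda>s. u s \<omega>"] by simp
    also have "\<dots> \<le> (\<integral>s. B * indicat_real {0..T} s \<partial>lborel)"
    proof (rule integral_mono')
      show "integrable lborel (\<lambda>s. B * indicat_real {0..T} s)"
        by (intro integrable_mult_right integrable_real_indicator) (use T in \<open>simp_all add: emeasure_lborel_Icc\<close>)
      show "\<bar>u s \<omega>\<bar> \<le> B * indicat_real {0..T} s" for s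
        using B[of s \<omega>] supp[of s \<omega>] by (auto simp: indicator_def)
    qed (use B0 in simp)
    finally have "\<bar>I \<omega>\<bar> \<le> (\<integral>s. B * indicat_real {0..T} s \<partial>lborel)" .
    then show ?thesis using T by simp
  qed
  have Ii: "integrable M I" by (rule integrable_const_bound[where B="B * T"]) (use IB Im in auto)
  have E0F: "E0 \<in> borel_measurable F" unfolding E0_def by simp
  have EF: "E \<in> borel_measurable F" unfolding E_def[abs_def] using E0F by simp
  have EM: "E \<in> borel_measurable M" by (rule measurable_from_subalg[OF subalg EF])
  have E0M: "E0 \<in> borel_measurable M" by (rule measurable_from_subalg[OF subalg E0F])
  have BT: "0 \<le> B * T" using B0 T by simp
  have EB: "\<bar>E \<omega>\<bar> \<le> B * T" for \<omega> using BT by (auto simp: E_def)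
  have E0E: "AE \<omega> in M. E \<omega> = E0 \<omega>"
  proof -
    have l: "I \<omega> \<le> B * T" and g: "- (B * T) \<le> I \<omega>" for \<omega> using IB[of \<omega>] by linarith+
    have "AE \<omega> in M. E0 \<omega> \<le> B * T" unfolding E0_def
      by (rule real_cond_exp_le_c[OF Ii]) (use l in auto)
    moreover have "AE \<omega> in M. E0 \<omega> \<ge> - (B * T)" unfolding E0_def
      by (rule real_cond_exp_ge_c[OF Ii]) (use g in auto)
    ultimately show ?thesis by eventually_elim (simp add: E_def)
  qed
  define h where "h \<omega> = I \<omega> - E \<omega>" for \<omega>
  have hM: "h \<in> borel_measurable M" unfolding h_def[abs_def] using Im EM by simp
  have hB: "\<bar>h \<omega>\<bar> \<le> 2 * (B * T)" for \<omega> using IB[of \<omega>] EB[of \<omega>] by (simp add: h_def)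
  have int: "integrable M (\<lambda>\<omega>. f \<omega> * g \<omega>)" if "f \<in> borel_measurable M" "g \<in> borel_measurable M"
     "AE \<omega> in M. \<bar>f \<omega>\<bar> \<le> a" "AE \<omega> in M. \<bar>g \<omega>\<bar> \<le> b" "0 \<le> a" for f g and a b :: real
  proof (rule integrable_const_bound[where B="a * b"])
    show "AE \<omega> in M. norm (f \<omega> * g \<omega>) \<le> a * b" using that(3,4)
      by eventually_elim (use that(5) in \<open>simp add: abs_mult mult_mono\<close>)
  qed (use that in simp)
  note int' = int[OF _ _ AE_I2 AE_I2]
  have orth: "(\<integral>\<omega>. f \<omega> * h \<omega> \<partial>M) = 0" if f: "f \<in> borel_measurable F" "AE \<omega> in M. \<bar>f \<omega>\<bar> \<le> a" "0 \<le> a" for f a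
  proof -
    have fM: "f \<in> borel_measurable M" by (rule measurable_from_subalg[OF subalg f(1)])
    have i1: "integrable M (\<lambda>\<omega>. f \<omega> * I \<omega>)" by (rule int[OF fM Im f(2) _ f(3)]) (use IB in auto)
    have i2: "integrable M (\<lambda>\<omega>. f \<omega> * E \<omega>)" by (rule int[OF fM EM f(2) _ f(3)]) (use EB in auto)
    have "(\<integral>\<omega>. f \<omega> * E \<omega> \<partial>M) = (\<integral>\<omega>. f \<omega> * E0 \<omega> \<partial>M)"
      by (rule integral_cong_AE) (use fM EM E0M E0E in auto)
    also have "\<dots> = (\<integral>\<omega>. f \<omega> * I \<omega> \<partial>M)"
      unfolding E0_def by (rule real_cond_exp_intg(2)[OF i1 f(1) Im])
    finally have "(\<integral>\<omega>. f \<omega> * E \<omega> \<partial>M) = (\<integral>\<omega>. f \<omega> * I \<omega> \<partial>M)" .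
    then show ?thesis using i1 i2 by (simp add: h_def right_diff_distrib)
  qed
  have hI: "(\<integral>\<omega>. h \<omega> * I \<omega> \<partial>M) = 0"
  proof -
    have jm: "(\<lambda>(s, \<omega>). h \<omega> * u s \<omega>) \<in> borel_measurable (lborel \<Otimes>\<^sub>M M)"
      using borel_measurable_times[OF measurable_compose[OF measurable_snd hM] m] by (simp add: split_beta')
    have ji: "integrable (lborel \<Otimes>\<^sub>M M) (\<lambda>(s, \<omega>). h \<omega> * u s \<omega>)"
    proof (rule integrableI_bounded_set[where A="{0..T} \<times> space M" and B="2 * (B * T) * B"])
      show "emeasure (lborel \<Otimes>\<^sub>M M) ({0..T} \<times> space M) < \<infinity>"
        by (subst emeasure_pair_measure_Times) (auto simp: ennreal_mult_less_top emeasure_eq_measure emeasure_lborel_Icc_eq)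
      show "AE p in lborel \<Otimes>\<^sub>M M. p \<in> {0..T} \<times> space M \<longrightarrow> norm (case p of (s, \<omega>) \<Rightarrow> h \<omega> * u s \<omega>) \<le> 2 * (B * T) * B"
      proof (rule AE_I2, rule impI)
        fix p :: "real \<times> 'a" assume "p \<in> space (lborel \<Otimes>\<^sub>M M)"
        obtain s \<omega> where p: "p = (s, \<omega>)" by force
        have "\<bar>h \<omega>\<bar> * \<bar>u s \<omega>\<bar> \<le> 2 * (B * T) * B" using hB B BT by (intro mult_mono) auto
        then show "norm (case p of (s, \<omega>) \<Rightarrow> h \<omega> * u s \<omega>) \<le> 2 * (B * T) * B" by (simp add: p abs_mult)
      qed
      show "AE p in lborel \<Otimes>\<^sub>M M. p \<notin> {0..T} \<times> space M \<longrightarrow> (case p of (s, \<omega>) \<Rightarrow> h \<omega> * u s \<omega>) = 0"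
      proof (rule AE_I2, rule impI)
        fix p :: "real \<times> 'a" assume sp: "p \<in> space (lborel \<Otimes>\<^sub>M M)" and np: "p \<notin> {0..T} \<times> space M"
        obtain s \<omega> where p: "p = (s, \<omega>)" by force
        have "s \<notin> {0..T}" using sp np p by (auto simp: space_pair_measure)
        then show "(case p of (s, \<omega>) \<Rightarrow> h \<omega> * u s \<omega>) = 0" by (simp add: p supp)
      qed
    qed (use jm in auto)
    have "(\<integral>\<omega>. h \<omega> * I \<omega> \<partial>M) = (\<integral>\<omega>. (\<integral>s. h \<omega> * u s \<omega> \<partial>lborel) \<partial>M)" unfolding I_def by simp
    also have "\<dots> = (\<integral>s. (\<integral>\<omega>. h \<omega> * u s \<omega> \<partial>M) \<partial>lborel)" by (rule P.Fubini_integral[OF ji])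
    also have "\<dots> = (\<integral>(s::real). 0 \<partial>lborel)"
    proof (rule Bochner_Integration.integral_cong[OF refl])
      fix s :: real
      show "(\<integral>\<omega>. h \<omega> * u s \<omega> \<partial>M) = 0"
      proof (cases "s \<in> {0..T}")
        case True
        from am[OF True] obtain g where g: "g \<in> borel_measurable F" "AE \<omega> in M. u s \<omega> = g \<omega>" by (auto simp: ae_meas_def)
        have us: "u s \<in> borel_measurable M" using measurable_Pair2[OF m, of s] by simp
        have gM: "g \<in> borel_measurable M" by (rule measurable_from_subalg[OF subalg g(1)])
        have gB: "AE \<omega> in M. \<bar>g \<omega>\<bar> \<le> B" using g(2)
        proof eventually_elim
          case (elim \<omega>) then show ?case using B[of s \<omega>] by simp
        qed
        have "(\<integral>\<omega>. h \<omega> * u s \<omega> \<partial>M) = (\<integral>\<omega>. g \<omega> * h \<omega> \<partial>M)"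
          by (rule integral_cong_AE) (use hM us gM g(2) in auto)
        also have "\<dots> = 0" by (rule orth[OF g(1) gB B0])
        finally show ?thesis .
      qed (simp add: supp)
    qed
    finally show ?thesis by simp
  qed
  have hE: "(\<integral>\<omega>. h \<omega> * E \<omega> \<partial>M) = 0"
    using orth[OF EF AE_I2[OF EB] BT] by (simp add: mult.commute)
  have "(\<integral>\<omega>. h \<omega> * h \<omega> \<partial>M) = (\<integral>\<omega>. h \<omega> * I \<omega> - h \<omega> * E \<omega> \<partial>M)"
    by (simp add: h_def algebra_simps)
  also have "\<dots> = 0"
  proof (subst Bochner_Integration.integral_diff)
    show "integrable M (\<lambda>\<omega>. h \<omega> * I \<omega>)" by (rule int'[OF hM Im hB IB]) (use BT in simp)
    show "integrable M (\<lambda>\<omega>. h \<omega> * E \<omega>)" by (rule int'[OF hM EM hB EB]) (use BT in simp)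
  qed (simp add: hI hE)
  finally have "AE \<omega> in M. h \<omega> * h \<omega> = 0"
    using int'[OF hM hM hB hB] BT by (subst (asm) integral_nonneg_eq_0_iff_AE) auto
  then have "AE \<omega> in M. (\<integral>s. u s \<omega> \<partial>lborel) = E \<omega>" by eventually_elim (simp add: h_def I_def)
  then show ?thesis by (rule ae_measI[OF EF])
qed

end

section \<open>Joint measurability in time and chance\<close>

text \<open>Approximate the time from below on the grid of mesh \<open>1/(n+1)\<close>, where only countably many functions occur.\<close>

lemma joint_measurable_continuous:
  fixes Y :: "real \<Rightarrow> 'a \<Rightarrow> 'b::euclidean_space"
  assumes Y: "\<And>t. t \<ge> 0 \<Longrightarrow> Y t \<in> borel_measurable M" and c: "\<And>\<omega>. \<omega> \<in> space M \<Longrightarrow> continuous_on {0..} (\<lambda>t. Y t \<omega>)"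
  shows "(\<lambda>(t, \<omega>). Y t \<omega>) \<in> borel_measurable (restrict_space borel {0..} \<Otimes>\<^sub>M M)"
proof (rule borel_measurable_LIMSEQ_metric)
  let ?N = "restrict_space borel {0..} \<Otimes>\<^sub>M M"
  let ?r = "\<lambda>n (t::real). real (nat \<lfloor>real (Suc n) * t\<rfloor>) / real (Suc n)"
  show "(\<lambda>(t, \<omega>). Y (?r n t) \<omega>) \<in> borel_measurable ?N" for n
  proof -
    have f: "(\<lambda>p. Y (real i / real (Suc n)) (snd p)) \<in> borel_measurable ?N" for i :: nat
      by (rule measurable_compose[OF measurable_snd Y]) simp
    have fl: "(\<lambda>t::real. nat \<lfloor>real (Suc n) * t\<rfloor>) \<in> measurable borel (count_space UNIV)" by measurable
    have "(\<lambda>p. nat \<lfloor>real (Suc n) * fst p\<rfloor>) \<in> measurable ?N (count_space UNIV)"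
      by (rule measurable_compose[OF measurable_fst measurable_restrict_space1[OF fl]])
    from measurable_compose_countable[OF f this] show ?thesis by (simp add: split_beta')
  qed
  fix p :: "real \<times> 'a" assume "p \<in> space ?N"
  then obtain t \<omega> where p: "p = (t, \<omega>)" "0 \<le> t" "\<omega> \<in> space M" by (auto simp: space_pair_measure space_restrict_space)
  have "(\<lambda>n. ?r n t) \<longlonglongrightarrow> t"
  proof -
    have b: "\<bar>?r n t - t\<bar> \<le> 1 / real (Suc n)" for n
    proof -
      have k: "real (nat \<lfloor>real (Suc n) * t\<rfloor>) = of_int \<lfloor>real (Suc n) * t\<rfloor>" using p(2) by simp
      have "\<bar>real (nat \<lfloor>real (Suc n) * t\<rfloor>) - real (Suc n) * t\<bar> \<le> 1" unfolding k by linarith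
      then have "\<bar>real (nat \<lfloor>real (Suc n) * t\<rfloor>) - real (Suc n) * t\<bar> / real (Suc n) \<le> 1 / real (Suc n)" by (intro divide_right_mono) auto
      moreover have "?r n t - t = (real (nat \<lfloor>real (Suc n) * t\<rfloor>) - real (Suc n) * t) / real (Suc n)"
        by (simp add: diff_divide_distrib del: of_nat_Suc)
      ultimately show ?thesis by (simp only: abs_divide abs_of_nat)
    qed
    have "(\<lambda>n. ?r n t - t) \<longlonglongrightarrow> 0"
      by (rule Lim_null_comparison[OF always_eventually[OF allI[OF b[folded real_norm_def]]]])
        (use LIMSEQ_inverse_real_of_nat in \<open>simp only: inverse_eq_divide\<close>)
    then show ?thesis by (simp add: LIM_zero_iff)
  qed
  then have "(\<lambda>n. Y (?r n t) \<omega>) \<longlonglongrightarrow> Y t \<omega>"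
    using p by (intro continuous_on_tendsto_compose[OF c[OF p(3)]]) auto
  then show "(\<lambda>n. case p of (t, \<omega>) \<Rightarrow> Y (?r n t) \<omega>) \<longlonglongrightarrow> (case p of (t, \<omega>) \<Rightarrow> Y t \<omega>)" by (simp add: p)
qed

lemma joint_measurable_extend:
  fixes y :: "real \<Rightarrow> 'a \<Rightarrow> 'b::topological_space"
  assumes "(\<lambda>(s, \<omega>). y s \<omega>) \<in> borel_measurable (restrict_space borel {0..} \<Otimes>\<^sub>M M)"
  shows "(\<lambda>(s, \<omega>). y (max 0 s) \<omega>) \<in> borel_measurable (lborel \<Otimes>\<^sub>M M)"
proof -
  have "(\<lambda>p. max 0 (fst p) :: real) \<in> measurable (borel \<Otimes>\<^sub>M M) (restrict_space borel {0..})"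
    by (rule measurable_restrict_space2) auto
  from measurable_compose[OF measurable_Pair[OF this measurable_snd] assms]
  have "(\<lambda>(s, \<omega>). y (max 0 s) \<omega>) \<in> borel_measurable (borel \<Otimes>\<^sub>M M)" by (simp add: split_beta')
  moreover have "sets (lborel \<Otimes>\<^sub>M M) = sets ((borel :: real measure) \<Otimes>\<^sub>M M)" by (rule sets_pair_measure_cong) auto
  ultimately show ?thesis using measurable_cong_sets by blast
qed

text \<open>Reduction to the bounded case by truncating the components. The value at a negative time is irrelevant; it is
replaced by the value at 0 to stay in the domain of joint measurability.\<close>

lemma (in finite_measure_subalgebra) section_integral_ae_meas:
  fixes y :: "real \<Rightarrow> 'a \<Rightarrow> real^'n"
  assumes m: "(\<lambda>(s, \<omega>). y s \<omega>) \<in> borel_measurable (restrict_space borel {0..} \<Otimes>\<^sub>M M)" and T: "0 \<le> T"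
    and am: "\<And>s. s \<in> {0..T} \<Longrightarrow> ae_meas M F (y s)"
    and int: "AE \<omega> in M. set_integrable lborel {0..T} (\<lambda>s. y s \<omega>)"
  shows "ae_meas M F (\<lambda>\<omega>. LINT s:{0..T}|lborel. y s \<omega>)"
proof (rule ae_meas_lim)
  define \<phi> :: "nat \<Rightarrow> real \<Rightarrow> real" where "\<phi> n x = (if \<bar>x\<bar> \<le> real n then x else 0)" for n x
  have \<phi>m: "\<phi> n \<in> borel_measurable borel" for n unfolding \<phi>_def[abs_def] by measurable
  define u where "u n i s \<omega> = indicat_real {0..T} s * \<phi> n (y (max 0 s) \<omega> $ i)" for n i s \<omega>
  show "ae_meas M F (\<lambda>\<omega>. \<chi> i. \<integral>s. u n i s \<omega> \<partial>lborel)" for n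
  proof (rule ae_meas_vecI, simp, rule bounded_section_integral_ae_meas[where B="real n", OF _ _ T])
    fix i
    have "(\<lambda>p. \<phi> n (y (max 0 (fst p)) (snd p) $ i)) \<in> borel_measurable (lborel \<Otimes>\<^sub>M M)"
      using measurable_compose[OF measurable_compose[OF joint_measurable_extend[OF m] borel_measurable_nth] \<phi>m]
      by (simp add: split_beta')
    then have "(\<lambda>p. indicat_real {0..T} (fst p) * \<phi> n (y (max 0 (fst p)) (snd p) $ i)) \<in> borel_measurable (lborel \<Otimes>\<^sub>M M)"
      by (intro borel_measurable_times measurable_compose[OF measurable_fst]) auto
    then show "(\<lambda>(s, \<omega>). u n i s \<omega>) \<in> borel_measurable (lborel \<Otimes>\<^sub>M M)" by (simp add: u_def split_beta')
    show "\<bar>u n i s \<omega>\<bar> \<le> real n" for s \<omega> by (auto simp: u_def \<phi>_def indicator_def)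
    show "u n i s \<omega> = 0" if "s \<notin> {0..T}" for s \<omega> using that by (simp add: u_def)
    fix s assume s: "s \<in> {0..T}"
    from am[OF s] obtain g where g: "g \<in> borel_measurable F" "AE \<omega> in M. y s \<omega> = g \<omega>" by (auto simp: ae_meas_def)
    have "(\<lambda>\<omega>. \<phi> n (g \<omega> $ i)) \<in> borel_measurable F"
      by (rule measurable_compose[OF measurable_compose[OF g(1) borel_measurable_nth] \<phi>m])
    moreover have "AE \<omega> in M. u n i s \<omega> = \<phi> n (g \<omega> $ i)" using g(2)
      by eventually_elim (use s in \<open>simp add: u_def max_def\<close>)
    ultimately show "ae_meas M F (u n i s)" by (rule ae_measI)
  qed
  show "AE \<omega> in M. (\<lambda>n. \<chi> i. \<integral>s. u n i s \<omega> \<partial>lborel) \<longlonglongrightarrow> (LINT s:{0..T}|lborel. y s \<omega>)"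
    using int
  proof eventually_elim
    case (elim \<omega>)
    show ?case
    proof (rule vec_tendstoI, simp)
      fix i
      have lin: "bounded_linear (\<lambda>x::real^'n. x $ i)" by (rule bounded_linear_vec_nth)
      note L = LINT_bounded_linear[OF lin elim]
      have eq: "u n i s \<omega> = indicat_real {0..T} s * \<phi> n (y s \<omega> $ i)" for n s by (auto simp: u_def indicator_def max_def)
      have yi: "integrable lborel (\<lambda>s. indicat_real {0..T} s * (y s \<omega> $ i))" using L(2) by (simp add: set_integrable_def)
      have "(\<lambda>n. \<integral>s. u n i s \<omega> \<partial>lborel) \<longlonglongrightarrow> (\<integral>s. indicat_real {0..T} s * (y s \<omega> $ i) \<partial>lborel)"
      proof (rule integral_dominated_convergence[where w="\<lambda>s. \<bar>indicat_real {0..T} s * (y s \<omega> $ i)\<bar>"])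
        show "(\<lambda>s. indicat_real {0..T} s * (y s \<omega> $ i)) \<in> borel_measurable lborel" using yi by (rule borel_measurable_integrable)
        have eq2: "u n i s \<omega> = \<phi> n (indicat_real {0..T} s * (y s \<omega> $ i))" for n s by (auto simp: eq indicator_def \<phi>_def)
        show "(\<lambda>s. u n i s \<omega>) \<in> borel_measurable lborel" for n
          unfolding eq2 by (rule measurable_compose[OF borel_measurable_integrable[OF yi] \<phi>m])
        show "integrable lborel (\<lambda>s. \<bar>indicat_real {0..T} s * (y s \<omega> $ i)\<bar>)" using yi by (rule integrable_abs)
        show "AE s in lborel. norm (u n i s \<omega>) \<le> \<bar>indicat_real {0..T} s * (y s \<omega> $ i)\<bar>" for n
          by (rule AE_I2) (simp add: eq2 \<phi>_def)
        show "AE s in lborel. (\<lambda>n. u n i s \<omega>) \<longlonglongrightarrow> indicat_real {0..T} s * (y s \<omega> $ i)"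
        proof (rule AE_I2)
          fix s
          obtain N :: nat where "\<bar>indicat_real {0..T} s * (y s \<omega> $ i)\<bar> \<le> real N" using real_arch_simple by blast
          then show "(\<lambda>n. u n i s \<omega>) \<longlonglongrightarrow> indicat_real {0..T} s * (y s \<omega> $ i)"
            unfolding eq2 by (intro tendsto_eventually eventually_sequentiallyI[of N]) (auto simp: \<phi>_def)
        qed
      qed
      then show "(\<lambda>n. \<integral>s. u n i s \<omega> \<partial>lborel) \<longlonglongrightarrow> (LINT s:{0..T}|lborel. y s \<omega>) $ i"
        using L(1) by (simp add: set_lebesgue_integral_def)
    qed
  qed
qed

text \<open>Fubini's theorem for null sets: almost sure equality at each time gives equality at almost all times, almost surely.\<close>

lemma (in prob_space) AE_sections_eq:
  fixes y z :: "real \<Rightarrow> 'a \<Rightarrow> real^'n"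
  assumes y: "(\<lambda>(s, \<omega>). y s \<omega>) \<in> borel_measurable (restrict_space borel {0..} \<Otimes>\<^sub>M M)"
    and z: "(\<lambda>(s, \<omega>). z s \<omega>) \<in> borel_measurable (restrict_space borel {0..} \<Otimes>\<^sub>M M)"
    and eq: "\<And>s. 0 \<le> s \<Longrightarrow> AE \<omega> in M. y s \<omega> = z s \<omega>"
  shows "AE \<omega> in M. AE s in lborel. 0 \<le> s \<longrightarrow> y s \<omega> = z s \<omega>"
proof -
  interpret P: pair_sigma_finite lborel M by standard
  have [measurable]: "(\<lambda>p. y (max 0 (fst p)) (snd p)) \<in> borel_measurable (lborel \<Otimes>\<^sub>M M)"
    "(\<lambda>p. z (max 0 (fst p)) (snd p)) \<in> borel_measurable (lborel \<Otimes>\<^sub>M M)"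
    using joint_measurable_extend[OF y] joint_measurable_extend[OF z] by (simp_all add: split_beta')
  have "AE s in lborel. AE \<omega> in M. y (max 0 s) \<omega> = z (max 0 s) \<omega>"
  proof (rule AE_I2)
    fix s :: real show "AE \<omega> in M. y (max 0 s) \<omega> = z (max 0 s) \<omega>" using eq[of "max 0 s"] by simp
  qed
  moreover have "{p \<in> space (lborel \<Otimes>\<^sub>M M). y (max 0 (fst p)) (snd p) = z (max 0 (fst p)) (snd p)} \<in> sets (lborel \<Otimes>\<^sub>M M)"
    by measurable
  ultimately have "AE \<omega> in M. AE s in lborel. y (max 0 s) \<omega> = z (max 0 s) \<omega>"
    using P.AE_commute[of "\<lambda>s \<omega>. y (max 0 s) \<omega> = z (max 0 s) \<omega>"] by simp
  then show ?thesis
  proof eventually_elim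
    case (elim \<omega>) then show ?case by eventually_elim (auto simp: max_def)
  qed
qed

lemma (in prob_space) indep_sets_three_one:
  assumes ind: "indep_sets (\<lambda>i. [A0, A1, A2, A3] ! i) {..<4::nat}"
    and stable: "Int_stable A0" "Int_stable A1" "Int_stable A2" "Int_stable A3"
    and A: "A \<in> sigma_sets (space M) (A0 \<union> A1 \<union> A2)" and B: "B \<in> A3"
  shows "prob (A \<inter> B) = prob A * prob B"
proof -
  let ?E = "\<lambda>i. [A0, A1, A2, A3] ! i"
  define I where "I b = (if b then {0, 1, 2} else {3::nat})" for b :: bool
  have "indep_sets (\<lambda>b. sigma_sets (space M) (\<Union>i\<in>I b. ?E i)) UNIV"
  proof (rule indep_sets_collect_sigma)
    have "(\<Union>b\<in>UNIV. I b) = {..<4::nat}" by (auto simp: I_def UNIV_bool)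
    then show "indep_sets ?E (\<Union>b\<in>UNIV. I b)" using ind by simp
    show "Int_stable (?E i)" if "i \<in> I b" for b i using that stable by (auto simp: I_def split: if_splits)
    show "disjoint_family_on I UNIV" by (auto simp: disjoint_family_on_def I_def)
  qed
  then have "prob (\<Inter>b\<in>UNIV. if b then A else B) = (\<Prod>b\<in>UNIV. prob (if b then A else B))"
  proof (rule indep_setsD)
    have "(\<Union>i\<in>I True. ?E i) = A0 \<union> A1 \<union> A2" "(\<Union>i\<in>I False. ?E i) = A3" by (auto simp: I_def)
    then show "\<forall>b\<in>UNIV. (if b then A else B) \<in> sigma_sets (space M) (\<Union>i\<in>I b. ?E i)"
      using A B by (auto simp: UNIV_bool)
  qed auto
  then show ?thesis by (simp add: UNIV_bool mult.commute Int_commute)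
qed

text \<open>The bound holds for Riemann sums by the triangle inequality and passes to the integral by Fatou's lemma. In this
way the process enters only through its values at single times and the continuity of its paths.\<close>

lemma nn_integral_norm_LINT_le:
  fixes H :: "real \<Rightarrow> 'c::euclidean_space" and y :: "real \<Rightarrow> 'a \<Rightarrow> 'd::euclidean_space"
    and prod :: "'c \<Rightarrow> 'd \<Rightarrow> 'e::euclidean_space"
  assumes bil: "bounded_bilinear prod" and le: "\<And>u v. norm (prod u v) \<le> norm u * norm v"
    and T: "0 \<le> T" and H: "set_integrable lborel {0..T} H"
    and y: "\<And>s. s \<in> {0..T} \<Longrightarrow> y s \<in> borel_measurable M"
    and c: "\<And>s. s \<in> {0..T} \<Longrightarrow> (\<integral>\<^sup>+\<omega>. ennreal (norm (y s \<omega>)) \<partial>M) \<le> ennreal b" and b: "0 \<le> b"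
    and cont: "AE \<omega> in M. continuous_on {0..T} (\<lambda>s. y s \<omega>)"
  shows "(\<integral>\<^sup>+\<omega>. ennreal (norm (LINT s:{0..T}|lborel. prod (H s) (y s \<omega>))) \<partial>M) \<le> ennreal ((LINT s:{0..T}|lborel. norm (H s)) * b)"
proof -
  interpret bounded_bilinear prod by (rule bil)
  define g :: "nat \<Rightarrow> nat \<Rightarrow> real" where "g = (\<lambda>n i. real i * (T / real (Suc n)))"
  have g: "g n i \<in> {0..T}" if "i \<le> Suc n" for n i
  proof -
    have "real i * T \<le> real (Suc n) * T" using that T by (intro mult_right_mono) auto
    then show ?thesis using T by (simp add: g_def field_simps)
  qed
  have gle: "g n i \<le> g n (Suc i)" for n i unfolding g_def using T by (intro mult_right_mono) auto
  define h where "h n i = (LINT s:{g n i..g n (Suc i)}|lborel. H s)" for n i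
  define S where "S n \<omega> = (\<Sum>i<Suc n. prod (h n i) (y (g n i) \<omega>))" for n \<omega>
  have Sm: "S n \<in> borel_measurable M" for n unfolding S_def[abs_def]
    by (intro borel_measurable_sum borel_measurable_continuous_on[OF linear_continuous_on[OF bounded_linear_right]] y g) auto
  have lim: "AE \<omega> in M. (\<lambda>n. S n \<omega>) \<longlonglongrightarrow> (LINT s:{0..T}|lborel. prod (H s) (y s \<omega>))"
    using cont
  proof eventually_elim
    case (elim \<omega>)
    show ?case unfolding S_def h_def g_def
      by (rule riemann_sum_bilinear[OF bil T H elim]) (use gle in \<open>simp add: g_def\<close>)
  qed
  have hN: "norm (h n i) \<le> (LINT s:{g n i..g n (Suc i)}|lborel. norm (H s))" if "i < Suc n" for n i
    unfolding h_def by (rule set_integral_norm_bound, rule set_integrable_sub_interval[OF H]) (use g[of i n] g[of "Suc i" n] that in auto)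
  have sumN: "(\<Sum>i<Suc n. LINT s:{g n i..g n (Suc i)}|lborel. norm (H s)) = (LINT s:{0..T}|lborel. norm (H s))" for n
  proof -
    have hT: "real (Suc n) * (T / real (Suc n)) = T" by simp
    have "set_integrable lborel {0..real (Suc n) * (T / real (Suc n))} (\<lambda>s. norm (H s))"
      unfolding hT by (rule set_integrable_norm[OF H])
    from LINT_grid[OF _ this] T show ?thesis unfolding g_def hT by simp
  qed
  have bound: "(\<integral>\<^sup>+\<omega>. ennreal (norm (S n \<omega>)) \<partial>M) \<le> ennreal ((LINT s:{0..T}|lborel. norm (H s)) * b)" for n
  proof -
    have "(\<integral>\<^sup>+\<omega>. ennreal (norm (S n \<omega>)) \<partial>M) \<le> (\<integral>\<^sup>+\<omega>. (\<Sum>i<Suc n. ennreal (norm (h n i)) * ennreal (norm (y (g n i) \<omega>))) \<partial>M)"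
    proof (rule nn_integral_mono)
      fix \<omega>
      have "norm (S n \<omega>) \<le> (\<Sum>i<Suc n. norm (h n i) * norm (y (g n i) \<omega>))"
        unfolding S_def by (rule sum_norm_le) (rule le)
      then have "ennreal (norm (S n \<omega>)) \<le> ennreal (\<Sum>i<Suc n. norm (h n i) * norm (y (g n i) \<omega>))" by (rule ennreal_leI)
      also have "\<dots> = (\<Sum>i<Suc n. ennreal (norm (h n i) * norm (y (g n i) \<omega>)))" by (rule sum_ennreal[symmetric]) simp
      also have "\<dots> = (\<Sum>i<Suc n. ennreal (norm (h n i)) * ennreal (norm (y (g n i) \<omega>)))" by (intro sum.cong refl ennreal_mult) auto
      finally show "ennreal (norm (S n \<omega>)) \<le> (\<Sum>i<Suc n. ennreal (norm (h n i)) * ennreal (norm (y (g n i) \<omega>)))" .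
    qed
    also have "\<dots> = (\<Sum>i<Suc n. \<integral>\<^sup>+\<omega>. ennreal (norm (h n i)) * ennreal (norm (y (g n i) \<omega>)) \<partial>M)"
    proof (rule nn_integral_sum)
      fix i assume "i \<in> {..<Suc n}"
      then have [measurable]: "y (g n i) \<in> borel_measurable M" by (intro y g) auto
      show "(\<lambda>\<omega>. ennreal (norm (h n i)) * ennreal (norm (y (g n i) \<omega>))) \<in> borel_measurable M" by measurable
    qed
    also have "\<dots> \<le> (\<Sum>i<Suc n. ennreal ((LINT s:{g n i..g n (Suc i)}|lborel. norm (H s)) * b))"
    proof (rule sum_mono)
      fix i assume i: "i \<in> {..<Suc n}"
      then have [measurable]: "y (g n i) \<in> borel_measurable M" by (intro y g) auto
      have "(\<integral>\<^sup>+\<omega>. ennreal (norm (h n i)) * ennreal (norm (y (g n i) \<omega>)) \<partial>M) = ennreal (norm (h n i)) * (\<integral>\<^sup>+\<omega>. ennreal (norm (y (g n i) \<omega>)) \<partial>M)"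
        by (rule nn_integral_cmult) measurable
      also have "\<dots> \<le> ennreal (LINT s:{g n i..g n (Suc i)}|lborel. norm (H s)) * ennreal b"
        using i g[of i n] by (intro mult_mono ennreal_leI hN c) auto
      also have "\<dots> = ennreal ((LINT s:{g n i..g n (Suc i)}|lborel. norm (H s)) * b)"
        using order_trans[OF norm_ge_zero hN[of i n]] i by (subst ennreal_mult''[symmetric]) (auto simp: b)
      finally show "(\<integral>\<^sup>+\<omega>. ennreal (norm (h n i)) * ennreal (norm (y (g n i) \<omega>)) \<partial>M) \<le> ennreal ((LINT s:{g n i..g n (Suc i)}|lborel. norm (H s)) * b)" .
    qed
    also have "\<dots> = ennreal (\<Sum>i<Suc n. (LINT s:{g n i..g n (Suc i)}|lborel. norm (H s)) * b)"
    proof (rule sum_ennreal)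
      fix i assume "i \<in> {..<Suc n}"
      then have "0 \<le> (LINT s:{g n i..g n (Suc i)}|lborel. norm (H s))" using order_trans[OF norm_ge_zero hN[of i n]] by simp
      then show "0 \<le> (LINT s:{g n i..g n (Suc i)}|lborel. norm (H s)) * b" using b by simp
    qed
    also have "(\<Sum>i<Suc n. (LINT s:{g n i..g n (Suc i)}|lborel. norm (H s)) * b) = (LINT s:{0..T}|lborel. norm (H s)) * b"
      by (simp only: sum_distrib_right[symmetric] sumN)
    finally show ?thesis .
  qed
  have "(\<integral>\<^sup>+\<omega>. ennreal (norm (LINT s:{0..T}|lborel. prod (H s) (y s \<omega>))) \<partial>M) = (\<integral>\<^sup>+\<omega>. liminf (\<lambda>n. ennreal (norm (S n \<omega>))) \<partial>M)"
  proof (rule nn_integral_cong_AE, use lim in eventually_elim)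
    fix \<omega> assume "(\<lambda>n. S n \<omega>) \<longlonglongrightarrow> (LINT s:{0..T}|lborel. prod (H s) (y s \<omega>))"
    then have "(\<lambda>n. ennreal (norm (S n \<omega>))) \<longlonglongrightarrow> ennreal (norm (LINT s:{0..T}|lborel. prod (H s) (y s \<omega>)))"
      by (intro tendsto_ennrealI tendsto_norm)
    then show "ennreal (norm (LINT s:{0..T}|lborel. prod (H s) (y s \<omega>))) = liminf (\<lambda>n. ennreal (norm (S n \<omega>)))"
      by (intro lim_imp_Liminf[symmetric]) (rule trivial_limit_sequentially)
  qed
  also have "\<dots> \<le> liminf (\<lambda>n. \<integral>\<^sup>+\<omega>. ennreal (norm (S n \<omega>)) \<partial>M)"
    by (rule nn_integral_liminf) (use Sm in measurable)
  also have "\<dots> \<le> ennreal ((LINT s:{0..T}|lborel. norm (H s)) * b)"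
    by (intro Liminf_le always_eventually allI bound) simp
  finally show ?thesis .
qed

lemma space_augmented [simp]: "space (augmented_filtration M x0 Z t) = space M"
  unfolding augmented_filtration_def
  by (rule space_measure_of) (use sets.space_closed[of "gen_sigma M {()} (\<lambda>_. x0)"] sets.space_closed[of "gen_sigma M {0..t} Z"] sets.space_closed[of M] in \<open>auto\<close>)

lemma sets_augmented:
  "sets (augmented_filtration M x0 Z t) =
    sigma_sets (space M) (sets (gen_sigma M {()} (\<lambda>_. x0)) \<union> sets (gen_sigma M {0..t} Z) \<union> null_sets M)"
  unfolding augmented_filtration_def
  by (rule sets_measure_of) (use sets.space_closed[of "gen_sigma M {()} (\<lambda>_. x0)"] sets.space_closed[of "gen_sigma M {0..t} Z"] sets.space_closed[of M] in \<open>auto\<close>)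

text \<open>The null sets of \<open>M\<close>, which the augmented filtration contains, absorb the exceptional set.\<close>

lemma ae_meas_imp_augmented:
  assumes f: "f \<in> borel_measurable M" and am: "ae_meas M (gen_sigma M {0..t} Z) f" and sub: "subalgebra M (gen_sigma M {0..t} Z)"
  shows "(f :: 'a \<Rightarrow> real^'n) \<in> borel_measurable (augmented_filtration M x0 Z t)"
proof (rule measurableI)
  from am obtain g where g: "g \<in> borel_measurable (gen_sigma M {0..t} Z)" "AE \<omega> in M. f \<omega> = g \<omega>" by (auto simp: ae_meas_def)
  have gM: "g \<in> borel_measurable M" by (rule measurable_from_subalg[OF sub g(1)])
  define D where "D = {\<omega> \<in> space M. f \<omega> \<noteq> g \<omega>}"
  have Dm: "D \<in> sets M" unfolding D_def using f gM by measurable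
  have D: "D \<in> null_sets M" using g(2) Dm unfolding D_def by (simp add: AE_iff_null_sets[OF Dm[unfolded D_def]] AE_iff_measurable null_sets_def)
  fix S :: "(real^'n) set" assume S: "S \<in> sets borel"
  have 1: "g -` S \<inter> space M \<in> sets (augmented_filtration M x0 Z t)"
    using measurable_sets[OF g(1) S] unfolding sets_augmented by (intro sigma_sets.Basic) simp
  have 2: "D \<in> sets (augmented_filtration M x0 Z t)" unfolding sets_augmented using D by (intro sigma_sets.Basic) simp
  have "f -` S \<inter> space M \<inter> D \<in> null_sets M"
    by (rule null_sets_subset[OF D]) (use measurable_sets[OF f S] Dm in auto)
  then have 3: "f -` S \<inter> space M \<inter> D \<in> sets (augmented_filtration M x0 Z t)" unfolding sets_augmented by (intro sigma_sets.Basic) simp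
  have eq: "f -` S \<inter> space M = (g -` S \<inter> space M - D) \<union> (f -` S \<inter> space M \<inter> D)" by (auto simp: D_def)
  show "f -` S \<inter> space (augmented_filtration M x0 Z t) \<in> sets (augmented_filtration M x0 Z t)"
    unfolding space_augmented by (subst eq) (intro sets.Un sets.Diff 1 2 3)
qed simp

text \<open>Replacing the exceptional paths by zero gives a process for which \<open>joint_measurable_continuous\<close> applies.\<close>

lemma continuous_modification:
  fixes Y :: "real \<Rightarrow> 'a \<Rightarrow> 'b::euclidean_space"
  assumes Y: "\<And>t. t \<ge> 0 \<Longrightarrow> Y t \<in> borel_measurable M" and c: "AE \<omega> in M. continuous_on {0..} (\<lambda>t. Y t \<omega>)"
  obtains Y' where "\<And>t. t \<ge> 0 \<Longrightarrow> Y' t \<in> borel_measurable M" "\<And>\<omega>. \<omega> \<in> space M \<Longrightarrow> continuous_on {0..} (\<lambda>t. Y' t \<omega>)"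
    "AE \<omega> in M. \<forall>t. Y' t \<omega> = Y t \<omega>"
    "(\<lambda>(t, \<omega>). Y' t \<omega>) \<in> borel_measurable (restrict_space borel {0..} \<Otimes>\<^sub>M M)"
proof -
  from AE_E3[OF c] obtain N where N: "\<And>\<omega>. \<omega> \<in> space M - N \<Longrightarrow> continuous_on {0..} (\<lambda>t. Y t \<omega>)" "N \<in> null_sets M" by blast
  define Y' where "Y' t \<omega> = (if \<omega> \<in> N then 0 else Y t \<omega>)" for t \<omega>
  have Nm: "N \<in> sets M" using N(2) by auto
  have m: "Y' t \<in> borel_measurable M" if "t \<ge> 0" for t unfolding Y'_def[abs_def]
    by (rule measurable_If_set) (use Y[OF that] Nm in auto)
  have c': "continuous_on {0..} (\<lambda>t. Y' t \<omega>)" if "\<omega> \<in> space M" for \<omega>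
    using N(1)[of \<omega>] that by (cases "\<omega> \<in> N") (simp_all add: Y'_def)
  have "AE \<omega> in M. \<forall>t. Y' t \<omega> = Y t \<omega>" using AE_not_in[OF N(2)] by eventually_elim (simp add: Y'_def)
  from that[OF m c' this joint_measurable_continuous[OF m c']] show ?thesis .
qed

lemma set_borel_measurable_halfline:
  fixes f :: "real \<Rightarrow> 'b::euclidean_space"
  assumes "\<And>T. T \<ge> 0 \<Longrightarrow> set_borel_measurable lborel {0..T} f"
  shows "f \<in> borel_measurable (restrict_space borel {0..})"
proof -
  have "(\<lambda>t. indicat_real {0..} t *\<^sub>R f t) \<in> borel_measurable borel"
  proof (rule borel_measurable_LIMSEQ_metric)
    show "(\<lambda>t. indicat_real {0..real n} t *\<^sub>R f t) \<in> borel_measurable borel" for n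
      using assms[of "real n"] by (simp add: set_borel_measurable_def)
    fix t :: real
    obtain N :: nat where "t \<le> real N" using real_arch_simple by blast
    then have "\<forall>\<^sub>F n in sequentially. indicat_real {0..real n} t *\<^sub>R f t = indicat_real {0..} t *\<^sub>R f t"
      by (intro eventually_sequentiallyI[of N]) (auto simp: indicator_def)
    then show "(\<lambda>n. indicat_real {0..real n} t *\<^sub>R f t) \<longlonglongrightarrow> indicat_real {0..} t *\<^sub>R f t"
      by (rule tendsto_eventually)
  qed
  then show ?thesis by (simp add: borel_measurable_restrict_space_iff)
qed

lemma set_integrable_imp_measurable: "set_integrable M S f \<Longrightarrow> set_borel_measurable M S f"
  unfolding set_integrable_def set_borel_measurable_def by (rule borel_measurable_integrable)

section \<open>Transition matrices\<close>

text \<open>\<open>\<Phi>\<close> is the transition matrix of the adjoint equation \<open>p' = - F\<^sup>T p\<close>. The transposes \<open>V t = \<Phi>(0;t)\<^sup>T\<close> and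
\<open>P t = \<Phi>(t;0)\<^sup>T\<close> are inverse to each other, and \<open>V\<close> is the transition matrix of \<open>x' = F x\<close> from time 0.\<close>

locale adjoint_flow =
  fixes F :: "real \<Rightarrow> real^'d^'d" and \<Phi> :: "real \<Rightarrow> real \<Rightarrow> real^'d^'d"
  assumes F_int: "\<And>T. T \<ge> 0 \<Longrightarrow> set_integrable lborel {0..T} F"
    and id: "\<And>\<tau>. \<tau> \<ge> 0 \<Longrightarrow> \<Phi> \<tau> \<tau> = mat 1"
    and der: "\<And>t \<tau>. t \<ge> 0 \<Longrightarrow> \<tau> \<ge> 0 \<Longrightarrow>
        ((\<lambda>t. \<Phi> t \<tau>) has_vector_derivative - transpose (F t) ** \<Phi> t \<tau>) (at t within {0..})"
begin

definition "V t = transpose (\<Phi> 0 t)"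
definition "P t = transpose (\<Phi> t 0)"

lemma cont_\<Phi>: "\<tau> \<ge> 0 \<Longrightarrow> continuous_on {0..} (\<lambda>t. \<Phi> t \<tau>)"
  using der has_vector_derivative_continuous by (fastforce simp: continuous_on_eq_continuous_within)

text \<open>Both sides solve the same linear equation in \<open>t\<close> and agree at \<open>t = 0\<close>, so that uniqueness forward in time
is enough, for \<open>t < \<tau>\<close> as well. With \<open>t = \<tau>\<close> it says that \<open>\<Phi>(\<tau>;0)\<close> and \<open>\<Phi>(0;\<tau>)\<close> are inverse to each other.\<close>

lemma factor:
  assumes t: "t \<ge> 0" and \<tau>: "\<tau> \<ge> 0"
  shows "\<Phi> t \<tau> = \<Phi> t 0 ** \<Phi> 0 \<tau>"
proof -
  define D where "D t = \<Phi> t \<tau> - \<Phi> t 0 ** \<Phi> 0 \<tau>" for t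
  have D': "(D has_vector_derivative - transpose (F s) ** D s) (at s within {0..t})" if "s \<in> {0..t}" for s
  proof -
    have s: "0 \<le> s" using that by simp
    have "((\<lambda>t. \<Phi> t \<tau> - \<Phi> t 0 ** \<Phi> 0 \<tau>) has_vector_derivative
        (- transpose (F s) ** \<Phi> s \<tau> - (- transpose (F s) ** \<Phi> s 0) ** \<Phi> 0 \<tau>)) (at s within {0..})"
      by (intro has_vector_derivative_diff der s \<tau> order_refl
          bounded_linear.has_vector_derivative[OF mm.bounded_linear_left])
    also have "- transpose (F s) ** \<Phi> s \<tau> - (- transpose (F s) ** \<Phi> s 0) ** \<Phi> 0 \<tau> = - transpose (F s) ** D s"
      by (simp add: D_def mm.diff_right matrix_mul_assoc)
    finally show ?thesis unfolding D_def[abs_def] by (rule has_vector_derivative_within_subset) auto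
  qed
  have cD: "continuous_on {0..t} D"
    using D' has_vector_derivative_continuous by (fastforce simp: continuous_on_eq_continuous_within)
  have iF: "set_integrable lborel {0..t} (\<lambda>s. - transpose (F s))"
    by (rule LINT_bounded_linear(2)[OF bounded_linear_minus[OF bounded_linear_transpose] F_int[OF t]])
  have iD: "set_integrable lborel {0..t} (\<lambda>s. - transpose (F s) ** D s)"
    by (rule set_integrable_bilinear[OF bounded_bilinear_matrix_matrix iF cD])
  have "D t = 0"
  proof (rule gronwall_zero[OF cD])
    show "set_integrable lborel {0..t} (\<lambda>s. norm (F s))" by (rule set_integrable_norm[OF F_int[OF t]])
    show "norm (D r) \<le> (LINT s:{0..r}|lborel. norm (F s) * norm (D s))" if r: "r \<in> {0..t}" for r
    proof -
      have i: "set_integrable lborel {0..r} (\<lambda>s. - transpose (F s) ** D s)"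
        by (rule set_integrable_sub_interval[OF iD]) (use r in auto)
      have "D r = D 0 + (LINT s:{0..r}|lborel. - transpose (F s) ** D s)"
      proof (rule LINT_FTC[OF _ i])
        show "(D has_vector_derivative - transpose (F s) ** D s) (at s within {0..r})" if "s \<in> {0..r}" for s
          by (rule has_vector_derivative_within_subset[OF D']) (use that r in auto)
      qed (use r in simp)
      also have "D 0 = 0" using id[of 0] by (simp add: D_def)
      finally have "norm (D r) \<le> (LINT s:{0..r}|lborel. norm (- transpose (F s) ** D s))"
        using set_integral_norm_bound[OF i] by simp
      also have "\<dots> \<le> (LINT s:{0..r}|lborel. norm (F s) * norm (D s))"
      proof (rule set_integral_mono)
        show "set_integrable lborel {0..r} (\<lambda>s. norm (- transpose (F s) ** D s))" by (rule set_integrable_norm[OF i])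
        show "set_integrable lborel {0..r} (\<lambda>s. norm (F s) * norm (D s))"
          by (rule set_integrable_bilinear[OF bounded_bilinear_mult set_integrable_norm[OF F_int]])
            (use r cD in \<open>auto intro!: continuous_on_norm intro: continuous_on_subset\<close>)
        show "norm (- transpose (F s) ** D s) \<le> norm (F s) * norm (D s)" for s
          using matrix_matrix_norm_le[of "- transpose (F s)" "D s"] by (simp add: norm_transpose)
      qed
      finally show ?thesis .
    qed
  qed (use t in auto)
  then show ?thesis by (simp add: D_def)
qed

lemma VP: assumes "t \<ge> 0" shows "V t ** P t = mat 1" "P t ** V t = mat 1"
proof -
  have 1: "\<Phi> t 0 ** \<Phi> 0 t = mat 1" using factor[OF assms assms] id[OF assms] by simp
  then have 2: "\<Phi> 0 t ** \<Phi> t 0 = mat 1" by (simp add: matrix_left_right_inverse)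
  show "V t ** P t = mat 1" "P t ** V t = mat 1"
    using 1 2 by (simp_all add: V_def P_def matrix_transpose_mul[symmetric] transpose_mat)
qed

lemma V_0 [simp]: "V 0 = mat 1" and P_0 [simp]: "P 0 = mat 1"
  by (simp_all add: V_def P_def id transpose_mat)

lemma transpose_transition: "t \<ge> 0 \<Longrightarrow> T \<ge> 0 \<Longrightarrow> transpose (\<Phi> t T) = V T ** P t"
  using factor[of t T] by (simp add: V_def P_def matrix_transpose_mul)

lemma P_der: assumes "t \<ge> 0" shows "(P has_vector_derivative - (P t ** F t)) (at t within {0..})"
  using bounded_linear.has_vector_derivative[OF bounded_linear_transpose der[OF assms order_refl]]
  by (simp add: P_def[abs_def] P_def matrix_transpose_mul transpose_minus mm.minus_right)

lemma V_der: assumes t: "t \<ge> 0" shows "(V has_vector_derivative F t ** V t) (at t within {0..})"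
proof -
  have "(V has_vector_derivative - (V t ** - (P t ** F t) ** V t)) (at t within {0..})"
    by (rule matrix_inverse_path_has_vector_derivative[OF _ _ _ P_der]) (use VP t in auto)
  then show ?thesis by (simp add: matrix_mul_assoc VP t mm.minus_right mm.minus_left)
qed

lemma cont_V: "continuous_on {0..} V" and cont_P: "continuous_on {0..} P"
  using V_der P_der has_vector_derivative_continuous by (fastforce simp: continuous_on_eq_continuous_within)+

lemma FV_int: "T \<ge> 0 \<Longrightarrow> set_integrable lborel {0..T} (\<lambda>s. F s ** V s)"
  by (rule set_integrable_bilinear[OF bounded_bilinear_matrix_matrix F_int continuous_on_subset[OF cont_V]]) auto

lemma PF_int: "T \<ge> 0 \<Longrightarrow> set_integrable lborel {0..T} (\<lambda>s. - (P s ** F s))"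
  by (rule LINT_bounded_linear(2)[OF bounded_linear_minus[OF bounded_linear_ident]
     set_integrable_bilinear[OF bounded_bilinear.flip[OF bounded_bilinear_matrix_matrix] F_int continuous_on_subset[OF cont_P]]]) auto

lemma V_eq: assumes "T \<ge> 0" shows "V T = V 0 + (LINT s:{0..T}|lborel. F s ** V s)"
  by (rule LINT_FTC[OF assms FV_int[OF assms]]) (auto intro: has_vector_derivative_within_subset[OF V_der])

lemma P_eq: assumes "T \<ge> 0" shows "P T = P 0 + (LINT s:{0..T}|lborel. - (P s ** F s))"
  by (rule LINT_FTC[OF assms PF_int[OF assms]]) (auto intro: has_vector_derivative_within_subset[OF P_der])

lemma V_mult: "V T *v u = u + (LINT s:{0..T}|lborel. F s *v (V s *v u))" if T: "T \<ge> 0"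
proof -
  have "V T *v u = u + (LINT s:{0..T}|lborel. F s ** V s) *v u"
    unfolding V_eq[OF T] by (simp add: mv.add_left)
  also have "(LINT s:{0..T}|lborel. F s ** V s) *v u = (LINT s:{0..T}|lborel. (F s ** V s) *v u)"
    by (rule LINT_bounded_linear(1)[OF mv.bounded_linear_left FV_int[OF T], symmetric])
  finally show ?thesis by (simp add: matrix_vector_mul_assoc)
qed

end

context riccati_flow begin

definition "gain t = \<Sigma> t ** transpose (C t) ** matrix_inv (R t)"

lemma gain_C: "gain t ** C t = \<Sigma> t ** G t"
  by (simp add: gain_def G_def matrix_mul_assoc)

lemma \<Sigma>_sym: "t \<ge> 0 \<Longrightarrow> transpose (\<Sigma> t) = \<Sigma> t" using \<Sigma>_pos_def by (simp add: pos_def_def)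
lemma inv\<Sigma>_sym: "t \<ge> 0 \<Longrightarrow> transpose (matrix_inv (\<Sigma> t)) = matrix_inv (\<Sigma> t)"
  using pos_def_matrix_inv[OF \<Sigma>_pos_def] by (simp add: pos_def_def)
lemma Q_sym: "t \<ge> 0 \<Longrightarrow> transpose (Q t) = Q t" using Qpos by (simp add: pos_def_def)

lemma gain_measurable: "set_borel_measurable lborel {0..T} gain"
  unfolding gain_def[abs_def]
  by (intro set_borel_measurable_bilinear[OF bounded_bilinear_matrix_matrix] invR_measurable order_refl
       set_borel_measurable_continuous_Icc continuous_on_subset[OF contC] continuous_on_subset[OF cont\<Sigma>]
       bounded_linear.continuous_on[OF bounded_linear_transpose]) auto

lemma gain_C_int: "T \<ge> 0 \<Longrightarrow> set_integrable lborel {0..T} (\<lambda>t. gain t ** C t)"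
  unfolding gain_C
  by (rule set_integrable_bilinear[OF bounded_bilinear.flip[OF bounded_bilinear_matrix_matrix] G_integrable continuous_on_subset[OF cont\<Sigma>]]) auto

lemma mult_gain_C_int:
  fixes H :: "real \<Rightarrow> real^'d^'p"
  assumes "T \<ge> 0" "continuous_on {0..T} H" shows "set_integrable lborel {0..T} (\<lambda>t. (H t ** gain t) ** C t)"
  unfolding matrix_mul_assoc[symmetric]
  by (rule set_integrable_bilinear[OF bounded_bilinear.flip[OF bounded_bilinear_matrix_matrix] gain_C_int[OF assms(1)] assms(2)])

lemma quad_gain: "t \<ge> 0 \<Longrightarrow> quad (R t) (gain t) = trace (\<Sigma> t ** G t ** \<Sigma> t)"
proof -
  assume t: "t \<ge> 0"
  have Ri: "transpose (matrix_inv (R t)) = matrix_inv (R t)" using pos_def_matrix_inv[OF Rpos[OF t]] by (simp add: pos_def_def)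
  have "gain t ** R t ** transpose (gain t) = \<Sigma> t ** transpose (C t) ** (matrix_inv (R t) ** R t) ** matrix_inv (R t) ** C t ** \<Sigma> t"
    by (simp add: gain_def matrix_transpose_mul Ri \<Sigma>_sym t matrix_mul_assoc)
  also have "\<dots> = \<Sigma> t ** G t ** \<Sigma> t" using pos_def_inv_left[OF Rpos[OF t]] by (simp add: G_def matrix_mul_assoc)
  finally show ?thesis by (simp add: quad_def)
qed

text \<open>The two matrices that govern the mean-field equation: the conditional mean moves with \<open>closed_loop\<close>, and the deviation
from it moves with \<open>deviation\<close>.\<close>

definition "closed_loop t = A t - gain t ** C t"
definition "deviation t = A t - (1/2) *\<^sub>R (gain t ** C t) + (1/2) *\<^sub>R (Q t ** matrix_inv (\<Sigma> t))"

lemma A_int: "set_integrable lborel {0..T} A"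
  by (intro borel_integrable_atLeastAtMost' continuous_on_subset[OF contA]) auto

lemma closed_loop_int: "T \<ge> 0 \<Longrightarrow> set_integrable lborel {0..T} closed_loop"
  unfolding closed_loop_def[abs_def] by (intro set_integral_diff A_int gain_C_int)

lemma deviation_int: assumes T: "T \<ge> 0" shows "set_integrable lborel {0..T} deviation"
proof -
  have "set_integrable lborel {0..T} (\<lambda>t. Q t ** matrix_inv (\<Sigma> t))"
    by (rule set_integrable_bilinear[OF bounded_bilinear_matrix_matrix Qint[OF T] continuous_on_subset[OF cont_inv\<Sigma>]]) auto
  then show ?thesis unfolding deviation_def[abs_def]
    by (intro set_integral_add set_integral_diff A_int LINT_bounded_linear(2)[OF bounded_linear_scaleR_right] gain_C_int T)
qed

lemma closed_loop_adjoint: "- transpose (A t) + transpose (C t) ** transpose (gain t) = - transpose (closed_loop t)"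
  by (simp add: closed_loop_def transpose_diff matrix_transpose_mul)

lemma deviation_adjoint:
  assumes "t \<ge> 0"
  shows "- transpose (A t) + (1/2) *\<^sub>R (transpose (C t) ** transpose (gain t)) - (1/2) *\<^sub>R (matrix_inv (\<Sigma> t) ** Q t) = - transpose (deviation t)"
  using assms by (simp add: deviation_def transpose_add transpose_diff matrix_transpose_mul transpose_scalar inv\<Sigma>_sym Q_sym
      linear_scale[OF bounded_linear.linear[OF bounded_linear_transpose]])

lemma drift_eq:
  "A t *v x - gain t *v ((1/2) *\<^sub>R (C t *v x + C t *v m)) + (1/2) *\<^sub>R ((Q t ** matrix_inv (\<Sigma> t)) *v (x - m))
   = closed_loop t *v m + deviation t *v (x - m)"
proof -
  have "gain t *v ((1/2) *\<^sub>R (C t *v x + C t *v m)) = (1/2) *\<^sub>R ((gain t ** C t) *v x) + (1/2) *\<^sub>R ((gain t ** C t) *v m)"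
    by (simp add: mv.scaleR_right mv.add_right scaleR_add_right matrix_vector_mul_assoc)
  moreover have "(gain t ** C t) *v m = (1/2) *\<^sub>R ((gain t ** C t) *v m) + (1/2) *\<^sub>R ((gain t ** C t) *v m)"
    by (simp add: scaleR_add_left[symmetric])
  ultimately show ?thesis
    by (simp add: closed_loop_def deviation_def mv.diff_left mv.add_left mv.diff_right mv.scaleR_left algebra_simps)
qed

end

section \<open>Step functions integrated against the observations\<close>

lemma LINT_el:
  fixes y :: "real \<Rightarrow> real^'m" and xs :: "(real \<times> (real^'m^'n)) list"
  assumes xs: "tpos xs" and t: "0 \<le> t" and y: "set_integrable lborel {0..t} y"
  shows "set_integrable lborel {0..t} (\<lambda>r. el xs r *v y r)"
    "(LINT r:{0..t}|lborel. el xs r *v y r) = (\<Sum>(s, c)\<leftarrow>xs. c *v (LINT r:{0..min s t}|lborel. y r))"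
proof -
  have "set_integrable lborel {0..t} (\<lambda>r. el xs r *v y r) \<and>
    (LINT r:{0..t}|lborel. el xs r *v y r) = (\<Sum>(s, c)\<leftarrow>xs. c *v (LINT r:{0..min s t}|lborel. y r))"
    using xs
  proof (induction xs)
    case Nil
    show ?case by (simp add: set_integrable_def set_lebesgue_integral_def mv.zero_left)
  next
    case (Cons a xs)
    obtain s c where a: "a = (s, c)" by force
    have s: "0 \<le> s" using Cons.prems by (simp add: a)
    have IH: "set_integrable lborel {0..t} (\<lambda>r. el xs r *v y r)"
       "(LINT r:{0..t}|lborel. el xs r *v y r) = (\<Sum>(s, c)\<leftarrow>xs. c *v (LINT r:{0..min s t}|lborel. y r))"
      using Cons by auto
    let ?g = "\<lambda>r. (indicat_real {0<..s} r *\<^sub>R c) *v y r"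
    have eq: "indicat_real {0..t} r *\<^sub>R ?g r = indicat_real {0<..min s t} r *\<^sub>R (c *v y r)" for r
      by (auto simp: indicator_def mv.zero_left)
    have iy: "set_integrable lborel {0..min s t} y" by (rule set_integrable_sub_interval[OF y]) auto
    note cy = LINT_bounded_linear[OF mv.bounded_linear_right iy, of c]
    have io: "set_integrable lborel {0<..min s t} (\<lambda>r. c *v y r)"
      by (rule set_integrable_subset[OF cy(2)]) auto
    have ig: "set_integrable lborel {0..t} ?g" using io unfolding set_integrable_def eq .
    have "(LINT r:{0..t}|lborel. ?g r) = (LINT r:{0..min s t}|lborel. c *v y r)"
      unfolding set_lebesgue_integral_def eq
    proof (rule integral_cong_AE)
      show "(\<lambda>r. indicat_real {0<..min s t} r *\<^sub>R (c *v y r)) \<in> borel_measurable lborel"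
        using io unfolding set_integrable_def by (rule borel_measurable_integrable)
      show "(\<lambda>r. indicat_real {0..min s t} r *\<^sub>R (c *v y r)) \<in> borel_measurable lborel"
        using cy(2) unfolding set_integrable_def by (rule borel_measurable_integrable)
      show "AE r in lborel. indicat_real {0<..min s t} r *\<^sub>R (c *v y r) = indicat_real {0..min s t} r *\<^sub>R (c *v y r)"
        using AE_lborel_singleton[of 0] by eventually_elim (auto simp: indicator_def)
    qed
    also have "\<dots> = c *v (LINT r:{0..min s t}|lborel. y r)" by (rule cy(1))
    finally have lg: "(LINT r:{0..t}|lborel. ?g r) = c *v (LINT r:{0..min s t}|lborel. y r)" .
    have "set_integrable lborel {0..t} (\<lambda>r. ?g r + el xs r *v y r)" by (rule set_integral_add(1)[OF ig IH(1)])
    moreover have "(LINT r:{0..t}|lborel. ?g r + el xs r *v y r) = c *v (LINT r:{0..min s t}|lborel. y r) + (LINT r:{0..t}|lborel. el xs r *v y r)"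
      using set_integral_add(2)[OF ig IH(1)] lg by simp
    ultimately show ?case by (simp add: a mv.add_left IH(2))
  qed
  then show "set_integrable lborel {0..t} (\<lambda>r. el xs r *v y r)"
    "(LINT r:{0..t}|lborel. el xs r *v y r) = (\<Sum>(s, c)\<leftarrow>xs. c *v (LINT r:{0..min s t}|lborel. y r))" by auto
qed

text \<open>Expand \<open>0 \<le> (u - l S\<^sup>-\<^sup>1 w) \<bullet> S (u - l S\<^sup>-\<^sup>1 w)\<close>.\<close>

lemma pos_def_young:
  fixes S :: "real^'m^'m"
  assumes S: "pos_def S" and l: "0 < l"
  shows "\<bar>u \<bullet> w\<bar> \<le> (u \<bullet> (S *v u)) / (2 * l) + l / 2 * (w \<bullet> (matrix_inv S *v w))"
proof -
  have key: "u \<bullet> w \<le> (u \<bullet> (S *v u)) / (2 * l) + l / 2 * (w \<bullet> (matrix_inv S *v w))" for u w :: "real^'m"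
  proof -
    define z where "z = matrix_inv S *v w"
    have Sz: "S *v z = w" using pos_def_inv_right[OF S] by (simp add: z_def matrix_vector_mul_assoc)
    have zu: "z \<bullet> (S *v u) = u \<bullet> w"
      by (subst inner_transpose_matrix) (use S Sz in \<open>simp add: pos_def_def inner_commute[of w u] del: transpose_matrix_vector\<close>)
    have "0 \<le> (u - l *\<^sub>R z) \<bullet> (S *v (u - l *\<^sub>R z))" by (rule pos_def_nonneg[OF S])
    also have "\<dots> = u \<bullet> (S *v u) - 2 * l * (u \<bullet> w) + l * l * (w \<bullet> z)"
      by (simp add: mv.diff_right mv.scaleR_right Sz zu inner_diff_left inner_diff_right inner_commute[of z w]) (simp add: algebra_simps)
    finally have "u \<bullet> w \<le> (u \<bullet> (S *v u)) / (2 * l) + l / 2 * (w \<bullet> z)" using l by (simp add: field_simps)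
    then show ?thesis by (simp add: z_def)
  qed
  from key[of u w] key[of "- u" w] show ?thesis by (simp add: mv.minus_right abs_le_iff)
qed

text \<open>Smallness of an integrand in the seminorm of the Ito isometry has to control its drift integral. The price is
the trace of \<open>C\<^sup>T S\<^sup>-\<^sup>1 C\<close>, with a weight \<open>l\<close> that can be made small.\<close>

lemma norm_mult_le_quad:
  fixes S :: "real^'m^'m" and g :: "real^'m^'n" and C :: "real^'d^'m"
  assumes S: "pos_def S" and l: "0 < l"
  shows "norm (g ** C) \<le> real CARD('d) / (2 * l) * quad S g + real CARD('n) * l / 2 * trace (transpose C ** matrix_inv S ** C)"
proof -
  let ?h = "\<lambda>i. (g $ i \<bullet> (S *v (g $ i))) / (2 * l)"
  let ?k = "\<lambda>j. l / 2 * ((C *v axis j 1) \<bullet> (matrix_inv S *v (C *v axis j 1)))"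
  have ent: "(g ** C) $ i $ j = g $ i \<bullet> (C *v axis j 1)" for i j
    by (simp add: matrix_matrix_mult_def inner_vec_def matrix_vector_mult_basis column_def)
  have tr: "trace (transpose C ** matrix_inv S ** C) = (\<Sum>j\<in>UNIV. (C *v axis j 1) \<bullet> (matrix_inv S *v (C *v axis j 1)))"
    by (simp add: trace_def inner_axis_matrix_axis[symmetric] matrix_vector_mul_assoc[symmetric] inner_transpose_matrix transpose_transpose
        del: transpose_matrix_vector)
  have "norm (g ** C) \<le> (\<Sum>i\<in>UNIV. \<Sum>j\<in>UNIV. \<bar>(g ** C) $ i $ j\<bar>)"
  proof -
    have "norm (g ** C) \<le> (\<Sum>i\<in>UNIV. norm ((g ** C) $ i))" unfolding norm_vec_def[of "g ** C"] by (rule L2_set_le_sum) simp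
    also have "\<dots> \<le> (\<Sum>i\<in>UNIV. \<Sum>j\<in>UNIV. \<bar>(g ** C) $ i $ j\<bar>)" by (intro sum_mono norm_le_l1_cart)
    finally show ?thesis .
  qed
  also have "\<dots> \<le> (\<Sum>i\<in>UNIV. \<Sum>j\<in>UNIV. ?h i + ?k j)"
    unfolding ent by (intro sum_mono pos_def_young[OF S l])
  also have "\<dots> = (\<Sum>i\<in>UNIV. real CARD('d) * ?h i + (\<Sum>j\<in>UNIV. ?k j))" by (simp add: sum.distrib)
  also have "\<dots> = real CARD('d) * (\<Sum>i\<in>UNIV. ?h i) + real CARD('n) * (\<Sum>j\<in>UNIV. ?k j)" by (simp add: sum.distrib sum_distrib_left)
  also have "(\<Sum>i\<in>UNIV. ?h i) = quad S g / (2 * l)" by (simp add: quad_def trace_quad_rows sum_divide_distrib)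
  also have "(\<Sum>j\<in>UNIV. ?k j) = l / 2 * trace (transpose C ** matrix_inv S ** C)" by (simp add: tr sum_distrib_left)
  finally show ?thesis by (simp add: field_simps)
qed

locale kalman_noise = ric: riccati_flow A Q \<Sigma> C R + noise: wiener_integration M R W
  for A Q \<Sigma> :: "real \<Rightarrow> real^'d^'d" and C :: "real \<Rightarrow> real^'d^'m" and R :: "real \<Rightarrow> real^'m^'m"
    and M :: "'a measure" and W :: "real \<Rightarrow> 'a \<Rightarrow> real^'m"
begin

lemma mult_gain_measurable:
  fixes H :: "real \<Rightarrow> real^'d^'p"
  assumes H: "continuous_on {0..T} H" shows "set_borel_measurable lborel {0..T} (\<lambda>t. H t ** ric.gain t)"
  by (rule set_borel_measurable_bilinear[OF bounded_bilinear_matrix_matrix set_borel_measurable_continuous_Icc[OF H] ric.gain_measurable])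

text \<open>For \<open>H = 1\<close> the integrand is the trace of \<open>K R K\<^sup>T = \<Sigma> G \<Sigma>\<close>.\<close>

lemma mult_gain_q_finite:
  fixes H :: "real \<Rightarrow> real^'d^'p"
  assumes H: "continuous_on {0..T} H" and T: "0 \<le> T" shows "noise.q (\<lambda>t. indicat_real {0<..T} t *\<^sub>R (H t ** ric.gain t)) < \<infinity>"
proof -
  let ?S = "\<lambda>t. \<Sigma> t ** ric.G t ** \<Sigma> t"
  have cS: "continuous_on {0..T} \<Sigma>" by (rule continuous_on_subset[OF ric.cont\<Sigma>]) auto
  have "compact (H ` {0..T})" by (intro compact_continuous_image H) simp
  then obtain b where b: "\<And>t. t \<in> {0..T} \<Longrightarrow> norm (H t) \<le> b" using compact_imp_bounded bounded_iff by (metis imageI)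
  have b0: "0 \<le> b" using b[of 0] norm_ge_zero order_trans T by (metis atLeastAtMost_iff order_refl)
  define c where "c = real CARD('p) * (real CARD('d) * real CARD('d)) * b\<^sup>2 * real CARD('d)"
  have c0: "0 \<le> c" by (simp add: c_def)
  have le: "quad (R t) (H t ** ric.gain t) \<le> c * norm (?S t)" if t: "t \<in> {0..T}" for t
  proof -
    have "quad (R t) (H t ** ric.gain t) \<le> real CARD('p) * (real CARD('d) * real CARD('d)) * (norm (H t))\<^sup>2 * quad (R t) (ric.gain t)"
      by (rule quad_mult_le) (use ric.Rpos t in auto)
    also have "\<dots> \<le> real CARD('p) * (real CARD('d) * real CARD('d)) * b\<^sup>2 * (real CARD('d) * norm (?S t))"
    proof (intro mult_mono order_refl power_mono b t)
      show "quad (R t) (ric.gain t) \<le> real CARD('d) * norm (?S t)"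
        using abs_trace_le[of "?S t"] t by (simp add: ric.quad_gain)
      show "0 \<le> quad (R t) (ric.gain t)" by (rule quad_nonneg) (use ric.Rpos t in auto)
    qed auto
    finally show ?thesis by (simp add: c_def mult.assoc)
  qed
  have iS: "set_integrable lborel {0..T} (\<lambda>t. c * norm (?S t))"
    by (intro set_integrable_mult_right set_integrable_norm
       set_integrable_bilinear[OF bounded_bilinear_matrix_matrix _ cS]
       set_integrable_bilinear[OF bounded_bilinear.flip[OF bounded_bilinear_matrix_matrix] ric.G_integrable[OF T] cS])
  have "noise.q (\<lambda>t. indicat_real {0<..T} t *\<^sub>R (H t ** ric.gain t)) \<le> (\<integral>\<^sup>+t. ennreal (indicat_real {0..T} t *\<^sub>R (c * norm (?S t))) \<partial>lborel)"
    unfolding noise.q_def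
    by (intro nn_integral_mono) (auto simp: indicator_def intro!: ennreal_leI le)
  also have "\<dots> < \<infinity>" using iS c0 unfolding set_integrable_def by (subst nn_integral_eq_integral) auto
  finally show ?thesis .
qed

lemma mult_gain_Ioc_measurable:
  fixes H :: "real \<Rightarrow> real^'d^'p"
  assumes H: "continuous_on {0..} H" shows "(\<lambda>t. indicat_real {0<..T} t *\<^sub>R (H t ** ric.gain t)) \<in> borel_measurable borel"
  by (rule noise.measurable_on_Ioc[OF mult_gain_measurable[OF continuous_on_subset[OF H]]]) auto

text \<open>Apply \<open>norm_mult_le_quad\<close> to \<open>f - el (xs k)\<close> with \<open>l = 2\<^sup>-\<^sup>k\<close>. The first term is of order
\<open>2\<^sup>k 8\<^sup>-\<^sup>k\<close> by the choice of \<open>xs\<close>, and the second of order \<open>2\<^sup>-\<^sup>k\<close> because \<open>G\<close> is integrable.\<close>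

lemma drift_tendsto:
  fixes f :: "real \<Rightarrow> real^'m^'n" and y :: "real \<Rightarrow> real^'d"
  assumes f: "(\<lambda>t. indicat_real {0<..T} t *\<^sub>R f t) \<in> borel_measurable borel"
    and fC: "set_integrable lborel {0..T} (\<lambda>t. f t ** C t)"
    and xs: "\<And>k. tpos (xs k)"
    and approx: "\<And>k. noise.q (\<lambda>t. indicat_real {0<..real k} t *\<^sub>R (f t - el (xs k) t)) \<le> ennreal ((1/8)^k)"
    and y: "continuous_on {0..T} y" and T: "0 \<le> T"
  shows "(\<lambda>k. LINT r:{0..T}|lborel. el (xs k) r *v (C r *v y r)) \<longlonglongrightarrow> (LINT r:{0..T}|lborel. f r *v (C r *v y r))"
proof -
  have "compact (y ` {0..T})" by (intro compact_continuous_image y) simp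
  then obtain b where b: "\<And>t. t \<in> {0..T} \<Longrightarrow> norm (y t) \<le> b" using compact_imp_bounded bounded_iff by (metis imageI)
  have b0: "0 \<le> b" using b[of 0] norm_ge_zero order_trans T by (metis atLeastAtMost_iff order_refl)
  have cC: "continuous_on {0..T} C" by (rule continuous_on_subset[OF ric.contC]) auto
  have i1: "set_integrable lborel {0..T} (\<lambda>r. f r *v (C r *v y r))"
    using set_integrable_bilinear[OF bounded_bilinear_matrix_vector fC y] by (simp add: matrix_vector_mul_assoc)
  have iCy: "set_integrable lborel {0..T} (\<lambda>r. C r *v y r)"
    by (intro borel_integrable_atLeastAtMost' continuous_on_mv cC y)
  note i2 = LINT_el(1)[OF xs T iCy]
  define \<tau> where "\<tau> = (\<integral>\<^sup>+t. ennreal (indicat_real {0..T} t *\<^sub>R norm (trace (ric.G t))) \<partial>lborel)"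
  have iG: "set_integrable lborel {0..T} (\<lambda>t. norm (trace (ric.G t)))"
    by (intro set_integrable_norm LINT_bounded_linear(2)[OF bounded_linear_trace ric.G_integrable[OF T]])
  have \<tau>: "\<tau> < \<infinity>" unfolding \<tau>_def using iG unfolding set_integrable_def by (subst nn_integral_eq_integral) auto
  define a where "a k = real CARD('d) * b * (1/4)^k / 2" for k
  define c where "c k = real CARD('n) * b * (1/2)^k / 2" for k
  have bound: "ennreal (norm ((LINT r:{0..T}|lborel. f r *v (C r *v y r)) - (LINT r:{0..T}|lborel. el (xs k) r *v (C r *v y r))))
     \<le> ennreal (a k) + ennreal (c k) * \<tau>" if k: "T \<le> real k" for k
  proof -
    let ?g = "\<lambda>r. indicat_real {0<..real k} r *\<^sub>R (f r - el (xs k) r)"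
    let ?z = "\<lambda>r. f r *v (C r *v y r) - el (xs k) r *v (C r *v y r)"
    have iz: "set_integrable lborel {0..T} ?z" by (rule set_integral_diff(1)[OF i1 i2])
    have pw: "ennreal (norm (indicat_real {0..T} r *\<^sub>R ?z r)) \<le>
        ennreal (real CARD('d) * b * 2^k / 2) * (ennreal (quad (R r) (?g r)) * indicator {0..} r) + ennreal (c k) * ennreal (indicat_real {0..T} r *\<^sub>R norm (trace (ric.G r)))"
      if r: "r \<noteq> 0" for r
    proof (cases "r \<in> {0..T}")
      case True
      have Rp: "pos_def (R r)" using ric.Rpos True by auto
      have g: "?g r = f r - el (xs k) r" using True r k by (auto simp: indicator_def)
      have "norm (?z r) = norm ((?g r ** C r) *v y r)" by (simp add: g mv.diff_left mm.diff_left matrix_vector_mul_assoc)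
      also have "\<dots> \<le> norm (?g r ** C r) * norm (y r)" by (rule matrix_vector_norm_le)
      also have "\<dots> \<le> (real CARD('d) / (2 * (1/2)^k) * quad (R r) (?g r) + real CARD('n) * (1/2)^k / 2 * norm (trace (ric.G r))) * b"
      proof (rule mult_mono)
        have "norm (?g r ** C r) \<le> real CARD('d) / (2 * (1/2)^k) * quad (R r) (?g r) + real CARD('n) * (1/2)^k / 2 * trace (ric.G r)"
          unfolding ric.G_def by (rule norm_mult_le_quad[OF Rp]) simp
        also have "\<dots> \<le> real CARD('d) / (2 * (1/2)^k) * quad (R r) (?g r) + real CARD('n) * (1/2)^k / 2 * norm (trace (ric.G r))"
          by (intro add_left_mono mult_left_mono) auto
        finally show "norm (?g r ** C r) \<le> real CARD('d) / (2 * (1/2)^k) * quad (R r) (?g r) + real CARD('n) * (1/2)^k / 2 * norm (trace (ric.G r))" .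
        show "norm (y r) \<le> b" by (rule b[OF True])
        show "0 \<le> real CARD('d) / (2 * (1/2)^k) * quad (R r) (?g r) + real CARD('n) * (1/2)^k / 2 * norm (trace (ric.G r))"
          using quad_nonneg[OF Rp, of "?g r"] by simp
      qed simp
      also have "\<dots> = (real CARD('d) * b * 2^k / 2) * quad (R r) (?g r) + c k * norm (trace (ric.G r))"
        by (simp add: c_def power_one_over field_simps)
      finally have "ennreal (norm (?z r)) \<le> ennreal ((real CARD('d) * b * 2^k / 2) * quad (R r) (?g r) + c k * norm (trace (ric.G r)))"
        by (rule ennreal_leI)
      also have "\<dots> = ennreal (real CARD('d) * b * 2^k / 2) * ennreal (quad (R r) (?g r)) + ennreal (c k) * ennreal (norm (trace (ric.G r)))"
      proof -
        have n: "0 \<le> real CARD('d) * b * 2^k / 2" "0 \<le> c k" using b0 by (simp_all add: c_def)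
        show ?thesis
          by (simp only: ennreal_mult[OF n(1) quad_nonneg[OF Rp]] ennreal_mult[OF n(2) norm_ge_zero]
             ennreal_plus[OF mult_nonneg_nonneg[OF n(1) quad_nonneg[OF Rp]] mult_nonneg_nonneg[OF n(2) norm_ge_zero]])
      qed
      finally show ?thesis using True by simp
    qed simp
    have gm: "(\<lambda>r. indicat_real {0<..T} r *\<^sub>R ?g r) \<in> borel_measurable borel"
    proof -
      have "(\<lambda>r. indicat_real {0<..T} r *\<^sub>R f r - indicat_real {0<..T} r *\<^sub>R el (xs k) r) \<in> borel_measurable borel"
        by (intro borel_measurable_diff f borel_measurable_scaleR el_measurable borel_measurable_indicator) simp
      also have "(\<lambda>r. indicat_real {0<..T} r *\<^sub>R f r - indicat_real {0<..T} r *\<^sub>R el (xs k) r) = (\<lambda>r. indicat_real {0<..T} r *\<^sub>R ?g r)"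
        using k by (auto simp: indicator_def)
      finally show ?thesis .
    qed
    have pw': "ennreal (norm (indicat_real {0..T} r *\<^sub>R ?z r)) \<le>
        ennreal (real CARD('d) * b * 2^k / 2) * (ennreal (quad (R r) (indicat_real {0<..T} r *\<^sub>R ?g r)) * indicator {0..} r) + ennreal (c k) * ennreal (indicat_real {0..T} r *\<^sub>R norm (trace (ric.G r)))"
      if r: "r \<noteq> 0" for r
      using pw[OF r] r by (cases "r \<in> {0..T}") (auto simp: indicator_def)
    have "ennreal (norm (LINT r:{0..T}|lborel. ?z r)) \<le> (\<integral>\<^sup>+r. ennreal (norm (indicat_real {0..T} r *\<^sub>R ?z r)) \<partial>lborel)"
      using iz unfolding set_integrable_def set_lebesgue_integral_def by (rule integral_norm_bound_ennreal)
    also have "\<dots> \<le> (\<integral>\<^sup>+r. ennreal (real CARD('d) * b * 2^k / 2) * (ennreal (quad (R r) (indicat_real {0<..T} r *\<^sub>R ?g r)) * indicator {0..} r) + ennreal (c k) * ennreal (indicat_real {0..T} r *\<^sub>R norm (trace (ric.G r))) \<partial>lborel)"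
      by (rule nn_integral_mono_AE, rule AE_mp[OF AE_lborel_singleton[of 0]], rule AE_I2, rule impI, rule pw')
    also have "\<dots> = (\<integral>\<^sup>+r. ennreal (real CARD('d) * b * 2^k / 2) * (ennreal (quad (R r) (indicat_real {0<..T} r *\<^sub>R ?g r)) * indicator {0..} r) \<partial>lborel) + (\<integral>\<^sup>+r. ennreal (c k) * ennreal (indicat_real {0..T} r *\<^sub>R norm (trace (ric.G r))) \<partial>lborel)"
      by (intro nn_integral_add borel_measurable_times_ennreal borel_measurable_const noise.quad_meas gm measurable_compose[OF borel_measurable_integrable[OF iG[unfolded set_integrable_def]] measurable_ennreal])
    also have "(\<integral>\<^sup>+r. ennreal (real CARD('d) * b * 2^k / 2) * (ennreal (quad (R r) (indicat_real {0<..T} r *\<^sub>R ?g r)) * indicator {0..} r) \<partial>lborel) = ennreal (real CARD('d) * b * 2^k / 2) * noise.q (\<lambda>r. indicat_real {0<..T} r *\<^sub>R ?g r)"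
      unfolding noise.q_def by (rule nn_integral_cmult[OF noise.quad_meas[OF gm]])
    also have "(\<integral>\<^sup>+r. ennreal (c k) * ennreal (indicat_real {0..T} r *\<^sub>R norm (trace (ric.G r))) \<partial>lborel) = ennreal (c k) * \<tau>"
      unfolding \<tau>_def by (rule nn_integral_cmult) (rule measurable_compose[OF borel_measurable_integrable[OF iG[unfolded set_integrable_def]] measurable_ennreal])
    also have "ennreal (real CARD('d) * b * 2^k / 2) * noise.q (\<lambda>r. indicat_real {0<..T} r *\<^sub>R ?g r) \<le> ennreal (real CARD('d) * b * 2^k / 2) * ennreal ((1/8)^k)"
      by (intro mult_left_mono order_trans[OF noise.q_indicator_le approx]) simp
    also have "\<dots> = ennreal (a k)"
    proof -
      have "2^k * (1/8::real)^k = (1/4)^k" by (simp add: power_mult_distrib[symmetric])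
      then have "real CARD('d) * b * 2^k / 2 * (1/8)^k = a k" unfolding a_def by (metis (no_types, lifting) mult.assoc times_divide_eq_left)
      then show ?thesis using b0 by (simp add: ennreal_mult[symmetric])
    qed
    finally have "ennreal (norm (LINT r:{0..T}|lborel. ?z r)) \<le> ennreal (a k) + ennreal (c k) * \<tau>" by (simp add: add_right_mono)
    then show ?thesis by (simp add: set_integral_diff(2)[OF i1 i2])
  qed
  have lim0: "(\<lambda>k. ennreal (a k) + ennreal (c k) * \<tau>) \<longlonglongrightarrow> 0"
  proof -
    obtain t where t: "\<tau> = ennreal t" "0 \<le> t" using \<tau> by (cases \<tau>) auto
    have c0: "0 \<le> c k" "0 \<le> a k" for k using b0 by (simp_all add: c_def a_def)
    have "(\<lambda>k. a k + c k * t) \<longlonglongrightarrow> 0 + 0 * t"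
      unfolding a_def c_def
      by (intro tendsto_add tendsto_mult tendsto_const tendsto_divide_zero tendsto_mult_right_zero LIMSEQ_power_zero) auto
    then have "(\<lambda>k. ennreal (a k + c k * t)) \<longlonglongrightarrow> ennreal 0" by (intro tendsto_ennrealI) simp
    then show ?thesis using c0 t by (simp add: ennreal_plus ennreal_mult)
  qed
  obtain N :: nat where N: "T \<le> real N" using real_arch_simple by blast
  have "(\<lambda>k. ennreal (norm ((LINT r:{0..T}|lborel. f r *v (C r *v y r)) - (LINT r:{0..T}|lborel. el (xs k) r *v (C r *v y r))))) \<longlonglongrightarrow> 0"
  proof (rule tendsto_sandwich[OF _ _ tendsto_const lim0])
    show "\<forall>\<^sub>F k in sequentially. ennreal (norm ((LINT r:{0..T}|lborel. f r *v (C r *v y r)) - (LINT r:{0..T}|lborel. el (xs k) r *v (C r *v y r)))) \<le> ennreal (a k) + ennreal (c k) * \<tau>"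
      by (rule eventually_sequentiallyI[of N]) (use N in \<open>intro bound, simp\<close>)
  qed simp
  then have "(\<lambda>k. norm ((LINT r:{0..T}|lborel. f r *v (C r *v y r)) - (LINT r:{0..T}|lborel. el (xs k) r *v (C r *v y r)))) \<longlonglongrightarrow> 0"
    using tendsto_ennreal_iff[of "\<lambda>k. norm ((LINT r:{0..T}|lborel. f r *v (C r *v y r)) - (LINT r:{0..T}|lborel. el (xs k) r *v (C r *v y r)))" sequentially 0] by simp
  then show ?thesis
    by (subst (asm) norm_minus_commute) (simp add: tendsto_norm_zero_iff LIM_zero_iff)
qed

end

lemma eI_cut_decompose:
  assumes Z: "\<And>u. 0 \<le> u \<Longrightarrow> Z u \<omega> = (LINT r:{0..u}|lborel. y r) + W u \<omega>" and xs: "tpos xs" and t: "0 \<le> t"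
  shows "eI Z (cut t xs) \<omega> = (\<Sum>(s, c)\<leftarrow>xs. c *v (LINT r:{0..min s t}|lborel. y r)) + eI W (cut t xs) \<omega>"
  using xs
proof (induction xs)
  case (Cons a xs)
  obtain s c where a: "a = (s, c)" by force
  have "Z (min s t) \<omega> - Z 0 \<omega> = (LINT r:{0..min s t}|lborel. y r) + (W (min s t) \<omega> - W 0 \<omega>)"
    using Cons.prems t by (simp add: a Z)
  then show ?case using Cons by (simp add: a mv.add_right)
qed simp

lemma eI_cut_measurable:
  assumes Y: "\<And>u. u \<in> {0..t} \<Longrightarrow> Y u \<in> borel_measurable N" and xs: "tpos xs" and t: "0 \<le> t"
  shows "eI Y (cut t xs) \<in> borel_measurable N"
  using xs
proof (induction xs)
  case Nil then show ?case by (simp add: eI_def[abs_def])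
next
  case (Cons a xs)
  obtain s c where a: "a = (s, c)" by force
  have "(\<lambda>\<omega>. c *v (Y (min s t) \<omega> - Y 0 \<omega>) + eI Y (cut t xs) \<omega>) \<in> borel_measurable N"
    by (intro borel_measurable_add borel_measurable_linear[OF mv.bounded_linear_right] borel_measurable_diff Y)
      (use Cons t in \<open>auto simp: a\<close>)
  moreover have "eI Y (cut t (a # xs)) = (\<lambda>\<omega>. c *v (Y (min s t) \<omega> - Y 0 \<omega>) + eI Y (cut t xs) \<omega>)" by (rule ext) (simp add: a)
  ultimately show ?case by simp
qed

section \<open>The solution by variation of constants\<close>

locale mean_field_filter = kalman_noise A Q \<Sigma> C R M W + signal: wiener_integration M Q B +
    flow: adjoint_flow "riccati_flow.closed_loop A \<Sigma> C R" \<Phi> + dev: adjoint_flow "riccati_flow.deviation A Q \<Sigma> C R" \<Psi>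
  for A Q \<Sigma> :: "real \<Rightarrow> real^'d^'d" and C :: "real \<Rightarrow> real^'d^'m" and R :: "real \<Rightarrow> real^'m^'m"
    and M :: "'a measure" and W :: "real \<Rightarrow> 'a \<Rightarrow> real^'m" and B :: "real \<Rightarrow> 'a \<Rightarrow> real^'d" and \<Phi> \<Psi> +
  fixes X :: "real \<Rightarrow> 'a \<Rightarrow> real^'d" and Z :: "real \<Rightarrow> 'a \<Rightarrow> real^'m" and m0 :: "real^'d" and Xbar0 :: "'a \<Rightarrow> real^'d"
  assumes X_meas: "\<And>t. t \<ge> 0 \<Longrightarrow> X t \<in> borel_measurable M" and Z_meas: "\<And>t. t \<ge> 0 \<Longrightarrow> Z t \<in> borel_measurable M"
    and X_init: "gaussian_vector M (X 0) m0 (\<Sigma> 0)"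
    and X_cont: "AE \<omega> in M. continuous_on {0..} (\<lambda>t. X t \<omega>)"
    and X_eq: "AE \<omega> in M. \<forall>t\<ge>0. X t \<omega> = X 0 \<omega> + (LINT s:{0..t}|lborel. A s *v X s \<omega>) + B t \<omega>"
    and Z_eq: "AE \<omega> in M. \<forall>t\<ge>0. Z t \<omega> = (LINT s:{0..t}|lborel. C s *v X s \<omega>) + W t \<omega>"
    and Xbar0_gauss: "gaussian_vector M Xbar0 m0 (\<Sigma> 0)"
    and indep: "prob_space.indep_sets M
          (\<lambda>i. [sets (gen_sigma M {0..} B), sets (gen_sigma M {0..} W),
                sets (gen_sigma M {0} X), sets (gen_sigma M {()} (\<lambda>_. Xbar0))] ! i) {..<4::nat}"
begin

abbreviation "F \<equiv> ric.closed_loop"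
abbreviation "\<Gamma> \<equiv> ric.deviation"
abbreviation "K \<equiv> ric.gain"

text \<open>The integrand \<open>V\<^sup>-\<^sup>1 K\<close> of the variation-of-constants formula.\<close>

definition "weight t = flow.P t ** K t"

lemma V_weight: "t \<ge> 0 \<Longrightarrow> flow.V t ** weight t = K t"
  by (simp add: weight_def matrix_mul_assoc flow.VP)

lemma weight_measurable: "(\<lambda>t. indicat_real {0<..T} t *\<^sub>R weight t) \<in> borel_measurable borel"
  unfolding weight_def by (rule mult_gain_Ioc_measurable[OF flow.cont_P])

lemma weight_q_finite: "0 \<le> T \<Longrightarrow> noise.q (\<lambda>t. indicat_real {0<..T} t *\<^sub>R weight t) < \<infinity>"
  unfolding weight_def by (rule mult_gain_q_finite[OF continuous_on_subset[OF flow.cont_P]]) auto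

lemma weight_C_int: "0 \<le> T \<Longrightarrow> set_integrable lborel {0..T} (\<lambda>t. weight t ** C t)"
  unfolding weight_def by (rule ric.mult_gain_C_int[OF _ continuous_on_subset[OF flow.cont_P]]) auto

definition approximants :: "nat \<Rightarrow> (real \<times> (real^'m^'d)) list" where
  "approximants = (SOME xs. (\<forall>k. tpos (xs k)) \<and>
     (\<forall>k. noise.q (\<lambda>t. indicat_real {0<..real k} t *\<^sub>R (weight t - el (xs k) t)) \<le> ennreal ((1/8)^k)))"

lemma approximants: "tpos (approximants k)"
  "noise.q (\<lambda>t. indicat_real {0<..real k} t *\<^sub>R (weight t - el (approximants k) t)) \<le> ennreal ((1/8)^k)"
  using someI_ex[OF noise.approximating_sequence[OF weight_measurable weight_q_finite], folded approximants_def] by blast+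

abbreviation "L \<equiv> noise.version approximants"

lemmas L_paths = noise.version_paths[OF weight_measurable approximants]
lemmas L_wi = noise.wi_version[OF weight_measurable approximants]
lemmas L_meas = noise.version_measurable[of approximants, OF approximants(1)]

text \<open>The drift part of the integral of \<open>weight\<close> against \<open>Z\<close>; its martingale part is \<open>L\<close>.\<close>

definition "D t \<omega> = (LINT r:{0..t}|lborel. weight r *v (C r *v X r \<omega>))"

text \<open>The same integral computed from the observations alone, which makes it measurable with respect to
\<open>\<sigma>(Z s; s \<le> t)\<close> by construction. That it equals \<open>D + L\<close> is \<open>Zint_eq\<close>.\<close>

definition "Zint t \<omega> = lim (\<lambda>k. eI Z (cut t (approximants k)) \<omega>)"

lemma D_integrand:
  assumes "continuous_on {0..} (\<lambda>t. X t \<omega>)" "0 \<le> T"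
  shows "set_integrable lborel {0..T} (\<lambda>r. weight r *v (C r *v X r \<omega>))"
  unfolding matrix_vector_mul_assoc
  by (rule set_integrable_bilinear[OF bounded_bilinear_matrix_vector weight_C_int[OF assms(2)] continuous_on_subset[OF assms(1)]]) auto

lemma Zint_eq: "AE \<omega> in M. \<forall>t\<ge>0. Zint t \<omega> = D t \<omega> + L t \<omega>"
  using X_cont Z_eq L_paths
proof eventually_elim
  case (elim \<omega>)
  show ?case
  proof (intro allI impI)
    fix t :: real assume t: "0 \<le> t"
    have cX: "continuous_on {0..t} (\<lambda>t. X t \<omega>)" by (rule continuous_on_subset[OF elim(1)]) auto
    have iCX: "set_integrable lborel {0..t} (\<lambda>r. C r *v X r \<omega>)"
      by (intro borel_integrable_atLeastAtMost' continuous_on_mv cX continuous_on_subset[OF ric.contC]) auto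
    have "eI Z (cut t (approximants k)) \<omega> = (LINT r:{0..t}|lborel. el (approximants k) r *v (C r *v X r \<omega>)) + eI W (cut t (approximants k)) \<omega>" for k
      unfolding LINT_el(2)[OF approximants(1) t iCX]
      by (rule eI_cut_decompose[OF _ approximants(1) t]) (use elim(2) in blast)
    moreover have "(\<lambda>k. (LINT r:{0..t}|lborel. el (approximants k) r *v (C r *v X r \<omega>)) + eI W (cut t (approximants k)) \<omega>) \<longlonglongrightarrow> D t \<omega> + L t \<omega>"
      unfolding D_def
      by (intro tendsto_add drift_tendsto weight_measurable weight_C_int approximants cX t) (use elim(3) t in blast)
    ultimately have "(\<lambda>k. eI Z (cut t (approximants k)) \<omega>) \<longlonglongrightarrow> D t \<omega> + L t \<omega>" by simp
    then show "Zint t \<omega> = D t \<omega> + L t \<omega>" unfolding Zint_def by (rule limI)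
  qed
qed

lemma Zint_meas: "t \<ge> 0 \<Longrightarrow> Zint t \<in> borel_measurable (gen_sigma M {0..t} Z)"
  unfolding Zint_def[abs_def]
  by (rule borel_measurable_lim_metric, rule eI_cut_measurable[OF gen_sigma_measurable approximants(1)])

lemma subalgebra_Z: "subalgebra M (gen_sigma M {0..t} Z)"
  by (rule gen_sigma_subalgebra) (use Z_meas in auto)

lemma Zint_cont: "AE \<omega> in M. continuous_on {0..} (\<lambda>t. Zint t \<omega>)"
  using X_cont Zint_eq L_paths
proof eventually_elim
  case (elim \<omega>)
  have "continuous_on {0..} (\<lambda>t. D t \<omega> + L t \<omega>)"
    unfolding D_def using elim by (intro continuous_on_add continuous_on_LINT_halfline D_integrand) auto
  then show ?case by (rule continuous_on_eq) (use elim in auto)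
qed

text \<open>A modification of \<open>Zint\<close> all of whose paths are continuous.\<close>

definition "Zc = (SOME Y. (\<forall>t\<ge>0. Y t \<in> borel_measurable M) \<and> (\<forall>\<omega>\<in>space M. continuous_on {0..} (\<lambda>t. Y t \<omega>)) \<and>
   (AE \<omega> in M. \<forall>t. Y t \<omega> = Zint t \<omega>))"

lemma Zc: "t \<ge> 0 \<Longrightarrow> Zc t \<in> borel_measurable M" "\<omega> \<in> space M \<Longrightarrow> continuous_on {0..} (\<lambda>t. Zc t \<omega>)"
    "AE \<omega> in M. \<forall>t. Zc t \<omega> = Zint t \<omega>"
proof -
  have "\<exists>Y. (\<forall>t\<ge>0. Y t \<in> borel_measurable M) \<and> (\<forall>\<omega>\<in>space M. continuous_on {0..} (\<lambda>t. Y t \<omega>)) \<and>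
   (AE \<omega> in M. \<forall>t. Y t \<omega> = Zint t \<omega>)"
    by (rule continuous_modification[OF measurable_from_subalg[OF subalgebra_Z Zint_meas] Zint_cont]) blast+
  from someI_ex[OF this, folded Zc_def]
  show "t \<ge> 0 \<Longrightarrow> Zc t \<in> borel_measurable M" "\<omega> \<in> space M \<Longrightarrow> continuous_on {0..} (\<lambda>t. Zc t \<omega>)"
    "AE \<omega> in M. \<forall>t. Zc t \<omega> = Zint t \<omega>" by blast+
qed

lemma Zc_eq: "AE \<omega> in M. \<forall>t\<ge>0. Zc t \<omega> = D t \<omega> + L t \<omega>"
  using Zc(3) Zint_eq by eventually_elim simp

definition "mhat t \<omega> = flow.V t *v (m0 + Zc t \<omega>)"
definition "Xbar t \<omega> = mhat t \<omega> + dev.V t *v (Xbar0 \<omega> - m0)"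

lemma cont_mhat: "\<omega> \<in> space M \<Longrightarrow> continuous_on {0..} (\<lambda>t. mhat t \<omega>)"
  unfolding mhat_def by (intro continuous_on_mv flow.cont_V continuous_on_add continuous_on_const Zc)

lemma cont_Xbar: "\<omega> \<in> space M \<Longrightarrow> continuous_on {0..} (\<lambda>t. Xbar t \<omega>)"
  unfolding Xbar_def by (intro continuous_on_add cont_mhat continuous_on_mv dev.cont_V continuous_on_const)

lemma gain_wi: assumes T: "0 \<le> T" shows "noise.has_wiener_integral (\<lambda>t. indicat_real {0<..T} t *\<^sub>R K t) (wiener_integral M R W T K)"
proof (rule noise.wiener_integral_wi[OF T ric.gain_measurable])
  show "noise.q (\<lambda>t. indicat_real {0<..T} t *\<^sub>R K t) < \<infinity>"
    using mult_gain_q_finite[of T "\<lambda>_. mat 1 :: real^'d^'d"] T by simp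
qed

text \<open>Since \<open>K = V weight\<close>, integrate by parts: by \<open>wi_integration_by_parts\<close> for the part against \<open>W\<close>
and by \<open>LINT_product_rule\<close> for the drift.\<close>

lemma obs_integral_gain:
  assumes T: "0 \<le> T"
  shows "AE \<omega> in M. obs_integral M R C X W T K \<omega> = flow.V T *v Zc T \<omega> - (LINT s:{0..T}|lborel. F s *v (flow.V s *v Zc s \<omega>))"
proof -
  let ?V = flow.V
  have cL: "AE \<omega> in M. continuous_on {0..T} (\<lambda>t. L t \<omega>)"
    using L_paths by eventually_elim (auto intro: continuous_on_subset)
  have L0: "AE \<omega> in M. L 0 \<omega> = 0"
    using L_paths
  proof eventually_elim
    case (elim \<omega>)
    then have "(\<lambda>k. eI W (cut 0 (approximants k)) \<omega>) \<longlonglongrightarrow> L 0 \<omega>" by simp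
    then show ?case by (simp add: noise.eI_cut_0[OF approximants(1)] LIMSEQ_const_iff)
  qed
  have "\<exists>H. noise.has_wiener_integral (\<lambda>t. indicat_real {0<..T} t *\<^sub>R (?V t ** weight t)) H \<and>
    (AE \<omega> in M. H \<omega> = ?V T *v L T \<omega> - (LINT s:{0..T}|lborel. (F s ** ?V s) *v L s \<omega>))"
    by (rule noise.wi_integration_by_parts[OF T flow.FV_int[OF T] flow.V_eq weight_measurable weight_q_finite[OF T] L_wi cL L0]) auto
  then obtain H where H: "noise.has_wiener_integral (\<lambda>t. indicat_real {0<..T} t *\<^sub>R (?V t ** weight t)) H"
    "AE \<omega> in M. H \<omega> = ?V T *v L T \<omega> - (LINT s:{0..T}|lborel. (F s ** ?V s) *v L s \<omega>)" by blast
  have "AE t in lborel. t \<ge> 0 \<longrightarrow> indicat_real {0<..T} t *\<^sub>R K t = indicat_real {0<..T} t *\<^sub>R (?V t ** weight t)"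
    by (rule AE_I2) (simp add: V_weight)
  from noise.wi_unique[OF gain_wi[OF T] H(1) this] H(2) Zc_eq L_paths X_cont AE_space
  show ?thesis
  proof eventually_elim
    case (elim \<omega>)
    have iD: "set_integrable lborel {0..T} (\<lambda>r. weight r *v (C r *v X r \<omega>))" by (rule D_integrand[OF elim(5) T])
    have cD: "continuous_on {0..T} (\<lambda>t. D t \<omega>)" unfolding D_def by (rule continuous_on_LINT[OF iD])
    have cL': "continuous_on {0..T} (\<lambda>t. L t \<omega>)" using elim(4) by (auto intro: continuous_on_subset)
    have i1: "set_integrable lborel {0..T} (\<lambda>s. (F s ** ?V s) *v D s \<omega>)" "set_integrable lborel {0..T} (\<lambda>s. (F s ** ?V s) *v L s \<omega>)"
      by (rule set_integrable_bilinear[OF bounded_bilinear_matrix_vector flow.FV_int[OF T] cD])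
         (rule set_integrable_bilinear[OF bounded_bilinear_matrix_vector flow.FV_int[OF T] cL'])
    have "?V T *v D T \<omega> = ?V 0 *v D 0 \<omega> + (LINT s:{0..T}|lborel. (F s ** ?V s) *v D s \<omega>)
       + (LINT s:{0..T}|lborel. ?V s *v (weight s *v (C s *v X s \<omega>)))"
      by (rule LINT_product_rule[OF bounded_bilinear_matrix_vector T flow.FV_int[OF T] iD flow.V_eq]) (auto simp: D_def)
    also have "(LINT s:{0..T}|lborel. ?V s *v (weight s *v (C s *v X s \<omega>))) = (LINT s:{0..T}|lborel. K s *v (C s *v X s \<omega>))"
      by (rule set_lebesgue_integral_cong) (auto simp: matrix_vector_mul_assoc matrix_mul_assoc V_weight)
    also have "?V 0 *v D 0 \<omega> = 0" by (simp add: D_def)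
    finally have VD: "(LINT s:{0..T}|lborel. K s *v (C s *v X s \<omega>)) = ?V T *v D T \<omega> - (LINT s:{0..T}|lborel. (F s ** ?V s) *v D s \<omega>)" by simp
    have "(LINT s:{0..T}|lborel. F s *v (?V s *v Zc s \<omega>)) = (LINT s:{0..T}|lborel. (F s ** ?V s) *v D s \<omega> + (F s ** ?V s) *v L s \<omega>)"
      by (rule set_lebesgue_integral_cong) (use elim(3) in \<open>auto simp: matrix_vector_mul_assoc mv.add_right\<close>)
    also have "\<dots> = (LINT s:{0..T}|lborel. (F s ** ?V s) *v D s \<omega>) + (LINT s:{0..T}|lborel. (F s ** ?V s) *v L s \<omega>)"
      by (rule set_integral_add(2)[OF i1])
    finally show ?case unfolding obs_integral_def elim(1) elim(2) VD using elim(3) T by (simp add: mv.add_right)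
  qed
qed

text \<open>On \<open>[0, T]\<close> the integrand is \<open>V T ** weight t\<close>, and the constant matrix \<open>V T\<close> comes out of the integral.\<close>

lemma obs_integral_transition:
  assumes T: "0 \<le> T"
  shows "AE \<omega> in M. obs_integral M R C X W T (\<lambda>t. transpose (\<Phi> t T) ** K t) \<omega> = flow.V T *v Zc T \<omega>"
proof -
  let ?V = "flow.V T"
  have eq: "transpose (\<Phi> t T) ** K t = ?V ** weight t" if "t \<ge> 0" for t
    using flow.transpose_transition[OF that T] by (simp add: weight_def matrix_mul_assoc)
  have cP: "continuous_on {0..} (\<lambda>t. transpose (\<Phi> t T))"
    by (rule bounded_linear.continuous_on[OF bounded_linear_transpose flow.cont_\<Phi>[OF T]])
  have w1: "noise.has_wiener_integral (\<lambda>t. indicat_real {0<..T} t *\<^sub>R (transpose (\<Phi> t T) ** K t)) (wiener_integral M R W T (\<lambda>t. transpose (\<Phi> t T) ** K t))"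
    by (rule noise.wiener_integral_wi[OF T mult_gain_measurable mult_gain_q_finite]) (auto intro: continuous_on_subset[OF cP] T)
  have w2: "noise.has_wiener_integral (\<lambda>t. ?V ** (indicat_real {0<..T} t *\<^sub>R weight t)) (\<lambda>\<omega>. ?V *v L T \<omega>)"
    by (rule noise.wi_mult[OF L_wi[OF T]])
  have "AE t in lborel. t \<ge> 0 \<longrightarrow> indicat_real {0<..T} t *\<^sub>R (transpose (\<Phi> t T) ** K t) = ?V ** (indicat_real {0<..T} t *\<^sub>R weight t)"
    by (rule AE_I2) (simp add: eq mm.scaleR_right)
  from noise.wi_unique[OF w1 w2 this] Zc_eq X_cont show ?thesis
  proof eventually_elim
    case (elim \<omega>)
    have "(LINT t:{0..T}|lborel. (transpose (\<Phi> t T) ** K t) *v (C t *v X t \<omega>)) = (LINT t:{0..T}|lborel. ?V *v (weight t *v (C t *v X t \<omega>)))"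
      by (rule set_lebesgue_integral_cong) (auto simp: eq matrix_vector_mul_assoc matrix_mul_assoc)
    also have "\<dots> = ?V *v D T \<omega>" unfolding D_def
      by (rule LINT_bounded_linear(1)[OF mv.bounded_linear_right D_integrand[OF elim(3) T]])
    finally show ?case using elim(1,2) T by (simp add: obs_integral_def mv.add_right)
  qed
qed

lemma F_mhat_int: "\<omega> \<in> space M \<Longrightarrow> 0 \<le> T \<Longrightarrow> set_integrable lborel {0..T} (\<lambda>s. F s *v mhat s \<omega>)"
  by (rule set_integrable_bilinear[OF bounded_bilinear_matrix_vector ric.closed_loop_int continuous_on_subset[OF cont_mhat]]) auto

lemma dev_int: "0 \<le> T \<Longrightarrow> set_integrable lborel {0..T} (\<lambda>s. \<Gamma> s *v (dev.V s *v u))"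
  using LINT_bounded_linear(2)[OF mv.bounded_linear_left dev.FV_int, of T u] by (simp add: matrix_vector_mul_assoc)

lemma mhat_eq:
  assumes T: "0 \<le> T"
  shows "AE \<omega> in M. mhat T \<omega> = m0 + (LINT s:{0..T}|lborel. F s *v mhat s \<omega>) + obs_integral M R C X W T K \<omega>"
  using obs_integral_gain[OF T] AE_space
proof eventually_elim
  case (elim \<omega>)
  have i1: "set_integrable lborel {0..T} (\<lambda>s. F s *v (flow.V s *v m0))"
    using LINT_bounded_linear(2)[OF mv.bounded_linear_left flow.FV_int[OF T], of m0] by (simp add: matrix_vector_mul_assoc)
  have i2: "set_integrable lborel {0..T} (\<lambda>s. F s *v (flow.V s *v Zc s \<omega>))"
    by (rule set_integrable_bilinear[OF bounded_bilinear_matrix_vector ric.closed_loop_int[OF T] continuous_on_mv])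
       (auto intro: continuous_on_subset[OF flow.cont_V] continuous_on_subset[OF Zc(2)[OF elim(2)]])
  have "(LINT s:{0..T}|lborel. F s *v mhat s \<omega>) = (LINT s:{0..T}|lborel. F s *v (flow.V s *v m0) + F s *v (flow.V s *v Zc s \<omega>))"
    by (simp add: mhat_def mv.add_right)
  also have "\<dots> = (LINT s:{0..T}|lborel. F s *v (flow.V s *v m0)) + (LINT s:{0..T}|lborel. F s *v (flow.V s *v Zc s \<omega>))"
    by (rule set_integral_add(2)[OF i1 i2])
  finally show ?case unfolding elim(1) using flow.V_mult[OF T, of m0] by (simp add: mhat_def mv.add_right)
qed

lemma Xbar_eq:
  assumes T: "0 \<le> T"
  shows "AE \<omega> in M. Xbar T \<omega> = Xbar0 \<omega> + (LINT s:{0..T}|lborel. F s *v mhat s \<omega> + \<Gamma> s *v (Xbar s \<omega> - mhat s \<omega>)) + obs_integral M R C X W T K \<omega>"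
  using mhat_eq[OF T] AE_space
proof eventually_elim
  case (elim \<omega>)
  have "(LINT s:{0..T}|lborel. F s *v mhat s \<omega> + \<Gamma> s *v (Xbar s \<omega> - mhat s \<omega>)) =
     (LINT s:{0..T}|lborel. F s *v mhat s \<omega>) + (LINT s:{0..T}|lborel. \<Gamma> s *v (dev.V s *v (Xbar0 \<omega> - m0)))"
    using set_integral_add(2)[OF F_mhat_int[OF elim(2) T] dev_int[OF T, of "Xbar0 \<omega> - m0"]] by (simp add: Xbar_def)
  moreover note dev.V_mult[OF T, of "Xbar0 \<omega> - m0"]
  ultimately show ?case using elim(1) by (simp add: Xbar_def)
qed

lemma drift_int:
  assumes T: "0 \<le> T" and \<omega>: "\<omega> \<in> space M"
  shows "set_integrable lborel {0..T} (\<lambda>s. F s *v mhat s \<omega> + \<Gamma> s *v (Xbar s \<omega> - mhat s \<omega>))"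
  using set_integral_add(1)[OF F_mhat_int[OF \<omega> T] dev_int[OF T, of "Xbar0 \<omega> - m0"]] by (simp add: Xbar_def)

lemma terminal_estimator:
  assumes T: "0 \<le> T"
  shows "AE \<omega> in M. transpose (\<Phi> 0 T) *v m0 + transpose (\<Psi> 0 T) *v (Xbar0 \<omega> - m0)
      + obs_integral M R C X W T (\<lambda>t. transpose (\<Phi> t T) ** K t) \<omega> = Xbar T \<omega>"
  using obs_integral_transition[OF T]
  by eventually_elim (simp add: Xbar_def mhat_def mv.add_right flow.V_def dev.V_def del: transpose_matrix_vector)

end

section \<open>Integrability and conditional means\<close>

lemma real_le_one_plus_square: assumes "0 \<le> (x::real)" shows "x \<le> 1 + x\<^sup>2"
proof -
  have "2 * x \<le> x\<^sup>2 + 1" using zero_le_power2[of "x - 1"] by (simp add: power2_diff)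
  then show ?thesis using assms by linarith
qed

lemma (in prob_space) gaussian_vector_moments:
  fixes Y :: "'a \<Rightarrow> real^'n"
  assumes g: "gaussian_vector M Y \<mu> S" and S: "pos_def S"
  shows "integrable M Y" "expectation (\<lambda>\<omega>. Y \<omega> $ i) = \<mu> $ i"
proof -
  have Ym: "Y \<in> borel_measurable M" using g by (simp add: gaussian_vector_def)
  have c: "integrable M (\<lambda>\<omega>. Y \<omega> $ i) \<and> expectation (\<lambda>\<omega>. Y \<omega> $ i) = \<mu> $ i" for i
  proof -
    let ?v = "axis i 1 :: real^'n"
    define \<sigma> where "\<sigma> = sqrt (?v \<bullet> (S *v ?v))"
    have v: "?v \<noteq> 0" by (simp add: axis_eq_0_iff)
    then have \<sigma>: "0 < \<sigma>" using S by (simp add: pos_def_def \<sigma>_def)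
    have eq: "?v \<bullet> Y \<omega> = Y \<omega> $ i" "?v \<bullet> \<mu> = \<mu> $ i" for \<omega> by (simp_all add: inner_axis')
    have d: "distributed M lborel (\<lambda>\<omega>. Y \<omega> $ i) (normal_density (\<mu> $ i) \<sigma>)"
      using g[unfolded gaussian_vector_def, THEN conjunct2, rule_format, OF v] unfolding eq \<sigma>_def[symmetric] .
    have "integrable lborel (\<lambda>x. normal_density (\<mu> $ i) \<sigma> x * (x - \<mu> $ i) + normal_density (\<mu> $ i) \<sigma> x * \<mu> $ i)"
      using integrable_normal_moment[OF \<sigma>, of "\<mu> $ i" 1] integrable_normal_moment[OF \<sigma>, of "\<mu> $ i" 0] by simp
    then have "integrable lborel (\<lambda>x. normal_density (\<mu> $ i) \<sigma> x * x)" by (simp add: distrib_left[symmetric])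
    then have i1: "integrable M (\<lambda>\<omega>. Y \<omega> $ i)"
      by (subst distributed_integrable[OF d, of "\<lambda>x. x", symmetric]) auto
    show ?thesis using i1 normal_distributed_expectation[OF \<sigma> d] by simp
  qed
  show "expectation (\<lambda>\<omega>. Y \<omega> $ i) = \<mu> $ i" using c by simp
  have "integrable M (\<lambda>\<omega>. \<Sum>i\<in>UNIV. (Y \<omega> $ i) *\<^sub>R axis i 1)" using c by simp
  also have "(\<lambda>\<omega>. \<Sum>i\<in>UNIV. (Y \<omega> $ i) *\<^sub>R axis i 1) = Y"
    using basis_expansion[of "Y _"] by (simp add: scalar_mult_eq_scaleR)
  finally show "integrable M Y" .
qed

lemma (in prob_space) integrable_of_second_moment:
  fixes Y :: "'a \<Rightarrow> real^'n"
  assumes Y: "Y \<in> borel_measurable M" and fin: "(\<integral>\<^sup>+\<omega>. ennreal ((norm (Y \<omega>))\<^sup>2) \<partial>M) < \<infinity>"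
  shows "integrable M Y"
proof (rule integrableI_bounded[OF Y])
  have "(\<integral>\<^sup>+\<omega>. ennreal (norm (Y \<omega>)) \<partial>M) \<le> (\<integral>\<^sup>+\<omega>. 1 + ennreal ((norm (Y \<omega>))\<^sup>2) \<partial>M)"
  proof (rule nn_integral_mono)
    fix \<omega>
    have "norm (Y \<omega>) \<le> 1 + (norm (Y \<omega>))\<^sup>2"
      by (rule real_le_one_plus_square) simp
    then show "ennreal (norm (Y \<omega>)) \<le> 1 + ennreal ((norm (Y \<omega>))\<^sup>2)"
      using ennreal_leI by (fastforce simp: ennreal_plus)
  qed
  also have "\<dots> = 1 + (\<integral>\<^sup>+\<omega>. ennreal ((norm (Y \<omega>))\<^sup>2) \<partial>M)"
    using Y by (subst nn_integral_add) (auto simp: emeasure_space_1)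
  also have "\<dots> < \<infinity>" using fin by simp
  finally show "(\<integral>\<^sup>+\<omega>. ennreal (norm (Y \<omega>)) \<partial>M) < \<infinity>" .
qed

lemma (in wiener_integration) wiener_first_moment:
  assumes T: "0 \<le> T"
  obtains b where "0 \<le> b" "\<And>s. s \<in> {0..T} \<Longrightarrow> (\<integral>\<^sup>+\<omega>. ennreal (norm (W s \<omega>)) \<partial>M) \<le> ennreal b"
proof -
  let ?c = "real CARD('m) * (norm (mat 1 :: real^'m^'m))\<^sup>2"
  define q1 where "q1 = (\<integral>\<^sup>+t. ennreal (?c * norm (R t)) * indicator {0..T} t \<partial>lborel)"
  have q1: "q1 < \<infinity>" unfolding q1_def by (rule Rnorm_integral_finite[OF T])
  have le: "(\<integral>\<^sup>+\<omega>. ennreal (norm (W s \<omega>)) \<partial>M) \<le> 1 + q1" if s: "s \<in> {0..T}" for s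
  proof -
    have s0: "0 \<le> s" using s by simp
    have "(\<integral>\<^sup>+\<omega>. ennreal (norm (W s \<omega>)) \<partial>M) \<le> (\<integral>\<^sup>+\<omega>. 1 + ennreal ((norm (W s \<omega>))\<^sup>2) \<partial>M)"
    proof (rule nn_integral_mono)
      fix \<omega>
      have "norm (W s \<omega>) \<le> 1 + (norm (W s \<omega>))\<^sup>2"
        by (rule real_le_one_plus_square) simp
      then show "ennreal (norm (W s \<omega>)) \<le> 1 + ennreal ((norm (W s \<omega>))\<^sup>2)"
        using ennreal_leI by (fastforce simp: ennreal_plus)
    qed
    also have "\<dots> = 1 + (\<integral>\<^sup>+\<omega>. ennreal ((norm (W s \<omega>))\<^sup>2) \<partial>M)"
      using W_meas[OF s0] by (subst nn_integral_add) (auto simp: emeasure_space_1)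
    also have "(\<integral>\<^sup>+\<omega>. ennreal ((norm (W s \<omega>))\<^sup>2) \<partial>M) = d2 (eI W [(s, mat 1 :: real^'m^'m)])"
      unfolding d2_def by (rule nn_integral_cong_AE, use W_0 in eventually_elim) simp
    also have "\<dots> = q (el [(s, mat 1 :: real^'m^'m)])" by (rule isometry) (simp add: s0)
    also have "\<dots> \<le> q1" unfolding q_def q1_def
    proof (rule nn_integral_mono)
      fix t :: real
      have "quad (R t) (mat 1 :: real^'m^'m) \<le> ?c * norm (R t)" using quad_le_norm[of "R t" "mat 1 :: real^'m^'m"] by simp
      then show "ennreal (quad (R t) (el [(s, mat 1 :: real^'m^'m)] t)) * indicator {0..} t \<le> ennreal (?c * norm (R t)) * indicator {0..T} t"
        using s by (auto simp: indicator_def intro!: ennreal_leI)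
    qed
    finally show ?thesis by (simp add: add_left_mono)
  qed
  have "ennreal (1 + enn2real q1) = 1 + q1" using q1 by (simp add: ennreal_plus ennreal_enn2real)
  with le that[of "1 + enn2real q1"] show ?thesis by simp
qed

context mean_field_filter begin

lemma \<Sigma>0_pos: "pos_def (\<Sigma> 0)" by (rule ric.\<Sigma>_pos_def) simp

lemmas X0_integrable = noise.gaussian_vector_moments(1)[OF X_init \<Sigma>0_pos]
lemmas Xbar0_integrable = noise.gaussian_vector_moments(1)[OF Xbar0_gauss \<Sigma>0_pos]
lemmas Xbar0_mean = noise.gaussian_vector_moments(2)[OF Xbar0_gauss \<Sigma>0_pos]

text \<open>Gronwall's inequality bounds \<open>norm (X t)\<close> by a constant times the first moments of \<open>X 0\<close> and \<open>B\<close>, uniformly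
on \<open>[0, T]\<close>.\<close>

lemma state_first_moment:
  assumes T: "0 \<le> T"
  obtains b where "0 \<le> b" "\<And>s. s \<in> {0..T} \<Longrightarrow> (\<integral>\<^sup>+\<omega>. ennreal (norm (X s \<omega>)) \<partial>M) \<le> ennreal b"
proof -
  obtain b1 where b1: "0 \<le> b1" "\<And>s. s \<in> {0..T} \<Longrightarrow> (\<integral>\<^sup>+\<omega>. ennreal (norm (B s \<omega>)) \<partial>M) \<le> ennreal b1"
    using signal.wiener_first_moment[OF T] by blast
  define b0 where "b0 = (\<integral>\<omega>. norm (X 0 \<omega>) \<partial>M)"
  have b0: "0 \<le> b0" "(\<integral>\<^sup>+\<omega>. ennreal (norm (X 0 \<omega>)) \<partial>M) = ennreal b0"
    using X0_integrable by (auto simp: b0_def nn_integral_eq_integral)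
  define g where "g s \<omega> = norm (X 0 \<omega> + B s \<omega>)" for s \<omega>
  have gm: "g s \<in> borel_measurable M" if "s \<in> {0..T}" for s
  proof -
    have "X 0 \<in> borel_measurable M" "B s \<in> borel_measurable M" using that by (auto intro: X_meas signal.W_meas)
    then show ?thesis unfolding g_def[abs_def] by measurable
  qed
  have gb: "(\<integral>\<^sup>+\<omega>. ennreal (g s \<omega>) \<partial>M) \<le> ennreal (b0 + b1)" if s: "s \<in> {0..T}" for s
  proof -
    have m [measurable]: "X 0 \<in> borel_measurable M" "B s \<in> borel_measurable M" using s by (auto intro: X_meas signal.W_meas)
    have "(\<integral>\<^sup>+\<omega>. ennreal (g s \<omega>) \<partial>M) \<le> (\<integral>\<^sup>+\<omega>. ennreal (norm (X 0 \<omega>)) + ennreal (norm (B s \<omega>)) \<partial>M)"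
      unfolding g_def by (intro nn_integral_mono) (simp add: ennreal_plus[symmetric] ennreal_leI norm_triangle_ineq del: ennreal_plus)
    also have "\<dots> = (\<integral>\<^sup>+\<omega>. ennreal (norm (X 0 \<omega>)) \<partial>M) + (\<integral>\<^sup>+\<omega>. ennreal (norm (B s \<omega>)) \<partial>M)"
      by (rule nn_integral_add; measurable)
    also have "\<dots> \<le> ennreal b0 + ennreal b1" unfolding b0(2) by (intro add_left_mono b1 s)
    also have "\<dots> = ennreal (b0 + b1)" using b0 b1 by (simp add: ennreal_plus)
    finally show ?thesis .
  qed
  have gcont: "AE \<omega> in M. continuous_on {0..T} (\<lambda>s. X 0 \<omega> + B s \<omega>)"
    using signal.W_cont by eventually_elim (intro continuous_intros, auto intro: continuous_on_subset)
  define I where "I \<omega> = (LINT s:{0..T}|lborel. g s \<omega>)" for \<omega>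
  have I0: "0 \<le> I \<omega>" for \<omega> unfolding I_def set_lebesgue_integral_def by (rule Bochner_Integration.integral_nonneg) (simp add: g_def)
  have nI: "(\<integral>\<^sup>+\<omega>. ennreal (I \<omega>) \<partial>M) \<le> ennreal (T * (b0 + b1))"
  proof -
    have "(\<integral>\<^sup>+\<omega>. ennreal (norm (LINT s:{0..T}|lborel. 1 * g s \<omega>)) \<partial>M) \<le> ennreal ((LINT s:{0..T}|lborel. norm (1::real)) * (b0 + b1))"
    proof (rule nn_integral_norm_LINT_le[OF bounded_bilinear_mult _ T _ gm])
      show "norm (u * v) \<le> norm u * norm v" for u v :: real by (simp add: abs_mult)
      show "set_integrable lborel {0..T} (\<lambda>s. 1 :: real)" by (intro borel_integrable_atLeastAtMost' continuous_on_const)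
      show "(\<integral>\<^sup>+\<omega>. ennreal (norm (g s \<omega>)) \<partial>M) \<le> ennreal (b0 + b1)" if "s \<in> {0..T}" for s
        using gb[OF that] by (simp add: g_def)
      show "0 \<le> b0 + b1" using b0 b1 by simp
      show "AE \<omega> in M. continuous_on {0..T} (\<lambda>s. g s \<omega>)"
        unfolding g_def using gcont by eventually_elim (rule continuous_on_norm)
    qed
    moreover have "(LINT s:{0..T}|lborel. norm (1::real)) = T" using T by (simp add: set_lebesgue_integral_def)
    moreover have "norm (LINT s:{0..T}|lborel. 1 * g s \<omega>) = I \<omega>" for \<omega> using I0[of \<omega>] by (simp add: I_def)
    ultimately show ?thesis by simp
  qed
  have "compact (A ` {0..T})" by (intro compact_continuous_image continuous_on_subset[OF ric.contA]) auto
  then obtain a where a: "\<And>t. t \<in> {0..T} \<Longrightarrow> norm (A t) \<le> a" using compact_imp_bounded bounded_iff by (metis imageI)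
  have a0: "0 \<le> a" using a[of 0] norm_ge_zero order_trans T by (metis atLeastAtMost_iff order_refl)
  let ?k = "a * exp (a * T)"
  have k0: "0 \<le> ?k" using a0 by simp
  have pw: "AE \<omega> in M. \<forall>t\<in>{0..T}. norm (X t \<omega>) \<le> g t \<omega> + ?k * I \<omega>"
    using X_cont X_eq gcont
  proof eventually_elim
    case (elim \<omega>)
    show ?case
    proof
      fix t assume t: "t \<in> {0..T}"
      have cX: "continuous_on {0..T} (\<lambda>t. X t \<omega>)" by (rule continuous_on_subset[OF elim(1)]) auto
      show "norm (X t \<omega>) \<le> g t \<omega> + ?k * I \<omega>"
        unfolding g_def I_def
      proof (rule gronwall_linear[OF cX elim(3) a0 _ t])
        fix r assume r: "r \<in> {0..T}"
        have cr: "continuous_on {0..r} (\<lambda>t. X t \<omega>)" "continuous_on {0..r} A"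
          using r by (auto intro: continuous_on_subset[OF elim(1)] continuous_on_subset[OF ric.contA])
        have iAX: "set_integrable lborel {0..r} (\<lambda>s. A s *v X s \<omega>)"
          by (intro borel_integrable_atLeastAtMost' continuous_on_mv cr)
        have inX: "set_integrable lborel {0..r} (\<lambda>s. norm (X s \<omega>))"
          by (intro borel_integrable_atLeastAtMost' continuous_on_norm cr)
        have "X r \<omega> = X 0 \<omega> + (LINT s:{0..r}|lborel. A s *v X s \<omega>) + B r \<omega>"
          by (rule elim(2)[rule_format]) (use r in simp)
        then have "X r \<omega> = (X 0 \<omega> + B r \<omega>) + (LINT s:{0..r}|lborel. A s *v X s \<omega>)" by (simp only: add_ac)
        then have "norm (X r \<omega>) \<le> norm (X 0 \<omega> + B r \<omega>) + norm (LINT s:{0..r}|lborel. A s *v X s \<omega>)" by (metis norm_triangle_ineq)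
        also have "norm (LINT s:{0..r}|lborel. A s *v X s \<omega>) \<le> (LINT s:{0..r}|lborel. norm (A s *v X s \<omega>))"
          by (rule set_integral_norm_bound[OF iAX])
        also have "\<dots> \<le> (LINT s:{0..r}|lborel. a * norm (X s \<omega>))"
        proof (rule set_integral_mono[OF set_integrable_norm[OF iAX] set_integrable_mult_right[OF inX]])
          fix s assume "s \<in> {0..r}"
          then have "norm (A s) \<le> a" using r by (intro a) auto
          then show "norm (A s *v X s \<omega>) \<le> a * norm (X s \<omega>)"
            by (intro order_trans[OF matrix_vector_norm_le] mult_right_mono) auto
        qed
        also have "\<dots> = a * (LINT s:{0..r}|lborel. norm (X s \<omega>))" by simp
        finally show "norm (X r \<omega>) \<le> norm (X 0 \<omega> + B r \<omega>) + a * (LINT s:{0..r}|lborel. norm (X s \<omega>))" by simp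
      qed
    qed
  qed
  \<comment> \<open>The integral of \<open>g\<close> is measurable up to a null set only; \<open>J\<close> replaces it.\<close>
  have "ae_meas M M (\<lambda>\<omega>. LINT s:{0..T}|lborel. 1 * g s \<omega>)"
  proof (rule ae_meas_LINT[OF bounded_bilinear_mult T])
    show "set_integrable lborel {0..T} (\<lambda>s. 1 :: real)" by (intro borel_integrable_atLeastAtMost' continuous_on_const)
    show "ae_meas M M (g s)" if "s \<in> {0..T}" for s by (rule ae_meas_meas[OF gm[OF that]])
    show "AE \<omega> in M. continuous_on {0..T} (\<lambda>s. g s \<omega>)"
      unfolding g_def using gcont by eventually_elim (rule continuous_on_norm)
  qed
  then obtain J where J: "J \<in> borel_measurable M" "AE \<omega> in M. I \<omega> = J \<omega>" by (auto simp: ae_meas_def I_def)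
  have "(\<integral>\<^sup>+\<omega>. ennreal (norm (X s \<omega>)) \<partial>M) \<le> ennreal ((b0 + b1) + ?k * (T * (b0 + b1)))" if s: "s \<in> {0..T}" for s
  proof -
    have "(\<integral>\<^sup>+\<omega>. ennreal (norm (X s \<omega>)) \<partial>M) \<le> (\<integral>\<^sup>+\<omega>. ennreal (g s \<omega>) + ennreal ?k * ennreal (J \<omega>) \<partial>M)"
    proof (rule nn_integral_mono_AE, use pw J(2) in eventually_elim)
      fix \<omega> assume "\<forall>t\<in>{0..T}. norm (X t \<omega>) \<le> g t \<omega> + ?k * I \<omega>" and e: "I \<omega> = J \<omega>"
      then have "ennreal (norm (X s \<omega>)) \<le> ennreal (g s \<omega> + ?k * J \<omega>)" using s by (intro ennreal_leI) auto
      also have "\<dots> = ennreal (g s \<omega>) + ennreal ?k * ennreal (J \<omega>)"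
        using I0[of \<omega>] k0 e by (subst ennreal_plus) (auto simp: g_def ennreal_mult)
      finally show "ennreal (norm (X s \<omega>)) \<le> ennreal (g s \<omega>) + ennreal ?k * ennreal (J \<omega>)" .
    qed
    also have "\<dots> = (\<integral>\<^sup>+\<omega>. ennreal (g s \<omega>) \<partial>M) + ennreal ?k * (\<integral>\<^sup>+\<omega>. ennreal (J \<omega>) \<partial>M)"
      using gm[OF s] J(1) by (subst nn_integral_add) (auto simp: nn_integral_cmult)
    also have "(\<integral>\<^sup>+\<omega>. ennreal (J \<omega>) \<partial>M) = (\<integral>\<^sup>+\<omega>. ennreal (I \<omega>) \<partial>M)"
      by (intro nn_integral_cong_AE eventually_mono[OF J(2)]) simp
    also have "(\<integral>\<^sup>+\<omega>. ennreal (g s \<omega>) \<partial>M) + ennreal ?k * (\<integral>\<^sup>+\<omega>. ennreal (I \<omega>) \<partial>M) \<le> ennreal (b0 + b1) + ennreal ?k * ennreal (T * (b0 + b1))"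
      by (intro add_mono mult_left_mono gb s nI) simp
    also have "\<dots> = ennreal ((b0 + b1) + ?k * (T * (b0 + b1)))"
      using b0 b1 k0 T by (simp add: ennreal_plus ennreal_mult)
    finally show ?thesis .
  qed
  moreover have "0 \<le> (b0 + b1) + ?k * (T * (b0 + b1))" using b0 b1 k0 T by simp
  ultimately show ?thesis using that by blast
qed

lemma D_first_moment:
  assumes T: "0 \<le> T" shows "(\<integral>\<^sup>+\<omega>. ennreal (norm (D T \<omega>)) \<partial>M) < \<infinity>"
proof -
  obtain b where b: "0 \<le> b" "\<And>s. s \<in> {0..T} \<Longrightarrow> (\<integral>\<^sup>+\<omega>. ennreal (norm (X s \<omega>)) \<partial>M) \<le> ennreal b"
    using state_first_moment[OF T] by blast
  have "(\<integral>\<^sup>+\<omega>. ennreal (norm (LINT s:{0..T}|lborel. (weight s ** C s) *v X s \<omega>)) \<partial>M) \<le> ennreal ((LINT s:{0..T}|lborel. norm (weight s ** C s)) * b)"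
    by (rule nn_integral_norm_LINT_le[OF bounded_bilinear_matrix_vector matrix_vector_norm_le T weight_C_int[OF T] X_meas b(2) b(1)])
      (use X_cont in \<open>auto elim!: eventually_mono intro: continuous_on_subset\<close>)
  then show ?thesis by (simp add: D_def matrix_vector_mul_assoc order_le_less_trans[OF _ ennreal_less_top])
qed

lemma Zc_integrable: assumes T: "0 \<le> T" shows "integrable M (Zc T)"
proof -
  have "noise.d2 (L T) \<le> 4 * noise.q (\<lambda>r. indicat_real {0<..T} r *\<^sub>R weight r)" by (rule noise.wi_bound[OF L_wi[OF T]])
  also have "\<dots> < \<infinity>" using weight_q_finite[OF T] by (simp add: ennreal_mult_less_top)
  finally have L: "integrable M (L T)"
    by (intro noise.integrable_of_second_moment L_meas T) (simp add: noise.d2_def)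
  have "integrable M (\<lambda>\<omega>. Zc T \<omega> - L T \<omega>)"
  proof (rule integrableI_bounded)
    show "(\<lambda>\<omega>. Zc T \<omega> - L T \<omega>) \<in> borel_measurable M" by (intro borel_measurable_diff Zc L_meas T)
    have "(\<integral>\<^sup>+\<omega>. ennreal (norm (Zc T \<omega> - L T \<omega>)) \<partial>M) = (\<integral>\<^sup>+\<omega>. ennreal (norm (D T \<omega>)) \<partial>M)"
      by (intro nn_integral_cong_AE eventually_mono[OF Zc_eq]) (use T in simp)
    then show "(\<integral>\<^sup>+\<omega>. ennreal (norm (Zc T \<omega> - L T \<omega>)) \<partial>M) < \<infinity>" using D_first_moment[OF T] by simp
  qed
  from Bochner_Integration.integrable_add[OF this L] show ?thesis by simp
qed

lemma mhat_integrable: "0 \<le> T \<Longrightarrow> integrable M (mhat T)"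
  unfolding mhat_def[abs_def]
  by (intro integrable_bounded_linear[OF mv.bounded_linear_right] Bochner_Integration.integrable_add Zc_integrable) simp

lemma deviation_integrable: "integrable M (\<lambda>\<omega>. dev.V T *v (Xbar0 \<omega> - m0))"
  by (intro integrable_bounded_linear[OF mv.bounded_linear_right] Bochner_Integration.integrable_diff Xbar0_integrable) simp

lemma Xbar_integrable: "0 \<le> T \<Longrightarrow> integrable M (Xbar T)"
  unfolding Xbar_def[abs_def] by (intro Bochner_Integration.integrable_add mhat_integrable deviation_integrable)

text \<open>The randomness that drives the observations: \<open>X\<close> and \<open>Z\<close> are functions of it up to null sets, and
it is independent of \<open>Xbar0\<close>.\<close>

definition "history = sigma (space M) (sets (gen_sigma M {0..} B) \<union> sets (gen_sigma M {0..} W) \<union> sets (gen_sigma M {0} X))"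

lemma history_closed:
  "sets (gen_sigma M {0..} B) \<union> sets (gen_sigma M {0..} W) \<union> sets (gen_sigma M {0} X) \<subseteq> Pow (space M)"
  using sets.space_closed[of "gen_sigma M {0..} B"] sets.space_closed[of "gen_sigma M {0..} W"] sets.space_closed[of "gen_sigma M {0} X"] by simp

lemma space_history [simp]: "space history = space M"
  unfolding history_def by (rule space_measure_of[OF history_closed])

lemma sets_history: "sets history = sigma_sets (space M) (sets (gen_sigma M {0..} B) \<union> sets (gen_sigma M {0..} W) \<union> sets (gen_sigma M {0} X))"
  unfolding history_def by (rule sets_measure_of[OF history_closed])

lemma history_measurable_mono:
  assumes f: "f \<in> borel_measurable N" and N: "space N = space M" "sets N \<subseteq> sets history"
  shows "f \<in> borel_measurable history"
  by (rule measurable_from_subalg[OF _ f]) (use N in \<open>simp add: subalgebra_def\<close>)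

lemma history_measurable: "t \<ge> 0 \<Longrightarrow> B t \<in> borel_measurable history" "t \<ge> 0 \<Longrightarrow> W t \<in> borel_measurable history"
  "X 0 \<in> borel_measurable history"
proof -
  have s: "sets (gen_sigma M {0..} B) \<subseteq> sets history" "sets (gen_sigma M {0..} W) \<subseteq> sets history" "sets (gen_sigma M {0} X) \<subseteq> sets history"
    unfolding sets_history by (auto intro: sigma_sets.Basic)
  show "B t \<in> borel_measurable history" "W t \<in> borel_measurable history" if "t \<ge> 0"
    using history_measurable_mono[OF gen_sigma_measurable[of t "{0..}" B M] _ s(1)]
      history_measurable_mono[OF gen_sigma_measurable[of t "{0..}" W M] _ s(2)] that by simp_all
  show "X 0 \<in> borel_measurable history"
    using history_measurable_mono[OF gen_sigma_measurable[of 0 "{0}" X M] _ s(3)] by simp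
qed

lemma subalgebra_history: "subalgebra M history"
proof -
  have "sets (gen_sigma M {0..} B) \<subseteq> sets M" "sets (gen_sigma M {0..} W) \<subseteq> sets M" "sets (gen_sigma M {0} X) \<subseteq> sets M"
    using gen_sigma_subalgebra[of "{0..}" B M] gen_sigma_subalgebra[of "{0..}" W M] gen_sigma_subalgebra[of "{0}" X M]
      signal.W_meas noise.W_meas X_meas by (simp_all add: subalgebra_def)
  then show ?thesis unfolding subalgebra_def sets_history by (intro conjI sets.sigma_sets_subset) auto
qed

lemma X_history: assumes t: "0 \<le> t" shows "ae_meas M history (X t)"
proof (rule linear_sde_ae_meas[where g="\<lambda>s \<omega>. X 0 \<omega> + B s \<omega>" and A=A and T=t])
  show "ae_meas M history (\<lambda>\<omega>. X 0 \<omega> + B s \<omega>)" if "s \<in> {0..t}" for s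
    by (intro ae_meas_add ae_meas_meas history_measurable) (use that in simp)
  show "AE \<omega> in M. continuous_on {0..t} (\<lambda>s. X 0 \<omega> + B s \<omega>)"
    using signal.W_cont by eventually_elim (intro continuous_intros, auto intro: continuous_on_subset)
  show "AE \<omega> in M. continuous_on {0..t} (\<lambda>s. X s \<omega>)"
    using X_cont by eventually_elim (auto intro: continuous_on_subset)
  show "AE \<omega> in M. \<forall>r\<in>{0..t}. X r \<omega> = X 0 \<omega> + B r \<omega> + (LINT s:{0..r}|lborel. A s *v X s \<omega>)"
  proof (rule eventually_mono[OF X_eq], rule ballI)
    fix \<omega> r assume e: "\<forall>t\<ge>0. X t \<omega> = X 0 \<omega> + (LINT s:{0..t}|lborel. A s *v X s \<omega>) + B t \<omega>" and r: "r \<in> {0..t}"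
    have "X r \<omega> = X 0 \<omega> + (LINT s:{0..r}|lborel. A s *v X s \<omega>) + B r \<omega>" by (rule e[rule_format]) (use r in simp)
    then show "X r \<omega> = X 0 \<omega> + B r \<omega> + (LINT s:{0..r}|lborel. A s *v X s \<omega>)" by (simp only: add_ac)
  qed
  show "continuous_on {0..t} A" by (rule continuous_on_subset[OF ric.contA]) auto
qed (use t in auto)

lemma Z_history: assumes t: "0 \<le> t" shows "ae_meas M history (Z t)"
proof (rule ae_meas_cong)
  have C: "set_integrable lborel {0..t} C"
    by (intro borel_integrable_atLeastAtMost' continuous_on_subset[OF ric.contC]) auto
  have c: "AE \<omega> in M. continuous_on {0..t} (\<lambda>s. X s \<omega>)"
    using X_cont by eventually_elim (auto intro: continuous_on_subset)
  show "ae_meas M history (\<lambda>\<omega>. (LINT s:{0..t}|lborel. C s *v X s \<omega>) + W t \<omega>)"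
  proof (rule ae_meas_add)
    show "ae_meas M history (\<lambda>\<omega>. LINT s:{0..t}|lborel. C s *v X s \<omega>)"
      by (rule ae_meas_LINT[OF bounded_bilinear_matrix_vector t C _ c]) (rule X_history, simp)
    show "ae_meas M history (W t)" by (rule ae_meas_meas[OF history_measurable(2)[OF t]])
  qed
  show "AE \<omega> in M. (LINT s:{0..t}|lborel. C s *v X s \<omega>) + W t \<omega> = Z t \<omega>"
    by (rule eventually_mono[OF Z_eq]) (use t in simp)
qed

lemma Xbar0_subalgebra: "subalgebra M (gen_sigma M {()} (\<lambda>_. Xbar0))"
  by (rule gen_sigma_subalgebra) (use Xbar0_gauss in \<open>simp add: gaussian_vector_def\<close>)

lemma observation_indep: "noise.indep_set (sets (gen_sigma M {0..t} Z)) (sets (gen_sigma M {()} (\<lambda>_. Xbar0)))"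
proof (rule noise.indep_set_ae_transfer[OF _ _ subalgebra_history Xbar0_subalgebra])
  show "noise.prob (a \<inter> b) = noise.prob a * noise.prob b" if "a \<in> sets history" "b \<in> sets (gen_sigma M {()} (\<lambda>_. Xbar0))" for a b
    by (rule noise.indep_sets_three_one[OF indep _ _ _ _ that(1)[unfolded sets_history] that(2)]) (auto simp: Int_stable_def)
qed (auto intro: Z_history Z_meas)

text \<open>The deviation is independent of the observations and has mean zero.\<close>

lemma deviation_cond_exp:
  "AE \<omega> in M. vec_cond_exp M (gen_sigma M {0..t} Z) (\<lambda>\<omega>. dev.V T *v (Xbar0 \<omega> - m0)) \<omega> = 0"
proof -
  let ?Y = "\<lambda>\<omega>. dev.V T *v (Xbar0 \<omega> - m0)"
  interpret Fz: finite_measure_subalgebra M "gen_sigma M {0..t} Z" by standard (rule subalgebra_Z)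
  have m: "Xbar0 \<in> borel_measurable (gen_sigma M {()} (\<lambda>_. Xbar0))" using gen_sigma_measurable[of "()" "{()}" "\<lambda>_. Xbar0" M] by simp
  have mY: "?Y \<in> borel_measurable (gen_sigma M {()} (\<lambda>_. Xbar0))"
    by (intro borel_measurable_linear[OF mv.bounded_linear_right] borel_measurable_diff m) simp
  have "AE \<omega> in M. real_cond_exp M (gen_sigma M {0..t} Z) (\<lambda>\<omega>. ?Y \<omega> $ i) \<omega> = 0" for i
  proof -
    have "AE \<omega> in M. real_cond_exp M (gen_sigma M {0..t} Z) (\<lambda>\<omega>. ?Y \<omega> $ i) \<omega> = noise.expectation (\<lambda>\<omega>. ?Y \<omega> $ i)"
      by (rule noise.real_cond_exp_indep[OF subalgebra_Z Xbar0_subalgebra observation_indep _ Fz.integrable_component[OF deviation_integrable]])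
        (rule borel_measurable_linear[OF bounded_linear_vec_nth mY])
    moreover have "noise.expectation (\<lambda>\<omega>. ?Y \<omega> $ i) = 0"
    proof -
      have i0: "integrable M (\<lambda>\<omega>. Xbar0 \<omega> $ j)" for j by (rule Fz.integrable_component[OF Xbar0_integrable])
      have "noise.expectation (\<lambda>\<omega>. ?Y \<omega> $ i) = noise.expectation (\<lambda>\<omega>. \<Sum>j\<in>UNIV. dev.V T $ i $ j * (Xbar0 \<omega> $ j - m0 $ j))"
        by (simp add: matrix_vector_mult_def)
      also have "\<dots> = (\<Sum>j\<in>UNIV. dev.V T $ i $ j * (noise.expectation (\<lambda>\<omega>. Xbar0 \<omega> $ j) - m0 $ j))"
        using i0 by (subst Bochner_Integration.integral_sum) (auto simp: noise.prob_space)
      also have "\<dots> = 0" by (simp add: Xbar0_mean)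
      finally show ?thesis .
    qed
    ultimately show ?thesis by simp
  qed
  then have "AE \<omega> in M. \<forall>i. real_cond_exp M (gen_sigma M {0..t} Z) (\<lambda>\<omega>. ?Y \<omega> $ i) \<omega> = 0" by (simp add: AE_all_countable)
  then show ?thesis by eventually_elim (simp add: vec_cond_exp_def vec_eq_iff)
qed

lemma mhat_ae_meas: assumes t: "0 \<le> t" shows "ae_meas M (gen_sigma M {0..t} Z) (mhat t)"
proof (rule ae_measI)
  show "(\<lambda>\<omega>. flow.V t *v (m0 + Zint t \<omega>)) \<in> borel_measurable (gen_sigma M {0..t} Z)"
    by (intro borel_measurable_linear[OF mv.bounded_linear_right] borel_measurable_add borel_measurable_const Zint_meas t)
  show "AE \<omega> in M. mhat t \<omega> = flow.V t *v (m0 + Zint t \<omega>)" using Zc(3) by eventually_elim (simp add: mhat_def)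
qed

lemma Xbar_cond_exp:
  assumes t: "0 \<le> t" shows "AE \<omega> in M. vec_cond_exp M (gen_sigma M {0..t} Z) (Xbar t) \<omega> = mhat t \<omega>"
proof -
  interpret Fz: finite_measure_subalgebra M "gen_sigma M {0..t} Z" by standard (rule subalgebra_Z)
  from Fz.vec_cond_exp_add[OF mhat_integrable[OF t] deviation_integrable[of t]]
    Fz.vec_cond_exp_ae_meas[OF mhat_integrable[OF t] mhat_ae_meas[OF t]] deviation_cond_exp[of t t]
  show ?thesis unfolding Xbar_def[abs_def] by eventually_elim simp
qed

lemma Xbar0_augmented: "Xbar0 \<in> borel_measurable (augmented_filtration M Xbar0 Z t)"
proof (rule measurable_from_subalg)
  show "Xbar0 \<in> borel_measurable (gen_sigma M {()} (\<lambda>_. Xbar0))" using gen_sigma_measurable[of "()" "{()}" "\<lambda>_. Xbar0" M] by simp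
  show "subalgebra (augmented_filtration M Xbar0 Z t) (gen_sigma M {()} (\<lambda>_. Xbar0))"
    unfolding subalgebra_def sets_augmented by (auto intro: sigma_sets.Basic)
qed

lemma mhat_meas: "0 \<le> t \<Longrightarrow> mhat t \<in> borel_measurable M"
  using mhat_integrable by (rule borel_measurable_integrable)

lemma Xbar_augmented: assumes t: "0 \<le> t" shows "Xbar t \<in> borel_measurable (augmented_filtration M Xbar0 Z t)"
  unfolding Xbar_def[abs_def]
  by (intro borel_measurable_add ae_meas_imp_augmented mhat_meas mhat_ae_meas subalgebra_Z t
      borel_measurable_linear[OF mv.bounded_linear_right] borel_measurable_diff borel_measurable_const Xbar0_augmented)

lemma Xbar_solution:
  "mean_field_strong_solution M R C X W Z (\<lambda>t x m. F t *v m + \<Gamma> t *v (x - m)) K Xbar0 Xbar"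
  unfolding mean_field_strong_solution_def
proof (intro conjI exI[of _ mhat])
  show "\<forall>t\<ge>0. Xbar t \<in> borel_measurable (augmented_filtration M Xbar0 Z t)" by (blast intro: Xbar_augmented)
  show "\<forall>t\<ge>0. integrable M (Xbar t)" by (blast intro: Xbar_integrable)
  show "AE \<omega> in M. continuous_on {0..} (\<lambda>t. Xbar t \<omega>)" by (rule AE_I2) (rule cont_Xbar)
  show "(\<lambda>(t, \<omega>). mhat t \<omega>) \<in> borel_measurable (restrict_space borel {0..} \<Otimes>\<^sub>M M)"
    by (rule joint_measurable_continuous[OF mhat_meas cont_mhat])
  show "\<forall>t\<ge>0. AE \<omega> in M. mhat t \<omega> = vec_cond_exp M (gen_sigma M {0..t} Z) (Xbar t) \<omega>"
    using Xbar_cond_exp by (simp add: eq_commute)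
  show "\<forall>t\<ge>0. AE \<omega> in M. set_integrable lborel {0..t} (\<lambda>s. F s *v mhat s \<omega> + \<Gamma> s *v (Xbar s \<omega> - mhat s \<omega>))"
    by (intro allI impI AE_I2 drift_int)
  show "\<forall>t\<ge>0. AE \<omega> in M. Xbar t \<omega> = Xbar0 \<omega> + (LINT s:{0..t}|lborel. F s *v mhat s \<omega> + \<Gamma> s *v (Xbar s \<omega> - mhat s \<omega>)) + obs_integral M R C X W t K \<omega>"
    by (blast intro: Xbar_eq)
qed

end

section \<open>Uniqueness\<close>

lemma obs_integral_cong:
  assumes "\<And>t. t \<in> {0..T} \<Longrightarrow> f t = g t"
  shows "obs_integral M R C X W T f = obs_integral M R C X W T g"
proof -
  have "set_borel_measurable lborel {0..T} f \<longleftrightarrow> set_borel_measurable lborel {0..T} g"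
    unfolding set_borel_measurable_def
    by (rule arg_cong[where f="\<lambda>u. u \<in> borel_measurable lborel"]) (intro ext, use assms in \<open>auto simp: indicator_def\<close>)
  moreover have "(\<integral>\<^sup>+t\<in>{0..T}. ennreal (trace ((f t - step_integrand n \<tau> c t) ** R t ** transpose (f t - step_integrand n \<tau> c t))) \<partial>lborel) =
     (\<integral>\<^sup>+t\<in>{0..T}. ennreal (trace ((g t - step_integrand n \<tau> c t) ** R t ** transpose (g t - step_integrand n \<tau> c t))) \<partial>lborel)" for n \<tau> c
    by (rule nn_integral_cong) (auto simp: indicator_def assms)
  ultimately have "is_wiener_integral M R W T f = is_wiener_integral M R W T g"
    unfolding is_wiener_integral_def[abs_def] by simp
  then have "wiener_integral M R W T f = wiener_integral M R W T g" by (simp add: wiener_integral_def)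
  moreover have "(LINT t:{0..T}|lborel. f t *v (C t *v X t \<omega>)) = (LINT t:{0..T}|lborel. g t *v (C t *v X t \<omega>))" for \<omega>
    by (rule set_lebesgue_integral_cong) (auto simp: assms)
  ultimately show ?thesis unfolding obs_integral_def[abs_def] by simp
qed

text \<open>The gain is specified for nonnegative times only, so it agrees with \<open>riccati_flow.gain\<close> only there.\<close>

lemma mean_field_strong_solution_cong:
  assumes b: "\<And>t. t \<ge> 0 \<Longrightarrow> b t = b' t" and K: "\<And>t. t \<ge> 0 \<Longrightarrow> K t = K' t"
  shows "mean_field_strong_solution M R C X W Z b K x0 Y = mean_field_strong_solution M R C X W Z b' K' x0 Y"
proof -
  have o: "obs_integral M R C X W t K = obs_integral M R C X W t K'" for t by (rule obs_integral_cong) (use K in auto)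
  have i: "set_integrable lborel {0..t} (\<lambda>s. b s (y s) (m s)) \<longleftrightarrow> set_integrable lborel {0..t} (\<lambda>s. b' s (y s) (m s))" for t y m
    by (rule set_integrable_cong) (auto simp: b)
  have l: "(LINT s:{0..t}|lborel. b s (y s) (m s)) = (LINT s:{0..t}|lborel. b' s (y s) (m s))" for t y m
    by (rule set_lebesgue_integral_cong) (auto simp: b)
  show ?thesis unfolding mean_field_strong_solution_def o i l ..
qed

lemma eq_on_halfline_of_rats:
  fixes x y :: "real \<Rightarrow> 'b::real_normed_vector"
  assumes x: "continuous_on {0..} x" and y: "continuous_on {0..} y"
    and eq: "\<And>r::rat. 0 \<le> r \<Longrightarrow> x (of_rat r) = y (of_rat r)" and t: "0 \<le> t"
  shows "x t = y t"
proof -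
  have "norm (x t - y t) \<le> 0"
  proof (rule continuous_le_on_rats[where T="t + 1" and \<phi>="\<lambda>t. norm (x t - y t)"])
    show "continuous_on {0..t + 1} (\<lambda>t. norm (x t - y t))"
      by (intro continuous_on_norm continuous_on_diff continuous_on_subset[OF x] continuous_on_subset[OF y]) auto
    show "norm (x r - y r) \<le> 0" if "r \<in> \<rat>" "r \<in> {0..t + 1}" for r
      using that eq by (auto elim!: Rats_cases)
  qed (use t in auto)
  then show ?thesis by simp
qed

lemma joint_measurable_apply:
  fixes H :: "real \<Rightarrow> real^'n^'p" and y :: "real \<Rightarrow> 'a \<Rightarrow> real^'n"
  assumes H: "H \<in> borel_measurable (restrict_space borel {0..})"
    and y: "(\<lambda>(s, \<omega>). y s \<omega>) \<in> borel_measurable (restrict_space borel {0..} \<Otimes>\<^sub>M M)"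
  shows "(\<lambda>(s, \<omega>). H s *v y s \<omega>) \<in> borel_measurable (restrict_space borel {0..} \<Otimes>\<^sub>M M)"
  using measurable_mv[OF measurable_compose[OF measurable_fst H] y] by (simp add: split_beta')

context mean_field_filter begin

lemma gen_sigma_Z_mono: "s \<le> t \<Longrightarrow> subalgebra (gen_sigma M {0..t} Z) (gen_sigma M {0..s} Z)"
  unfolding subalgebra_def sets_gen_sigma
proof (intro conjI sigma_sets_mono' subsetI)
  fix E assume st: "s \<le> t" and "E \<in> {Z u -` S \<inter> space M |u S. u \<in> {0..s} \<and> S \<in> sets borel}"
  then obtain u S where "E = Z u -` S \<inter> space M" "u \<in> {0..s}" "S \<in> sets borel" by blast
  with st show "E \<in> {Z u -` S \<inter> space M |u S. u \<in> {0..t} \<and> S \<in> sets borel}"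
    by (intro CollectI exI[of _ u] exI[of _ S]) auto
qed simp

text \<open>The equation for \<open>Y\<close> is given at each time outside a null set that may depend on the time. Equality at rational
times and continuity give one null set for all times. The conditional mean \<open>m\<close> of \<open>Y\<close> is known at each time only, up to null sets, and
may have irregular paths. This is why \<open>section_integral_ae_meas\<close> and \<open>AE_sections_eq\<close> are
needed.\<close>

lemma solution_unique:
  assumes sol: "mean_field_strong_solution M R C X W Z (\<lambda>t x m. F t *v m + \<Gamma> t *v (x - m)) K Xbar0 Y"
  shows "AE \<omega> in M. \<forall>t\<ge>0. Y t \<omega> = Xbar t \<omega>"
proof -
  from sol obtain m where Yint: "\<And>t. t \<ge> 0 \<Longrightarrow> integrable M (Y t)" and Yc: "AE \<omega> in M. continuous_on {0..} (\<lambda>t. Y t \<omega>)"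
    and mj: "(\<lambda>(t, \<omega>). m t \<omega>) \<in> borel_measurable (restrict_space borel {0..} \<Otimes>\<^sub>M M)"
    and mc: "\<And>t. t \<ge> 0 \<Longrightarrow> AE \<omega> in M. m t \<omega> = vec_cond_exp M (gen_sigma M {0..t} Z) (Y t) \<omega>"
    and mi: "\<And>t. t \<ge> 0 \<Longrightarrow> AE \<omega> in M. set_integrable lborel {0..t} (\<lambda>s. F s *v m s \<omega> + \<Gamma> s *v (Y s \<omega> - m s \<omega>))"
    and me: "\<And>t. t \<ge> 0 \<Longrightarrow> AE \<omega> in M. Y t \<omega> = Xbar0 \<omega> + (LINT s:{0..t}|lborel. F s *v m s \<omega> + \<Gamma> s *v (Y s \<omega> - m s \<omega>)) + obs_integral M R C X W t K \<omega>"
    unfolding mean_field_strong_solution_def by blast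
  define e where "e t \<omega> = Y t \<omega> - Xbar t \<omega>" for t \<omega>
  define \<mu> where "\<mu> t \<omega> = m t \<omega> - mhat t \<omega>" for t \<omega>
  define \<Lambda> where "\<Lambda> t = F t - \<Gamma> t" for t
  define h where "h s \<omega> = \<Gamma> s *v e s \<omega> + \<Lambda> s *v \<mu> s \<omega>" for s \<omega>
  have h: "h s \<omega> = (F s *v m s \<omega> + \<Gamma> s *v (Y s \<omega> - m s \<omega>)) - (F s *v mhat s \<omega> + \<Gamma> s *v (Xbar s \<omega> - mhat s \<omega>))" for s \<omega>
    by (simp add: h_def e_def \<mu>_def \<Lambda>_def mv.diff_left mv.diff_right)
  have \<Lambda>int: "set_integrable lborel {0..T} \<Lambda>" if "T \<ge> 0" for T
    unfolding \<Lambda>_def[abs_def] by (intro set_integral_diff ric.closed_loop_int ric.deviation_int that)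
  have e_int: "integrable M (e t)" if "t \<ge> 0" for t
    unfolding e_def[abs_def] by (intro Bochner_Integration.integrable_diff Yint Xbar_integrable that)
  have ec: "AE \<omega> in M. continuous_on {0..} (\<lambda>t. e t \<omega>)"
    using Yc AE_space unfolding e_def by eventually_elim (intro continuous_on_diff cont_Xbar)

  have hi: "AE \<omega> in M. set_integrable lborel {0..t} (\<lambda>s. h s \<omega>)" if t: "t \<ge> 0" for t
    using mi[OF t] AE_space unfolding h by eventually_elim (rule set_integral_diff(1)[OF _ drift_int[OF t]])
  have he: "AE \<omega> in M. e t \<omega> = (LINT s:{0..t}|lborel. h s \<omega>)" if t: "t \<ge> 0" for t
    using me[OF t] Xbar_eq[OF t] mi[OF t] AE_space
  proof eventually_elim
    case (elim \<omega>)
    then show ?case unfolding h by (subst set_integral_diff(2)[OF elim(3) drift_int[OF t elim(4)]]) (simp add: e_def)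
  qed
  have "AE \<omega> in M. \<forall>n::nat. set_integrable lborel {0..real n} (\<lambda>s. h s \<omega>)"
    by (subst AE_all_countable) (simp add: hi)
  then have hi': "AE \<omega> in M. \<forall>T\<ge>0. set_integrable lborel {0..T} (\<lambda>s. h s \<omega>)"
  proof eventually_elim
    case (elim \<omega>)
    show ?case
    proof (intro allI impI)
      fix T :: real
      obtain n :: nat where "T \<le> real n" using real_arch_simple by blast
      then show "set_integrable lborel {0..T} (\<lambda>s. h s \<omega>)"
        by (intro set_integrable_sub_interval[OF elim[rule_format, of n]]) auto
    qed
  qed
  have "AE \<omega> in M. \<forall>r::rat. 0 \<le> r \<longrightarrow> e (of_rat r) \<omega> = (LINT s:{0..of_rat r}|lborel. h s \<omega>)"
  proof (subst AE_all_countable, rule allI)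
    show "AE \<omega> in M. 0 \<le> r \<longrightarrow> e (of_rat r) \<omega> = (LINT s:{0..of_rat r}|lborel. h s \<omega>)" for r :: rat
      by (cases "0 \<le> r") (use he[of "of_rat r"] in auto)
  qed
  with ec hi' have he': "AE \<omega> in M. \<forall>t\<ge>0. e t \<omega> = (LINT s:{0..t}|lborel. h s \<omega>)"
  proof eventually_elim
    case (elim \<omega>)
    have "continuous_on {0..} (\<lambda>t. LINT s:{0..t}|lborel. h s \<omega>)"
      by (rule continuous_on_LINT_halfline) (use elim(2) in blast)
    from eq_on_halfline_of_rats[OF elim(1) this] elim(3) show ?case by blast
  qed

  have \<Lambda>\<mu>: "AE \<omega> in M. set_integrable lborel {0..T} (\<lambda>s. \<Lambda> s *v \<mu> s \<omega>)" if T: "T \<ge> 0" for T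
    using hi' ec
  proof eventually_elim
    case (elim \<omega>)
    have "set_integrable lborel {0..T} (\<lambda>s. h s \<omega> - \<Gamma> s *v e s \<omega>)"
      by (rule set_integral_diff(1)[OF elim(1)[rule_format, OF T]
            set_integrable_bilinear[OF bounded_bilinear_matrix_vector ric.deviation_int[OF T] continuous_on_subset[OF elim(2)]]]) auto
    then show ?case by (simp add: h_def)
  qed
  have P\<Lambda>\<mu>: "AE \<omega> in M. set_integrable lborel {0..T} (\<lambda>s. dev.P s *v (\<Lambda> s *v \<mu> s \<omega>))" if T: "T \<ge> 0" for T
    using \<Lambda>\<mu>[OF T]
    by eventually_elim (rule set_integrable_bilinear[OF bounded_bilinear.flip[OF bounded_bilinear_matrix_vector] _ continuous_on_subset[OF dev.cont_P]], auto)
  \<comment> \<open>Variation of constants for \<open>e\<close> with the inverse \<open>dev.P\<close> of the flow of \<open>\<Gamma>\<close>.\<close>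
  have Pe: "AE \<omega> in M. dev.P T *v e T \<omega> = (LINT s:{0..T}|lborel. dev.P s *v (\<Lambda> s *v \<mu> s \<omega>))" if T: "T \<ge> 0" for T
    using hi' he' ec P\<Lambda>\<mu>[OF T]
  proof eventually_elim
    case (elim \<omega>)
    note hT = elim(1)[rule_format, OF T]
    have e0: "e 0 \<omega> = 0" using elim(2)[rule_format, of 0] by simp
    have ce: "continuous_on {0..T} (\<lambda>t. e t \<omega>)" by (rule continuous_on_subset[OF elim(3)]) auto
    have i1: "set_integrable lborel {0..T} (\<lambda>s. (- (dev.P s ** \<Gamma> s)) *v e s \<omega>)"
      by (rule set_integrable_bilinear[OF bounded_bilinear_matrix_vector dev.PF_int[OF T] ce])
    have i2: "set_integrable lborel {0..T} (\<lambda>s. dev.P s *v h s \<omega>)"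
      by (rule set_integrable_bilinear[OF bounded_bilinear.flip[OF bounded_bilinear_matrix_vector] hT continuous_on_subset[OF dev.cont_P]]) auto
    have "dev.P T *v e T \<omega> = dev.P 0 *v e 0 \<omega> + (LINT s:{0..T}|lborel. (- (dev.P s ** \<Gamma> s)) *v e s \<omega>) + (LINT s:{0..T}|lborel. dev.P s *v h s \<omega>)"
    proof (rule LINT_product_rule[OF bounded_bilinear_matrix_vector T dev.PF_int[OF T] hT])
      show "dev.P t = dev.P 0 + (LINT s:{0..t}|lborel. - (dev.P s ** \<Gamma> s))" if "t \<in> {0..T}" for t
        by (rule dev.P_eq) (use that in simp)
      show "e t \<omega> = e 0 \<omega> + (LINT s:{0..t}|lborel. h s \<omega>)" if "t \<in> {0..T}" for t
        unfolding e0 add_0_left by (rule elim(2)[rule_format]) (use that in simp)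
    qed
    also have "\<dots> = (LINT s:{0..T}|lborel. (- (dev.P s ** \<Gamma> s)) *v e s \<omega> + dev.P s *v h s \<omega>)"
      by (subst set_integral_add(2)[OF i1 i2]) (simp add: e0)
    also have "\<dots> = (LINT s:{0..T}|lborel. dev.P s *v (\<Lambda> s *v \<mu> s \<omega>))"
      by (simp add: h_def mv.add_right mv.minus_left matrix_vector_mul_assoc)
    finally show ?case .
  qed

  have mhatj: "(\<lambda>(t, \<omega>). mhat t \<omega>) \<in> borel_measurable (restrict_space borel {0..} \<Otimes>\<^sub>M M)"
    by (rule joint_measurable_continuous[OF mhat_meas cont_mhat])
  have \<mu>j: "(\<lambda>(t, \<omega>). \<mu> t \<omega>) \<in> borel_measurable (restrict_space borel {0..} \<Otimes>\<^sub>M M)"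
    using borel_measurable_diff[OF mj mhatj] by (simp add: \<mu>_def split_beta')
  have P\<Lambda>j: "(\<lambda>(s, \<omega>). dev.P s *v (\<Lambda> s *v \<mu> s \<omega>)) \<in> borel_measurable (restrict_space borel {0..} \<Otimes>\<^sub>M M)"
    by (intro joint_measurable_apply \<mu>j borel_measurable_continuous_on_restrict dev.cont_P
        set_borel_measurable_halfline set_integrable_imp_measurable \<Lambda>int)
  have \<mu>am: "ae_meas M (gen_sigma M {0..T} Z) (\<mu> s)" if s: "s \<in> {0..T}" for s T
  proof -
    interpret Fz: finite_measure_subalgebra M "gen_sigma M {0..s} Z" by standard (rule subalgebra_Z)
    have s0: "0 \<le> s" "s \<le> T" using s by auto
    have am: "ae_meas M (gen_sigma M {0..s} Z) (\<mu> s)"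
      unfolding \<mu>_def[abs_def] by (intro ae_meas_diff mhat_ae_meas s0 ae_measI[OF Fz.vec_cond_exp_measurable mc])
    then obtain g where g: "g \<in> borel_measurable (gen_sigma M {0..s} Z)" "AE \<omega> in M. \<mu> s \<omega> = g \<omega>" by (auto simp: ae_meas_def)
    from g(2) show ?thesis by (rule ae_measI[OF measurable_from_subalg[OF gen_sigma_Z_mono[OF s0(2)] g(1)]])
  qed
  \<comment> \<open>Hence \<open>e T\<close> is a function of the observations up to \<open>T\<close> and equals its conditional mean.\<close>
  have \<mu>e: "AE \<omega> in M. \<mu> T \<omega> = e T \<omega>" if T: "0 \<le> T" for T
  proof -
    interpret Fz: finite_measure_subalgebra M "gen_sigma M {0..T} Z" by standard (rule subalgebra_Z)
    have "ae_meas M (gen_sigma M {0..T} Z) (\<lambda>\<omega>. LINT s:{0..T}|lborel. dev.P s *v (\<Lambda> s *v \<mu> s \<omega>))"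
      by (rule Fz.section_integral_ae_meas[OF P\<Lambda>j T _ P\<Lambda>\<mu>[OF T]])
         (intro ae_meas_linear[OF mv.bounded_linear_right] \<mu>am)
    then have "ae_meas M (gen_sigma M {0..T} Z) (\<lambda>\<omega>. dev.V T *v (LINT s:{0..T}|lborel. dev.P s *v (\<Lambda> s *v \<mu> s \<omega>)))"
      by (rule ae_meas_linear[OF mv.bounded_linear_right])
    moreover have "AE \<omega> in M. dev.V T *v (LINT s:{0..T}|lborel. dev.P s *v (\<Lambda> s *v \<mu> s \<omega>)) = e T \<omega>"
      using Pe[OF T]
    proof eventually_elim
      case (elim \<omega>)
      show ?case unfolding elim[symmetric] by (simp add: matrix_vector_mul_assoc dev.VP T)
    qed
    ultimately have "ae_meas M (gen_sigma M {0..T} Z) (e T)" by (rule ae_meas_cong)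
    from Fz.vec_cond_exp_ae_meas[OF e_int[OF T] this] Fz.vec_cond_exp_diff[OF Yint[OF T] Xbar_integrable[OF T]] mc[OF T] Xbar_cond_exp[OF T]
    show ?thesis unfolding e_def[abs_def] by eventually_elim (simp add: \<mu>_def)
  qed
  obtain e' where e': "AE \<omega> in M. \<forall>t. e' t \<omega> = e t \<omega>"
    "(\<lambda>(t, \<omega>). e' t \<omega>) \<in> borel_measurable (restrict_space borel {0..} \<Otimes>\<^sub>M M)"
    by (rule continuous_modification[OF borel_measurable_integrable[OF e_int] ec]) blast+
  have "AE \<omega> in M. AE s in lborel. 0 \<le> s \<longrightarrow> \<mu> s \<omega> = e' s \<omega>"
  proof (rule noise.AE_sections_eq[OF \<mu>j e'(2)])
    show "AE \<omega> in M. \<mu> s \<omega> = e' s \<omega>" if "0 \<le> s" for s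
      using \<mu>e[OF that] e'(1) by eventually_elim simp
  qed
  from this e'(1) hi' he' ec
  have "AE \<omega> in M. \<forall>t\<ge>0. e t \<omega> = 0"
  proof eventually_elim
    case (elim \<omega>)
    \<comment> \<open>So \<open>e\<close> solves the homogeneous equation of \<open>F\<close>.\<close>
    have ae: "AE s in lborel. 0 \<le> s \<longrightarrow> \<mu> s \<omega> = e s \<omega>" using elim(1) by (simp add: elim(2))
    show ?case
    proof (intro allI impI)
      fix T :: real assume T: "0 \<le> T"
      have ce: "continuous_on {0..T} (\<lambda>t. e t \<omega>)" by (rule continuous_on_subset[OF elim(5)]) auto
      show "e T \<omega> = 0"
      proof (rule gronwall_zero[OF ce])
        show "set_integrable lborel {0..T} (\<lambda>s. norm (F s))" by (rule set_integrable_norm[OF ric.closed_loop_int[OF T]])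
        fix t assume t: "t \<in> {0..T}"
        then have t0: "0 \<le> t" by simp
        have iF: "set_integrable lborel {0..t} (\<lambda>s. F s *v e s \<omega>)"
          by (rule set_integrable_bilinear[OF bounded_bilinear_matrix_vector ric.closed_loop_int[OF t0] continuous_on_subset[OF elim(5)]]) auto
        have "e t \<omega> = (LINT s:{0..t}|lborel. h s \<omega>)" by (rule elim(4)[rule_format, OF t0])
        also have "\<dots> = (LINT s:{0..t}|lborel. F s *v e s \<omega>)"
          unfolding set_lebesgue_integral_def
        proof (rule integral_cong_AE)
          show "(\<lambda>s. indicat_real {0..t} s *\<^sub>R h s \<omega>) \<in> borel_measurable lborel"
            using elim(3)[rule_format, OF t0] unfolding set_integrable_def by (rule borel_measurable_integrable)
          show "(\<lambda>s. indicat_real {0..t} s *\<^sub>R (F s *v e s \<omega>)) \<in> borel_measurable lborel"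
            using iF unfolding set_integrable_def by (rule borel_measurable_integrable)
          show "AE s in lborel. indicat_real {0..t} s *\<^sub>R h s \<omega> = indicat_real {0..t} s *\<^sub>R (F s *v e s \<omega>)"
            using ae by eventually_elim (auto simp: indicator_def h_def \<Lambda>_def mv.diff_left)
        qed
        finally have "norm (e t \<omega>) \<le> (LINT s:{0..t}|lborel. norm (F s *v e s \<omega>))" using set_integral_norm_bound[OF iF] by simp
        also have "\<dots> \<le> (LINT s:{0..t}|lborel. norm (F s) * norm (e s \<omega>))"
        proof (rule set_integral_mono[OF set_integrable_norm[OF iF]])
          show "set_integrable lborel {0..t} (\<lambda>s. norm (F s) * norm (e s \<omega>))"
            by (rule set_integrable_bilinear[OF bounded_bilinear_mult set_integrable_norm[OF ric.closed_loop_int[OF t0]] continuous_on_norm[OF continuous_on_subset[OF elim(5)]]]) auto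
        qed (rule matrix_vector_norm_le)
        finally show "norm (e t \<omega>) \<le> (LINT s:{0..t}|lborel. norm (F s) * norm (e s \<omega>))" .
      qed (use T in auto)
    qed
  qed
  then show ?thesis by eventually_elim (simp add: e_def)
qed

end

theorem proposition2:
  fixes M :: "'a measure"
    and A Q \<Sigma> :: "real \<Rightarrow> real^'d^'d"
    and C :: "real \<Rightarrow> real^'d^'m"
    and R :: "real \<Rightarrow> real^'m^'m"
    and K :: "real \<Rightarrow> real^'m^'d"
    and \<Phi> \<Psi> :: "real \<Rightarrow> real \<Rightarrow> real^'d^'d"
    and X B :: "real \<Rightarrow> 'a \<Rightarrow> real^'d"
    and Z W :: "real \<Rightarrow> 'a \<Rightarrow> real^'m"
    and m0 :: "real^'d"
    and Xbar0 :: "'a \<Rightarrow> real^'d"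
  assumes "prob_space M"
    and model: "linear_gaussian_model M A C Q R m0 (\<Sigma> 0) X Z B W"
    and init: "gaussian_vector M Xbar0 m0 (\<Sigma> 0)"
    and indep: "prob_space.indep_sets M
          (\<lambda>i. [sets (gen_sigma M {0..} B), sets (gen_sigma M {0..} W),
                sets (gen_sigma M {0} X), sets (gen_sigma M {()} (\<lambda>_. Xbar0))] ! i) {..<4::nat}"
    and riccati: "\<And>t. t \<ge> 0 \<Longrightarrow>
          (\<Sigma> has_vector_derivative
             (A t ** \<Sigma> t + \<Sigma> t ** transpose (A t) + Q t
              - \<Sigma> t ** transpose (C t) ** matrix_inv (R t) ** C t ** \<Sigma> t)) (at t within {0..})"
    and gain: "\<And>t. t \<ge> 0 \<Longrightarrow> K t = \<Sigma> t ** transpose (C t) ** matrix_inv (R t)"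
    and Phi: "\<And>\<tau>. \<tau> \<ge> 0 \<Longrightarrow> \<Phi> \<tau> \<tau> = mat 1"
          "\<And>t \<tau>. t \<ge> 0 \<Longrightarrow> \<tau> \<ge> 0 \<Longrightarrow>
             ((\<lambda>t. \<Phi> t \<tau>) has_vector_derivative
                (- transpose (A t) + transpose (C t) ** transpose (K t)) ** \<Phi> t \<tau>) (at t within {0..})"
    and Psi: "\<And>\<tau>. \<tau> \<ge> 0 \<Longrightarrow> \<Psi> \<tau> \<tau> = mat 1"
          "\<And>t \<tau>. t \<ge> 0 \<Longrightarrow> \<tau> \<ge> 0 \<Longrightarrow>
             ((\<lambda>t. \<Psi> t \<tau>) has_vector_derivative
                (- transpose (A t) + (1/2) *\<^sub>R (transpose (C t) ** transpose (K t))
                 - (1/2) *\<^sub>R (matrix_inv (\<Sigma> t) ** Q t)) ** \<Psi> t \<tau>) (at t within {0..})"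
  shows "let sol = mean_field_strong_solution M R C X W Z
               (\<lambda>t x m. A t *v x - K t *v ((1/2) *\<^sub>R (C t *v x + C t *v m))
                        + (1/2) *\<^sub>R ((Q t ** matrix_inv (\<Sigma> t)) *v (x - m)))
               K Xbar0
         in \<exists>Xbar. sol Xbar \<and>
              (\<forall>Y. sol Y \<longrightarrow> (AE \<omega> in M. \<forall>t\<ge>0. Y t \<omega> = Xbar t \<omega>)) \<and>
              (\<forall>a. \<forall>T\<ge>0. AE \<omega> in M.
                 a \<bullet> (transpose (\<Phi> 0 T) *v m0 + transpose (\<Psi> 0 T) *v (Xbar0 \<omega> - m0)
                      + obs_integral M R C X W T (\<lambda>t. transpose (\<Phi> t T) ** K t) \<omega>)
                 = a \<bullet> Xbar T \<omega>)"
proof -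
  note model' = model[unfolded linear_gaussian_model_def]
  have noise: "wiener_integration M R W" and signal: "wiener_integration M Q B"
    using \<open>prob_space M\<close> model' by (auto intro!: wiener_integration.intro wiener_integration_axioms.intro)
  have ric: "riccati_flow A Q \<Sigma> C R"
  proof (rule riccati_flow.intro)
    show "set_integrable lborel {0..T} Q" "set_integrable lborel {0..T} R" if "T \<ge> 0" for T
      using model' that by (simp_all add: wiener_process_def)
  qed (use model' riccati in auto)
  interpret ric: riccati_flow A Q \<Sigma> C R by (rule ric)
  have K: "K t = ric.gain t" if "t \<ge> 0" for t using gain[OF that] by (simp add: ric.gain_def)
  have flow: "adjoint_flow ric.closed_loop \<Phi>"
  proof (rule adjoint_flow.intro[OF ric.closed_loop_int Phi(1)])
    show "((\<lambda>t. \<Phi> t \<tau>) has_vector_derivative - transpose (ric.closed_loop t) ** \<Phi> t \<tau>) (at t within {0..})"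
      if "t \<ge> 0" "\<tau> \<ge> 0" for t \<tau>
      using Phi(2)[OF that] unfolding K[OF that(1)] ric.closed_loop_adjoint .
  qed
  have dev: "adjoint_flow ric.deviation \<Psi>"
  proof (rule adjoint_flow.intro[OF ric.deviation_int Psi(1)])
    show "((\<lambda>t. \<Psi> t \<tau>) has_vector_derivative - transpose (ric.deviation t) ** \<Psi> t \<tau>) (at t within {0..})"
      if "t \<ge> 0" "\<tau> \<ge> 0" for t \<tau>
      using Psi(2)[OF that] unfolding K[OF that(1)] ric.deviation_adjoint[OF that(1)] .
  qed
  interpret mean_field_filter A Q \<Sigma> C R M W B \<Phi> \<Psi> X Z m0 Xbar0
  proof (intro mean_field_filter.intro kalman_noise.intro mean_field_filter_axioms.intro)
  qed (use ric noise signal flow dev model' init indep in auto)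
  have sol: "mean_field_strong_solution M R C X W Z
               (\<lambda>t x m. A t *v x - K t *v ((1/2) *\<^sub>R (C t *v x + C t *v m))
                        + (1/2) *\<^sub>R ((Q t ** matrix_inv (\<Sigma> t)) *v (x - m))) K Xbar0 Y
      = mean_field_strong_solution M R C X W Z (\<lambda>t x m. ric.closed_loop t *v m + ric.deviation t *v (x - m)) ric.gain Xbar0 Y" for Y
    by (rule mean_field_strong_solution_cong) (simp_all add: K ric.drift_eq)
  have obs: "obs_integral M R C X W T (\<lambda>t. transpose (\<Phi> t T) ** K t) = obs_integral M R C X W T (\<lambda>t. transpose (\<Phi> t T) ** ric.gain t)" for T
    by (rule obs_integral_cong) (simp add: K)
  show ?thesis unfolding Let_def sol obs
  proof (intro exI[of _ Xbar] conjI allI impI)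
    fix a and T :: real assume "0 \<le> T"
    from terminal_estimator[OF this]
    show "AE \<omega> in M. a \<bullet> (transpose (\<Phi> 0 T) *v m0 + transpose (\<Psi> 0 T) *v (Xbar0 \<omega> - m0)
        + obs_integral M R C X W T (\<lambda>t. transpose (\<Phi> t T) ** ric.gain t) \<omega>) = a \<bullet> Xbar T \<omega>"
      by eventually_elim (simp only:)
  qed (rule Xbar_solution, rule solution_unique)
qed

end
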